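(* Let $(X,d,\mu)$ be any space of homogeneous type with quasi-triangle constant $A_0$, and let $a:=(1+2\log_2A_0)^{-1}$, or $a:=1$ if $d$ is Lipschitz-continuous. There exists an orthonormal basis $\psi^k_\beta$, $k\in\mathbb{Z}$ (and $k\ge k_0$ if $X$ is bounded), $y^k_\beta\in\mathscr{Y}^k$, of $L^2(\mu)$ (or of the orthogonal complement of the constants in $L^2(\mu)$ if $X$ is bounded), and constants $C<\infty$, $\gamma>0$ independent of $k,\beta,x,y$, with the following properties: exponential decay $$|\psi^k_\beta(x)|\le\frac{C}{\sqrt{\mu(B(y^k_\beta,\delta^k))}}\exp\Big(-\gamma\big(\delta^{-k}d(y^k_\beta,x)\big)^a\Big),\qquad x\in X,$$ H\"older-regularity $$|\psi^k_\beta(x)-\psi^k_\beta(y)|\le\frac{C}{\sqrt{\mu(B(y^k_\beta,\delta^k))}}\Big(\frac{d(x,y)}{\delta^k}\Big)^{\eta}\exp\Big(-\gamma\big(\delta^{-k}d(y^k_\beta,x)\big)^a\Big),\qquad d(x,y)\le\delta^k,$$ and vanishing mean $$\int_X\psi^k_\beta(x)\,d\mu(x)=0$$ for all $k\in\mathbb{Z}$ ($k\ge k_0$ if $X$ is bounded) and all $y^k_\beta\in\mathscr{Y}^k$.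
   Context: Space of homogeneous type: $d:X\times X\to[0,\infty)$ is symmetric, $d(x,y)=0$ iff $x=y$, $d(x,y)\le A_0(d(x,z)+d(z,y))$ with $A_0\ge1$; $\mu$ is a nontrivial Borel measure, balls $B(x,r)=\{y:d(x,y)<r\}$ are Borel sets, and $0<\mu(B(x,2r))\le C_\mu\mu(B(x,r))<\infty$ for all $x\in X$, $r>0$. (This implies that $(X,d)$ is geometrically doubling.) A set is open if it contains, with each of its points, a ball centred at that point. $d$ is Lipschitz-continuous if for some $L'$, $d(x,z)\le d(x,y)+L'd(y,z)$ for all $x,y,z$. $d(x,E)=\inf_{y\in E}d(x,y)$. Random dyadic system. Fix $\delta\in(0,1)$ with $\delta\le\frac1{1000}A_0^{-10}$. Reference points: $\mathscr{X}^0=\{x^0_\alpha\}_\alpha$ is a maximal $1$-separated set in $X$ ($r$-separated: distinct points at distance $\ge r$); inductively for $k\ge1$, $\mathscr{X}^k=\{x^k_\alpha\}_\alpha\supseteq\mathscr{X}^{k-1}$ is a maximal $\delta^k$-separated set in $X$ and $\mathscr{X}^{-k}=\{x^{-k}_\alpha\}_\alpha\subseteq\mathscr{X}^{-(k-1)}$ is a maximal $\delta^{-k}$-separated subset of $\mathscr{X}^{-(k-1)}$. Set $\mathscr{Y}^k:=\mathscr{X}^{k+1}\setminus\mathscr{X}^k=\{y^k_\beta\}_\beta$. If $X$ is bounded, $k_0$ is a fixed integer for which $\mathscr{X}^{k_0}$ is a single point (the paper takes the largest such integer). Reference partial order $\le$ on pairs $(k,\alpha)$, generated by a parent relation: each $(k+1,\beta)$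 satisfies $(k+1,\beta)\le(k,\alpha)$ for exactly one $\alpha$, chosen so that $d(x^{k+1}_\beta,x^k_\alpha)<\frac1{2A_0}\delta^k\Rightarrow(k+1,\beta)\le(k,\alpha)\Rightarrow d(x^{k+1}_\beta,x^k_\alpha)<2A_0\delta^k$; then $(k+1,\beta)$ is a child of $(k,\alpha)$. Distinct pairs $(k,\alpha),(k,\beta)$ are neighbours if they have children $(k+1,\gamma)\le(k,\alpha)$, $(k+1,\theta)\le(k,\beta)$ with $d(x^{k+1}_\gamma,x^{k+1}_\theta)<(2A_0)^{-1}\delta^k$. Let $L$ and $M$ be the (finite) maximal numbers of neighbours and of children. Fix labels $\mathrm{label}_1(k,\alpha)\in\{0,\dots,L\}$, different for neighbours, and $\mathrm{label}_2(k,\alpha)\in\{1,\dots,M\}$, different for different children of the same parent. Let $\Omega=(\{0,\dots,L\}\times\{1,\dots,M\})^{\mathbb{Z}}$, $\omega=(\omega_k)_{k}$, $\omega_k=(\ell_k,m_k)$, with the product probability $\mathbb{P}_\omega$ of uniform measures. New points: $z^k_\alpha=z^k_\alpha(\omega):=x^{k+1}_\beta$ if $\mathrm{label}_1(k,\alpha)=\ell_k$ and there is a child $(k+1,\beta)\le(k,\alpha)$ with $\mathrm{label}_2(k+1,\beta)=m_k$; otherwise $z^k_\alpha:=x^k_\alpha$. New partial order $\le_\omega$, generated by: $(k+1,\beta)\le_\omega(k,\alpha)$ iff either $d(x^{k+1}_\beta,z^k_\alpha)<\frac14A_0^{-2}\delta^k$, or $(k+1,\beta)\le(k,\alpha)$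 and there is no $\gamma$ with $d(x^{k+1}_\beta,z^k_\gamma)<\frac14A_0^{-2}\delta^k$. Cubes: $\hat Q^k_\alpha(\omega)=\{z^\ell_\beta(\omega):(\ell,\beta)\le_\omega(k,\alpha)\}$, $\bar Q^k_\alpha(\omega)$ is its closure, $\tilde Q^k_\alpha(\omega)$ is the interior of $\bar Q^k_\alpha(\omega)$. Exponent $\eta$: with $\partial_\varepsilon Q^k_\alpha(\omega)=\{y\in\bar Q^k_\alpha(\omega):d(y,X\setminus\tilde Q^k_\alpha(\omega))<\varepsilon\delta^k\}$, $\eta\in(0,1]$ is a fixed exponent such that for some constant $C$, $\mathbb{P}_\omega(x\in\bigcup_\alpha\partial_\varepsilon Q^k_\alpha(\omega))\le C\varepsilon^\eta$ for all $x\in X$, $k\in\mathbb{Z}$, $\varepsilon>0$ (such an exponent exists). *)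

theory Defs
  imports "HOL-Probability.Probability"
begin

definition quasi_ball :: "('a \<Rightarrow> 'a \<Rightarrow> real) \<Rightarrow> 'a \<Rightarrow> real \<Rightarrow> 'a set" where
  "quasi_ball d x r = {y. d x y < r}"

text \<open>Balls of a quasi-metric need not be open in this topology.\<close>

definition quasi_topology :: "('a \<Rightarrow> 'a \<Rightarrow> real) \<Rightarrow> 'a topology" where
  "quasi_topology d = topology (\<lambda>U. \<forall>x\<in>U. \<exists>r>0. quasi_ball d x r \<subseteq> U)"

lemma openin_quasi_topology:
  "openin (quasi_topology d) U \<longleftrightarrow> (\<forall>x\<in>U. \<exists>r>0. quasi_ball d x r \<subseteq> U)"
proof -
  have "istopology (\<lambda>U. \<forall>x\<in>U. \<exists>r>0. quasi_ball d x r \<subseteq> U)"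
    unfolding istopology_def
  proof (intro conjI allI impI ballI)
    fix S T x
    assume S: "\<forall>x\<in>S. \<exists>r>0. quasi_ball d x r \<subseteq> S"
      and T: "\<forall>x\<in>T. \<exists>r>0. quasi_ball d x r \<subseteq> T" and x: "x \<in> S \<inter> T"
    then obtain r s where "r > 0" "quasi_ball d x r \<subseteq> S" "s > 0" "quasi_ball d x s \<subseteq> T"
      by blast
    then show "\<exists>r>0. quasi_ball d x r \<subseteq> S \<inter> T"
      by (intro exI[of _ "min r s"]) (auto simp: quasi_ball_def)
  next
    fix \<K> x
    assume "\<forall>K\<in>\<K>. \<forall>x\<in>K. \<exists>r>0. quasi_ball d x r \<subseteq> K" "x \<in> \<Union>\<K>"
    then show "\<exists>r>0. quasi_ball d x r \<subseteq> \<Union>\<K>"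
      by (meson UnionE Union_upper subset_trans)
  qed
  then show ?thesis
    by (simp add: quasi_topology_def)
qed

text \<open>The infimum is taken in the extended reals, so that the distance to the empty set
  is \<open>\<infinity>\<close>.\<close>

definition dist_to_set :: "('a \<Rightarrow> 'a \<Rightarrow> real) \<Rightarrow> 'a \<Rightarrow> 'a set \<Rightarrow> ereal" where
  "dist_to_set d x E = (INF y\<in>E. ereal (d x y))"

definition quasi_bounded :: "('a \<Rightarrow> 'a \<Rightarrow> real) \<Rightarrow> bool" where
  "quasi_bounded d \<longleftrightarrow> (\<exists>R. \<forall>x y. d x y \<le> R)"

definition lipschitz_quasi_metric :: "('a \<Rightarrow> 'a \<Rightarrow> real) \<Rightarrow> bool" where
  "lipschitz_quasi_metric d \<longleftrightarrow> (\<exists>L. \<forall>x y z. d x z \<le> d x y + L * d y z)"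

definition decay_exponent :: "('a \<Rightarrow> 'a \<Rightarrow> real) \<Rightarrow> real \<Rightarrow> real" where
  "decay_exponent d A0 = (if lipschitz_quasi_metric d then 1 else 1 / (1 + 2 * log 2 A0))"

definition separated :: "('a \<Rightarrow> 'a \<Rightarrow> real) \<Rightarrow> real \<Rightarrow> 'a set \<Rightarrow> bool" where
  "separated d r A \<longleftrightarrow> (\<forall>x\<in>A. \<forall>y\<in>A. x \<noteq> y \<longrightarrow> r \<le> d x y)"

definition maximal_separated :: "('a \<Rightarrow> 'a \<Rightarrow> real) \<Rightarrow> real \<Rightarrow> 'a set \<Rightarrow> 'a set \<Rightarrow> bool" where
  "maximal_separated d r S A \<longleftrightarrow> A \<subseteq> S \<and> separated d r A \<and>
     (\<forall>B. A \<subseteq> B \<and> B \<subseteq> S \<and> separated d r B \<longrightarrow> B = A)"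

text \<open>The underlying set of the space is the whole type \<open>'a\<close>.\<close>

locale homogeneous_space =
  fixes d :: "'a \<Rightarrow> 'a \<Rightarrow> real" and A0 :: real and \<mu> :: "'a measure"
  assumes dist_nonneg: "0 \<le> d x y"
    and dist_sym: "d x y = d y x"
    and dist_eq_0: "d x y = 0 \<longleftrightarrow> x = y"
    and A0_ge_1: "1 \<le> A0"
    and quasi_triangle: "d x y \<le> A0 * (d x z + d z y)"
    and space_eq: "space \<mu> = UNIV"
    and sets_eq: "sets \<mu> = sigma_sets UNIV {U. openin (quasi_topology d) U}"
    and ball_sets: "quasi_ball d x r \<in> sets \<mu>"
    and doubling: "\<exists>C::real. \<forall>x. \<forall>r>0.
          0 < emeasure \<mu> (quasi_ball d x (2 * r)) \<and>
          emeasure \<mu> (quasi_ball d x (2 * r)) \<le> ennreal C * emeasure \<mu> (quasi_ball d x r) \<and>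
          ennreal C * emeasure \<mu> (quasi_ball d x r) < \<infinity>"

text \<open>Indices are identified with points: \<open>X k\<close> is the set of reference points of
  generation \<open>k\<close>, the pair \<open>(k, \<alpha>)\<close> becomes \<open>(k, x)\<close> with \<open>x \<in> X k\<close>, and \<open>parent k y\<close> is
  the unique \<open>x \<in> X k\<close> such that \<open>(k + 1, y) \<le> (k, x)\<close>.\<close>

locale reference_dyadic_system = homogeneous_space d A0 \<mu>
  for d :: "'a \<Rightarrow> 'a \<Rightarrow> real" and A0 :: real and \<mu> :: "'a measure" +
  fixes \<delta> :: real and X :: "int \<Rightarrow> 'a set" and parent :: "int \<Rightarrow> 'a \<Rightarrow> 'a"
  assumes delta_bounds: "0 < \<delta>" "\<delta> < 1" "\<delta> \<le> 1 / (1000 * A0 ^ 10)"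
    and points_zero: "maximal_separated d 1 UNIV (X 0)"
    and points_pos: "k \<ge> 1 \<Longrightarrow> X (k - 1) \<subseteq> X k \<and> maximal_separated d (\<delta> powi k) UNIV (X k)"
    and points_neg: "k \<le> -1 \<Longrightarrow> maximal_separated d (\<delta> powi k) (X (k + 1)) (X k)"
    and parent_in: "y \<in> X (k + 1) \<Longrightarrow> parent k y \<in> X k"
    and parent_near: "y \<in> X (k + 1) \<Longrightarrow> x \<in> X k \<Longrightarrow> d y x < \<delta> powi k / (2 * A0) \<Longrightarrow> parent k y = x"
    and parent_dist: "y \<in> X (k + 1) \<Longrightarrow> d y (parent k y) < 2 * A0 * \<delta> powi k"
begin

definition children :: "int \<Rightarrow> 'a \<Rightarrow> 'a set" where
  "children k x = {y \<in> X (k + 1). parent k y = x}"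

definition neighbours :: "int \<Rightarrow> 'a \<Rightarrow> 'a set" where
  "neighbours k x = {x' \<in> X k. x' \<noteq> x \<and>
     (\<exists>y\<in>children k x. \<exists>y'\<in>children k x'. d y y' < \<delta> powi k / (2 * A0))}"

text \<open>By geometric doubling the sets counted here are finite and their cardinalities are
  uniformly bounded, so the suprema are maxima.\<close>

definition max_neighbours :: nat where
  "max_neighbours = (SUP (k, x)\<in>{(k, x). x \<in> X k}. card (neighbours k x))"

definition max_children :: nat where
  "max_children = (SUP (k, x)\<in>{(k, x). x \<in> X k}. card (children k x))"

end

locale labelled_dyadic_system = reference_dyadic_system d A0 \<mu> \<delta> X parent
  for d :: "'a \<Rightarrow> 'a \<Rightarrow> real" and A0 :: real and \<mu> :: "'a measure" and \<delta> :: real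
    and X :: "int \<Rightarrow> 'a set" and parent :: "int \<Rightarrow> 'a \<Rightarrow> 'a" +
  fixes label1 label2 :: "int \<Rightarrow> 'a \<Rightarrow> nat"
  assumes label1_range: "x \<in> X k \<Longrightarrow> label1 k x \<in> {0..max_neighbours}"
    and label1_neighbours: "x \<in> X k \<Longrightarrow> x' \<in> neighbours k x \<Longrightarrow> label1 k x \<noteq> label1 k x'"
    and label2_range: "x \<in> X k \<Longrightarrow> label2 k x \<in> {1..max_children}"
    and label2_siblings: "x \<in> X k \<Longrightarrow> y \<in> children k x \<Longrightarrow> y' \<in> children k x \<Longrightarrow> y \<noteq> y' \<Longrightarrow>
          label2 (k + 1) y \<noteq> label2 (k + 1) y'"
begin

definition P\<^sub>\<omega> :: "(int \<Rightarrow> nat \<times> nat) measure" where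
  "P\<^sub>\<omega> = PiM UNIV (\<lambda>_. uniform_count_measure ({0..max_neighbours} \<times> {1..max_children}))"

definition new_point :: "(int \<Rightarrow> nat \<times> nat) \<Rightarrow> int \<Rightarrow> 'a \<Rightarrow> 'a" where
  "new_point \<omega> k x =
     (if label1 k x = fst (\<omega> k) \<and> (\<exists>y\<in>children k x. label2 (k + 1) y = snd (\<omega> k))
      then THE y. y \<in> children k x \<and> label2 (k + 1) y = snd (\<omega> k)
      else x)"

definition new_child :: "(int \<Rightarrow> nat \<times> nat) \<Rightarrow> int \<times> 'a \<Rightarrow> int \<times> 'a \<Rightarrow> bool" where
  "new_child \<omega> = (\<lambda>(l, y) (k, x). l = k + 1 \<and> y \<in> X l \<and> x \<in> X k \<and>
     (d y (new_point \<omega> k x) < \<delta> powi k / (4 * A0\<^sup>2) \<or>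
      parent k y = x \<and> \<not> (\<exists>x'\<in>X k. d y (new_point \<omega> k x') < \<delta> powi k / (4 * A0\<^sup>2))))"

definition new_le :: "(int \<Rightarrow> nat \<times> nat) \<Rightarrow> int \<times> 'a \<Rightarrow> int \<times> 'a \<Rightarrow> bool" where
  "new_le \<omega> = (new_child \<omega>)\<^sup>*\<^sup>*"

definition pre_cube :: "(int \<Rightarrow> nat \<times> nat) \<Rightarrow> int \<Rightarrow> 'a \<Rightarrow> 'a set" where
  "pre_cube \<omega> k x = {new_point \<omega> l y | l y. y \<in> X l \<and> new_le \<omega> (l, y) (k, x)}"

definition closed_cube :: "(int \<Rightarrow> nat \<times> nat) \<Rightarrow> int \<Rightarrow> 'a \<Rightarrow> 'a set" where
  "closed_cube \<omega> k x = quasi_topology d closure_of (pre_cube \<omega> k x)"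

definition open_cube :: "(int \<Rightarrow> nat \<times> nat) \<Rightarrow> int \<Rightarrow> 'a \<Rightarrow> 'a set" where
  "open_cube \<omega> k x = quasi_topology d interior_of (closed_cube \<omega> k x)"

definition boundary_layer :: "real \<Rightarrow> (int \<Rightarrow> nat \<times> nat) \<Rightarrow> int \<Rightarrow> 'a \<Rightarrow> 'a set" where
  "boundary_layer \<epsilon> \<omega> k x =
     {y \<in> closed_cube \<omega> k x. dist_to_set d y (- open_cube \<omega> k x) < ereal (\<epsilon> * \<delta> powi k)}"

text \<open>The outer measure is the probability of the event whenever the event is measurable;
  it avoids the convention that non-measurable sets have measure \<open>0\<close>.\<close>

definition boundary_exponent :: "real \<Rightarrow> bool" where
  "boundary_exponent \<eta> \<longleftrightarrow> 0 < \<eta> \<and> \<eta> \<le> 1 \<and>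
     (\<exists>C::real. \<forall>x k \<epsilon>. \<epsilon> > 0 \<longrightarrow>
        outer_measure_of P\<^sub>\<omega> {\<omega> \<in> space P\<^sub>\<omega>. x \<in> (\<Union>x'\<in>X k. boundary_layer \<epsilon> \<omega> k x')}
          \<le> ennreal (C * \<epsilon> powr \<eta>))"

end

definition L2_functions :: "'a measure \<Rightarrow> ('a \<Rightarrow> real) set" where
  "L2_functions M = {f \<in> borel_measurable M. integrable M (\<lambda>x. (f x)\<^sup>2)}"

definition L2_inner :: "'a measure \<Rightarrow> ('a \<Rightarrow> real) \<Rightarrow> ('a \<Rightarrow> real) \<Rightarrow> real" where
  "L2_inner M f g = (\<integral>x. f x * g x \<partial>M)"

definition L2_perp_constants :: "'a measure \<Rightarrow> ('a \<Rightarrow> real) set" where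
  "L2_perp_constants M = {f \<in> L2_functions M. \<forall>c. L2_inner M f (\<lambda>_. c) = 0}"

text \<open>An orthonormal family of a subspace \<open>V\<close> of \<open>L\<^sup>2\<close> whose linear span is dense in \<open>V\<close>.
  Elements of \<open>L\<^sup>2\<close> are represented by functions.\<close>

definition L2_orthonormal_basis ::
    "'a measure \<Rightarrow> ('a \<Rightarrow> real) set \<Rightarrow> 'i set \<Rightarrow> ('i \<Rightarrow> 'a \<Rightarrow> real) \<Rightarrow> bool" where
  "L2_orthonormal_basis M V I \<psi> \<longleftrightarrow>
     (\<forall>i\<in>I. \<psi> i \<in> V) \<and>
     (\<forall>i\<in>I. \<forall>j\<in>I. L2_inner M (\<psi> i) (\<psi> j) = (if i = j then 1 else 0)) \<and>
     (\<forall>f\<in>V. \<forall>\<epsilon>>0. \<exists>F c. finite F \<and> F \<subseteq> I \<and>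
        sqrt (\<integral>x. (f x - (\<Sum>i\<in>F. c i * \<psi> i x))\<^sup>2 \<partial>M) < \<epsilon>)"

text \<open>\<open>Y\<^sup>k = X\<^sup>k\<^sup>+\<^sup>1 - X\<^sup>k\<close>; a wavelet is indexed by its generation \<open>k\<close> and its point in \<open>Y\<^sup>k\<close>.\<close>

definition wavelet_points :: "(int \<Rightarrow> 'a set) \<Rightarrow> int \<Rightarrow> 'a set" where
  "wavelet_points X k = X (k + 1) - X k"

definition wavelet_indices ::
    "('a \<Rightarrow> 'a \<Rightarrow> real) \<Rightarrow> (int \<Rightarrow> 'a set) \<Rightarrow> int \<Rightarrow> (int \<times> 'a) set" where
  "wavelet_indices d X k0 =
     {(k, y). y \<in> wavelet_points X k \<and> (quasi_bounded d \<longrightarrow> k0 \<le> k)}"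

end

theory Submission
  imports Defs
begin

text \<open>
  The probability \<open>s\<^sup>k\<^sub>x (y)\<close> that \<open>y\<close> lies in the random cube of the reference point \<open>x\<close> is a spline:
  the splines of a level form a partition of unity, equal 1 near their own reference point, are
  Hoelder continuous by the boundary estimate, and satisfy a two-scale relation because the
  coordinate at \<open>k\<close> is independent of the later ones. Coarse splines at the points of \<open>X k\<close> and fine
  splines at the new points are together a Riesz basis of the fine spline space, with a banded
  normalized Gram matrix. The dual functions at the new points are orthogonal to the coarse splines;
  orthonormalizing them by the inverse square root of their Gram matrix gives the wavelets. The
  entries of that inverse square root decay exponentially in a genuine metric comparable to \<open>d powr a\<close>
  (Frink chains, or additivity along chains if \<open>d\<close> is Lipschitz), by interpolating between operator norm
  bounds and decay bounds for the powers in the binomial series. Completeness holds since the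
  splines are dense, while projections onto coarser and coarser spline spaces vanish if \<open>X\<close> is unbounded
  and end at the constants otherwise.
\<close>

text \<open>One exponent and one constant must serve all generations at once. Therefore the systems
  of all levels form a single matrix indexed by pairs \<open>(k, y)\<close>: the weight
  \<open>blk_wt\<close> vanishes between different levels, so an estimate for this block diagonal
  matrix is automatically uniform in k. The inverse square root is preferred to Gram-Schmidt because
  it needs no ordering of the points and is a power series in the matrix, to which decay estimates
  for powers apply. In the general case the exponent a satisfies (2 A0)^a <= 2, which is the
  condition that Frink's argument puts on d^a. Balls of d need not be open; where an exhaustion by
  open sets is needed, balls of the continuous metric \<open>rho\<close> take their place.\<close>

lemma summable_on_product_bound:
  fixes f :: "'a \<Rightarrow> 'b \<Rightarrow> real"
  assumes f: "\<And>x y. \<bar>f x y\<bar> \<le> g x * h y"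
    and g: "g summable_on UNIV" and h: "h summable_on UNIV"
    and g0: "\<And>x. 0 \<le> g x" and h0: "\<And>y. 0 \<le> h y"
  shows "(\<lambda>(x, y). f x y) summable_on UNIV \<times> UNIV"
proof -
  have "(\<lambda>(x, y). g x * h y) summable_on (SIGMA x:UNIV. UNIV)"
    by (rule summable_on_SigmaI[where g = "\<lambda>x. g x * infsum h UNIV"])
      (auto intro!: has_sum_cmult_right summable_on_cmult_left g mult_nonneg_nonneg g0 h0 simp: h)
  then have "(\<lambda>z. norm (case z of (x, y) \<Rightarrow> f x y)) summable_on UNIV \<times> UNIV"
    by (rule summable_on_comparison_test) (auto intro: f)
  then show ?thesis
    by (rule abs_summable_summable)
qed

lemma infsum_swap_bound:
  fixes f :: "'a \<Rightarrow> 'b \<Rightarrow> real"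
  assumes "\<And>x y. \<bar>f x y\<bar> \<le> g x * h y"
    and "g summable_on UNIV" and "h summable_on UNIV"
    and "\<And>x. 0 \<le> g x" and "\<And>y. 0 \<le> h y"
  shows "(\<Sum>\<^sub>\<infinity>x. \<Sum>\<^sub>\<infinity>y. f x y) = (\<Sum>\<^sub>\<infinity>y. \<Sum>\<^sub>\<infinity>x. f x y)"
  by (rule infsum_swap_banach) (rule summable_on_product_bound[OF assms])

lemma summable_on_real_bound:
  fixes f :: "'a \<Rightarrow> real"
  assumes "g summable_on A" "\<And>x. x \<in> A \<Longrightarrow> \<bar>f x\<bar> \<le> g x"
  shows "f summable_on A"
  by (rule abs_summable_summable, rule summable_on_comparison_test[OF assms(1)])
    (use assms(2) in auto)

lemma abs_infsum_le:
  fixes f :: "'a \<Rightarrow> real"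
  assumes "g summable_on A" "\<And>x. x \<in> A \<Longrightarrow> \<bar>f x\<bar> \<le> g x"
  shows "\<bar>infsum f A\<bar> \<le> infsum g A"
proof -
  have s: "(\<lambda>x. \<bar>f x\<bar>) summable_on A"
    by (rule summable_on_real_bound[OF assms(1)]) (use assms(2) in auto)
  have "\<bar>infsum f A\<bar> \<le> (\<Sum>\<^sub>\<infinity>x\<in>A. \<bar>f x\<bar>)"
    using norm_infsum_bound[of f A] s by simp
  also have "\<dots> \<le> infsum g A"
    by (rule infsum_mono) (use s assms in auto)
  finally show ?thesis .
qed

lemma infsum_of_sum:
  fixes f :: "'a \<Rightarrow> 'b \<Rightarrow> real"
  assumes "finite F" "\<And>i. i \<in> F \<Longrightarrow> f i summable_on A"
  shows "(\<Sum>\<^sub>\<infinity>x\<in>A. \<Sum>i\<in>F. f i x) = (\<Sum>i\<in>F. infsum (f i) A)"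
    and "(\<lambda>x. \<Sum>i\<in>F. f i x) summable_on A"
  using assms by (induction rule: finite_induct) (auto simp: infsum_add summable_on_add)

lemma infsum_suminf_bound:
  fixes f :: "nat \<Rightarrow> real"
  assumes "summable (\<lambda>n. \<bar>f n\<bar>)"
  shows "infsum f UNIV = suminf f" "f summable_on UNIV"
proof -
  have "(f has_sum suminf f) UNIV"
    using assms by (intro norm_summable_imp_has_sum) (auto intro: summable_sums summable_rabs_cancel)
  then show "infsum f UNIV = suminf f" "f summable_on UNIV"
    by (auto simp: infsumI summable_on_def)
qed

subsection \<open>Operator bounds from bilinear form bounds\<close>

text \<open>Testing the form against \<open>y = T x\<close> on \<open>F\<close>, scaled by \<open>1 / q\<close>, gives the \<open>\<ell>\<^sup>2\<close> bound.\<close>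

lemma bilinear_bound_imp_l2_bound_finite:
  fixes T :: "'i \<Rightarrow> 'j \<Rightarrow> real"
  assumes q: "0 < q" and fin: "finite F" "finite G"
    and B: "\<And>x y. \<bar>\<Sum>i\<in>F. \<Sum>j\<in>G. x i * y j * T i j\<bar> \<le> q / 2 * ((\<Sum>i\<in>F. (x i)\<^sup>2) + (\<Sum>j\<in>G. (y j)\<^sup>2))"
  shows "(\<Sum>i\<in>F. (\<Sum>j\<in>G. T i j * y j)\<^sup>2) \<le> q\<^sup>2 * (\<Sum>j\<in>G. (y j)\<^sup>2)"
proof -
  define z where "z i = (\<Sum>j\<in>G. T i j * y j)" for i
  let ?Z = "\<Sum>i\<in>F. (z i)\<^sup>2" and ?Y = "\<Sum>j\<in>G. (y j)\<^sup>2"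
  have "(\<Sum>i\<in>F. \<Sum>j\<in>G. z i / q * y j * T i j) = ?Z / q"
  proof -
    have "(\<Sum>j\<in>G. z i / q * y j * T i j) = z i / q * z i" for i
    proof -
      have "(\<Sum>j\<in>G. z i / q * y j * T i j) = (\<Sum>j\<in>G. z i / q * (T i j * y j))"
        by (intro sum.cong) auto
      then show ?thesis
        unfolding z_def[of i] sum_distrib_left[symmetric] .
    qed
    then show ?thesis
      by (simp add: sum_divide_distrib power2_eq_square)
  qed
  moreover have "(\<Sum>i\<in>F. (z i / q)\<^sup>2) = ?Z / q\<^sup>2"
    by (simp add: power_divide sum_divide_distrib)
  ultimately have "?Z / q \<le> q / 2 * (?Z / q\<^sup>2 + ?Y)"
    using abs_le_D1[OF B[of "\<lambda>i. z i / q" y]] by simp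
  then have "?Z \<le> q\<^sup>2 * ?Y"
    using q by (simp add: field_simps power2_eq_square)
  then show ?thesis
    by (simp add: z_def)
qed

text \<open>The finite bound is uniform in G, so it passes to the limit along the net of finite sets
  of columns. Square summability of y enters only through bounded partial sums, which is the form
  that an induction over matrix powers supplies.\<close>

lemma bilinear_bound_imp_l2_bound:
  fixes T :: "'i \<Rightarrow> 'j \<Rightarrow> real"
  assumes q: "0 < q" and F: "finite F"
    and B: "\<And>G x y. finite G \<Longrightarrow>
      \<bar>\<Sum>i\<in>F. \<Sum>j\<in>G. x i * y j * T i j\<bar> \<le> q / 2 * ((\<Sum>i\<in>F. (x i)\<^sup>2) + (\<Sum>j\<in>G. (y j)\<^sup>2))"
    and M: "\<And>G. finite G \<Longrightarrow> (\<Sum>j\<in>G. (y j)\<^sup>2) \<le> M"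
    and s: "\<And>i. i \<in> F \<Longrightarrow> (\<lambda>j. T i j * y j) summable_on UNIV"
  shows "(\<Sum>i\<in>F. (\<Sum>\<^sub>\<infinity>j. T i j * y j)\<^sup>2) \<le> q\<^sup>2 * M"
proof (rule tendsto_upperbound)
  show "((\<lambda>G. \<Sum>i\<in>F. (\<Sum>j\<in>G. T i j * y j)\<^sup>2) \<longlongrightarrow> (\<Sum>i\<in>F. (\<Sum>\<^sub>\<infinity>j. T i j * y j)\<^sup>2))
      (finite_subsets_at_top UNIV)"
    by (intro tendsto_sum tendsto_power infsum_tendsto s)
  have "(\<Sum>i\<in>F. (\<Sum>j\<in>G. T i j * y j)\<^sup>2) \<le> q\<^sup>2 * M" if "finite G" for G
  proof -
    have "(\<Sum>i\<in>F. (\<Sum>j\<in>G. T i j * y j)\<^sup>2) \<le> q\<^sup>2 * (\<Sum>j\<in>G. (y j)\<^sup>2)"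
      by (rule bilinear_bound_imp_l2_bound_finite[OF q F that B]) (rule that)
    also have "\<dots> \<le> q\<^sup>2 * M"
      by (intro mult_left_mono M that) auto
    finally show ?thesis .
  qed
  then show "\<forall>\<^sub>F G in finite_subsets_at_top UNIV. (\<Sum>i\<in>F. (\<Sum>j\<in>G. T i j * y j)\<^sup>2) \<le> q\<^sup>2 * M"
    by (auto simp: eventually_finite_subsets_at_top)
qed simp

text \<open>Polarization: 4 B(u, v) = B(u + v, u + v) - B(u - v, u - v), where positivity discards
  the subtracted form, the upper bound controls the other one, and the parallelogram law finishes.
  Exchanging the two forms bounds -4 B(u, v). This turns 0 <= R <= q, meant as forms, into an
  operator bound.\<close>

lemma quadratic_imp_bilinear_bound:
  fixes R :: "'i \<Rightarrow> 'i \<Rightarrow> real"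
  assumes q: "0 < q" and sym: "\<And>i j. R i j = R j i"
    and nonneg: "\<And>F x. finite F \<Longrightarrow> 0 \<le> (\<Sum>i\<in>F. \<Sum>j\<in>F. x i * x j * R i j)"
    and le: "\<And>F x. finite F \<Longrightarrow> (\<Sum>i\<in>F. \<Sum>j\<in>F. x i * x j * R i j) \<le> q * (\<Sum>i\<in>F. (x i)\<^sup>2)"
    and fin: "finite F" "finite G"
  shows "\<bar>\<Sum>i\<in>F. \<Sum>j\<in>G. x i * y j * R i j\<bar> \<le> q / 2 * ((\<Sum>i\<in>F. (x i)\<^sup>2) + (\<Sum>j\<in>G. (y j)\<^sup>2))"
proof -
  \<comment> \<open>Both vectors are extended by zero to a common index set, because the symmetry of
    R can only be used on a square sum.\<close>
  define H where "H = F \<union> G"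
  have H: "finite H" "F \<subseteq> H" "G \<subseteq> H"
    using fin by (auto simp: H_def)
  define u where "u i = (if i \<in> F then x i else 0)" for i
  define v where "v i = (if i \<in> G then y i else 0)" for i
  define B where "B a b = (\<Sum>i\<in>H. \<Sum>j\<in>H. a i * b j * R i j)" for a b
  have uu: "(\<Sum>i\<in>H. (u i)\<^sup>2) = (\<Sum>i\<in>F. (x i)\<^sup>2)"
    by (rule sum.mono_neutral_cong_right) (use H in \<open>auto simp: u_def\<close>)
  have idx_vol: "(\<Sum>i\<in>H. (v i)\<^sup>2) = (\<Sum>i\<in>G. (y i)\<^sup>2)"
    by (rule sum.mono_neutral_cong_right) (use H in \<open>auto simp: v_def\<close>)
  have "(\<Sum>j\<in>H. u i * v j * R i j) = (\<Sum>j\<in>G. u i * y j * R i j)" for i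
    by (rule sum.mono_neutral_cong_right) (use H in \<open>auto simp: v_def\<close>)
  then have "B u v = (\<Sum>i\<in>H. \<Sum>j\<in>G. u i * y j * R i j)"
    by (simp add: B_def)
  also have "\<dots> = (\<Sum>i\<in>F. \<Sum>j\<in>G. x i * y j * R i j)"
    by (rule sum.mono_neutral_cong_right) (use H in \<open>auto simp: u_def\<close>)
  finally have Buv: "B u v = (\<Sum>i\<in>F. \<Sum>j\<in>G. x i * y j * R i j)" .
  have sw: "B v u = B u v"
    unfolding B_def by (subst sum.swap) (simp add: sym mult.commute mult.left_commute)
  have p: "B (\<lambda>i. u i + v i) (\<lambda>i. u i + v i) = B u u + 2 * B u v + B v v"
  proof -
    have "B (\<lambda>i. u i + v i) (\<lambda>i. u i + v i) = B u u + B u v + B v u + B v v"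
      unfolding B_def sum.distrib[symmetric] by (intro sum.cong refl) (simp add: algebra_simps)
    then show ?thesis
      using sw by simp
  qed
  have m: "B (\<lambda>i. u i - v i) (\<lambda>i. u i - v i) = B u u - 2 * B u v + B v v"
  proof -
    have "B (\<lambda>i. u i - v i) (\<lambda>i. u i - v i) + B u v + B v u = B u u + B v v"
      unfolding B_def sum.distrib[symmetric] by (intro sum.cong refl) (simp add: algebra_simps)
    then show ?thesis
      using sw by simp
  qed
  have s: "(\<Sum>i\<in>H. (u i + v i)\<^sup>2) + (\<Sum>i\<in>H. (u i - v i)\<^sup>2) = 2 * (\<Sum>i\<in>H. (u i)\<^sup>2) + 2 * (\<Sum>i\<in>H. (v i)\<^sup>2)"
    unfolding sum_distrib_left sum.distrib[symmetric]
    by (intro sum.cong refl) (simp add: power2_eq_square algebra_simps)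
  have np: "0 \<le> (\<Sum>i\<in>H. (u i + v i)\<^sup>2)" "0 \<le> (\<Sum>i\<in>H. (u i - v i)\<^sup>2)"
    by (auto intro: sum_nonneg)
  have "4 * B u v \<le> q * (\<Sum>i\<in>H. (u i + v i)\<^sup>2)"
    using nonneg[OF H(1), of "\<lambda>i. u i - v i"] le[OF H(1), of "\<lambda>i. u i + v i"] p m
    unfolding B_def by linarith
  also have "\<dots> \<le> q * (2 * (\<Sum>i\<in>H. (u i)\<^sup>2) + 2 * (\<Sum>i\<in>H. (v i)\<^sup>2))"
    using q s np by (intro mult_left_mono) auto
  finally have 1: "4 * B u v \<le> q * (2 * (\<Sum>i\<in>H. (u i)\<^sup>2) + 2 * (\<Sum>i\<in>H. (v i)\<^sup>2))" .
  have "- 4 * B u v \<le> q * (\<Sum>i\<in>H. (u i - v i)\<^sup>2)"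
    using nonneg[OF H(1), of "\<lambda>i. u i + v i"] le[OF H(1), of "\<lambda>i. u i - v i"] p m
    unfolding B_def by linarith
  also have "\<dots> \<le> q * (2 * (\<Sum>i\<in>H. (u i)\<^sup>2) + 2 * (\<Sum>i\<in>H. (v i)\<^sup>2))"
    using q s np by (intro mult_left_mono) auto
  finally have 2: "- 4 * B u v \<le> q * (2 * (\<Sum>i\<in>H. (u i)\<^sup>2) + 2 * (\<Sum>i\<in>H. (v i)\<^sup>2))" .
  have "\<bar>B u v\<bar> \<le> q / 2 * ((\<Sum>i\<in>H. (u i)\<^sup>2) + (\<Sum>i\<in>H. (v i)\<^sup>2))"
    using 1 2 by (simp add: algebra_simps abs_le_iff)
  then show ?thesis
    unfolding Buv uu idx_vol .
qed

subsection \<open>Matrices with off-diagonal decay\<close>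

definition mmul :: "('i \<Rightarrow> 'k \<Rightarrow> real) \<Rightarrow> ('k \<Rightarrow> 'j \<Rightarrow> real) \<Rightarrow> 'i \<Rightarrow> 'j \<Rightarrow> real" where
  "mmul A B i j = (\<Sum>\<^sub>\<infinity>k. A i k * B k j)"

text \<open>Matrices are indexed by a whole type but supported on J, so the unit of their algebra is
  the projection onto the coordinates in J.\<close>

definition mident :: "'i set \<Rightarrow> 'i \<Rightarrow> 'i \<Rightarrow> real" where
  "mident J i j = (if i \<in> J \<and> i = j then 1 else 0)"

primrec mpow :: "'i set \<Rightarrow> ('i \<Rightarrow> 'i \<Rightarrow> real) \<Rightarrow> nat \<Rightarrow> 'i \<Rightarrow> 'i \<Rightarrow> real" where
  "mpow J R 0 = mident J"
| "mpow J R (Suc n) = mmul R (mpow J R n)"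

text \<open>The weight \<open>e\<close> stands for \<open>exp (- \<rho>)\<close> with a metric \<open>\<rho>\<close> on \<open>J\<close> that may take
  the value \<open>\<infinity>\<close>: the matrices below are then block diagonal, and a statement about one of them
  is uniform over all blocks.\<close>

locale exp_weight =
  fixes e :: "'i \<Rightarrow> 'i \<Rightarrow> real" and J :: "'i set" and N :: "real \<Rightarrow> real"
  assumes e_nonneg: "0 \<le> e i j" and e_le_1: "e i j \<le> 1" and e_sym: "e i j = e j i"
    and e_diag: "i \<in> J \<Longrightarrow> e i i = 1" and e_outside: "i \<notin> J \<Longrightarrow> e i j = 0"
    and e_mult_le: "e i k * e k j \<le> e i j"
    and e_sum_le: "0 < t \<Longrightarrow> finite F \<Longrightarrow> (\<Sum>j\<in>F. e i j powr t) \<le> N t"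
begin

definition decays :: "real \<Rightarrow> real \<Rightarrow> ('i \<Rightarrow> 'i \<Rightarrow> real) \<Rightarrow> bool" where
  "decays C t A \<longleftrightarrow> (\<forall>i j. \<bar>A i j\<bar> \<le> C * e i j powr t)"

lemma decaysD: "decays C t A \<Longrightarrow> \<bar>A i j\<bar> \<le> C * e i j powr t"
  by (simp add: decays_def)

lemma N_nonneg: "0 < t \<Longrightarrow> 0 \<le> N t"
  using e_sum_le[of t "{}"] by simp

lemma e_summable:
  assumes "0 < t"
  shows "(\<lambda>j. e i j powr t) summable_on UNIV"
  by (rule nonneg_bdd_above_summable_on) (auto intro!: bdd_aboveI e_sum_le assms)

lemma e_infsum_le: "0 < t \<Longrightarrow> (\<Sum>\<^sub>\<infinity>j. e i j powr t) \<le> N t"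
  by (rule infsum_le_finite_sums) (auto intro: e_summable e_sum_le)

lemma e_powr_le_1: "0 \<le> t \<Longrightarrow> e i j powr t \<le> 1"
  using powr_mono2[of t "e i j" 1] e_nonneg e_le_1 by simp

lemma e_powr_mono: "s \<le> t \<Longrightarrow> e i j powr t \<le> e i j powr s"
  by (intro powr_mono' e_nonneg e_le_1)

lemma e_powr_mult_le: "0 \<le> t \<Longrightarrow> e i k powr t * e k j powr t \<le> e i j powr t"
  using powr_mono2[OF _ _ e_mult_le, of t i k j] e_nonneg by (simp add: powr_mult)

text \<open>The part s of the exponent is carried through the composition by the triangle
  inequality, and the surplus t - s stays on the first factor, where it makes the sum over the inner
  index k converge.\<close>

lemma e_powr_mult_split:
  assumes "0 \<le> s" "s \<le> t"
  shows "e i k powr t * e k j powr s \<le> e i k powr (t - s) * e i j powr s"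
proof -
  have "e i k powr t * e k j powr s = e i k powr (t - s) * (e i k powr s * e k j powr s)"
    using powr_add[of "e i k" "t - s" s] by simp
  also have "\<dots> \<le> e i k powr (t - s) * e i j powr s"
    by (intro mult_left_mono e_powr_mult_le assms) auto
  finally show ?thesis .
qed

lemma decays_outside: "decays C t A \<Longrightarrow> i \<notin> J \<or> j \<notin> J \<Longrightarrow> A i j = 0"
  using decaysD[of C t A i j] e_outside[of i j] e_outside[of j i] e_sym[of i j] by auto

lemma decays_mono:
  assumes "decays C t A" "C \<le> D" "s \<le> t" "0 \<le> D"
  shows "decays D s A"
  unfolding decays_def
proof (intro allI)
  fix i j
  have "\<bar>A i j\<bar> \<le> C * e i j powr t"
    using assms(1) by (rule decaysD)
  also have "\<dots> \<le> D * e i j powr s"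
    using assms(2-4) by (intro mult_mono e_powr_mono) auto
  finally show "\<bar>A i j\<bar> \<le> D * e i j powr s" .
qed

lemma decays_le_abs: "decays C t A \<Longrightarrow> decays \<bar>C\<bar> t A"
  by (rule decays_mono[of C t A]) auto

lemma decays_transpose: "decays C t A \<Longrightarrow> decays C t (\<lambda>i j. A j i)"
  unfolding decays_def by (metis e_sym)

lemma decays_mident: "decays 1 t (mident J)"
  using e_diag by (auto simp: decays_def mident_def)

lemma decays_term_bound:
  assumes "decays C t A" "decays D s B" "0 \<le> s" "s \<le> t" "0 \<le> C" "0 \<le> D"
  shows "\<bar>A i k * B k j\<bar> \<le> C * D * e i j powr s * e i k powr (t - s)"
proof -
  have "\<bar>A i k * B k j\<bar> \<le> (C * e i k powr t) * (D * e k j powr s)"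
    unfolding abs_mult
    using assms by (intro mult_mono decaysD) auto
  also have "\<dots> = C * D * (e i k powr t * e k j powr s)"
    by simp
  also have "\<dots> \<le> C * D * (e i k powr (t - s) * e i j powr s)"
    using assms by (intro mult_left_mono e_powr_mult_split) auto
  finally show ?thesis
    by (simp add: mult_ac)
qed

lemma decays_mmul:
  assumes A: "decays C t A" and B: "decays D s B" and "0 \<le> s" "s < t" "0 \<le> C" "0 \<le> D"
  shows "decays (C * D * N (t - s)) s (mmul A B)"
  unfolding decays_def mmul_def
proof (intro allI)
  fix i j
  have s: "(\<lambda>k. C * D * e i j powr s * e i k powr (t - s)) summable_on UNIV"
    using assms by (intro summable_on_cmult_right e_summable) auto
  have "\<bar>\<Sum>\<^sub>\<infinity>k. A i k * B k j\<bar> \<le> (\<Sum>\<^sub>\<infinity>k. C * D * e i j powr s * e i k powr (t - s))"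
    using assms by (intro abs_infsum_le s decays_term_bound) auto
  also have "\<dots> = C * D * e i j powr s * (\<Sum>\<^sub>\<infinity>k. e i k powr (t - s))"
    by (simp add: infsum_cmult_right')
  also have "\<dots> \<le> C * D * e i j powr s * N (t - s)"
    using assms by (intro mult_left_mono e_infsum_le) auto
  finally show "\<bar>\<Sum>\<^sub>\<infinity>k. A i k * B k j\<bar> \<le> C * D * N (t - s) * e i j powr s"
    by (simp add: mult_ac)
qed

text \<open>A product has a strictly smaller exponent than its factors. With constant and exponent
  quantified existentially, the class is closed under products and transposes.\<close>

definition decaying :: "('i \<Rightarrow> 'i \<Rightarrow> real) \<Rightarrow> bool" where
  "decaying A \<longleftrightarrow> (\<exists>C t. 0 \<le> C \<and> 0 < t \<and> decays C t A)"

lemma decayingI: "decays C t A \<Longrightarrow> 0 < t \<Longrightarrow> decaying A"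
  unfolding decaying_def using decays_le_abs[of C t A] abs_ge_zero by blast

lemma decaying2E:
  assumes "decaying A" "decaying B"
  obtains C t where "0 \<le> C" "0 < t" "decays C t A" "decays C t B"
proof -
  obtain C t D s where *: "0 \<le> C" "0 < t" "decays C t A" "0 \<le> D" "0 < s" "decays D s B"
    using assms unfolding decaying_def by blast
  show ?thesis
    using *(1,2,4,5) decays_mono[OF *(3), of "max C D" "min t s"]
      decays_mono[OF *(6), of "max C D" "min t s"]
    by (intro that[of "max C D" "min t s"]) auto
qed

lemma decaying_mmul:
  assumes "decaying A" "decaying B"
  shows "decaying (mmul A B)"
proof -
  obtain C t where *: "0 \<le> C" "0 < t" "decays C t A" "decays C t B"
    using decaying2E[OF assms] .
  have "decays C (t / 2) B"
    using * by (intro decays_mono[OF *(4)]) auto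
  then show ?thesis
    using * decayingI[OF decays_mmul[OF *(3), of C "t / 2" B]] by simp
qed

lemma decaying_transpose: "decaying A \<Longrightarrow> decaying (\<lambda>i j. A j i)"
  unfolding decaying_def using decays_transpose by blast

lemma decaying_outside: "decaying A \<Longrightarrow> i \<notin> J \<or> j \<notin> J \<Longrightarrow> A i j = 0"
  unfolding decaying_def using decays_outside by blast

lemma mmul_summable:
  assumes "decaying A" "decaying B"
  shows "(\<lambda>k. A i k * B k j) summable_on UNIV"
proof -
  obtain C t where *: "0 \<le> C" "0 < t" "decays C t A" "decays C t B"
    using decaying2E[OF assms] .
  have "decays C (t / 2) B"
    using * by (intro decays_mono[OF *(4)]) auto
  then have "\<bar>A i k * B k j\<bar> \<le> C * C * e i j powr (t / 2) * e i k powr (t - t / 2)" for k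
    using * by (intro decays_term_bound) auto
  moreover have "(\<lambda>k. C * C * e i j powr (t / 2) * e i k powr (t - t / 2)) summable_on UNIV"
    using * by (intro summable_on_cmult_right e_summable) auto
  ultimately show ?thesis
    by (rule summable_on_real_bound[rotated])
qed

lemma mmul_assoc:
  assumes "decaying A" "decaying B" "decaying D"
  shows "mmul (mmul A B) D = mmul A (mmul B D)"
proof (intro ext)
  fix i j
  obtain C t where 1: "0 \<le> C" "0 < t" "decays C t A" "decays C t B"
    using decaying2E[OF assms(1,2)] .
  obtain E s where 2: "0 \<le> E" "0 < s" "decays E s D"
    using assms(3) unfolding decaying_def by blast
  \<comment> \<open>A function of k times a function of l dominates the triple product, which
    justifies exchanging the sums. The middle factor contributes only the bound C; summability comes
    from the two outer ones.\<close>
  have b: "\<bar>A i k * B k l * D l j\<bar> \<le> (C * C * e i k powr t) * (E * e j l powr s)" for k l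
  proof -
    have "\<bar>B k l\<bar> \<le> C * 1"
      using decaysD[OF 1(4), of k l] mult_left_mono[OF e_powr_le_1[of t k l] 1(1)] 1(2) by simp
    then have "\<bar>A i k * B k l\<bar> \<le> (C * e i k powr t) * C"
      unfolding abs_mult using decaysD[OF 1(3), of i k] 1(1)
      by (intro mult_mono) auto
    then have "\<bar>A i k * B k l\<bar> * \<bar>D l j\<bar> \<le> ((C * e i k powr t) * C) * (E * e l j powr s)"
      using decaysD[OF 2(3), of l j] 1(1) by (intro mult_mono) auto
    then show ?thesis
      by (simp add: abs_mult e_sym[of l j] mult_ac)
  qed
  have "mmul (mmul A B) D i j = (\<Sum>\<^sub>\<infinity>l. \<Sum>\<^sub>\<infinity>k. A i k * B k l * D l j)"
    by (simp add: mmul_def infsum_cmult_left')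
  also have "\<dots> = (\<Sum>\<^sub>\<infinity>k. \<Sum>\<^sub>\<infinity>l. A i k * B k l * D l j)"
    by (rule infsum_swap_bound[symmetric, OF b])
      (use 1 2 in \<open>auto intro!: summable_on_cmult_right e_summable\<close>)
  also have "\<dots> = mmul A (mmul B D) i j"
    by (simp add: mmul_def infsum_cmult_right' mult.assoc)
  finally show "mmul (mmul A B) D i j = mmul A (mmul B D) i j" .
qed

lemma mmul_transpose: "mmul (\<lambda>i j. B j i) (\<lambda>i j. A j i) = (\<lambda>i j. mmul A B j i)"
proof (intro ext)
  show "mmul (\<lambda>i j. B j i) (\<lambda>i j. A j i) i j = mmul A B j i" for i j
    unfolding mmul_def by (rule infsum_cong) (rule mult.commute)
qed

lemma infsum_single:
  fixes f :: "'b \<Rightarrow> real"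
  assumes "\<And>k. k \<noteq> i \<Longrightarrow> f k = 0"
  shows "infsum f UNIV = f i"
proof -
  have "infsum f UNIV = infsum f {i}"
    by (rule infsum_cong_neutral) (use assms in auto)
  then show ?thesis by simp
qed

lemma mmul_mident_left: "decaying A \<Longrightarrow> mmul (mident J) A = A"
proof (intro ext)
  fix i j assume A: "decaying A"
  have "mmul (mident J) A i j = mident J i i * A i j"
    unfolding mmul_def by (rule infsum_single) (auto simp: mident_def)
  then show "mmul (mident J) A i j = A i j"
    using decaying_outside[OF A, of i j] by (auto simp: mident_def)
qed

lemma mident_sym: "mident J i j = mident J j i"
  by (auto simp: mident_def)

lemma mmul_mident_right: "decaying A \<Longrightarrow> mmul A (mident J) = A"
proof (intro ext)
  fix i j assume A: "decaying A"
  have "mmul A (mident J) i j = A i j * mident J j j"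
    unfolding mmul_def by (rule infsum_single) (auto simp: mident_def)
  then show "mmul A (mident J) i j = A i j"
    using decaying_outside[OF A, of i j] by (auto simp: mident_def)
qed

end

section \<open>Coefficients of the power series of (1 - x)^(-1/2)\<close>

definition inv_sqrt_coeff :: "nat \<Rightarrow> real" where
  "inv_sqrt_coeff n = pochhammer (1 / 2) n / fact n"

lemma inv_sqrt_coeff_nonneg: "0 \<le> inv_sqrt_coeff n"
  by (simp add: inv_sqrt_coeff_def pochhammer_nonneg)

text \<open>The square of (1 - x)^(-1/2) is 1 / (1 - x), whose coefficients are all 1. For the
  coefficients this is the Vandermonde identity for rising factorials at 1/2 + 1/2.\<close>

lemma inv_sqrt_coeff_conv: "(\<Sum>k\<le>n. inv_sqrt_coeff k * inv_sqrt_coeff (n - k)) = 1"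
proof -
  have "pochhammer (1 / 2 + 1 / 2 :: real) n =
      (\<Sum>k\<le>n. of_nat (n choose k) * pochhammer (1 / 2) k * pochhammer (1 / 2) (n - k))"
    by (rule pochhammer_binomial_sum)
  also have "\<dots> = (\<Sum>k\<le>n. fact n * (inv_sqrt_coeff k * inv_sqrt_coeff (n - k)))"
    by (intro sum.cong refl) (simp add: inv_sqrt_coeff_def binomial_fact)
  also have "pochhammer (1 / 2 + 1 / 2 :: real) n = fact n"
    by (simp add: pochhammer_fact)
  finally have "fact n = fact n * (\<Sum>k\<le>n. inv_sqrt_coeff k * inv_sqrt_coeff (n - k))"
    by (simp add: sum_distrib_left)
  then show ?thesis
    by simp
qed

text \<open>The convolution identity has nonnegative terms, and its term at k = n is the coefficient
  itself. The estimates for matrix series ask only for coefficients of modulus at most 1.\<close>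

lemma inv_sqrt_coeff_le_1: "inv_sqrt_coeff n \<le> 1"
proof -
  have "inv_sqrt_coeff n * inv_sqrt_coeff (n - n) \<le> (\<Sum>k\<le>n. inv_sqrt_coeff k * inv_sqrt_coeff (n - k))"
    by (rule member_le_sum) (auto simp: inv_sqrt_coeff_nonneg)
  then show ?thesis
    unfolding inv_sqrt_coeff_conv by (simp add: inv_sqrt_coeff_def)
qed

lemma mmul_scale_left: "mmul (\<lambda>i j. a * A i j) B = (\<lambda>i j. a * mmul A B i j)"
  by (intro ext) (simp add: mmul_def mult.assoc infsum_cmult_right')

lemma mmul_scale_right: "mmul A (\<lambda>i j. a * B i j) = (\<lambda>i j. a * mmul A B i j)"
  by (intro ext) (simp add: mmul_def mult.left_commute infsum_cmult_right')

context exp_weight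
begin

text \<open>Schur test: 2 |x y| <= x^2 + y^2 separates the two vectors; the entries are then summed
  along rows for one and along columns for the other, and the symmetry of e bounds both sums by
  \<open>N t\<close>.\<close>

lemma decays_bilinear_bound:
  assumes A: "decays C t A" and t: "0 < t" and C: "0 \<le> C" and fin: "finite F" "finite G"
  shows "\<bar>\<Sum>i\<in>F. \<Sum>j\<in>G. x i * y j * A i j\<bar> \<le> C * N t / 2 * ((\<Sum>i\<in>F. (x i)\<^sup>2) + (\<Sum>j\<in>G. (y j)\<^sup>2))"
proof -
  have b: "\<bar>x i * y j * A i j\<bar> \<le> C / 2 * ((x i)\<^sup>2 * e i j powr t) + C / 2 * ((y j)\<^sup>2 * e i j powr t)" for i j
  proof -
    have "\<bar>x i * y j\<bar> \<le> ((x i)\<^sup>2 + (y j)\<^sup>2) / 2"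
      using sum_squares_ge_zero[of "\<bar>x i\<bar> - \<bar>y j\<bar>" 0]
      by (simp add: abs_mult algebra_simps power2_eq_square)
    then have "\<bar>x i * y j\<bar> * \<bar>A i j\<bar> \<le> ((x i)\<^sup>2 + (y j)\<^sup>2) / 2 * (C * e i j powr t)"
      by (intro mult_mono decaysD[OF A]) auto
    then show ?thesis
      by (simp add: abs_mult algebra_simps add_divide_distrib)
  qed
  have e_sum_le': "(\<Sum>i\<in>F. e i j powr t) \<le> N t" for j
    using e_sum_le[OF t fin(1), of j] by (simp add: e_sym[of _ j])
  have "\<bar>\<Sum>i\<in>F. \<Sum>j\<in>G. x i * y j * A i j\<bar> \<le> (\<Sum>i\<in>F. \<Sum>j\<in>G. \<bar>x i * y j * A i j\<bar>)"
    by (rule order_trans[OF sum_abs sum_mono]) (rule sum_abs)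
  also have "\<dots> \<le> (\<Sum>i\<in>F. \<Sum>j\<in>G. C / 2 * ((x i)\<^sup>2 * e i j powr t) + C / 2 * ((y j)\<^sup>2 * e i j powr t))"
    by (intro sum_mono b)
  also have "\<dots> = C / 2 * (\<Sum>i\<in>F. (x i)\<^sup>2 * (\<Sum>j\<in>G. e i j powr t)) + C / 2 * (\<Sum>j\<in>G. (y j)\<^sup>2 * (\<Sum>i\<in>F. e i j powr t))"
    unfolding sum.distrib sum_distrib_left by (subst (4) sum.swap) simp
  also have "\<dots> \<le> C / 2 * (\<Sum>i\<in>F. (x i)\<^sup>2 * N t) + C / 2 * (\<Sum>j\<in>G. (y j)\<^sup>2 * N t)"
    using C t fin e_sum_le e_sum_le'
    by (intro add_mono mult_left_mono sum_mono) auto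
  also have "\<dots> = C * N t / 2 * ((\<Sum>i\<in>F. (x i)\<^sup>2) + (\<Sum>j\<in>G. (y j)\<^sup>2))"
    by (simp only: sum_distrib_right[symmetric]) (simp add: algebra_simps)
  finally show ?thesis .
qed

end

section \<open>Powers and power series of a positive contraction with decay\<close>

locale exp_contraction = exp_weight +
  fixes R :: "'a \<Rightarrow> 'a \<Rightarrow> real" and C t q :: real
  assumes R_sym: "R i j = R j i" and R_decays: "decays C t R" and t_pos: "0 < t" and C_nonneg: "0 \<le> C"
    and q: "0 < q" "q < 1"
    and R_form_nonneg: "finite F \<Longrightarrow> 0 \<le> (\<Sum>i\<in>F. \<Sum>j\<in>F. x i * x j * R i j)"
    and R_form_le: "finite F \<Longrightarrow> (\<Sum>i\<in>F. \<Sum>j\<in>F. x i * x j * R i j) \<le> q * (\<Sum>i\<in>F. (x i)\<^sup>2)"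
begin

abbreviation "Rp \<equiv> mpow J R"

definition "K = max 1 (C * N (t / 2))"

text \<open>The factor R brings the exponent t while the power carries only t/2. The surplus t/2
  pays for the matrix product, so the exponent does not shrink with n; only the constant grows, by a
  factor K per step.\<close>

lemma mpow_decays: "decays (K ^ n) (t / 2) (Rp n)"
proof (induction n)
  case 0
  show ?case by (simp add: decays_mident)
next
  case (Suc n)
  have "decays (C * K ^ n * N (t - t / 2)) (t / 2) (mmul R (Rp n))"
    using t_pos C_nonneg by (intro decays_mmul[OF R_decays Suc]) (auto simp: K_def)
  moreover have "C * K ^ n * N (t - t / 2) \<le> K ^ Suc n"
  proof -
    have "C * N (t / 2) * K ^ n \<le> K * K ^ n"
      by (intro mult_right_mono) (auto simp: K_def)
    then show ?thesis by (simp add: mult_ac)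
  qed
  ultimately show ?case
    by (simp, elim decays_mono) (auto simp: K_def)
qed

lemma R_decaying: "decaying R"
  using R_decays t_pos by (rule decayingI)

lemma mpow_decaying: "decaying (Rp n)"
  using t_pos by (intro decayingI[OF mpow_decays]) auto

text \<open>The form bounds make R a contraction of l^2 with factor q, so the norm of a column loses
  a factor q with each multiplication. This is the bound that decreases with n, as opposed to
  K^n.\<close>

lemma mpow_l2: "finite F \<Longrightarrow> (\<Sum>i\<in>F. (Rp n i j)\<^sup>2) \<le> (q\<^sup>2) ^ n"
proof (induction n arbitrary: F)
  case 0
  have "(\<Sum>i\<in>F. (mident J i j)\<^sup>2) \<le> (\<Sum>i\<in>F. if i = j then 1 else 0)"
    by (intro sum_mono) (auto simp: mident_def)
  also have "\<dots> \<le> 1"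
    using 0 by simp
  finally show ?case by simp
next
  case (Suc n)
  have "(\<Sum>i\<in>F. (\<Sum>\<^sub>\<infinity>k. R i k * Rp n k j)\<^sup>2) \<le> q\<^sup>2 * (q\<^sup>2) ^ n"
  proof (rule bilinear_bound_imp_l2_bound)
    show "\<bar>\<Sum>i\<in>F. \<Sum>k\<in>G. x i * y k * R i k\<bar> \<le> q / 2 * ((\<Sum>i\<in>F. (x i)\<^sup>2) + (\<Sum>k\<in>G. (y k)\<^sup>2))"
      if "finite G" for G x y
      by (rule quadratic_imp_bilinear_bound[OF q(1) R_sym R_form_nonneg R_form_le Suc.prems that])
    show "(\<lambda>k. R i k * Rp n k j) summable_on UNIV" for i
      by (rule mmul_summable[OF R_decaying mpow_decaying])
  qed (use q Suc in auto)
  then show ?case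
    by (simp add: mmul_def)
qed

lemma mpow_le: "\<bar>Rp n i j\<bar> \<le> q ^ n"
proof -
  have "(Rp n i j)\<^sup>2 \<le> (q ^ n)\<^sup>2"
    using mpow_l2[of "{i}" n j] by (simp add: power_mult[symmetric] mult.commute)
  then show ?thesis
    using q by (simp add: abs_le_square_iff[symmetric])
qed

text \<open>Interpolation between the uniform bound \<open>q ^ n\<close> and the decaying bound \<open>K ^ n\<close>.\<close>

lemma mpow_interpolate:
  obtains s where "0 < s" "\<And>n. decays (sqrt q ^ n) s (Rp n)"
proof -
  \<comment> \<open>\<theta> solves q^(1 - \<theta>) K^\<theta> = sqrt q. It lies in (0, 1) because
    ln q < 0 <= ln K, the latter owing to the 1 in the maximum that defines K.\<close>
  define \<theta> where "\<theta> = ln q / (2 * (ln q - ln K))"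
  have K: "1 \<le> K" by (simp add: K_def)
  have lq: "ln q < 0" using q by simp
  have lK: "0 \<le> ln K" using K by simp
  have \<theta>: "0 < \<theta>" "\<theta> < 1"
    using lq lK by (auto simp: \<theta>_def divide_simps mult_less_0_iff) 
  have "(1 - \<theta>) * ln q + \<theta> * ln K = ln q - \<theta> * (ln q - ln K)"
    by (simp add: algebra_simps)
  also have "\<dots> = ln q / 2"
    using lq lK by (simp add: \<theta>_def field_simps)
  finally have "exp ((1 - \<theta>) * ln q + \<theta> * ln K) = exp (ln q / 2)"
    by simp
  then have r: "q powr (1 - \<theta>) * K powr \<theta> = sqrt q"
    using q K by (simp add: powr_def exp_add powr_half_sqrt[symmetric])
  have "decays (sqrt q ^ n) (\<theta> * (t / 2)) (Rp n)" for n
    unfolding decays_def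
  proof (intro allI)
    fix i j
    let ?x = "\<bar>Rp n i j\<bar>"
    have "?x = ?x powr (1 - \<theta>) * ?x powr \<theta>"
      by (simp add: powr_add[symmetric])
    also have "\<dots> \<le> (q ^ n) powr (1 - \<theta>) * (K ^ n * e i j powr (t / 2)) powr \<theta>"
      using \<theta> q by (intro mult_mono powr_mono2 mpow_le decaysD[OF mpow_decays]) auto
    also have "\<dots> = ((q ^ n) powr (1 - \<theta>) * (K ^ n) powr \<theta>) * e i j powr (\<theta> * (t / 2))"
      using K by (simp add: powr_mult powr_powr mult_ac)
    also have "(q ^ n) powr (1 - \<theta>) * (K ^ n) powr \<theta> = (q powr (1 - \<theta>) * K powr \<theta>) ^ n"
      using q K by (simp add: power_mult_distrib powr_realpow[symmetric] powr_powr mult.commute)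
    finally show "?x \<le> sqrt q ^ n * e i j powr (\<theta> * (t / 2))"
      by (simp add: r)
  qed
  then show ?thesis
    using \<theta> t_pos by (intro that[of "\<theta> * (t / 2)"]) auto
qed

lemma mpow_add: "mmul (Rp m) (Rp n) = Rp (m + n)"
proof (induction m)
  case (Suc m)
  have "mmul (mmul R (Rp m)) (Rp n) = mmul R (mmul (Rp m) (Rp n))"
    by (rule mmul_assoc) (auto simp: R_decaying mpow_decaying)
  then show ?case by (simp add: Suc)
qed (simp add: mmul_mident_left mpow_decaying)

lemma mpow_1: "Rp 1 = R"
  by (simp add: mmul_mident_right R_decaying)

lemma mpow_sym: "Rp n i j = Rp n j i"
proof (induction n arbitrary: i j)
  case 0
  show ?case by (simp add: mident_sym)
next
  case (Suc n)
  have "Rp (Suc n) i j = mmul (Rp n) R i j"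
    using mpow_add[of n 1] mpow_1 by simp
  also have "\<dots> = mmul R (Rp n) j i"
    unfolding mmul_def
  proof (rule infsum_cong)
    show "Rp n i k * R k j = R j k * Rp n k i" for k
      using Suc[of i k] R_sym[of k j] by simp
  qed
  finally show ?case
    by simp
qed

definition "decay_exp = (SOME s. 0 < s \<and> (\<forall>n. decays (sqrt q ^ n) s (Rp n)))"

lemma decay_exp: "0 < decay_exp" "decays (sqrt q ^ n) decay_exp (Rp n)"
proof -
  have "\<exists>s. 0 < s \<and> (\<forall>n. decays (sqrt q ^ n) s (Rp n))"
    by (meson mpow_interpolate)
  from someI_ex[OF this] show "0 < decay_exp" "decays (sqrt q ^ n) decay_exp (Rp n)"
    unfolding decay_exp_def by auto
qed

definition mseries :: "(nat \<Rightarrow> real) \<Rightarrow> 'a \<Rightarrow> 'a \<Rightarrow> real" where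
  "mseries a i j = (\<Sum>n. a n * Rp n i j)"

lemma sqrt_q: "0 \<le> sqrt q" "sqrt q < 1"
  using q by auto

lemma term_le:
  assumes "\<bar>a n\<bar> \<le> 1"
  shows "\<bar>a n * Rp n i j\<bar> \<le> e i j powr decay_exp * sqrt q ^ n"
proof -
  have "\<bar>a n\<bar> * \<bar>Rp n i j\<bar> \<le> 1 * (sqrt q ^ n * e i j powr decay_exp)"
    by (intro mult_mono assms decaysD[OF decay_exp(2)]) auto
  then show ?thesis
    by (simp add: abs_mult mult.commute)
qed

lemma mseries_summable:
  assumes "\<And>n. \<bar>a n\<bar> \<le> 1"
  shows "summable (\<lambda>n. \<bar>a n * Rp n i j\<bar>)"
  by (rule summable_comparison_test'[where g = "\<lambda>n. e i j powr decay_exp * sqrt q ^ n"])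
    (use sqrt_q term_le[of a, OF assms] in \<open>auto intro!: summable_mult summable_geometric\<close>)

lemma mseries_decays:
  assumes "\<And>n. \<bar>a n\<bar> \<le> 1"
  shows "decays (1 / (1 - sqrt q)) decay_exp (mseries a)"
  unfolding decays_def mseries_def
proof (intro allI)
  fix i j
  have "\<bar>\<Sum>n. a n * Rp n i j\<bar> \<le> (\<Sum>n. \<bar>a n * Rp n i j\<bar>)"
    by (rule summable_rabs[OF mseries_summable[OF assms]])
  also have "\<dots> \<le> (\<Sum>n. e i j powr decay_exp * sqrt q ^ n)"
    using sqrt_q assms
    by (intro suminf_le mseries_summable term_le summable_mult summable_geometric) auto
  also have "\<dots> = e i j powr decay_exp * (1 / (1 - sqrt q))"
    using sqrt_q by (subst suminf_mult) (auto intro!: summable_geometric simp: suminf_geometric)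
  finally show "\<bar>\<Sum>n. a n * Rp n i j\<bar> \<le> 1 / (1 - sqrt q) * e i j powr decay_exp"
    by (simp add: mult.commute)
qed

lemma mseries_sym: "mseries a i j = mseries a j i"
  unfolding mseries_def by (subst mpow_sym) (rule refl)

text \<open>This is the Cauchy product of scalar power series evaluated at R; powers of R multiply
  by \<open>mpow_add\<close>. The work lies in exchanging the sum over n with the sum over the inner
  matrix index.\<close>

lemma mseries_mmul:
  assumes a: "\<And>n. \<bar>a n\<bar> \<le> 1" and b: "\<And>n. \<bar>b n\<bar> \<le> 1"
  shows "mmul (mseries a) (mseries b) = mseries (\<lambda>n. \<Sum>k\<le>n. a k * b (n - k))"
proof (intro ext)
  fix i j
  define f where "f k n = (\<Sum>m\<le>n. (a m * Rp m i k) * (b (n - m) * Rp (n - m) k j))" for k n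
  \<comment> \<open>The n-th Cauchy term has n + 1 summands. The bound separates into a factor in k
    and a factor in n, both summable, which permits the exchange.\<close>
  have fb: "\<bar>f k n\<bar> \<le> e i k powr decay_exp * (real (Suc n) * sqrt q ^ n)" for k n
  proof -
    have "\<bar>f k n\<bar> \<le> (\<Sum>m\<le>n. e i k powr decay_exp * sqrt q ^ n)"
      unfolding f_def
    proof (rule order_trans[OF sum_abs sum_mono])
      fix m assume "m \<in> {..n}"
      have "\<bar>a m * Rp m i k\<bar> * \<bar>b (n - m) * Rp (n - m) k j\<bar>
          \<le> (e i k powr decay_exp * sqrt q ^ m) * (e k j powr decay_exp * sqrt q ^ (n - m))"
        using q by (intro mult_mono term_le a b) auto
      also have "\<dots> \<le> (e i k powr decay_exp * sqrt q ^ m) * (1 * sqrt q ^ (n - m))"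
        using q decay_exp(1) by (intro mult_left_mono mult_right_mono e_powr_le_1) auto
      also have "\<dots> = e i k powr decay_exp * sqrt q ^ n"
        using \<open>m \<in> {..n}\<close> by (simp add: power_add[symmetric])
      finally show "\<bar>(a m * Rp m i k) * (b (n - m) * Rp (n - m) k j)\<bar> \<le> e i k powr decay_exp * sqrt q ^ n"
        by (simp add: abs_mult)
    qed
    then show ?thesis by (simp add: mult_ac)
  qed
  have gs: "summable (\<lambda>n. real (Suc n) * sqrt q ^ n)"
    using geometric_deriv_sums[of "sqrt q"] sqrt_q by (auto simp: sums_iff)
  have fs: "summable (\<lambda>n. \<bar>f k n\<bar>)" for k
    by (rule summable_comparison_test'[OF summable_mult[OF gs]]) (use fb in auto)
  have "mmul (mseries a) (mseries b) i j = (\<Sum>\<^sub>\<infinity>k. \<Sum>n. f k n)"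
    unfolding mmul_def
  proof (rule infsum_cong)
    fix k
    have "(\<lambda>n. f k n) sums ((\<Sum>n. a n * Rp n i k) * (\<Sum>n. b n * Rp n k j))"
      unfolding f_def by (rule Cauchy_product_sums) (use mseries_summable a b in auto)
    then show "mseries a i k * mseries b k j = (\<Sum>n. f k n)"
      by (simp add: mseries_def sums_iff)
  qed
  also have "\<dots> = (\<Sum>\<^sub>\<infinity>k. \<Sum>\<^sub>\<infinity>n. f k n)"
    by (simp add: infsum_suminf_bound fs)
  also have "\<dots> = (\<Sum>\<^sub>\<infinity>n. \<Sum>\<^sub>\<infinity>k. f k n)"
  proof (rule infsum_swap_bound[OF fb])
    show "(\<lambda>n. real (Suc n) * sqrt q ^ n) summable_on UNIV"
      using infsum_suminf_bound(2)[of "\<lambda>n. real (Suc n) * sqrt q ^ n"] gs q by (simp add: abs_mult)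
  qed (use q decay_exp(1) e_summable in auto)
  also have "\<dots> = (\<Sum>\<^sub>\<infinity>n. (\<Sum>m\<le>n. a m * b (n - m)) * Rp n i j)"
  proof (rule infsum_cong)
    fix n
    have s: "(\<lambda>k. Rp m i k * Rp (n - m) k j) summable_on UNIV" for m
      by (rule mmul_summable[OF mpow_decaying mpow_decaying])
    have f': "f = (\<lambda>k n. (\<Sum>m\<le>n. (a m * b (n - m)) * (Rp m i k * Rp (n - m) k j)))"
      by (simp add: f_def mult_ac fun_eq_iff)
    have "(\<Sum>\<^sub>\<infinity>k. f k n) = (\<Sum>m\<le>n. \<Sum>\<^sub>\<infinity>k. (a m * b (n - m)) * (Rp m i k * Rp (n - m) k j))"
      unfolding f' by (rule infsum_of_sum) (auto intro: summable_on_cmult_right s)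
    also have "\<dots> = (\<Sum>m\<le>n. a m * b (n - m) * Rp n i j)"
    proof (rule sum.cong[OF refl])
      fix m assume "m \<in> {..n}"
      then have "mmul (Rp m) (Rp (n - m)) i j = Rp n i j"
        by (simp add: mpow_add)
      then show "(\<Sum>\<^sub>\<infinity>k. (a m * b (n - m)) * (Rp m i k * Rp (n - m) k j)) = a m * b (n - m) * Rp n i j"
        by (simp add: infsum_cmult_right' mmul_def)
    qed
    finally show "(\<Sum>\<^sub>\<infinity>k. f k n) = (\<Sum>m\<le>n. a m * b (n - m)) * Rp n i j"
      by (simp add: sum_distrib_right)
  qed
  also have "\<dots> = mseries (\<lambda>n. \<Sum>k\<le>n. a k * b (n - k)) i j"
    unfolding mseries_def
  proof (rule infsum_suminf_bound(1), rule summable_comparison_test'[OF gs])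
    fix n :: nat
    have "\<bar>\<Sum>k\<le>n. a k * b (n - k)\<bar> \<le> (\<Sum>k\<le>n. 1)"
      by (rule order_trans[OF sum_abs sum_mono]) (simp add: abs_mult mult_le_one a b)
    moreover have "\<bar>Rp n i j\<bar> \<le> sqrt q ^ n"
    proof (rule order_trans[OF decaysD[OF decay_exp(2)]])
      show "sqrt q ^ n * e i j powr decay_exp \<le> sqrt q ^ n"
        by (rule mult_left_le) (use q decay_exp(1) e_powr_le_1[of decay_exp] in auto)
    qed
    ultimately have "\<bar>\<Sum>k\<le>n. a k * b (n - k)\<bar> * \<bar>Rp n i j\<bar> \<le> real (Suc n) * sqrt q ^ n"
      by (intro mult_mono) auto
    then show "norm \<bar>(\<Sum>k\<le>n. a k * b (n - k)) * Rp n i j\<bar> \<le> real (Suc n) * sqrt q ^ n"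
      by (simp add: abs_mult)
  qed
  finally show "mmul (mseries a) (mseries b) i j = mseries (\<lambda>n. \<Sum>k\<le>n. a k * b (n - k)) i j" .
qed

text \<open>S squared has all coefficients 1, so it is the Neumann series of 1 - R; its Cauchy
  product with 1 - x telescopes to the constant 1.\<close>

lemma inverse_sqrt:
  defines "S \<equiv> mseries inv_sqrt_coeff"
  shows "mmul (mmul S S) (\<lambda>i j. mident J i j - R i j) = mident J"
proof -
  define b :: "nat \<Rightarrow> real" where "b n = (if n = 0 then 1 else if n = 1 then - 1 else 0)" for n
  have b: "\<bar>b n\<bar> \<le> 1" for n
    by (simp add: b_def)
  have SS: "mmul S S = mseries (\<lambda>_. 1)"
    unfolding S_def by (subst mseries_mmul)
      (auto simp: inv_sqrt_coeff_conv inv_sqrt_coeff_le_1 inv_sqrt_coeff_nonneg)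
  have IR: "mseries b = (\<lambda>i j. mident J i j - R i j)"
  proof (intro ext)
    fix i j
    have "(\<lambda>n. b n * Rp n i j) sums (\<Sum>n\<in>{0, 1}. b n * Rp n i j)"
      by (rule sums_finite) (auto simp: b_def)
    then show "mseries b i j = mident J i j - R i j"
      using mpow_1 by (simp add: mseries_def sums_iff b_def)
  qed
  have "(\<Sum>k\<le>n. 1 * b (n - k)) = (if n = 0 then 1 else 0)" for n
  proof -
    have "(\<Sum>k\<le>n. 1 * b (n - k)) = (\<Sum>k\<le>n. b k)"
      by simp (rule sum.nat_diff_reindex[of b "Suc n", simplified lessThan_Suc_atMost diff_Suc_Suc, simplified])
    also have "\<dots> = (if n = 0 then 1 else 0)"
      by (induction n) (auto simp: b_def)
    finally show ?thesis .
  qed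
  then have "mmul (mseries (\<lambda>_. 1)) (mseries b) = mseries (\<lambda>n. if n = 0 then 1 else 0)"
    by (subst mseries_mmul) (auto simp: b)
  also have "\<dots> = mident J"
  proof (intro ext)
    fix i j
    have "(\<lambda>n. (if n = 0 then 1 else 0) * Rp n i j) sums (\<Sum>n\<in>{0}. (if n = 0 then 1 else 0) * Rp n i j)"
      by (rule sums_finite) auto
    then show "mseries (\<lambda>n. if n = 0 then 1 else 0) i j = mident J i j"
      by (simp add: mseries_def sums_iff)
  qed
  finally show ?thesis
    unfolding SS IR .
qed

end

context exp_weight
begin

text \<open>Loewdin orthonormalization: \<open>S\<close> is the inverse square root of \<open>\<Gamma>\<close>, given by a binomial
  series in \<open>1 - \<Gamma> / \<Lambda>\<close>.\<close>

lemma inverse_sqrt_exists: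
  assumes \<Gamma>: "decays C t \<Gamma>" and t: "0 < t" and C: "0 \<le> C" and c: "0 < c"
    and sym: "\<And>i j. \<Gamma> i j = \<Gamma> j i"
    and low: "\<And>F x. finite F \<Longrightarrow> F \<subseteq> J \<Longrightarrow> c * (\<Sum>i\<in>F. (x i)\<^sup>2) \<le> (\<Sum>i\<in>F. \<Sum>j\<in>F. x i * x j * \<Gamma> i j)"
  obtains S where "decaying S" "\<And>i j. S i j = S j i" "mmul (mmul S S) \<Gamma> = mident J"
proof -
  \<comment> \<open>By the Schur test \<Gamma> is at most \<open>C * N t\<close> as a form, so 1 -
    \<Gamma> / \<Lambda> is nonnegative. The extra 2 c ensures c < \<Lambda>, which puts q = 1 - c /
    \<Lambda> strictly between 0 and 1.\<close>
  define \<Lambda> where "\<Lambda> = C * N t + 2 * c"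
  have CN: "0 \<le> C * N t"
    using C N_nonneg[OF t] by simp
  then have \<Lambda>: "0 < \<Lambda>" "c < \<Lambda>"
    using c by (auto simp: \<Lambda>_def)
  define q where "q = 1 - c / \<Lambda>"
  have q: "0 < q" "q < 1"
    using \<Lambda> c by (auto simp: q_def)
  define R where "R i j = mident J i j - \<Gamma> i j / \<Lambda>" for i j
  \<comment> \<open>The contraction bounds have to be checked on arbitrary finite F, while the lower
    bound is available only inside J. Entries outside J vanish, so every form reduces to F \<inter>
    J.\<close>
  have Rform: "(\<Sum>i\<in>F. \<Sum>j\<in>F. x i * x j * R i j)
      = (\<Sum>i\<in>F \<inter> J. (x i)\<^sup>2) - (\<Sum>i\<in>F \<inter> J. \<Sum>j\<in>F \<inter> J. x i * x j * \<Gamma> i j) / \<Lambda>" if F: "finite F" for F x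
  proof -
    have "(\<Sum>i\<in>F. \<Sum>j\<in>F. x i * x j * mident J i j) = (\<Sum>i\<in>F. if i \<in> J then (x i)\<^sup>2 else 0)"
    proof (rule sum.cong[OF refl])
      fix i assume "i \<in> F"
      have "(\<Sum>j\<in>F. x i * x j * mident J i j) = (\<Sum>j\<in>F. if j = i then (if i \<in> J then (x i)\<^sup>2 else 0) else 0)"
        by (rule sum.cong) (auto simp: mident_def power2_eq_square)
      then show "(\<Sum>j\<in>F. x i * x j * mident J i j) = (if i \<in> J then (x i)\<^sup>2 else 0)"
        using F \<open>i \<in> F\<close> by simp
    qed
    moreover have "(\<Sum>i\<in>F. \<Sum>j\<in>F. x i * x j * \<Gamma> i j) = (\<Sum>i\<in>F \<inter> J. \<Sum>j\<in>F \<inter> J. x i * x j * \<Gamma> i j)"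
    proof -
      have "(\<Sum>j\<in>F. x i * x j * \<Gamma> i j) = (\<Sum>j\<in>F \<inter> J. x i * x j * \<Gamma> i j)" for i
        by (rule sum.mono_neutral_right) (use F decays_outside[OF \<Gamma>] in auto)
      moreover have "(\<Sum>i\<in>F. \<Sum>j\<in>F \<inter> J. x i * x j * \<Gamma> i j) = (\<Sum>i\<in>F \<inter> J. \<Sum>j\<in>F \<inter> J. x i * x j * \<Gamma> i j)"
        by (rule sum.mono_neutral_right) (use F decays_outside[OF \<Gamma>] in auto)
      ultimately show ?thesis by simp
    qed
    moreover have "(\<Sum>i\<in>F. \<Sum>j\<in>F. x i * x j * R i j)
        = (\<Sum>i\<in>F. \<Sum>j\<in>F. x i * x j * mident J i j) - (\<Sum>i\<in>F. \<Sum>j\<in>F. x i * x j * \<Gamma> i j) / \<Lambda>"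
      by (simp add: R_def sum_divide_distrib sum_subtractf[symmetric] right_diff_distrib)
    ultimately show ?thesis
      using F by (simp add: sum.inter_restrict)
  qed
  interpret R: exp_contraction e J N R "1 + C / \<Lambda>" t q
  proof
    show "R i j = R j i" for i j
      by (simp add: R_def mident_sym[of i j] sym[of i j])
    show "decays (1 + C / \<Lambda>) t R"
      unfolding decays_def
    proof (intro allI)
      fix i j
      have "\<bar>R i j\<bar> \<le> \<bar>mident J i j\<bar> + \<bar>\<Gamma> i j\<bar> / \<Lambda>"
        using \<Lambda> abs_triangle_ineq4[of "mident J i j" "\<Gamma> i j / \<Lambda>"] by (simp add: R_def)
      also have "\<dots> \<le> 1 * e i j powr t + C * e i j powr t / \<Lambda>"
        using \<Lambda> by (intro add_mono divide_right_mono decaysD[OF \<Gamma>] decaysD[OF decays_mident]) auto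
      finally show "\<bar>R i j\<bar> \<le> (1 + C / \<Lambda>) * e i j powr t"
        by (simp add: distrib_right)
    qed
    fix F :: "'i set" and x :: "'i \<Rightarrow> real" assume F: "finite F"
    let ?s = "\<Sum>i\<in>F \<inter> J. (x i)\<^sup>2" and ?g = "\<Sum>i\<in>F \<inter> J. \<Sum>j\<in>F \<inter> J. x i * x j * \<Gamma> i j"
    have s0: "0 \<le> ?s" by (auto intro: sum_nonneg)
    have "?g \<le> C * N t / 2 * (?s + ?s)"
      using decays_bilinear_bound[OF \<Gamma> t C, of "F \<inter> J" "F \<inter> J" x x] F by simp
    also have "\<dots> \<le> \<Lambda> * ?s"
      using s0 c by (simp add: \<Lambda>_def algebra_simps)
    finally have "?g / \<Lambda> \<le> ?s"
      using \<Lambda> by (simp add: divide_le_eq mult.commute)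
    then show "0 \<le> (\<Sum>i\<in>F. \<Sum>j\<in>F. x i * x j * R i j)"
      by (simp add: Rform[OF F])
    have "c * ?s / \<Lambda> \<le> ?g / \<Lambda>"
      using \<Lambda> F by (intro divide_right_mono low) auto
    then have "(\<Sum>i\<in>F. \<Sum>j\<in>F. x i * x j * R i j) \<le> q * ?s"
      unfolding Rform[OF F] q_def left_diff_distrib by simp
    also have "\<dots> \<le> q * (\<Sum>i\<in>F. (x i)\<^sup>2)"
      using q F by (intro mult_left_mono sum_mono2) auto
    finally show "(\<Sum>i\<in>F. \<Sum>j\<in>F. x i * x j * R i j) \<le> q * (\<Sum>i\<in>F. (x i)\<^sup>2)" .
  qed (use t q C \<Lambda> in auto)
  define S0 where "S0 = R.mseries inv_sqrt_coeff"
  have S0: "mmul (mmul S0 S0) (\<lambda>i j. mident J i j - R i j) = mident J"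
    unfolding S0_def by (rule R.inverse_sqrt)
  have IR: "(\<lambda>i j. mident J i j - R i j) = (\<lambda>i j. (1 / \<Lambda>) * \<Gamma> i j)"
    by (simp add: R_def)
  \<comment> \<open>From \<Gamma> = \<Lambda> (1 - R), the inverse square root of \<Gamma> is that
    of 1 - R divided by sqrt \<Lambda>.\<close>
  define S where "S i j = (1 / sqrt \<Lambda>) * S0 i j" for i j
  have dS0: "decaying S0"
    unfolding S0_def by (rule decayingI[OF R.mseries_decays R.decay_exp(1)])
      (simp add: inv_sqrt_coeff_nonneg inv_sqrt_coeff_le_1)
  show ?thesis
  proof
    obtain D s where D: "0 \<le> D" "0 < s" "decays D s S0"
      using dS0 unfolding decaying_def by blast
    have "decays (1 / sqrt \<Lambda> * D) s S"
      unfolding decays_def S_def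
      using D(3) \<Lambda> by (auto simp: decays_def abs_mult divide_simps)
    then show "decaying S"
      using D by (intro decayingI)
    show "S i j = S j i" for i j
      unfolding S_def S0_def by (subst R.mseries_sym) simp
    have "mmul S S = (\<lambda>i j. (1 / \<Lambda>) * mmul S0 S0 i j)"
      unfolding S_def mmul_scale_left mmul_scale_right using \<Lambda> by (simp add: fun_eq_iff)
    then have "mmul (mmul S S) \<Gamma> = mmul (mmul S0 S0) (\<lambda>i j. (1 / \<Lambda>) * \<Gamma> i j)"
      by (simp only: mmul_scale_left mmul_scale_right)
    then show "mmul (mmul S S) \<Gamma> = mident J"
      using S0 unfolding IR by simp
  qed
qed

text \<open>It allows the inverse square root theorem to be applied a second time, to a compression
  supported on a subset of the indices, with the same summation bound N.\<close>

lemma exp_weight_subset: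
  assumes "Y \<subseteq> J"
  shows "exp_weight (\<lambda>i j. if i \<in> Y \<and> j \<in> Y then e i j else 0) Y N"
proof
  show "(\<Sum>j\<in>F. (if i \<in> Y \<and> j \<in> Y then e i j else 0) powr t) \<le> N t" if "0 < t" "finite F" for t F i
    by (rule order_trans[OF sum_mono e_sum_le[OF that]]) auto
qed (use assms in \<open>auto simp: e_nonneg e_le_1 e_sym e_diag e_mult_le intro: mult_nonneg_nonneg\<close>)

text \<open>With \<open>G = \<Gamma>\<^sup>-\<^sup>1\<close>, \<open>K\<close> the compression of \<open>G\<close> to \<open>Y\<close> and \<open>H = K\<^sup>-\<^sup>1\<^sup>/\<^sup>2\<close>, the rows of
  \<open>H G\<close> are the coefficients of an orthonormalization of the part of the dual basis that is
  indexed by \<open>Y\<close>.\<close>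

theorem dual_orthonormalization:
  assumes \<Gamma>: "decays C t \<Gamma>" and t: "0 < t" and C: "0 \<le> C" and c: "0 < c"
    and sym: "\<And>i j. \<Gamma> i j = \<Gamma> j i"
    and low: "\<And>F x. finite F \<Longrightarrow> F \<subseteq> J \<Longrightarrow> c * (\<Sum>i\<in>F. (x i)\<^sup>2) \<le> (\<Sum>i\<in>F. \<Sum>j\<in>F. x i * x j * \<Gamma> i j)"
    and Y: "Y \<subseteq> J"
  obtains A H where "decaying A" "decaying H" "\<And>i j. i \<notin> Y \<or> j \<notin> Y \<Longrightarrow> H i j = 0"
    "\<And>i j. i \<notin> Y \<Longrightarrow> A i j = 0"
    "mmul A \<Gamma> = H" "mmul H (\<lambda>i j. A j i) = mident Y"
    "\<And>i j. j \<in> Y \<Longrightarrow> mmul H A i j = mident Y i j"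
proof -
  obtain S where S: "decaying S" "\<And>i j. S i j = S j i" "mmul (mmul S S) \<Gamma> = mident J"
    using inverse_sqrt_exists[OF \<Gamma> t C c sym low] by metis
  have d\<Gamma>: "decaying \<Gamma>"
    using \<Gamma> t by (rule decayingI)
  define G where "G = mmul S S"
  have dG: "decaying G"
    unfolding G_def by (intro decaying_mmul S)
  have ST: "(\<lambda>i j. S j i) = S" and \<Gamma>T: "(\<lambda>i j. \<Gamma> j i) = \<Gamma>"
    using S(2) sym by (auto simp: fun_eq_iff)
  have GT: "(\<lambda>i j. G j i) = G"
    using mmul_transpose[of S S] by (simp add: G_def ST)
  have Gsym: "G i j = G j i" for i j
    using fun_cong[OF fun_cong[OF GT]] by metis
  have G\<Gamma>: "mmul G \<Gamma> = mident J"
    using S(3) by (simp add: G_def)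
  have mT: "(\<lambda>i j. mident J j i) = mident J"
    by (intro ext mident_sym)
  have \<Gamma>G: "mmul \<Gamma> G = mident J"
    using mmul_transpose[of \<Gamma> G] by (simp add: GT \<Gamma>T G\<Gamma> mT)
  \<comment> \<open>\<open>T\<close> is the inverse of \<open>S\<close>: T S = \<Gamma> S S = 1.
    Boundedness of T bounds S from below, and since G = S S this is the lower form bound needed for
    G and for its compression K.\<close>
  define T where "T = mmul \<Gamma> S"
  have dT: "decaying T"
    unfolding T_def by (intro decaying_mmul S d\<Gamma>)
  have TS: "mmul T S = mident J"
    unfolding T_def by (subst mmul_assoc) (auto simp: d\<Gamma> S \<Gamma>G[unfolded G_def])
  obtain CT s where T: "0 \<le> CT" "0 < s" "decays CT s T"
    using dT unfolding decaying_def by blast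
  define K where "K i j = (if i \<in> Y \<and> j \<in> Y then G i j else 0)" for i j
  define QT where "QT = CT * N s + 1"
  have QT: "0 < QT"
    using T N_nonneg[OF T(2)] by (auto simp: QT_def intro: add_nonneg_pos)
  have Klow: "1 / QT\<^sup>2 * (\<Sum>i\<in>F. (x i)\<^sup>2) \<le> (\<Sum>i\<in>F. \<Sum>j\<in>F. x i * x j * K i j)"
    if F: "finite F" "F \<subseteq> Y" for F and x :: "'i \<Rightarrow> real"
  proof -
    \<comment> \<open>With y = S x, the form of K at x is the squared norm of y, and T y returns x
      on F. Boundedness of T therefore bounds x by the form.\<close>
    define y where "y k = (\<Sum>j\<in>F. S k j * x j)" for k
    define M where "M = (\<Sum>i\<in>F. \<Sum>j\<in>F. x i * x j * K i j)"
    have sm: "(\<lambda>k. S i k * S k j) summable_on UNIV" for i j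
      by (rule mmul_summable[OF S(1) S(1)])
    have y2: "(y k)\<^sup>2 = (\<Sum>i\<in>F. \<Sum>j\<in>F. x i * x j * (S i k * S k j))" for k
      unfolding y_def power2_eq_square sum_product
      by (intro sum.cong refl) (simp add: S(2)[of k] mult_ac)
    have i: "(\<lambda>k. \<Sum>j\<in>F. x i * x j * (S i k * S k j)) summable_on UNIV" for i
      by (rule infsum_of_sum(2)[OF F(1) summable_on_cmult_right[OF sm]])
    have ys: "(\<lambda>k. (y k)\<^sup>2) summable_on UNIV"
      unfolding y2 by (rule infsum_of_sum(2)[OF F(1) i])
    have "(\<Sum>\<^sub>\<infinity>k. (y k)\<^sup>2) = (\<Sum>i\<in>F. \<Sum>\<^sub>\<infinity>k. \<Sum>j\<in>F. x i * x j * (S i k * S k j))"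
      unfolding y2 by (rule infsum_of_sum(1)[OF F(1) i])
    also have "\<dots> = (\<Sum>i\<in>F. \<Sum>j\<in>F. \<Sum>\<^sub>\<infinity>k. x i * x j * (S i k * S k j))"
      by (intro sum.cong refl infsum_of_sum(1)[OF F(1)] summable_on_cmult_right sm)
    also have "\<dots> = M"
      unfolding M_def using F by (intro sum.cong refl) (auto simp: infsum_cmult_right' K_def G_def mmul_def)
    finally have yM: "(\<Sum>\<^sub>\<infinity>k. (y k)\<^sup>2) = M" .
    have TSs: "(\<lambda>k. T i k * S k j) summable_on UNIV" for i j
      by (rule mmul_summable[OF dT S(1)])
    have Ty: "(\<lambda>k. T i k * y k) = (\<lambda>k. \<Sum>j\<in>F. x j * (T i k * S k j))" for i
      by (simp add: y_def sum_distrib_left mult_ac)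
    have Tys: "(\<lambda>k. T i k * y k) summable_on UNIV" for i
      unfolding Ty by (rule infsum_of_sum(2)[OF F(1) summable_on_cmult_right[OF TSs]])
    have Tyx: "(\<Sum>\<^sub>\<infinity>k. T i k * y k) = x i" if i: "i \<in> F" for i
    proof -
      have "(\<Sum>\<^sub>\<infinity>k. T i k * y k) = (\<Sum>j\<in>F. \<Sum>\<^sub>\<infinity>k. x j * (T i k * S k j))"
        unfolding Ty by (rule infsum_of_sum(1)[OF F(1) summable_on_cmult_right[OF TSs]])
      also have "\<dots> = (\<Sum>j\<in>F. x j * mident J i j)"
        by (simp add: infsum_cmult_right' TS[symmetric]) (simp add: mmul_def)
      also have "\<dots> = (\<Sum>j\<in>F. if j = i then x i else 0)"
        using F Y i by (intro sum.cong) (auto simp: mident_def)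
      finally show ?thesis
        using F(1) i by simp
    qed
    have "(\<Sum>i\<in>F. (\<Sum>\<^sub>\<infinity>k. T i k * y k)\<^sup>2) \<le> QT\<^sup>2 * M"
    proof (rule bilinear_bound_imp_l2_bound[OF QT F(1)])
      show "\<bar>\<Sum>i\<in>F. \<Sum>j\<in>G. u i * v j * T i j\<bar> \<le> QT / 2 * ((\<Sum>i\<in>F. (u i)\<^sup>2) + (\<Sum>j\<in>G. (v j)\<^sup>2))"
        if "finite G" for G u v
      proof (rule order_trans[OF decays_bilinear_bound[OF T(3,2,1) F(1) that]])
        show "CT * N s / 2 * ((\<Sum>i\<in>F. (u i)\<^sup>2) + (\<Sum>j\<in>G. (v j)\<^sup>2)) \<le> QT / 2 * ((\<Sum>i\<in>F. (u i)\<^sup>2) + (\<Sum>j\<in>G. (v j)\<^sup>2))"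
          by (intro mult_right_mono add_nonneg_nonneg sum_nonneg) (auto simp: QT_def)
      qed
      show "(\<Sum>j\<in>G. (y j)\<^sup>2) \<le> M" if "finite G" for G
        unfolding yM[symmetric] by (rule finite_sum_le_infsum[OF ys that]) auto
    qed (rule Tys)
    then have "(\<Sum>i\<in>F. (x i)\<^sup>2) \<le> QT\<^sup>2 * M"
      by (simp add: Tyx)
    then show ?thesis
      using QT by (simp add: M_def field_simps)
  qed
  interpret Y: exp_weight "\<lambda>i j. if i \<in> Y \<and> j \<in> Y then e i j else 0" Y N
    by (rule exp_weight_subset[OF Y])
  have Yd: "decaying A" if dYA: "Y.decaying A" for A
  proof -
    obtain C' t' where "0 \<le> C'" "0 < t'" "Y.decays C' t' A"
      using dYA[unfolded Y.decaying_def] by (elim exE conjE) (rule that)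
    have "decays C' t' A"
      unfolding decays_def
    proof (intro allI)
      fix i j
      show "\<bar>A i j\<bar> \<le> C' * e i j powr t'"
        by (rule order_trans[OF Y.decaysD[OF \<open>Y.decays C' t' A\<close>] mult_left_mono]) (use \<open>0 \<le> C'\<close> in auto)
    qed
    then show ?thesis
      using \<open>0 < t'\<close> by (rule decayingI)
  qed
  obtain CG tG where CG: "0 \<le> CG" "0 < tG" "decays CG tG G"
    using dG unfolding decaying_def by blast
  have YK: "Y.decays CG tG K"
    unfolding Y.decays_def K_def using decaysD[OF CG(3)] by auto
  obtain H where H: "Y.decaying H" "\<And>i j. H i j = H j i" "mmul (mmul H H) K = mident Y"
  proof (rule Y.inverse_sqrt_exists[OF YK CG(2,1) _ _ Klow])
    show "0 < 1 / QT\<^sup>2"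
      using QT by simp
    show "K i j = K j i" for i j
      using Gsym[of i j] by (simp add: K_def)
  qed (assumption | rule that)+
  have dK: "Y.decaying K"
    using YK CG by (intro Y.decayingI)
  have dH: "decaying H"
    by (rule Yd[OF H(1)])
  have H0: "H i j = 0" if "i \<notin> Y \<or> j \<notin> Y" for i j
    using Y.decaying_outside[OF H(1) that] .
  have HT: "(\<lambda>i j. H j i) = H" and KT: "(\<lambda>i j. K j i) = K"
    using H(2) Gsym by (auto simp: fun_eq_iff K_def)
  have mYT: "(\<lambda>i j. mident Y j i) = mident Y"
    by (intro ext Y.mident_sym)
  have HHT: "(\<lambda>i j. mmul H H j i) = mmul H H"
    using mmul_transpose[of H H] by (simp add: HT)
  have KHH: "mmul K (mmul H H) = mident Y"
    using mmul_transpose[of K "mmul H H"] by (simp add: HHT KT H(3) mYT)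
  have dd: "Y.decaying (mmul K H)" "Y.decaying (mmul H K)" "Y.decaying (mmul H H)"
    by (auto intro!: Y.decaying_mmul H dK)
  \<comment> \<open>H is known only through H H K = 1, so commutation with K has to be derived:
    inserting H H K = 1 on the right of K H and cancelling K H H = 1 on the left leaves H K.\<close>
  have comm: "mmul K H = mmul H K"
  proof -
    have "mmul K H = mmul (mmul K H) (mmul H (mmul H K))"
      using H(3) by (simp add: Y.mmul_assoc[symmetric] H dK dd Y.mmul_mident_right)
    also have "\<dots> = mmul (mmul (mmul K H) H) (mmul H K)"
      by (intro Y.mmul_assoc[symmetric] dd H)
    also have "\<dots> = mmul H K"
      using KHH by (simp add: Y.mmul_assoc H dK dd Y.mmul_mident_left)
    finally show ?thesis .
  qed
  have HKH: "mmul H (mmul K H) = mident Y"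
    unfolding comm using H(3) Y.mmul_assoc[OF H(1) H(1) dK] by simp
  \<comment> \<open>This passes between G and its compression K: behind a left factor supported on
    Y, and in columns of Y, only entries of G with both indices in Y are seen.\<close>
  have restrict_right: "mmul B G i j = mmul B K i j" if "\<And>i k. k \<notin> Y \<Longrightarrow> B i k = 0" "j \<in> Y" for B i j
    unfolding mmul_def by (rule infsum_cong) (use that in \<open>auto simp: K_def\<close>)
  define A where "A = mmul H G"
  have dA: "decaying A"
    unfolding A_def by (intro decaying_mmul dH dG)
  show ?thesis
  proof
    show "mmul A \<Gamma> = H"
      unfolding A_def by (simp add: mmul_assoc dH dG d\<Gamma> G\<Gamma> mmul_mident_right)
    show "A i j = 0" if "i \<notin> Y" for i j
      unfolding A_def mmul_def using that by (simp add: H0)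
    show "mmul H (\<lambda>i j. A j i) = mident Y"
    proof (intro ext)
      fix i j
      have "(\<lambda>i j. A j i) = mmul G H"
        unfolding A_def using mmul_transpose[of G H] by (simp add: GT HT)
      then have "mmul H (\<lambda>i j. A j i) i j = mmul (mmul H G) H i j"
        by (simp add: mmul_assoc dH dG)
      also have "\<dots> = mmul (mmul H K) H i j"
        unfolding mmul_def[of _ H]
      proof (rule infsum_cong)
        fix k
        show "mmul H G i k * H k j = mmul H K i k * H k j"
          by (cases "k \<in> Y") (auto simp: H0 restrict_right)
      qed
      also have "\<dots> = mident Y i j"
        using HKH by (simp add: Y.mmul_assoc H dK)
      finally show "mmul H (\<lambda>i j. A j i) i j = mident Y i j" .
    qed
    show "mmul H A i j = mident Y i j" if "j \<in> Y" for i j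
    proof -
      have "mmul H A i j = mmul (mmul H H) G i j"
        unfolding A_def by (simp add: mmul_assoc dH dG)
      also have "\<dots> = mmul (mmul H H) K i j"
        by (rule restrict_right[OF _ that]) (use Y.decaying_outside[OF dd(3)] in auto)
      finally show ?thesis
        by (simp add: H)
    qed
  qed (use dA dH H0 in auto)
qed

end

subsection \<open>Chains and metrization\<close>

text \<open>The values are the lengths of finite chains. Concatenation is a rule, so the infimum
  over chains satisfies the triangle inequality at once; the form with explicit sequences is
  recovered only for inductions along a chain.\<close>

inductive chain_sum :: "('a \<Rightarrow> 'a \<Rightarrow> real) \<Rightarrow> 'a \<Rightarrow> 'a \<Rightarrow> real \<Rightarrow> bool" for q where
  step: "chain_sum q x y (q x y)"
| trans: "chain_sum q x y s \<Longrightarrow> chain_sum q y z t \<Longrightarrow> chain_sum q x z (s + t)"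

lemma chain_sum_sequence:
  assumes "chain_sum q x y s"
  shows "\<exists>z n. 0 < n \<and> z 0 = x \<and> z n = y \<and> (\<Sum>k<n. q (z k) (z (Suc k))) = s"
  using assms
proof induction
  case (step x y)
  show ?case
    by (rule exI[of _ "\<lambda>k. if k = 0 then x else y"], rule exI[of _ 1]) auto
next
  case (trans x y s z t)
  then obtain u n v m where u: "0 < n" "u 0 = x" "u n = y" "(\<Sum>k<n. q (u k) (u (Suc k))) = s"
    and v: "0 < m" "v 0 = y" "v m = z" "(\<Sum>k<m. q (v k) (v (Suc k))) = t"
    by blast
  define w where "w k = (if k \<le> n then u k else v (k - n))" for k
  have "(\<Sum>k<n + m. q (w k) (w (Suc k))) = (\<Sum>k<n. q (w k) (w (Suc k))) + (\<Sum>k<m. q (w (n + k)) (w (Suc (n + k))))"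
    by (induction m) auto
  also have "(\<Sum>k<n. q (w k) (w (Suc k))) = s"
    unfolding u(4)[symmetric] by (rule sum.cong) (auto simp: w_def)
  also have "(\<Sum>k<m. q (w (n + k)) (w (Suc (n + k)))) = t"
    unfolding v(4)[symmetric] by (rule sum.cong) (use u v in \<open>auto simp: w_def\<close>)
  finally show ?case
    using u v by (intro exI[of _ w] exI[of _ "n + m"]) (auto simp: w_def)
qed

text \<open>Frink's argument: for the last \<open>i\<close> with \<open>q (z m) (z n) \<le> 2 * q (z i) (z n)\<close>, the chain is split
  into two overlapping pieces, and \<open>q (z m) (z n)\<close> is at most the sum over the pieces.\<close>

lemma frink_chain:
  fixes q :: "'a \<Rightarrow> 'a \<Rightarrow> real"
  assumes nonneg: "\<And>x y. 0 \<le> q x y"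
    and max: "\<And>x y z. q x z \<le> 2 * max (q x y) (q y z)"
    and "m < n"
  shows "q (z m) (z n) \<le> 2 * q (z m) (z (Suc m)) + 4 * (\<Sum>k\<in>{Suc m..<n - 1}. q (z k) (z (Suc k)))
    + 2 * q (z (n - 1)) (z n)"
  using \<open>m < n\<close>
proof (induction "n - m" arbitrary: m n rule: less_induct)
  case less
  let ?a = "q (z m) (z n)" and ?S = "\<lambda>m n. \<Sum>k\<in>{Suc m..<n - 1}. q (z k) (z (Suc k))"
  have S0: "0 \<le> ?S m n"
    by (intro sum_nonneg nonneg)
  consider "?a \<le> 2 * q (z m) (z (Suc m))" | "?a \<le> 2 * q (z (n - 1)) (z n)"
    | "2 * q (z m) (z (Suc m)) < ?a" "2 * q (z (n - 1)) (z n) < ?a"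
    by linarith
  then show ?case
  proof cases
    case 3
    have or: "?a \<le> 2 * q (z m) (z i) \<or> ?a \<le> 2 * q (z i) (z n)" for i
      using max[of "z m" "z n" "z i"] by (auto simp: max_def split: if_splits)
    define P where "P i \<longleftrightarrow> Suc m \<le> i \<and> i \<le> n - 1 \<and> ?a \<le> 2 * q (z i) (z n)" for i
    have n: "Suc m < n"
    proof (rule ccontr)
      assume "\<not> Suc m < n"
      then have "n = Suc m" using less.prems by simp
      then show False using 3 nonneg[of "z m" "z n"] by simp
    qed
    then have "P (Suc m)"
      using 3 or[of "Suc m"] by (auto simp: P_def)
    define i where "i = (GREATEST i. P i)"
    have bd: "\<And>j. P j \<Longrightarrow> j \<le> n" by (auto simp: P_def)
    have Pi: "P i"
      unfolding i_def using \<open>P (Suc m)\<close> bd by (rule GreatestI_nat)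
    have in1: "i < n - 1"
      using Pi 3 by (cases "i = n - 1") (auto simp: P_def)
    have "\<not> P (Suc i)"
      using Greatest_le_nat[of P "Suc i" n] bd unfolding i_def[symmetric] by auto
    then have ai: "?a \<le> 2 * q (z m) (z (Suc i))"
      using or[of "Suc i"] Pi in1 by (auto simp: P_def)
    have mi: "m < i" "Suc i < n"
      using Pi in1 by (auto simp: P_def)
    have 1: "q (z m) (z (Suc i)) \<le> 2 * q (z m) (z (Suc m)) + 4 * ?S m (Suc i) + 2 * q (z i) (z (Suc i))"
      using less.hyps[of "Suc i" m] mi by simp
    have 2: "q (z i) (z n) \<le> 2 * q (z i) (z (Suc i)) + 4 * ?S i n + 2 * q (z (n - 1)) (z n)"
      using less.hyps[of n i] mi by simp
    have "?S m n = ?S m (Suc i) + (\<Sum>k\<in>{i..<n - 1}. q (z k) (z (Suc k)))"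
      using mi sum.atLeastLessThan_concat[of "Suc m" i "n - 1" "\<lambda>k. q (z k) (z (Suc k))"] by simp
    also have "(\<Sum>k\<in>{i..<n - 1}. q (z k) (z (Suc k))) = q (z i) (z (Suc i)) + ?S i n"
      using in1 by (rule sum.atLeast_Suc_lessThan)
    finally show ?thesis
      using 1 2 ai Pi by (simp add: P_def)
  qed (use S0 nonneg[of "z m" "z (Suc m)"] nonneg[of "z (n - 1)" "z n"] in linarith)+
qed

lemma frink_chain_sum:
  fixes q :: "'a \<Rightarrow> 'a \<Rightarrow> real"
  assumes nonneg: "\<And>x y. 0 \<le> q x y"
    and max: "\<And>x y z. q x z \<le> 2 * max (q x y) (q y z)"
    and "chain_sum q x y s"
  shows "q x y \<le> 4 * s"
proof -
  obtain z n where z: "0 < n" "z 0 = x" "z n = y" "(\<Sum>k<n. q (z k) (z (Suc k))) = s"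
    using chain_sum_sequence[OF assms(3)] by blast
  have "q x y \<le> 2 * q (z 0) (z 1) + 4 * (\<Sum>k\<in>{1..<n - 1}. q (z k) (z (Suc k))) + 2 * q (z (n - 1)) (z n)"
    using frink_chain[of q 0 n z, OF nonneg max z(1)] z by simp
  also have "\<dots> \<le> 4 * s"
  \<comment> \<open>In a chain of one link the first and the last link coincide, and that link is
    counted with weight 2 twice.\<close>
  proof (cases "n = 1")
    case True
    then show ?thesis using z nonneg[of x y] by simp
  next
    case False
    have "s = (\<Sum>k\<in>{0..<n}. q (z k) (z (Suc k)))"
      using z by (simp add: lessThan_atLeast0)
    also have "\<dots> = q (z 0) (z 1) + (\<Sum>k\<in>{1..<n}. q (z k) (z (Suc k)))"
      using z by (simp add: sum.atLeast_Suc_lessThan)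
    also have "{1..<n} = insert (n - 1) {1..<n - 1}"
      using False z by auto
    finally have "s = q (z 0) (z 1) + (q (z (n - 1)) (z n) + (\<Sum>k\<in>{1..<n - 1}. q (z k) (z (Suc k))))"
      using z by simp
    then show ?thesis
      using nonneg[of "z 0" "z 1"] nonneg[of "z (n - 1)" "z n"] by simp
  qed
  finally show ?thesis .
qed

text \<open>The Lipschitz inequality adds L times the new link to the distance already reached, so
  constants do not compound along a chain and no power of q has to be taken.\<close>

lemma lipschitz_chain_sum:
  fixes q :: "'a \<Rightarrow> 'a \<Rightarrow> real"
  assumes nonneg: "\<And>x y. 0 \<le> q x y"
    and lip: "\<And>x y z. q x z \<le> q x y + L * q y z"
    and "chain_sum q x y s"
  shows "q x y \<le> max 1 L * s"
proof -
  obtain z n where z: "0 < n" "z 0 = x" "z n = y" "(\<Sum>k<n. q (z k) (z (Suc k))) = s"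
    using chain_sum_sequence[OF assms(3)] by blast
  have "q (z 0) (z (Suc m)) \<le> max 1 L * (\<Sum>k<Suc m. q (z k) (z (Suc k)))" for m
  proof (induction m)
    case 0
    show ?case
      using mult_right_mono[of 1 "max 1 L" "q (z 0) (z 1)"] nonneg by simp
  next
    case (Suc m)
    have "L * q (z (Suc m)) (z (Suc (Suc m))) \<le> max 1 L * q (z (Suc m)) (z (Suc (Suc m)))"
      by (intro mult_right_mono nonneg) auto
    then show ?case
      using Suc lip[of "z 0" "z (Suc (Suc m))" "z (Suc m)"] by (simp add: distrib_left)
  qed
  from this[of "n - 1"] show ?thesis
    using z by simp
qed

definition chain_metric :: "('a \<Rightarrow> 'a \<Rightarrow> real) \<Rightarrow> 'a \<Rightarrow> 'a \<Rightarrow> real" where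
  "chain_metric q x y = Inf {s. chain_sum q x y s}"

context
  fixes q :: "'a \<Rightarrow> 'a \<Rightarrow> real"
  assumes q_nonneg: "\<And>x y. 0 \<le> q x y"
begin

lemma chain_sum_nonneg: "chain_sum q x y s \<Longrightarrow> 0 \<le> s"
  by (induction rule: chain_sum.induct) (auto simp: q_nonneg)

lemma chain_metric_le: "chain_sum q x y s \<Longrightarrow> chain_metric q x y \<le> s"
  unfolding chain_metric_def by (rule cInf_lower) (auto intro!: bdd_belowI chain_sum_nonneg)

lemma chain_metric_greatest:
  assumes "\<And>s. chain_sum q x y s \<Longrightarrow> b \<le> s"
  shows "b \<le> chain_metric q x y"
  unfolding chain_metric_def by (rule cInf_greatest) (use assms chain_sum.step[of q x y] in auto)

lemma chain_metric_nonneg: "0 \<le> chain_metric q x y"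
  by (rule chain_metric_greatest) (rule chain_sum_nonneg)

lemma chain_metric_le_q: "chain_metric q x y \<le> q x y"
  by (rule chain_metric_le[OF chain_sum.step])

lemma chain_metric_triangle: "chain_metric q x z \<le> chain_metric q x y + chain_metric q y z"
proof -
  have "chain_metric q x z - chain_metric q x y \<le> chain_metric q y z"
  proof (rule chain_metric_greatest)
    fix t assume t: "chain_sum q y z t"
    have "chain_metric q x z - t \<le> chain_metric q x y"
    proof (rule chain_metric_greatest)
      fix s assume "chain_sum q x y s"
      from chain_metric_le[OF chain_sum.trans[OF this t]]
      show "chain_metric q x z - t \<le> s" by simp
    qed
    then show "chain_metric q x z - chain_metric q x y \<le> t" by simp
  qed
  then show ?thesis by simp
qed

lemma chain_metric_sym:
  assumes "\<And>x y. q x y = q y x"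
  shows "chain_metric q x y = chain_metric q y x"
proof -
  have "chain_sum q y x s" if "chain_sum q x y s" for x y s
    using that
  proof induction
    case (step x y)
    then show ?case using chain_sum.step[of q y x] assms[of x y] by simp
  next
    case (trans x y s z t)
    then show ?case using chain_sum.trans[of q z y t x s] by (simp add: add.commute)
  qed
  then have "{s. chain_sum q x y s} = {s. chain_sum q y x s}" by blast
  then show ?thesis by (simp add: chain_metric_def)
qed

end

text \<open>D^n will be the volume growth after n doublings and the exponential the decay of a
  weight at distance 2^n. A single term of the exponential series, of order m, already beats the
  growth.\<close>

lemma exp_growth_summable:
  fixes t a D :: real
  assumes t: "0 < t" and a: "0 < a" and D: "1 \<le> D"
  obtains M where "0 < M" "\<And>n. D ^ n * exp (- t * (2 ^ n) powr a) \<le> M * (1 / 2) ^ n"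
proof -
  \<comment> \<open>The order m is chosen so that D / 2^(a m) < 1/2, which yields the factor
    (1/2)^n.\<close>
  obtain m :: nat where m: "2 * D < (2 powr a) ^ m"
    using real_arch_pow[of "2 powr a" "2 * D"] a by auto
  define M where "M = fact m / t ^ m"
  have "D ^ n * exp (- t * (2 ^ n) powr a) \<le> M * (1 / 2) ^ n" for n
  proof -
    let ?z = "t * (2 ^ n) powr a"
    have z: "0 < ?z" using t by simp
    have ez: "?z ^ m / fact m \<le> exp ?z"
    proof -
      have "(\<lambda>k. ?z ^ k / fact k) sums exp ?z"
        using exp_converges[of ?z] by (simp add: divide_inverse mult.commute)
      then show ?thesis
        using sum_le_suminf[of "\<lambda>k. ?z ^ k / fact k" "{m}"] z by (auto simp: sums_iff)
    qed
    have e: "exp (- ?z) \<le> fact m / ?z ^ m"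
    proof -
      have *: "inverse E \<le> F / Z" if "0 < Z" "0 < F" "0 < E" "Z / F \<le> E" for Z F E :: real
        using that by (simp add: field_simps)
      show ?thesis
        unfolding exp_minus by (rule *[OF _ _ _ ez]) (use z in auto)
    qed
    have zm: "?z ^ m = t ^ m * ((2 powr a) ^ m) ^ n"
    proof -
      have "((2 ^ n) powr a) = (2 powr a) ^ n"
        by (simp add: powr_realpow[symmetric] powr_powr mult.commute)
      then show ?thesis
        by (simp add: power_mult_distrib power_mult[symmetric] mult.commute)
    qed
    have "D ^ n * exp (- ?z) \<le> D ^ n * (fact m / ?z ^ m)"
      using D e by (intro mult_left_mono) auto
    also have "\<dots> = M * (D / (2 powr a) ^ m) ^ n"
      unfolding zm M_def by (simp add: power_divide)
    also have "\<dots> \<le> M * (1 / 2) ^ n"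
      using m D t by (intro mult_left_mono power_mono) (auto simp: M_def field_simps)
    finally show ?thesis by simp
  qed
  then show ?thesis
    using t by (intro that[of M]) (auto simp: M_def)
qed

subsection \<open>Balls, topology and measure\<close>

context homogeneous_space
begin

lemma topspace_quasi_topology [simp]: "topspace (quasi_topology d) = UNIV"
proof -
  have "openin (quasi_topology d) UNIV"
    unfolding openin_quasi_topology by (auto intro: exI[of _ 1])
  then show ?thesis
    using openin_subset[of "quasi_topology d" UNIV] by auto
qed

lemma dist_self [simp]: "d x x = 0"
  by (simp add: dist_eq_0)

lemma A0_pos: "0 < A0"
  using A0_ge_1 by simp

lemma mem_ball [simp]: "y \<in> quasi_ball d x r \<longleftrightarrow> d x y < r"
  by (simp add: quasi_ball_def)

lemma quasi_triangle': "d x z < r \<Longrightarrow> d z y < s \<Longrightarrow> d x y < A0 * (r + s)"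
  using quasi_triangle[of x y z] A0_pos by (smt (verit) mult_strict_left_mono)

text \<open>Since balls need not be open, a ball around x cannot serve as a test neighbourhood. Its
  role is taken by the set U of points at positive distance from E, which is open by the
  quasi-triangle inequality.\<close>

lemma in_closure_iff: "x \<in> quasi_topology d closure_of E \<longleftrightarrow> (\<forall>r>0. \<exists>y\<in>E. d x y < r)"
proof
  assume x: "x \<in> quasi_topology d closure_of E"
  show "\<forall>r>0. \<exists>y\<in>E. d x y < r"
  proof (rule ccontr)
    assume "\<not> (\<forall>r>0. \<exists>y\<in>E. d x y < r)"
    then obtain r where r: "r > 0" "\<And>y. y \<in> E \<Longrightarrow> r \<le> d x y"
      by (meson not_less)
    define U where "U = {z. \<exists>r>0. \<forall>y\<in>E. r \<le> d z y}"
    have "openin (quasi_topology d) U"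
      unfolding openin_quasi_topology
    proof
      fix z assume "z \<in> U"
      then obtain r where r: "r > 0" "\<And>y. y \<in> E \<Longrightarrow> r \<le> d z y"
        by (auto simp: U_def)
      have "quasi_ball d z (r / (2 * A0)) \<subseteq> U"
      proof
        fix w assume "w \<in> quasi_ball d z (r / (2 * A0))"
        then have w: "d z w < r / (2 * A0)" by simp
        have "r / (2 * A0) \<le> d w y" if y: "y \<in> E" for y
        proof (rule ccontr)
          assume "\<not> r / (2 * A0) \<le> d w y"
          then have "d z y < A0 * (r / (2 * A0) + r / (2 * A0))"
            using quasi_triangle'[OF w, of y "r / (2 * A0)"] by simp
          then show False
            using r(2)[OF y] A0_pos by simp
        qed
        then show "w \<in> U"
          using r A0_pos by (auto simp: U_def intro!: exI[of _ "r / (2 * A0)"])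
      qed
      then show "\<exists>r>0. quasi_ball d z r \<subseteq> U"
        using r A0_pos by (intro exI[of _ "r / (2 * A0)"]) auto
    qed
    moreover have "x \<in> U"
      using r by (auto simp: U_def)
    ultimately obtain y where "y \<in> E" "y \<in> U"
      using x by (auto simp: in_closure_of)
    then show False
      by (force simp: U_def)
  qed
next
  assume *: "\<forall>r>0. \<exists>y\<in>E. d x y < r"
  show "x \<in> quasi_topology d closure_of E"
    unfolding in_closure_of
  proof (intro conjI allI impI)
    fix T assume T: "x \<in> T \<and> openin (quasi_topology d) T"
    then obtain r where "r > 0" "quasi_ball d x r \<subseteq> T"
      by (auto simp: openin_quasi_topology)
    then show "\<exists>y. y \<in> E \<and> y \<in> T"
      using * by (metis mem_ball subsetD)
  qed simp
qed

definition qcont :: "('a \<Rightarrow> real) \<Rightarrow> bool" where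
  "qcont f \<longleftrightarrow> (\<forall>x. \<forall>\<epsilon>>0. \<exists>r>0. \<forall>y. d x y < r \<longrightarrow> \<bar>f x - f y\<bar> < \<epsilon>)"

lemma open_sets: "openin (quasi_topology d) U \<Longrightarrow> U \<in> sets \<mu>"
  unfolding sets_eq by auto

lemma qcont_openin:
  assumes "qcont f"
  shows "openin (quasi_topology d) {x. c < f x}" "openin (quasi_topology d) {x. f x < c}"
proof -
  show "openin (quasi_topology d) {x. c < f x}"
    unfolding openin_quasi_topology
  proof safe
    fix x assume "c < f x"
    then obtain r where "r > 0" "\<And>y. d x y < r \<Longrightarrow> \<bar>f x - f y\<bar> < f x - c"
      using assms unfolding qcont_def by (metis diff_gt_0_iff_gt)
    then show "\<exists>r>0. quasi_ball d x r \<subseteq> {x. c < f x}"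
      by (intro exI[of _ r]) (auto simp: abs_less_iff)
  qed
  show "openin (quasi_topology d) {x. f x < c}"
    unfolding openin_quasi_topology
  proof safe
    fix x assume "f x < c"
    then obtain r where "r > 0" "\<And>y. d x y < r \<Longrightarrow> \<bar>f x - f y\<bar> < c - f x"
      using assms unfolding qcont_def by (metis diff_gt_0_iff_gt)
    then show "\<exists>r>0. quasi_ball d x r \<subseteq> {x. f x < c}"
      by (intro exI[of _ r]) (force simp: abs_less_iff)
  qed
qed

lemma qcont_measurable [measurable]:
  assumes "qcont f"
  shows "f \<in> borel_measurable \<mu>"
proof (rule borel_measurableI_greater)
  fix c
  show "{x \<in> space \<mu>. c < f x} \<in> sets \<mu>"
    using open_sets[OF qcont_openin(1)[OF assms, of c]] by (simp add: space_eq)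
qed

definition vol :: "'a \<Rightarrow> real \<Rightarrow> real" where
  "vol x r = measure \<mu> (quasi_ball d x r)"

lemma ball_emeasure: "0 < r \<Longrightarrow> 0 < emeasure \<mu> (quasi_ball d x r)"
  "0 < r \<Longrightarrow> emeasure \<mu> (quasi_ball d x r) < \<infinity>"
proof -
  obtain C :: real where C: "\<And>x r. r > 0 \<Longrightarrow> 0 < emeasure \<mu> (quasi_ball d x (2 * r)) \<and>
          emeasure \<mu> (quasi_ball d x (2 * r)) \<le> ennreal C * emeasure \<mu> (quasi_ball d x r) \<and>
          ennreal C * emeasure \<mu> (quasi_ball d x r) < \<infinity>"
    using doubling by blast
  show "0 < emeasure \<mu> (quasi_ball d x r)" if "0 < r"
    using C[of "r / 2" x] that by simp
  show "emeasure \<mu> (quasi_ball d x r) < \<infinity>" if "0 < r"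
    using C[of "r / 2" x] that by (auto intro: order_le_less_trans)
qed

lemma emeasure_ball_finite: "emeasure \<mu> (quasi_ball d x r) \<noteq> \<infinity>"
proof (cases "0 < r")
  case True
  then show ?thesis using ball_emeasure(2)[of r x] by auto
next
  case False
  then have "quasi_ball d x r = {}"
    unfolding quasi_ball_def using dist_nonneg[of x] by (auto simp: not_less intro: order_trans)
  then show ?thesis by simp
qed

lemma emeasure_ball: "emeasure \<mu> (quasi_ball d x r) = ennreal (vol x r)"
  unfolding vol_def by (rule emeasure_eq_ennreal_measure) (use emeasure_ball_finite[of x r] in simp)

lemma vol_pos: "0 < r \<Longrightarrow> 0 < vol x r"
  using ball_emeasure(1)[of r x] unfolding emeasure_ball by (simp add: vol_def)

lemma vol_nonneg [simp]: "0 \<le> vol x r"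
  by (simp add: vol_def)

lemma vol_mono: "quasi_ball d x r \<subseteq> quasi_ball d y s \<Longrightarrow> vol x r \<le> vol y s"
  unfolding vol_def by (rule measure_mono_fmeasurable) 
    (auto simp: ball_sets intro!: fmeasurableI, use emeasure_ball_finite[of y s] in \<open>auto simp: less_top\<close>)

lemma vol_mono': "r \<le> s \<Longrightarrow> vol x r \<le> vol x s"
  by (rule vol_mono) auto

lemma doubling_constant:
  obtains D where "1 \<le> D" "\<And>x r. 0 < r \<Longrightarrow> vol x (2 * r) \<le> D * vol x r"
proof -
  obtain C :: real where C: "\<And>x r. r > 0 \<Longrightarrow> 0 < emeasure \<mu> (quasi_ball d x (2 * r)) \<and>
          emeasure \<mu> (quasi_ball d x (2 * r)) \<le> ennreal C * emeasure \<mu> (quasi_ball d x r) \<and>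
          ennreal C * emeasure \<mu> (quasi_ball d x r) < \<infinity>"
    using doubling by blast
  have "vol x (2 * r) \<le> max 1 C * vol x r" if r: "0 < r" for x r
  proof -
    have "ennreal (vol x (2 * r)) \<le> ennreal C * ennreal (vol x r)"
      using C[OF r, of x] by (simp add: emeasure_ball)
    also have "\<dots> \<le> ennreal (max 1 C) * ennreal (vol x r)"
      by (intro mult_right_mono ennreal_leI) auto
    also have "\<dots> = ennreal (max 1 C * vol x r)"
      by (simp add: ennreal_mult)
    finally show ?thesis
      by (subst (asm) ennreal_le_iff) auto
  qed
  then show ?thesis
    by (intro that[of "max 1 C"]) auto
qed

definition Dbl :: real where
  "Dbl = (SOME D. 1 \<le> D \<and> (\<forall>x r. 0 < r \<longrightarrow> vol x (2 * r) \<le> D * vol x r))"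

lemma Dbl: "1 \<le> Dbl" "0 < r \<Longrightarrow> vol x (2 * r) \<le> Dbl * vol x r"
proof -
  have "\<exists>D. 1 \<le> D \<and> (\<forall>x r. 0 < r \<longrightarrow> vol x (2 * r) \<le> D * vol x r)"
    using doubling_constant by metis
  from someI_ex[OF this] show "1 \<le> Dbl" "0 < r \<Longrightarrow> vol x (2 * r) \<le> Dbl * vol x r"
    unfolding Dbl_def by auto
qed

lemma vol_pow2: "0 < r \<Longrightarrow> vol x (2 ^ n * r) \<le> Dbl ^ n * vol x r"
proof (induction n)
  case (Suc n)
  have "vol x (2 ^ Suc n * r) \<le> Dbl * vol x (2 ^ n * r)"
    using Dbl(2)[of "2 ^ n * r" x] Suc.prems by (simp add: mult.assoc)
  also have "\<dots> \<le> Dbl * (Dbl ^ n * vol x r)"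
    using Suc Dbl(1) by (intro mult_left_mono) auto
  finally show ?case by simp
qed simp

lemma vol_scale:
  assumes "0 < s"
  obtains C where "0 < C" "\<And>x r. 0 < r \<Longrightarrow> vol x (s * r) \<le> C * vol x r"
proof -
  obtain n where n: "s < 2 ^ n"
    using real_arch_pow[of 2 s] by auto
  have "vol x (s * r) \<le> Dbl ^ n * vol x r" if "0 < r" for x r
  proof -
    have "vol x (s * r) \<le> vol x (2 ^ n * r)"
      using n that by (intro vol_mono') auto
    also have "\<dots> \<le> Dbl ^ n * vol x r"
      by (rule vol_pow2[OF that])
    finally show ?thesis .
  qed
  then show ?thesis
    using Dbl(1) by (intro that[of "Dbl ^ n"]) auto
qed

subsection \<open>The metric comparable to a power of the quasi-metric\<close>

definition aexp :: real where "aexp = decay_exponent d A0"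

definition rho :: "'a \<Rightarrow> 'a \<Rightarrow> real" where
  "rho = chain_metric (\<lambda>x y. d x y powr aexp)"

lemma aexp: "0 < aexp" "aexp \<le> 1"
proof -
  have "0 \<le> log 2 A0"
    using A0_ge_1 by simp
  then have l: "1 \<le> 1 + 2 * log 2 A0"
    by linarith
  obtain x where "1 \<le> x" "aexp = 1 / x"
  proof (cases "lipschitz_quasi_metric d")
    case True
    then show ?thesis
      by (intro that[of 1]) (auto simp: aexp_def decay_exponent_def)
  next
    case False
    then have "aexp = 1 / (1 + 2 * log 2 A0)"
      by (simp add: aexp_def decay_exponent_def)
    with l show ?thesis
      by (rule that)
  qed
  then show "0 < aexp" "aexp \<le> 1"
    by auto
qed

lemma rho_nonneg: "0 \<le> rho x y" and rho_le: "rho x y \<le> d x y powr aexp"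
  and rho_triangle: "rho x z \<le> rho x y + rho y z" and rho_sym: "rho x y = rho y x"
  unfolding rho_def
  by (rule chain_metric_nonneg chain_metric_le_q chain_metric_triangle chain_metric_sym; simp add: dist_sym)+

lemma rho_self [simp]: "rho x x = 0"
  using rho_le[of x x] rho_nonneg[of x x] by simp

lemma le_rho_ex: "\<exists>K\<ge>1. \<forall>x y. d x y powr aexp \<le> K * rho x y"
proof -
  have "\<exists>K\<ge>1. \<forall>x y s. chain_sum (\<lambda>x y. d x y powr aexp) x y s \<longrightarrow> d x y powr aexp \<le> K * s"
  proof (cases "lipschitz_quasi_metric d")
    case True
    then obtain L where L: "\<And>x y z. d x z \<le> d x y + L * d y z"
      unfolding lipschitz_quasi_metric_def by blast
    have a: "aexp = 1"
      using True by (simp add: aexp_def decay_exponent_def)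
    have "d x y powr aexp \<le> max 1 L * s" if "chain_sum (\<lambda>x y. d x y powr aexp) x y s" for x y s
      by (rule lipschitz_chain_sum[OF _ _ that]) (use L dist_nonneg a in auto)
    then show ?thesis
      by (intro exI[of _ "max 1 L"]) auto
  next
    case False
    then have a: "aexp = 1 / (1 + 2 * log 2 A0)"
      by (simp add: aexp_def decay_exponent_def)
    have l: "0 \<le> log 2 A0"
      using A0_ge_1 by simp
    have *: "(1 + L) * (1 / (1 + 2 * L)) \<le> 1" if "0 \<le> L" for L :: real
      using that by (simp add: divide_le_eq)
    \<comment> \<open>With A0 = 2^L the left side is 2^((1 + L) / (1 + 2 L)) <= 2. Thus d^a is a
      quasi-ultrametric with constant at most 2, as Frink's argument requires.\<close>
    have "(2 * A0) powr aexp = (2 powr (1 + log 2 A0)) powr aexp"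
      using A0_pos by (simp add: powr_add)
    also have "\<dots> = 2 powr ((1 + log 2 A0) * aexp)"
      by (rule powr_powr)
    also have "\<dots> \<le> 2 powr 1"
      unfolding a using *[OF l] by (intro powr_mono) auto
    finally have le2: "(2 * A0) powr aexp \<le> 2"
      by simp
    have m: "d x z powr aexp \<le> 2 * max (d x y powr aexp) (d y z powr aexp)" for x y z
    proof -
      have "d x z \<le> 2 * A0 * max (d x y) (d y z)"
      proof -
        have "A0 * (d x y + d y z) \<le> A0 * (2 * max (d x y) (d y z))"
          using A0_pos by (intro mult_left_mono) auto
        then show ?thesis
          using quasi_triangle[of x z y] by simp
      qed
      then have "d x z powr aexp \<le> (2 * A0 * max (d x y) (d y z)) powr aexp"
        using aexp dist_nonneg by (intro powr_mono2) auto
      also have "\<dots> = (2 * A0) powr aexp * max (d x y) (d y z) powr aexp"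
        using A0_pos dist_nonneg by (subst powr_mult[symmetric]) (auto simp: max_def)
      also have "\<dots> \<le> 2 * max (d x y) (d y z) powr aexp"
        using le2 by (intro mult_right_mono) auto
      also have "\<dots> \<le> 2 * max (d x y powr aexp) (d y z powr aexp)"
        by (auto simp: max_def)
      finally show ?thesis .
    qed
    have "d x y powr aexp \<le> 4 * s" if "chain_sum (\<lambda>x y. d x y powr aexp) x y s" for x y s
      by (rule frink_chain_sum[OF _ m that]) simp
    then show ?thesis
      by (intro exI[of _ 4]) auto
  qed
  then obtain K where K: "K \<ge> 1" "\<And>x y s. chain_sum (\<lambda>x y. d x y powr aexp) x y s \<Longrightarrow> d x y powr aexp \<le> K * s"
    by blast
  have "d x y powr aexp \<le> K * rho x y" for x y
  proof -
    have "d x y powr aexp / K \<le> rho x y"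
      unfolding rho_def by (rule chain_metric_greatest) (use K in \<open>auto simp: divide_le_eq mult.commute\<close>)
    then show ?thesis
      using K by (simp add: divide_le_eq mult.commute)
  qed
  then show ?thesis using K by blast
qed

definition Krho :: real where "Krho = (SOME K. K \<ge> 1 \<and> (\<forall>x y. d x y powr aexp \<le> K * rho x y))"

lemma Krho: "1 \<le> Krho" "d x y powr aexp \<le> Krho * rho x y"
  using someI_ex[OF le_rho_ex] unfolding Krho_def by auto

lemma qcont_rho: "qcont (rho x)"
  unfolding qcont_def
proof (intro allI impI)
  fix y and \<epsilon> :: real assume \<epsilon>: "\<epsilon> > 0"
  show "\<exists>r>0. \<forall>z. d y z < r \<longrightarrow> \<bar>rho x y - rho x z\<bar> < \<epsilon>"
  proof (intro exI[of _ "\<epsilon> powr (1 / aexp)"] conjI allI impI)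
    fix z assume z: "d y z < \<epsilon> powr (1 / aexp)"
    have "\<bar>rho x y - rho x z\<bar> \<le> rho y z"
      using rho_triangle[of x z y] rho_triangle[of x y z] rho_sym[of y z] by linarith
    also have "\<dots> \<le> d y z powr aexp"
      by (rule rho_le)
    also have "\<dots> < (\<epsilon> powr (1 / aexp)) powr aexp"
      using z aexp dist_nonneg by (intro powr_less_mono2) auto
    finally show "\<bar>rho x y - rho x z\<bar> < \<epsilon>"
      using aexp \<epsilon> by (simp add: powr_powr)
  qed (use \<epsilon> in auto)
qed


section \<open>Exponential weights against volume growth\<close>

definition wt :: "real \<Rightarrow> 'a \<Rightarrow> 'a \<Rightarrow> real" where
  "wt r x y = exp (- (rho x y / r powr aexp))"

lemma wt_nonneg [simp]: "0 \<le> wt r x y" and wt_pos [simp]: "0 < wt r x y" and wt_le_1: "wt r x y \<le> 1"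
  and wt_sym: "wt r x y = wt r y x" and wt_self [simp]: "wt r x x = 1"
  using rho_nonneg[of x y] by (auto simp: wt_def rho_sym)

text \<open>This is the reason for using the metric \<open>rho\<close> in the weight: its exact
  triangle inequality makes the weight submultiplicative without any loss of constant in the
  exponent.\<close>

lemma wt_triangle: "wt r x y * wt r y z \<le> wt r x z"
proof -
  have "rho x z / r powr aexp \<le> (rho x y + rho y z) / r powr aexp"
    by (intro divide_right_mono rho_triangle) auto
  then show ?thesis
    by (simp add: wt_def exp_add[symmetric] add_divide_distrib)
qed

lemma wt_powr: "wt r x y powr t = exp (- (t * rho x y / r powr aexp))"
  by (simp add: wt_def powr_def)

lemma wt_ge:
  assumes "d x y \<le> c * r" "0 < r" "0 \<le> c"
  shows "exp (- (c powr aexp)) \<le> wt r x y"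
proof -
  have "rho x y \<le> d x y powr aexp"
    by (rule rho_le)
  also have "\<dots> \<le> (c * r) powr aexp"
    using assms aexp dist_nonneg by (intro powr_mono2) auto
  also have "\<dots> = c powr aexp * r powr aexp"
    using assms by (simp add: powr_mult)
  finally show ?thesis
    using assms by (simp add: wt_def divide_le_eq)
qed

lemma wt_le: "0 < r \<Longrightarrow> wt r x y \<le> exp (- (1 / Krho) * (d x y / r) powr aexp)"
proof -
  assume r: "0 < r"
  have "d x y powr aexp / Krho \<le> rho x y"
    using Krho(2)[of x y] Krho(1) by (simp add: divide_le_eq mult.commute)
  then have "d x y powr aexp / Krho / r powr aexp \<le> rho x y / r powr aexp"
    using r by (intro divide_right_mono) auto
  then show ?thesis
    using r dist_nonneg by (simp add: wt_def powr_divide)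
qed

lemma scale_exists:
  assumes "0 < r" "r \<le> d x y"
  obtains n where "2 ^ n * r \<le> d x y" "d x y < 2 ^ Suc n * r"
proof -
  obtain N :: nat where "d x y / r < 2 ^ N"
    using real_arch_pow[of 2 "d x y / r"] by auto
  then have N: "d x y < 2 ^ N * r"
    using assms by (simp add: divide_less_eq)
  define m where "m = (LEAST m. d x y < 2 ^ m * r)"
  have m: "d x y < 2 ^ m * r"
    unfolding m_def using N by (rule LeastI)
  have "m \<noteq> 0"
    using m assms by (cases m) auto
  then obtain n where n: "m = Suc n"
    using not0_implies_Suc by blast
  have "\<not> d x y < 2 ^ n * r"
    using not_less_Least[of n "\<lambda>m. d x y < 2 ^ m * r"] n unfolding m_def by simp
  then show ?thesis
    using m n by (intro that[of n]) auto
qed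

lemma wt_shell:
  assumes "0 < r" "0 < t" "2 ^ n * r \<le> d x y"
  shows "wt r x y powr t \<le> exp (- (t / Krho) * (2 ^ n) powr aexp)"
proof -
  have "(2 ^ n) powr aexp \<le> (d x y / r) powr aexp"
    using assms aexp by (intro powr_mono2) (auto simp: le_divide_eq)
  then have "t / Krho * (2 ^ n) powr aexp \<le> t / Krho * (d x y / r) powr aexp"
    using assms Krho(1) by (intro mult_left_mono) auto
  moreover have "wt r x y powr t \<le> exp (- (1 / Krho) * (d x y / r) powr aexp) powr t"
    using assms wt_le[of r x y] by (intro powr_mono2) auto
  moreover have "exp (- (1 / Krho) * (d x y / r) powr aexp) powr t = exp (- (t / Krho * (d x y / r) powr aexp))"
    by (simp add: powr_def)
  moreover have "exp (- (t / Krho * (d x y / r) powr aexp)) \<le> exp (- (t / Krho) * (2 ^ n) powr aexp)"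
    if "t / Krho * (2 ^ n) powr aexp \<le> t / Krho * (d x y / r) powr aexp"
    using that by simp
  ultimately show ?thesis
    by linarith
qed

text \<open>Moving the centre over a distance of order 2^n r costs a fixed power of the doubling
  constant times \<open>Dbl ^ n\<close>; the weight is superexponentially small in n at that
  distance and absorbs the cost.\<close>

lemma vol_compare:
  assumes t: "0 < t"
  obtains M where "0 < M" "\<And>r x y. 0 < r \<Longrightarrow> vol x r * wt r x y powr t \<le> M * vol y r"
proof -
  obtain m where m: "A0 < 2 ^ m"
    using real_arch_pow[of 2 A0] by auto
  obtain M where M: "0 < M" "\<And>n. Dbl ^ n * exp (- (t / Krho) * (2 ^ n) powr aexp) \<le> M * (1 / 2) ^ n"
    using exp_growth_summable[of "t / Krho" aexp Dbl] t aexp Dbl(1) Krho(1) by auto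
  \<comment> \<open>The doublings are counted as n for the distance, m for the quasi-triangle
    constant and one for the sum of the two radii.\<close>
  have b: "vol x r \<le> Dbl ^ (n + (m + 1)) * vol y r" if r: "0 < r" and d: "d x y < 2 ^ n * r" for x y r n
  proof -
    have "A0 * (2 ^ n * r + r) \<le> 2 ^ m * (2 * 2 ^ n * r)"
      using m r by (intro mult_mono) auto
    then have "quasi_ball d x r \<subseteq> quasi_ball d y (2 ^ (n + (m + 1)) * r)"
      using quasi_triangle'[of y x "2 ^ n * r" _ r] d
      by (fastforce simp: dist_sym power_add mult_ac)
    then have "vol x r \<le> vol y (2 ^ (n + (m + 1)) * r)"
      by (rule vol_mono)
    also have "\<dots> \<le> Dbl ^ (n + (m + 1)) * vol y r"
      by (rule vol_pow2[OF r])
    finally show ?thesis .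
  qed
  define M' where "M' = Dbl ^ (m + 2) * max 1 M"
  show ?thesis
  proof
    show "0 < M'"
      using Dbl(1) by (auto simp: M'_def)
    fix r x y assume r: "0 < (r :: real)"
    show "vol x r * wt r x y powr t \<le> M' * vol y r"
    proof (cases "d x y < r")
      case True
      have "vol x r * wt r x y powr t \<le> vol x r * 1"
        using t wt_le_1[of r x y] powr_mono2[of t "wt r x y" 1] by (intro mult_left_mono) auto
      also have "\<dots> \<le> Dbl ^ (m + 1) * vol y r"
        using b[OF r, of x y 0] True by simp
      also have "\<dots> \<le> Dbl ^ (m + 2) * vol y r"
        using Dbl(1) by (intro mult_right_mono power_increasing) auto
      also have "\<dots> \<le> M' * vol y r"
      proof (rule mult_right_mono)
        have "Dbl ^ (m + 2) * 1 \<le> Dbl ^ (m + 2) * max 1 M"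
          using Dbl(1) by (intro mult_left_mono) auto
        then show "Dbl ^ (m + 2) \<le> M'"
          by (simp add: M'_def)
      qed simp
      finally show ?thesis .
    next
      case False
      then obtain n where n: "2 ^ n * r \<le> d x y" "d x y < 2 ^ Suc n * r"
        using scale_exists[OF r, of x y] by auto
      have "vol x r * wt r x y powr t \<le> (Dbl ^ (Suc n + (m + 1)) * vol y r) * exp (- (t / Krho) * (2 ^ n) powr aexp)"
        using t r n Dbl(1) by (intro mult_mono b wt_shell) auto
      also have "\<dots> = Dbl ^ (m + 2) * (Dbl ^ n * exp (- (t / Krho) * (2 ^ n) powr aexp)) * vol y r"
        by (simp add: power_add mult_ac)
      also have "\<dots> \<le> Dbl ^ (m + 2) * max 1 M * vol y r"
      proof (intro mult_right_mono mult_left_mono)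
        have "M * (1 / 2) ^ n \<le> M * 1"
          using M(1) by (intro mult_left_mono power_le_one) auto
        then show "Dbl ^ n * exp (- (t / Krho) * (2 ^ n) powr aexp) \<le> max 1 M"
          using M(2)[of n] by linarith
      qed (use Dbl(1) in auto)
      finally show ?thesis
        unfolding M'_def .
    qed
  qed
qed

lemma qcont_wt: "(\<lambda>y. wt r x y powr t) \<in> borel_measurable \<mu>"
  using qcont_measurable[OF qcont_rho, of x] unfolding wt_powr by measurable

text \<open>The space is divided into the ball of radius r and dyadic shells at distance about 2^n
  r; the volume of a shell grows at most like \<open>Dbl ^ n\<close> and the weight on it decays
  faster.\<close>

lemma wt_nn_integral:
  assumes t: "0 < t"
  obtains M where "0 < M" "\<And>r x. 0 < r \<Longrightarrow> (\<integral>\<^sup>+y. ennreal (wt r x y powr t) \<partial>\<mu>) \<le> ennreal (M * vol x r)"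
proof -
  obtain M where M: "0 < M" "\<And>n. Dbl ^ n * exp (- (t / Krho) * (2 ^ n) powr aexp) \<le> M * (1 / 2) ^ n"
    using exp_growth_summable[of "t / Krho" aexp Dbl] t aexp Dbl(1) Krho(1) by auto
  define f where "f r x n y = ennreal (exp (- (t / Krho) * (2 ^ n) powr aexp)) * indicator (quasi_ball d x (2 ^ Suc n * r)) y"
    for r :: real and x y and n :: nat
  have fm[measurable]: "f r x n \<in> borel_measurable \<mu>" for r x n
    unfolding f_def using ball_sets by measurable
  have "(\<integral>\<^sup>+y. ennreal (wt r x y powr t) \<partial>\<mu>) \<le> ennreal ((1 + 2 * (Dbl * M)) * vol x r)" if r: "0 < r" for r x
  proof -
    have "(\<integral>\<^sup>+y. ennreal (wt r x y powr t) \<partial>\<mu>) \<le> (\<integral>\<^sup>+y. indicator (quasi_ball d x r) y + (\<Sum>n. f r x n y) \<partial>\<mu>)"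
    proof (rule nn_integral_mono)
      fix y
      show "ennreal (wt r x y powr t) \<le> indicator (quasi_ball d x r) y + (\<Sum>n. f r x n y)"
      proof (cases "d x y < r")
        case True
        have "ennreal (wt r x y powr t) \<le> 1"
          using t wt_le_1[of r x y] powr_mono2[of t "wt r x y" 1] by simp
        also have "\<dots> \<le> indicator (quasi_ball d x r) y + (\<Sum>n. f r x n y)"
          using True by simp
        finally show ?thesis .
      next
        case False
        then obtain n where n: "2 ^ n * r \<le> d x y" "d x y < 2 ^ Suc n * r"
          using scale_exists[OF r, of x y] by auto
        have "ennreal (wt r x y powr t) \<le> f r x n y"
          unfolding f_def using wt_shell[OF r t n(1)] n by (simp add: ennreal_leI)
        also have "\<dots> = (\<Sum>n\<in>{n}. f r x n y)" by simp
        also have "\<dots> \<le> (\<Sum>n. f r x n y)"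
          by (rule sum_le_suminf) auto
        finally show ?thesis
          by (simp add: add_increasing)
      qed
    qed
    also have "\<dots> = emeasure \<mu> (quasi_ball d x r) + (\<Sum>n. \<integral>\<^sup>+y. f r x n y \<partial>\<mu>)"
      using ball_sets by (simp add: nn_integral_add nn_integral_suminf)
    also have "(\<Sum>n. \<integral>\<^sup>+y. f r x n y \<partial>\<mu>) \<le> (\<Sum>n. ennreal (Dbl * M * vol x r * (1 / 2) ^ n))"
    proof (rule suminf_le)
      fix n
      have "(\<integral>\<^sup>+y. f r x n y \<partial>\<mu>) = ennreal (exp (- (t / Krho) * (2 ^ n) powr aexp) * vol x (2 ^ Suc n * r))"
        unfolding f_def using ball_sets
        by (simp add: nn_integral_cmult_indicator emeasure_ball ennreal_mult)
      also have "\<dots> \<le> ennreal (Dbl * M * vol x r * (1 / 2) ^ n)"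
      proof (rule ennreal_leI)
        have "exp (- (t / Krho) * (2 ^ n) powr aexp) * vol x (2 ^ Suc n * r)
            \<le> exp (- (t / Krho) * (2 ^ n) powr aexp) * (Dbl ^ Suc n * vol x r)"
          by (intro mult_left_mono vol_pow2 r) auto
        also have "\<dots> = Dbl * (Dbl ^ n * exp (- (t / Krho) * (2 ^ n) powr aexp)) * vol x r"
          by simp
        also have "\<dots> \<le> Dbl * (M * (1 / 2) ^ n) * vol x r"
          using Dbl(1) by (intro mult_right_mono mult_left_mono M) auto
        finally show "exp (- (t / Krho) * (2 ^ n) powr aexp) * vol x (2 ^ Suc n * r) \<le> Dbl * M * vol x r * (1 / 2) ^ n"
          by (simp add: mult_ac)
      qed
      finally show "(\<integral>\<^sup>+y. f r x n y \<partial>\<mu>) \<le> ennreal (Dbl * M * vol x r * (1 / 2) ^ n)" .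
    qed auto
    also have "\<dots> = ennreal (\<Sum>n. Dbl * M * vol x r * (1 / 2) ^ n)"
      using Dbl(1) M by (intro suminf_ennreal2 summable_mult summable_geometric) auto
    also have "(\<Sum>n. Dbl * M * vol x r * (1 / 2) ^ n) = Dbl * M * vol x r * 2"
      by (subst suminf_mult) (auto simp: suminf_geometric)
    finally have "(\<integral>\<^sup>+y. ennreal (wt r x y powr t) \<partial>\<mu>) \<le> ennreal (vol x r) + ennreal (Dbl * M * vol x r * 2)"
      by (simp add: emeasure_ball)
    also have "\<dots> = ennreal ((1 + 2 * (Dbl * M)) * vol x r)"
      using Dbl(1) M by (subst ennreal_plus[symmetric]) (auto simp: algebra_simps)
    finally show ?thesis .
  qed
  then show ?thesis
    using Dbl(1) M by (intro that[of "1 + 2 * (Dbl * M)"]) (auto intro: add_pos_nonneg)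
qed

end

subsection \<open>Reference points\<close>

context homogeneous_space
begin

lemma maximal_separated_cover:
  assumes "maximal_separated d r S A" "0 < r" "x \<in> S"
  shows "\<exists>y\<in>A. d x y < r"
proof (rule ccontr)
  assume n: "\<not> (\<exists>y\<in>A. d x y < r)"
  then have "separated d r (insert x A)"
    using assms unfolding maximal_separated_def separated_def by (auto simp: dist_sym not_less)
  then have "insert x A = A"
    using assms unfolding maximal_separated_def by blast
  then have "x \<in> A" by blast
  then show False
    using n \<open>0 < r\<close> by auto
qed

lemma sum_vol_disjoint_le:
  assumes "finite F" "disjoint_family_on (\<lambda>j. quasi_ball d j s) F"
    and "\<And>j. j \<in> F \<Longrightarrow> quasi_ball d j s \<subseteq> quasi_ball d x R"
  shows "(\<Sum>j\<in>F. vol j s) \<le> vol x R"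
proof -
  have "(\<Sum>j\<in>F. vol j s) = measure \<mu> (\<Union>j\<in>F. quasi_ball d j s)"
    unfolding vol_def using assms ball_sets
    by (intro measure_finite_Union[symmetric]) (auto simp: image_subset_iff emeasure_ball_finite[simplified])
  also have "\<dots> \<le> vol x R"
    unfolding vol_def using assms ball_sets emeasure_ball_finite[of x R]
    by (intro measure_mono_fmeasurable) (auto intro!: fmeasurableI simp: less_top)
  finally show ?thesis .
qed

end

context reference_dyadic_system
begin

abbreviation "sc k \<equiv> \<delta> powi k"

lemma sc_pos [simp]: "0 < sc k"
  using delta_bounds by simp

lemma sc_nonneg [simp]: "0 \<le> sc k"
  using sc_pos[of k] by linarith

lemma sc_le_scale: "1 \<le> c \<Longrightarrow> sc k \<le> c * sc k"
  using mult_right_mono[of 1 c "sc k"] by simp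

lemma sc_Suc: "sc (k + 1) = \<delta> * sc k"
  using delta_bounds by (simp add: power_int_add)

lemma sc_add: "sc (k + int m) = \<delta> ^ m * sc k"
  using delta_bounds by (simp add: power_int_add)

lemma sc_le_Suc: "sc (k + 1) \<le> sc k"
  unfolding sc_Suc using delta_bounds sc_pos[of k] by (simp add: mult_le_cancel_right1)

lemma sc_antimono: "sc (k + int m) \<le> sc k"
  unfolding sc_add using delta_bounds sc_pos[of k] by (simp add: mult_le_cancel_right1 power_le_one)

text \<open>Contributions of the next finer generation carry a factor A0^n \<delta> relative to
  \<open>sc k\<close>. Keeping these factors below 1/1000 lets the distance bounds reproduce
  themselves from one generation to the next.\<close>

lemma A0_delta:
  assumes "n \<le> 10"
  shows "A0 ^ n * \<delta> \<le> 1 / 1000"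
proof -
  have "A0 ^ n * \<delta> \<le> A0 ^ 10 * \<delta>"
    using A0_ge_1 delta_bounds assms by (intro mult_right_mono power_increasing) auto
  also have "\<dots> \<le> A0 ^ 10 * (1 / (1000 * A0 ^ 10))"
    using A0_ge_1 delta_bounds by (intro mult_left_mono) auto
  also have "\<dots> = 1 / 1000"
    using A0_ge_1 by simp
  finally show ?thesis .
qed

lemma X_mono: "X k \<subseteq> X (k + 1)"
proof (cases "0 \<le> k")
  case True
  then show ?thesis using points_pos[of "k + 1"] by simp
next
  case False
  then show ?thesis using points_neg[of k] by (auto simp: maximal_separated_def)
qed

lemma X_sep: "x \<in> X k \<Longrightarrow> y \<in> X k \<Longrightarrow> x \<noteq> y \<Longrightarrow> sc k \<le> d x y"
proof -
  have "separated d (sc k) (X k)"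
  proof (cases k "0 :: int" rule: linorder_cases)
    case less
    then show ?thesis using points_neg[of k] by (simp add: maximal_separated_def)
  next
    case equal
    then show ?thesis using points_zero by (simp add: maximal_separated_def)
  next
    case greater
    then show ?thesis using points_pos[of k] by (simp add: maximal_separated_def)
  qed
  then show "x \<in> X k \<Longrightarrow> y \<in> X k \<Longrightarrow> x \<noteq> y \<Longrightarrow> sc k \<le> d x y"
    by (auto simp: separated_def)
qed

text \<open>For negative k the set \<open>X k\<close> is maximal only among the points of
  \<open>X (k + 1)\<close>, so errors accumulate through the generations. The factor 2 A0 is stable
  under this induction because A0 \<delta> is tiny.\<close>

lemma X_cover: "\<exists>y\<in>X k. d x y < 2 * A0 * sc k"
proof (cases "0 \<le> k")
  case True
  have "maximal_separated d (sc k) UNIV (X k)"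
    using True points_zero points_pos[of k] by (cases "k = 0") auto
  then obtain y where "y \<in> X k" "d x y < sc k"
    using maximal_separated_cover[of "sc k" UNIV "X k" x] by auto
  moreover have "sc k \<le> 2 * A0 * sc k"
    using A0_ge_1 by (intro sc_le_scale) auto
  ultimately show ?thesis
    by (meson order_less_le_trans)
next
  case False
  have "\<exists>y\<in>X (- int n). d x y < 2 * A0 * sc (- int n)" for n
  proof (induction n)
    case 0
    have "maximal_separated d (sc 0) UNIV (X 0)"
      using points_zero by simp
    then obtain y where y: "y \<in> X 0" "d x y < 1"
      using maximal_separated_cover[of "sc 0" UNIV "X 0" x] by auto
    then show ?case
      using A0_ge_1 by (intro bexI[of _ y]) auto
  next
    case (Suc n)
    let ?k = "- int (Suc n)"
    have k1: "?k + 1 = - int n" by simp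
    obtain y where y: "y \<in> X (?k + 1)" "d x y < 2 * A0 * sc (?k + 1)"
      using Suc unfolding k1 by auto
    obtain z where z: "z \<in> X ?k" "d y z < sc ?k"
      using maximal_separated_cover[OF points_neg sc_pos y(1)] by auto
    have "d x z < A0 * (2 * A0 * sc (?k + 1) + sc ?k)"
      by (rule quasi_triangle'[OF y(2) z(2)])
    also have "\<dots> = A0 * ((2 * (A0 ^ 1 * \<delta>) + 1) * sc ?k)"
      unfolding sc_Suc by (simp add: algebra_simps)
    also have "\<dots> \<le> A0 * (2 * sc ?k)"
      using A0_delta[of 1] A0_pos by (intro mult_left_mono mult_right_mono) (auto simp del: power_one_right)
    finally show ?case
      using z by (intro bexI[of _ z]) (auto simp: mult_ac)
  qed
  from this[of "nat (- k)"] False show ?thesis by simp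
qed

lemma X_nonempty: "X k \<noteq> {}"
  using X_cover[of k undefined] by auto

lemma X_balls_disjoint:
  assumes "F \<subseteq> X k" "s \<le> sc k / (2 * A0)"
  shows "disjoint_family_on (\<lambda>j. quasi_ball d j s) F"
  unfolding disjoint_family_on_def
proof (intro ballI impI equals0I)
  fix i j z assume "i \<in> F" "j \<in> F" "i \<noteq> j" and z: "z \<in> quasi_ball d i s \<inter> quasi_ball d j s"
  then have "sc k \<le> d i j"
    using assms X_sep[of i k j] by auto
  also have "d i j < A0 * (sc k / (2 * A0) + sc k / (2 * A0))"
    using z assms(2) by (intro quasi_triangle'[of i z _ j]) (auto simp: dist_sym)
  finally show False
    using A0_pos by simp
qed

text \<open>Packing argument: the points carry disjoint balls that lie in one fixed ball and have
  volumes bounded below by doubling.\<close>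

lemma X_finite_near: "finite {j \<in> X k. d x j < R}"
proof (cases "0 < R")
  case R: True
  define s where "s = sc k / (2 * A0)"
  have s: "0 < s"
    using A0_pos by (simp add: s_def)
  obtain C where C: "0 < C" "\<And>x r. 0 < r \<Longrightarrow> vol x (2 * A0 * R / s * r) \<le> C * vol x r"
    using vol_scale[of "2 * A0 * R / s"] R s A0_pos by auto
  define M where "M = C * vol x (A0 * (R + s)) / vol x R"
  show ?thesis
  proof (rule finite_if_finite_subsets_card_bdd[THEN conjunct1])
    fix F assume F: "F \<subseteq> {j \<in> X k. d x j < R}" "finite F"
    have "vol x R \<le> C * vol j s" if j: "j \<in> F" for j
    proof -
      have "quasi_ball d x R \<subseteq> quasi_ball d j (2 * A0 * R)"
        using quasi_triangle'[of j x R _ R] j F by (fastforce simp: dist_sym)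
      then have "vol x R \<le> vol j (2 * A0 * R / s * s)"
        using s by (intro vol_mono) auto
      also have "\<dots> \<le> C * vol j s"
        by (rule C(2)[OF s])
      finally show ?thesis .
    qed
    then have "real (card F) * vol x R \<le> (\<Sum>j\<in>F. C * vol j s)"
      using sum_mono[of F "\<lambda>_. vol x R" "\<lambda>j. C * vol j s"] by simp
    also have "\<dots> = C * (\<Sum>j\<in>F. vol j s)"
      by (simp add: sum_distrib_left)
    also have "\<dots> \<le> C * vol x (A0 * (R + s))"
    proof (intro mult_left_mono sum_vol_disjoint_le F X_balls_disjoint)
      show "quasi_ball d j s \<subseteq> quasi_ball d x (A0 * (R + s))" if "j \<in> F" for j
        using that F quasi_triangle'[of x j R _ s] by auto
    qed (use C F in \<open>auto simp: s_def\<close>)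
    finally have "real (card F) \<le> M"
      using vol_pos[OF R, of x] by (simp add: M_def le_divide_eq)
    then show "card F \<le> nat \<lceil>M\<rceil>"
      by linarith
  qed
next
  case False
  then have "{j \<in> X k. d x j < R} = {}"
    using dist_nonneg[of x] by (auto simp: not_less intro: order_trans)
  then show ?thesis by (simp only: finite.emptyI)
qed

lemma X_countable: "countable (X k)"
proof -
  have "X k = (\<Union>n::nat. {j \<in> X k. d undefined j < real n})"
    using reals_Archimedean2 by auto
  also have "countable \<dots>"
    by (rule countable_UN) (auto intro: countable_finite X_finite_near)
  finally show ?thesis .
qed

text \<open>Discrete counterpart of the integral bound. Each point is thickened to a ball of radius
  q; these balls are disjoint and the weight changes on each by at most a constant factor. Half of
  the exponent pays for comparing the volume at i with the volumes at j, the other half is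
  integrated.\<close>

lemma wt_sum_bound:
  assumes t: "0 < t"
  obtains B where "0 < B" "\<And>k i F. finite F \<Longrightarrow> F \<subseteq> X (k + 1) \<Longrightarrow> (\<Sum>j\<in>F. wt (sc k) i j powr t) \<le> B"
proof -
  define s where "s = t / 2"
  have s: "0 < s" "s + s = t"
    using t by (auto simp: s_def)
  obtain M1 where M1: "0 < M1" "\<And>r x y. 0 < r \<Longrightarrow> vol x r * wt r x y powr s \<le> M1 * vol y r"
    using vol_compare[OF s(1)] by blast
  obtain M2 where M2: "0 < M2" "\<And>r x. 0 < r \<Longrightarrow> (\<integral>\<^sup>+y. ennreal (wt r x y powr s) \<partial>\<mu>) \<le> ennreal (M2 * vol x r)"
    using wt_nn_integral[OF s(1)] by blast
  obtain C where C: "0 < C" "\<And>x r. 0 < r \<Longrightarrow> vol x (2 * A0 / \<delta> * r) \<le> C * vol x r"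
    using vol_scale[of "2 * A0 / \<delta>"] A0_pos delta_bounds by auto
  define E where "E = exp s"
  define B where "B = M1 * C * (E * M2)"
  show ?thesis
  proof
    show "0 < B"
      using M1 C M2 by (simp add: B_def E_def)
    fix k i F assume F: "finite F" "F \<subseteq> X (k + 1)"
    let ?r = "sc k"
    define q where "q = sc (k + 1) / (2 * A0)"
    have q: "0 < q" "q \<le> ?r" "2 * A0 / \<delta> * q = ?r"
    proof -
      show "0 < q" using A0_pos by (simp add: q_def)
      have "q \<le> sc (k + 1)"
        using sc_le_scale[of "2 * A0" "k + 1"] A0_ge_1 by (simp add: q_def divide_le_eq mult_ac)
      then show "q \<le> ?r" using sc_le_Suc[of k] by simp
      show "2 * A0 / \<delta> * q = ?r"
        using A0_pos delta_bounds by (simp add: q_def sc_Suc)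
    qed
    have vi: "0 < vol i ?r" by (simp add: vol_pos)
    have dis: "disjoint_family_on (\<lambda>j. quasi_ball d j q) F"
      using F by (intro X_balls_disjoint) (auto simp: q_def)
    have 1: "vol i ?r * wt ?r i j powr s \<le> M1 * C * vol j q" for j
    proof -
      have "vol i ?r * wt ?r i j powr s \<le> M1 * vol j ?r"
        by (rule M1(2)) simp
      also have "\<dots> \<le> M1 * (C * vol j q)"
        using C(2)[OF q(1), of j] M1(1) q(3) by (intro mult_left_mono) auto
      finally show ?thesis by simp
    qed
    have 2: "wt ?r i j powr s * indicator (quasi_ball d j q) y \<le> E * wt ?r i y powr s * indicator (quasi_ball d j q) y" for j y
    proof (cases "d j y < q")
      case True
      have "exp (- 1) \<le> wt ?r j y"
        using wt_ge[of j y 1 ?r] True q(2) by simp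
      then have "wt ?r i j * exp (- 1) \<le> wt ?r i j * wt ?r j y"
        by (intro mult_left_mono) auto
      also have "\<dots> \<le> wt ?r i y"
        by (rule wt_triangle)
      finally have "(wt ?r i j * exp (- 1)) powr s \<le> wt ?r i y powr s"
        using s by (intro powr_mono2) auto
      then have "wt ?r i j powr s * exp (- s) \<le> wt ?r i y powr s"
        by (simp add: powr_mult) (simp add: powr_def)
      then have "wt ?r i j powr s \<le> E * wt ?r i y powr s"
        by (simp add: E_def exp_minus field_simps)
      then show ?thesis
        using True by simp
    qed simp
    have "ennreal (\<Sum>j\<in>F. wt ?r i j powr s * vol j q) = (\<Sum>j\<in>F. \<integral>\<^sup>+y. ennreal (wt ?r i j powr s) * indicator (quasi_ball d j q) y \<partial>\<mu>)"
      using ball_sets by (simp add: nn_integral_cmult_indicator emeasure_ball sum_ennreal flip: ennreal_mult)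
    also have "\<dots> = (\<integral>\<^sup>+y. (\<Sum>j\<in>F. ennreal (wt ?r i j powr s) * indicator (quasi_ball d j q) y) \<partial>\<mu>)"
      using ball_sets by (intro nn_integral_sum[symmetric]) auto
    also have "\<dots> \<le> (\<integral>\<^sup>+y. ennreal E * ennreal (wt ?r i y powr s) \<partial>\<mu>)"
    proof (rule nn_integral_mono)
      fix y
      show "(\<Sum>j\<in>F. ennreal (wt ?r i j powr s) * indicator (quasi_ball d j q) y) \<le> ennreal E * ennreal (wt ?r i y powr s)"
      proof (cases "\<exists>j\<in>F. y \<in> quasi_ball d j q")
        case True
        then obtain j where j: "j \<in> F" "y \<in> quasi_ball d j q" by blast
        have *: "y \<notin> quasi_ball d i' q" if "i' \<in> F" "i' \<noteq> j" for i'
          using disjoint_family_onD[OF dis that(1) j(1) that(2)] j(2) by blast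
        have "(\<Sum>i'\<in>F. ennreal (wt ?r i i' powr s) * indicator (quasi_ball d i' q) y)
            = (\<Sum>i'\<in>{j}. ennreal (wt ?r i i' powr s) * indicator (quasi_ball d i' q) y)"
          by (rule sum.mono_neutral_right)
            (use F j * in \<open>auto simp: indicator_def\<close>)
        also have "\<dots> \<le> ennreal E * ennreal (wt ?r i y powr s)"
          using 2[of j y] j(2) by (simp add: ennreal_leI E_def flip: ennreal_mult)
        finally show ?thesis .
      next
        case False
        then show ?thesis by (simp add: indicator_def)
      qed
    qed
    also have "\<dots> \<le> ennreal E * ennreal (M2 * vol i ?r)"
      using qcont_wt by (subst nn_integral_cmult) (auto intro!: mult_left_mono M2(2))
    also have "\<dots> = ennreal (E * (M2 * vol i ?r))"
      using M2(1) by (simp add: E_def ennreal_mult)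
    finally have 3: "(\<Sum>j\<in>F. wt ?r i j powr s * vol j q) \<le> E * (M2 * vol i ?r)"
      using M2(1) by (subst (asm) ennreal_le_iff) (auto simp: E_def)
    have "vol i ?r * (\<Sum>j\<in>F. wt ?r i j powr t) = (\<Sum>j\<in>F. (vol i ?r * wt ?r i j powr s) * wt ?r i j powr s)"
      unfolding sum_distrib_left s(2)[symmetric] powr_add by (simp add: mult.assoc)
    also have "\<dots> \<le> (\<Sum>j\<in>F. (M1 * C * vol j q) * wt ?r i j powr s)"
      by (intro sum_mono mult_right_mono 1) auto
    also have "\<dots> = M1 * C * (\<Sum>j\<in>F. wt ?r i j powr s * vol j q)"
      unfolding sum_distrib_left by (simp add: mult_ac)
    also have "\<dots> \<le> M1 * C * (E * (M2 * vol i ?r))"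
      using M1 C by (intro mult_left_mono 3) auto
    finally have "vol i ?r * (\<Sum>j\<in>F. wt ?r i j powr t) \<le> vol i ?r * B"
      by (simp add: B_def mult_ac)
    then show "(\<Sum>j\<in>F. wt ?r i j powr t) \<le> B"
      using vi by simp
  qed
qed

end

subsection \<open>The randomized parent relation\<close>

context labelled_dyadic_system
begin

lemma new_point_cases:
  assumes "x \<in> X k"
  shows "new_point \<omega> k x = x \<or> (new_point \<omega> k x \<in> children k x \<and> label1 k x = fst (\<omega> k))"
proof (cases "label1 k x = fst (\<omega> k) \<and> (\<exists>y\<in>children k x. label2 (k + 1) y = snd (\<omega> k))")
  case True
  then obtain y where y: "y \<in> children k x" "label2 (k + 1) y = snd (\<omega> k)" by blast
  have "new_point \<omega> k x = (THE y. y \<in> children k x \<and> label2 (k + 1) y = snd (\<omega> k))"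
    using True by (simp add: new_point_def)
  also have "\<dots> = y"
    by (rule the_equality) (use y label2_siblings[OF assms] in metis)+
  finally show ?thesis using True y by simp
qed (auto simp: new_point_def)

lemma childrenD: "y \<in> children k x \<Longrightarrow> y \<in> X (k + 1)" "y \<in> children k x \<Longrightarrow> parent k y = x"
  by (auto simp: children_def)

lemma new_point_dist:
  assumes "x \<in> X k"
  shows "d x (new_point \<omega> k x) < 2 * A0 * sc k"
proof -
  have "0 < 2 * A0 * sc k"
    using A0_pos by simp
  then show ?thesis
    using new_point_cases[OF assms, of \<omega>]
    by (metis childrenD dist_self dist_sym parent_dist)
qed

lemma new_point_in: "x \<in> X k \<Longrightarrow> new_point \<omega> k x \<in> X (k + 1)"
  using new_point_cases[of x k \<omega>] X_mono[of k] childrenD by auto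

lemma half_le: "sc k / (2 * A0) \<le> sc k"
  using sc_le_scale[of "2 * A0" k] A0_ge_1 by (simp add: divide_le_eq mult_ac)

text \<open>If neither point moved, the reference points are separated. If exactly one moved,
  closeness would force it to be a child of the other. If both moved, closeness would make the two
  parents neighbours, yet both have the drawn first label.\<close>

lemma new_point_sep:
  assumes x: "x \<in> X k" "x' \<in> X k" "x \<noteq> x'"
  shows "sc k / (2 * A0) \<le> d (new_point \<omega> k x) (new_point \<omega> k x')"
proof (rule ccontr)
  let ?z = "new_point \<omega> k"
  assume "\<not> ?thesis"
  then have lt: "d (?z x) (?z x') < sc k / (2 * A0)" by simp
  have mixed: False if "u \<in> X k" "v \<in> X k" "u \<noteq> v" "?z u \<in> children k u" "d (?z u) v < sc k / (2 * A0)" for u v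
    using parent_near[OF childrenD(1)[OF that(4)] that(2,5)] childrenD(2)[OF that(4)] that(3) by simp
  consider "?z x = x" "?z x' = x'" | "?z x \<in> children k x" "?z x' = x'" | "?z x = x" "?z x' \<in> children k x'"
    | "?z x \<in> children k x" "?z x' \<in> children k x'" "label1 k x = fst (\<omega> k)" "label1 k x' = fst (\<omega> k)"
    using new_point_cases[OF x(1), of \<omega>] new_point_cases[OF x(2), of \<omega>] by blast
  then show False
  proof cases
    case 1
    then show False
      using X_sep[OF x] half_le[of k] lt by simp
  next
    case 2
    then show False using mixed[OF x] lt by simp
  next
    case 3
    then show False using mixed[OF x(2,1)] x(3) lt by (simp add: dist_sym)
  next
    case 4
    then have "x' \<in> neighbours k x"
      using x lt unfolding neighbours_def by blast
    then show False
      using label1_neighbours[OF x(1), of x'] 4(3,4) by simp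
  qed
qed

lemma new_point_close_unique:
  assumes "x \<in> X k" "x' \<in> X k" "d y (new_point \<omega> k x) < sc k / (4 * A0\<^sup>2)" "d y (new_point \<omega> k x') < sc k / (4 * A0\<^sup>2)"
  shows "x = x'"
proof (rule ccontr)
  assume "x \<noteq> x'"
  have "d (new_point \<omega> k x) (new_point \<omega> k x') < A0 * (sc k / (4 * A0\<^sup>2) + sc k / (4 * A0\<^sup>2))"
    using assms by (intro quasi_triangle'[of _ y]) (auto simp: dist_sym)
  also have "\<dots> = sc k / (2 * A0)"
    using A0_pos by (simp add: power2_eq_square field_simps)
  finally show False
    using new_point_sep[OF assms(1,2) \<open>x \<noteq> x'\<close>, of \<omega>] by simp
qed

definition new_parent :: "(int \<Rightarrow> nat \<times> nat) \<Rightarrow> int \<Rightarrow> 'a \<Rightarrow> 'a" where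
  "new_parent \<omega> k y = (THE x. new_child \<omega> (k + 1, y) (k, x))"

lemma new_child_iff: "new_child \<omega> (k + 1, y) (k, x) \<longleftrightarrow> y \<in> X (k + 1) \<and> x \<in> X k \<and>
     (d y (new_point \<omega> k x) < sc k / (4 * A0\<^sup>2) \<or>
      parent k y = x \<and> \<not> (\<exists>x'\<in>X k. d y (new_point \<omega> k x') < sc k / (4 * A0\<^sup>2)))"
  by (simp add: new_child_def)

lemma new_child_ex1:
  assumes "y \<in> X (k + 1)"
  shows "\<exists>!x. new_child \<omega> (k + 1, y) (k, x)"
proof (cases "\<exists>x'\<in>X k. d y (new_point \<omega> k x') < sc k / (4 * A0\<^sup>2)")
  case True
  then obtain x where x: "x \<in> X k" "d y (new_point \<omega> k x) < sc k / (4 * A0\<^sup>2)" by blast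
  show ?thesis
    by (rule ex1I[of _ x]) (use x assms new_point_close_unique in \<open>auto simp: new_child_iff\<close>)
next
  case False
  then show ?thesis
    by (intro ex1I[of _ "parent k y"]) (use assms parent_in in \<open>auto simp: new_child_iff\<close>)
qed

lemma new_parent_iff: "y \<in> X (k + 1) \<Longrightarrow> new_parent \<omega> k y = x \<longleftrightarrow> new_child \<omega> (k + 1, y) (k, x)"
  unfolding new_parent_def using new_child_ex1[of y k \<omega>] the1_equality[of "\<lambda>x. new_child \<omega> (k + 1, y) (k, x)" x]
    theI'[of "\<lambda>x. new_child \<omega> (k + 1, y) (k, x)"] by metis

lemma new_parent_in: "y \<in> X (k + 1) \<Longrightarrow> new_parent \<omega> k y \<in> X k"
  using new_parent_iff[of y k \<omega> "new_parent \<omega> k y"] by (simp add: new_child_iff)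

lemma new_parent_eqI: "y \<in> X (k + 1) \<Longrightarrow> x \<in> X k \<Longrightarrow> d y (new_point \<omega> k x) < sc k / (4 * A0\<^sup>2) \<Longrightarrow> new_parent \<omega> k y = x"
  by (simp add: new_parent_iff new_child_iff)

lemma new_parent_new_point: "x \<in> X k \<Longrightarrow> new_parent \<omega> k (new_point \<omega> k x) = x"
  using A0_pos by (intro new_parent_eqI new_point_in) auto

lemma A0_pow_le: "m \<le> n \<Longrightarrow> A0 ^ m \<le> A0 ^ n"
  using A0_ge_1 by (rule power_increasing[rotated])

lemma new_parent_dist:
  assumes "y \<in> X (k + 1)"
  shows "d y (new_parent \<omega> k y) < 3 * A0 ^ 2 * sc k"
proof -
  let ?x = "new_parent \<omega> k y"
  have x: "?x \<in> X k" by (rule new_parent_in[OF assms])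
  have "d y (new_point \<omega> k ?x) < sc k / (4 * A0\<^sup>2) \<or> parent k y = ?x"
    using new_parent_iff[OF assms, of \<omega> ?x] by (auto simp: new_child_iff)
  then show ?thesis
  proof
    assume "d y (new_point \<omega> k ?x) < sc k / (4 * A0\<^sup>2)"
    then have "d y ?x < A0 * (sc k / (4 * A0\<^sup>2) + 2 * A0 * sc k)"
      using new_point_dist[OF x, of \<omega>] by (intro quasi_triangle'[of _ "new_point \<omega> k ?x"]) (auto simp: dist_sym)
    also have "\<dots> = (1 / (4 * A0) + 2 * A0 ^ 2) * sc k"
      using A0_pos by (simp add: field_simps power2_eq_square)
    also have "\<dots> \<le> (3 * A0 ^ 2) * sc k"
    proof (intro mult_right_mono)
      have "1 / (4 * A0) \<le> 1"
        using A0_ge_1 by simp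
      then show "1 / (4 * A0) + 2 * A0 ^ 2 \<le> 3 * A0 ^ 2"
        using one_le_power[OF A0_ge_1, of 2] by linarith
    qed simp
    finally show ?thesis .
  next
    assume "parent k y = ?x"
    then have "d y ?x < 2 * A0 * sc k"
      using parent_dist[OF assms] by simp
    also have "\<dots> \<le> 3 * A0 ^ 2 * sc k"
      using A0_pow_le[of 1 2] A0_pos by (intro mult_right_mono) auto
    finally show ?thesis .
  qed
qed

section \<open>Ancestors and the geometry of the random cubes\<close>

primrec ancestor :: "(int \<Rightarrow> nat \<times> nat) \<Rightarrow> int \<Rightarrow> nat \<Rightarrow> 'a \<Rightarrow> 'a" where
  "ancestor \<omega> k 0 y = y"
| "ancestor \<omega> k (Suc m) y = ancestor \<omega> k m (new_parent \<omega> (k + int m) y)"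

lemma k_Suc: "k + int (Suc m) = (k + int m) + 1"
  by simp

text \<open>The recursion removes the finest generation first; estimates that add one coarser
  generation need the last step at the top instead.\<close>

lemma ancestor_top: "ancestor \<omega> k (Suc m) y = new_parent \<omega> k (ancestor \<omega> (k + 1) m y)"
proof (induction m arbitrary: y)
  case (Suc m)
  have "ancestor \<omega> k (Suc (Suc m)) y = ancestor \<omega> k (Suc m) (new_parent \<omega> (k + 1 + int m) y)"
    by (simp add: add.commute add.left_commute)
  also have "\<dots> = new_parent \<omega> k (ancestor \<omega> (k + 1) (Suc m) y)"
    unfolding Suc by simp
  finally show ?case .
qed simp

lemma ancestor_in: "y \<in> X (k + int m) \<Longrightarrow> ancestor \<omega> k m y \<in> X k"
proof (induction m arbitrary: y)
  case (Suc m)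
  then have "new_parent \<omega> (k + int m) y \<in> X (k + int m)"
    by (intro new_parent_in) (simp add: algebra_simps)
  then show ?case using Suc.IH by simp
qed simp

text \<open>One coarse step costs 3 A0^2, and the distance accumulated at finer generations is
  multiplied by A0 \<delta>. The bound 4 A0^3 is a value that this recursion preserves,
  independently of m.\<close>

lemma ancestor_dist: "y \<in> X (k + int m) \<Longrightarrow> d y (ancestor \<omega> k m y) \<le> 4 * A0 ^ 3 * sc k"
proof (induction m arbitrary: k)
  case 0
  show ?case using A0_pos by simp
next
  case (Suc m)
  let ?u = "ancestor \<omega> (k + 1) m y"
  have y: "y \<in> X (k + 1 + int m)"
    using Suc.prems by (simp add: algebra_simps)
  have "d y (new_parent \<omega> k ?u) \<le> A0 * (d y ?u + d ?u (new_parent \<omega> k ?u))"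
    by (rule quasi_triangle)
  also have "\<dots> \<le> A0 * (4 * A0 ^ 3 * sc (k + 1) + 3 * A0 ^ 2 * sc k)"
    using Suc.IH[OF y] new_parent_dist[OF ancestor_in[OF y], of \<omega> \<omega>] A0_pos by (intro mult_left_mono) auto
  also have "\<dots> = (4 * (A0 ^ 4 * \<delta>) + 3 * A0 ^ 3) * sc k"
    unfolding sc_Suc by (simp add: algebra_simps power_numeral_reduce)
  also have "\<dots> \<le> (4 * A0 ^ 3) * sc k"
    using A0_delta[of 4] one_le_power[OF A0_ge_1, of 3] by (intro mult_right_mono) auto
  finally show ?case
    unfolding ancestor_top .
qed

lemma new_le_iff:
  assumes "y \<in> X l" "x \<in> X k"
  shows "new_le \<omega> (l, y) (k, x) \<longleftrightarrow> (\<exists>m. l = k + int m \<and> ancestor \<omega> k m y = x)"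
proof
  have *: "y \<in> X l \<longrightarrow> (\<exists>m. l = k + int m \<and> ancestor \<omega> k m y = x)" if "(new_child \<omega>)\<^sup>*\<^sup>* (l, y) (k, x)" for l y
    using that
  proof (induction rule: converse_rtranclp_induct2)
    case refl
    show ?case by (intro impI exI[of _ 0]) simp
  next
    case (step l y l' y')
    then have l: "l = l' + 1" "new_child \<omega> (l' + 1, y) (l', y')" "y' \<in> X l'" "y \<in> X (l' + 1)"
      by (auto simp: new_child_def)
    then obtain m where m: "l' = k + int m" "ancestor \<omega> k m y' = x"
      using step.IH by blast
    have "new_parent \<omega> l' y = y'"
      using l by (simp add: new_parent_iff)
    then show ?case
      using l m by (intro impI exI[of _ "Suc m"]) auto
  qed
  then show "new_le \<omega> (l, y) (k, x) \<Longrightarrow> \<exists>m. l = k + int m \<and> ancestor \<omega> k m y = x"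
    using assms by (auto simp: new_le_def)
next
  have "new_le \<omega> (k + int m, y) (k, ancestor \<omega> k m y)" if "y \<in> X (k + int m)" for m y
    using that
  proof (induction m arbitrary: y)
    case 0
    show ?case by (simp add: new_le_def)
  next
    case (Suc m)
    have y: "y \<in> X (k + int m + 1)"
      using Suc.prems by (simp add: algebra_simps)
    have "new_child \<omega> (k + int m + 1, y) (k + int m, new_parent \<omega> (k + int m) y)"
      using new_parent_iff[OF y] by blast
    moreover have "new_le \<omega> (k + int m, new_parent \<omega> (k + int m) y) (k, ancestor \<omega> k (Suc m) y)"
      using Suc.IH[OF new_parent_in[OF y]] by simp
    ultimately show ?case
      unfolding new_le_def by (simp add: algebra_simps converse_rtranclp_into_rtranclp)
  qed
  then show "\<exists>m. l = k + int m \<and> ancestor \<omega> k m y = x \<Longrightarrow> new_le \<omega> (l, y) (k, x)"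
    using assms by auto
qed

lemma pre_cube_iff:
  assumes "x \<in> X k"
  shows "z \<in> pre_cube \<omega> k x \<longleftrightarrow> (\<exists>m. \<exists>y\<in>X (k + int m). ancestor \<omega> k m y = x \<and> z = new_point \<omega> (k + int m) y)"
proof
  assume "z \<in> pre_cube \<omega> k x"
  then obtain l y where "z = new_point \<omega> l y" "y \<in> X l" "new_le \<omega> (l, y) (k, x)"
    unfolding pre_cube_def by blast
  then show "\<exists>m. \<exists>y\<in>X (k + int m). ancestor \<omega> k m y = x \<and> z = new_point \<omega> (k + int m) y"
    using new_le_iff[OF _ assms] by blast
next
  assume "\<exists>m. \<exists>y\<in>X (k + int m). ancestor \<omega> k m y = x \<and> z = new_point \<omega> (k + int m) y"
  then show "z \<in> pre_cube \<omega> k x"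
    unfolding pre_cube_def using new_le_iff[OF _ assms] by blast
qed

lemma closed_cube_iff:
  "y \<in> closed_cube \<omega> k x \<longleftrightarrow> (\<forall>r>0. \<exists>z\<in>pre_cube \<omega> k x. d y z < r)"
  unfolding closed_cube_def by (rule in_closure_iff)

lemma pre_cube_subset: "pre_cube \<omega> k x \<subseteq> closed_cube \<omega> k x"
  unfolding closed_cube_iff subset_iff by (metis dist_self)

lemma closed_cube_closed:
  assumes "\<And>r. 0 < r \<Longrightarrow> \<exists>z\<in>closed_cube \<omega> k x. d y z < r"
  shows "y \<in> closed_cube \<omega> k x"
proof -
  have "y \<in> quasi_topology d closure_of (closed_cube \<omega> k x)"
    unfolding in_closure_iff using assms by blast
  then show ?thesis
    by (simp add: closed_cube_def)
qed

text \<open>Finite unions of closed sets are closed: if y missed every cube, the least of finitely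
  many positive distances would contradict the approximation. The 1 in the minimum covers an empty
  S.\<close>

lemma closed_cube_finite_union:
  assumes "finite S" "\<And>r. 0 < r \<Longrightarrow> \<exists>x\<in>S. \<exists>z\<in>closed_cube \<omega> k x. d y z < r"
  shows "\<exists>x\<in>S. y \<in> closed_cube \<omega> k x"
proof (rule ccontr)
  assume "\<not> ?thesis"
  then have "\<forall>x\<in>S. \<exists>r>0. \<forall>z\<in>closed_cube \<omega> k x. r \<le> d y z"
    using closed_cube_closed by (meson not_less)
  then obtain r where r: "\<And>x. x \<in> S \<Longrightarrow> 0 < r x" "\<And>x z. x \<in> S \<Longrightarrow> z \<in> closed_cube \<omega> k x \<Longrightarrow> r x \<le> d y z"
    by metis
  define R where "R = Min (insert 1 (r ` S))"
  have "0 < R" "\<And>x. x \<in> S \<Longrightarrow> R \<le> r x"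
    using assms(1) r by (auto simp: R_def)
  then show False
    using assms(2)[of R] r(2) by fastforce
qed

lemma new_point_ancestor_dist:
  assumes "y \<in> X (k + int m)"
  shows "d (ancestor \<omega> k m y) (new_point \<omega> (k + int m) y) \<le> 6 * A0 ^ 4 * sc k"
proof -
  have "d (ancestor \<omega> k m y) (new_point \<omega> (k + int m) y) \<le> A0 * (d (ancestor \<omega> k m y) y + d y (new_point \<omega> (k + int m) y))"
    by (rule quasi_triangle)
  also have "\<dots> \<le> A0 * (4 * A0 ^ 3 * sc k + 2 * A0 * sc k)"
  proof (intro mult_left_mono add_mono)
    show "d (ancestor \<omega> k m y) y \<le> 4 * A0 ^ 3 * sc k"
      using ancestor_dist[OF assms, of \<omega>] by (simp add: dist_sym)
    have "2 * A0 * sc (k + int m) \<le> 2 * A0 * sc k"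
      using A0_pos by (intro mult_left_mono sc_antimono) auto
    then show "d y (new_point \<omega> (k + int m) y) \<le> 2 * A0 * sc k"
      using new_point_dist[OF assms, of \<omega>] by simp
  qed (use A0_pos in auto)
  also have "\<dots> = (4 * A0 ^ 4 + 2 * A0 ^ 2) * sc k"
    by (simp add: algebra_simps power_numeral_reduce)
  also have "\<dots> \<le> (6 * A0 ^ 4) * sc k"
    using A0_pow_le[of 2 4] by (intro mult_right_mono) auto
  finally show ?thesis .
qed

lemma closed_cube_dist:
  assumes "x \<in> X k" "y \<in> closed_cube \<omega> k x"
  shows "d x y < 8 * A0 ^ 5 * sc k"
proof -
  obtain z where z: "z \<in> pre_cube \<omega> k x" "d y z < sc k"
    using assms(2) sc_pos unfolding closed_cube_iff by blast
  then have "d x z \<le> 6 * A0 ^ 4 * sc k"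
    using new_point_ancestor_dist pre_cube_iff[OF assms(1)] by metis
  also have "6 * A0 ^ 4 * sc k < 7 * A0 ^ 4 * sc k"
    using A0_pos by simp
  finally have "d x y < A0 * (7 * A0 ^ 4 * sc k + sc k)"
    using z by (intro quasi_triangle'[of _ z]) (auto simp: dist_sym)
  also have "\<dots> = (7 * A0 ^ 5 + A0 ^ 1) * sc k"
    by (simp add: algebra_simps power_numeral_reduce)
  also have "\<dots> \<le> (8 * A0 ^ 5) * sc k"
    using A0_pow_le[of 1 5] by (intro mult_right_mono) auto
  finally show ?thesis .
qed

text \<open>The generator at generation k itself need not belong to the pre-cube of a child. It is
  treated separately: it is a reference point of generation k + 1 whose new parent is x.\<close>

lemma pre_cube_child:
  assumes "x \<in> X k" "z \<in> pre_cube \<omega> k x"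
  obtains "z = new_point \<omega> k x"
  | \<sigma> where "\<sigma> \<in> X (k + 1)" "new_parent \<omega> k \<sigma> = x" "z \<in> pre_cube \<omega> (k + 1) \<sigma>"
proof -
  obtain m y where y: "y \<in> X (k + int m)" "ancestor \<omega> k m y = x" "z = new_point \<omega> (k + int m) y"
    using assms pre_cube_iff by blast
  show ?thesis
  proof (cases m)
    case 0
    then show ?thesis using y that(1) by simp
  next
    case (Suc n)
    have k: "k + int m = k + 1 + int n"
      using Suc by simp
    have \<sigma>: "ancestor \<omega> (k + 1) n y \<in> X (k + 1)"
      using y(1) by (intro ancestor_in) (simp add: k)
    have "new_parent \<omega> k (ancestor \<omega> (k + 1) n y) = x"
      using y(2) unfolding Suc ancestor_top .
    moreover have "z \<in> pre_cube \<omega> (k + 1) (ancestor \<omega> (k + 1) n y)"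
      using y unfolding pre_cube_iff[OF \<sigma>] k by blast
    ultimately show ?thesis
      using \<sigma> that(2) by blast
  qed
qed

text \<open>Cubes of generation k + 1 have size 8 A0^5 \<delta> relative to \<open>sc k\<close>, and
  8 A0^8 \<delta> < 1/100. So near any point of the closed cube there is a reference point of
  generation k + 1 with parent x, and questions about cubes reduce to the parent relation at one
  level.\<close>

lemma closed_cube_child_near:
  assumes "x \<in> X k" "y \<in> closed_cube \<omega> k x"
  obtains \<sigma> where "\<sigma> \<in> X (k + 1)" "new_parent \<omega> k \<sigma> = x" "d \<sigma> y < sc k / (100 * A0 ^ 3)"
proof -
  define s where "s = 8 * A0 ^ 5 * sc (k + 1)"
  have "A0 ^ 3 * s = (8 * (A0 ^ 8 * \<delta>)) * sc k"
    unfolding s_def sc_Suc by (simp add: algebra_simps power_numeral_reduce)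
  also have "\<dots> < (1 / 100) * sc k"
    using A0_delta[of 8] by (intro mult_strict_right_mono) auto
  finally have s: "s < sc k / (100 * A0 ^ 3)"
    using A0_pos by (simp add: field_simps)
  have s0: "0 < s" "0 < sc (k + 1)"
    using A0_pos by (auto simp: s_def)
  obtain z where z: "z \<in> pre_cube \<omega> k x" "d y z < sc (k + 1)"
    using assms(2) s0(2) unfolding closed_cube_iff by blast
  from assms(1) z(1) show ?thesis
  proof (cases rule: pre_cube_child)
    case 1
    have "sc (k + 1) \<le> s"
      unfolding s_def using one_le_power[OF A0_ge_1, of 5] by (intro sc_le_scale) auto
    then show ?thesis
      using z s 1 new_point_in[OF assms(1), of \<omega>] new_parent_new_point[OF assms(1), of \<omega>]
      by (intro that[of z]) (auto simp: dist_sym)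
  next
    case (2 \<sigma>)
    have "d \<sigma> z \<le> 6 * A0 ^ 4 * sc (k + 1)"
      using new_point_ancestor_dist 2(3) pre_cube_iff[OF 2(1)] by metis
    also have "\<dots> < 7 * A0 ^ 4 * sc (k + 1)"
      using A0_pos by simp
    finally have "d \<sigma> y < A0 * (7 * A0 ^ 4 * sc (k + 1) + sc (k + 1))"
      using z by (intro quasi_triangle'[of _ z]) (auto simp: dist_sym)
    also have "\<dots> = (7 * A0 ^ 5 + A0 ^ 1) * sc (k + 1)"
      by (simp add: algebra_simps power_numeral_reduce)
    also have "\<dots> \<le> s"
      unfolding s_def using A0_pow_le[of 1 5] by (intro mult_right_mono) auto
    finally show ?thesis
      using s 2 by (intro that[of \<sigma>]) auto
  qed
qed

lemma third_plus_le: "A0 * (sc k / (100 * A0 ^ 3) + sc k / (8 * A0 ^ 3)) < sc k / (4 * A0\<^sup>2)"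
proof -
  have "A0 * (sc k / (100 * A0 ^ 3) + sc k / (8 * A0 ^ 3)) = (1 / 100 + 1 / 8) * (sc k / A0\<^sup>2)"
    using A0_pos by (simp add: field_simps power_numeral_reduce)
  also have "\<dots> < (1 / 4) * (sc k / A0\<^sup>2)"
    using A0_pos by (intro mult_strict_right_mono) auto
  finally show ?thesis by simp
qed

lemma closed_cube_near_new_point:
  assumes "x \<in> X k" "x' \<in> X k" "y \<in> closed_cube \<omega> k x'" "d (new_point \<omega> k x) y < sc k / (8 * A0 ^ 3)"
  shows "x' = x"
proof -
  obtain \<sigma> where \<sigma>: "\<sigma> \<in> X (k + 1)" "new_parent \<omega> k \<sigma> = x'" "d \<sigma> y < sc k / (100 * A0 ^ 3)"
    using closed_cube_child_near[OF assms(2,3)] .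
  have "d \<sigma> (new_point \<omega> k x) < A0 * (sc k / (100 * A0 ^ 3) + sc k / (8 * A0 ^ 3))"
    using \<sigma> assms(4) by (intro quasi_triangle'[of _ y]) (auto simp: dist_sym)
  with third_plus_le[of k] have "new_parent \<omega> k \<sigma> = x"
    using \<sigma>(1) assms(1) by (intro new_parent_eqI) auto
  with \<sigma> show ?thesis by simp
qed

text \<open>This holds for every \<omega>, even when the new point of x has moved away. A nearby
  child \<sigma> of x' is either captured by the new point of x', which is then so close to x that
  separation or the reference parent rule forces x' = x; or \<sigma> keeps its reference parent,
  which by closeness is x.\<close>

lemma closed_cube_near_reference_point:
  assumes "x \<in> X k" "x' \<in> X k" "y \<in> closed_cube \<omega> k x'" "d x y < sc k / (8 * A0 ^ 3)"
  shows "x' = x"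
proof -
  obtain \<sigma> where \<sigma>: "\<sigma> \<in> X (k + 1)" "new_parent \<omega> k \<sigma> = x'" "d \<sigma> y < sc k / (100 * A0 ^ 3)"
    using closed_cube_child_near[OF assms(2,3)] .
  have "d \<sigma> x < A0 * (sc k / (100 * A0 ^ 3) + sc k / (8 * A0 ^ 3))"
    using \<sigma> assms(4) by (intro quasi_triangle'[of _ y]) (auto simp: dist_sym)
  with third_plus_le[of k] have \<sigma>x: "d \<sigma> x < sc k / (4 * A0\<^sup>2)" by simp
  have half: "sc k / (4 * A0\<^sup>2) \<le> sc k / (2 * A0)"
  proof -
    have "2 * A0 \<le> 4 * A0\<^sup>2"
      using A0_pow_le[of 1 2] A0_pos by simp
    then show ?thesis
      using A0_pos by (intro divide_left_mono) auto
  qed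
  show ?thesis
  proof (cases "d \<sigma> (new_point \<omega> k x') < sc k / (4 * A0\<^sup>2)")
    case True
    have "d (new_point \<omega> k x') x < A0 * (sc k / (4 * A0\<^sup>2) + sc k / (4 * A0\<^sup>2))"
      using True \<sigma>x by (intro quasi_triangle'[of _ \<sigma>]) (auto simp: dist_sym)
    also have "\<dots> = sc k / (2 * A0)"
      using A0_pos by (simp add: power2_eq_square field_simps)
    finally have n: "d (new_point \<omega> k x') x < sc k / (2 * A0)" .
    show ?thesis
      using new_point_cases[OF assms(2), of \<omega>]
    proof
      assume "new_point \<omega> k x' = x'"
      then show ?thesis
        using n X_sep[OF assms(2,1)] half_le[of k] by fastforce
    next
      assume "new_point \<omega> k x' \<in> children k x' \<and> label1 k x' = fst (\<omega> k)"
      then show ?thesis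
        using parent_near[OF _ assms(1) n] childrenD[of "new_point \<omega> k x'" k x'] by simp
    qed
  next
    case False
    then have "parent k \<sigma> = x'"
      using \<sigma> new_parent_iff[OF \<sigma>(1), of \<omega> x'] by (simp add: new_child_iff)
    moreover have "parent k \<sigma> = x"
      using \<sigma>(1) assms(1) \<sigma>x half by (intro parent_near) auto
    ultimately show ?thesis by simp
  qed
qed

lemma closed_cube_new_parent:
  assumes "y \<in> X (k + 1)"
  shows "closed_cube \<omega> (k + 1) y \<subseteq> closed_cube \<omega> k (new_parent \<omega> k y)"
proof -
  have "pre_cube \<omega> (k + 1) y \<subseteq> pre_cube \<omega> k (new_parent \<omega> k y)"
  proof
    fix z assume "z \<in> pre_cube \<omega> (k + 1) y"
    then obtain m w where w: "w \<in> X (k + 1 + int m)" "ancestor \<omega> (k + 1) m w = y" "z = new_point \<omega> (k + 1 + int m) w"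
      using pre_cube_iff[OF assms] by blast
    have "k + 1 + int m = k + int (Suc m)" by simp
    then show "z \<in> pre_cube \<omega> k (new_parent \<omega> k y)"
      unfolding pre_cube_iff[OF new_parent_in[OF assms]] using w ancestor_top[of \<omega> k m w] by metis
  qed
  then show ?thesis
    unfolding closed_cube_def by (rule closure_of_mono)
qed

lemma sc_small:
  assumes "0 < r"
  obtains m where "c * sc (k + int m) < r"
proof -
  have "(\<lambda>m. c * (\<delta> ^ m * sc k)) \<longlonglongrightarrow> c * (0 * sc k)"
    using delta_bounds by (intro tendsto_intros LIMSEQ_realpow_zero) auto
  then have "\<forall>\<^sub>F m in sequentially. c * (\<delta> ^ m * sc k) < r"
    using assms by (intro order_tendstoD) auto
  then show ?thesis
    using that unfolding sc_add by (auto simp: eventually_sequentially)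
qed

text \<open>New points of ever finer generations approximate y, and their ancestors at generation k
  stay within a bounded distance of y. Only finitely many ancestors are possible, so one closed cube
  contains y.\<close>

lemma closed_cube_cover: "\<exists>x\<in>X k. y \<in> closed_cube \<omega> k x"
proof -
  let ?S = "{x \<in> X k. d y x < 7 * A0 ^ 4 * sc k}"
  have "\<exists>x\<in>?S. y \<in> closed_cube \<omega> k x"
  proof (rule closed_cube_finite_union[OF X_finite_near])
    fix r :: real assume "0 < r"
    then obtain m where m: "4 * A0\<^sup>2 * sc (k + int m) < r"
      using sc_small by blast
    obtain w where w: "w \<in> X (k + int m)" "d y w < 2 * A0 * sc (k + int m)"
      using X_cover by blast
    have "d y (new_point \<omega> (k + int m) w) < A0 * (2 * A0 * sc (k + int m) + 2 * A0 * sc (k + int m))"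
      by (rule quasi_triangle'[OF w(2) new_point_dist[OF w(1)]])
    also have "\<dots> < r"
      using m by (simp add: power2_eq_square algebra_simps)
    finally have 1: "d y (new_point \<omega> (k + int m) w) < r" .
    let ?x = "ancestor \<omega> k m w"
    have x: "?x \<in> X k" by (rule ancestor_in[OF w(1)])
    have "2 * A0 * sc (k + int m) \<le> 2 * A0 * sc k"
      using A0_pos by (intro mult_left_mono sc_antimono) auto
    with w(2) have yw: "d y w < 2 * A0 * sc k"
      by (rule order_less_le_trans)
    have "d w ?x \<le> 4 * A0 ^ 3 * sc k"
      by (rule ancestor_dist[OF w(1)])
    also have "\<dots> < 5 * A0 ^ 3 * sc k"
      using A0_pos by simp
    finally have wx: "d w ?x < 5 * A0 ^ 3 * sc k" .
    from yw wx have "d y ?x < A0 * (2 * A0 * sc k + 5 * A0 ^ 3 * sc k)"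
      by (rule quasi_triangle')
    also have "\<dots> = (2 * A0 ^ 2 + 5 * A0 ^ 4) * sc k"
      by (simp add: algebra_simps power_numeral_reduce)
    also have "\<dots> \<le> (7 * A0 ^ 4) * sc k"
      using A0_pow_le[of 2 4] by (intro mult_right_mono) auto
    finally have "?x \<in> ?S" using x by simp
    moreover have "new_point \<omega> (k + int m) w \<in> closed_cube \<omega> k ?x"
      using pre_cube_subset pre_cube_iff[OF x] w(1) by blast
    ultimately show "\<exists>x\<in>?S. \<exists>z\<in>closed_cube \<omega> k x. d y z < r"
      using 1 by blast
  qed
  then show ?thesis by blast
qed

lemma reference_point_in_closed_cube: "x \<in> X k \<Longrightarrow> x \<in> closed_cube \<omega> k x"
  using closed_cube_cover[of k x \<omega>] closed_cube_near_reference_point[of x k _ x \<omega>] A0_pos by force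

lemma closed_cube_refine:
  assumes x: "x \<in> X k" and y: "y \<in> closed_cube \<omega> k x"
  shows "\<exists>\<sigma>\<in>X (k + 1). new_parent \<omega> k \<sigma> = x \<and> y \<in> closed_cube \<omega> (k + 1) \<sigma>"
proof -
  let ?S = "{\<sigma> \<in> X (k + 1). d y \<sigma> < A0 * (1 + 8 * A0 ^ 5 * sc (k + 1))} \<inter> {\<sigma>. new_parent \<omega> k \<sigma> = x}"
  have "\<exists>\<sigma>\<in>?S. y \<in> closed_cube \<omega> (k + 1) \<sigma>"
  proof (rule closed_cube_finite_union)
    fix r :: real assume "0 < r"
    then obtain z where z: "z \<in> pre_cube \<omega> k x" "d y z < min r 1"
      using y unfolding closed_cube_iff by (meson less_numeral_extra(1) min_less_iff_conj)
    have "\<exists>\<sigma>\<in>X (k + 1). new_parent \<omega> k \<sigma> = x \<and> z \<in> closed_cube \<omega> (k + 1) \<sigma>"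
      using x z(1)
    proof (cases rule: pre_cube_child)
      case 1
      then show ?thesis
        using new_point_in[OF x, of \<omega>] new_parent_new_point[OF x, of \<omega>] reference_point_in_closed_cube by blast
    next
      case 2
      then show ?thesis
        using pre_cube_subset by blast
    qed
    then obtain \<sigma> where \<sigma>: "\<sigma> \<in> X (k + 1)" "new_parent \<omega> k \<sigma> = x" "z \<in> closed_cube \<omega> (k + 1) \<sigma>" by blast
    have "d y \<sigma> < A0 * (1 + 8 * A0 ^ 5 * sc (k + 1))"
      using z closed_cube_dist[OF \<sigma>(1,3)] by (intro quasi_triangle'[of _ z]) (auto simp: dist_sym)
    then show "\<exists>\<sigma>\<in>?S. \<exists>z\<in>closed_cube \<omega> (k + 1) \<sigma>. d y z < r"
      using \<sigma> z by auto
  qed (use X_finite_near in auto)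
  then show ?thesis by blast
qed

lemma closed_cube_refine_add:
  assumes "x \<in> X k" "y \<in> closed_cube \<omega> k x"
  shows "\<exists>w\<in>X (k + int m). ancestor \<omega> k m w = x \<and> y \<in> closed_cube \<omega> (k + int m) w"
proof (induction m)
  case 0
  then show ?case using assms by simp
next
  case (Suc m)
  then obtain w where w: "w \<in> X (k + int m)" "ancestor \<omega> k m w = x" "y \<in> closed_cube \<omega> (k + int m) w" by blast
  then obtain v where v: "v \<in> X (k + int m + 1)" "new_parent \<omega> (k + int m) v = w" "y \<in> closed_cube \<omega> (k + int m + 1) v"
    using closed_cube_refine[of w "k + int m" y \<omega>] by blast
  then show ?case
    using w unfolding k_Suc by (intro bexI[of _ v]) auto
qed

text \<open>A generator z is a new point of some generation k + m. Refining the other closed cube to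
  that same generation reduces the claim to the neighbourhood of a new point, which meets only its
  own cube.\<close>

lemma pre_cube_closed_cube_disjoint:
  assumes "x \<in> X k" "x' \<in> X k" "z \<in> pre_cube \<omega> k x'" "z \<in> closed_cube \<omega> k x"
  shows "x = x'"
proof -
  obtain m y where y: "y \<in> X (k + int m)" "ancestor \<omega> k m y = x'" "z = new_point \<omega> (k + int m) y"
    using assms(3) pre_cube_iff[OF assms(2)] by blast
  obtain w where w: "w \<in> X (k + int m)" "ancestor \<omega> k m w = x" "z \<in> closed_cube \<omega> (k + int m) w"
    using closed_cube_refine_add[OF assms(1,4)] by blast
  have "w = y"
    by (rule closed_cube_near_new_point[OF y(1) w(1,3)]) (use y A0_pos in auto)
  then show ?thesis using w y by simp
qed

lemma closed_cube_overlap: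
  assumes "x \<in> X k" "x' \<in> X k" "x \<noteq> x'" "y \<in> closed_cube \<omega> k x" "y \<in> closed_cube \<omega> k x'"
  shows "y \<notin> open_cube \<omega> k x"
proof
  assume "y \<in> open_cube \<omega> k x"
  then obtain U where U: "openin (quasi_topology d) U" "y \<in> U" "U \<subseteq> closed_cube \<omega> k x"
    unfolding open_cube_def interior_of_def by blast
  then obtain r where r: "0 < r" "quasi_ball d y r \<subseteq> U"
    unfolding openin_quasi_topology by blast
  then obtain z where z: "z \<in> pre_cube \<omega> k x'" "d y z < r"
    using assms(5) unfolding closed_cube_iff by blast
  then have "z \<in> closed_cube \<omega> k x"
    using r U by auto
  then show False
    using pre_cube_closed_cube_disjoint[OF assms(1,2) z(1)] assms(3) by blast
qed

lemma boundary_layer_overlap: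
  assumes "x \<in> X k" "x' \<in> X k" "x \<noteq> x'" "y \<in> closed_cube \<omega> k x" "y \<in> closed_cube \<omega> k x'" "0 < \<epsilon>"
  shows "y \<in> boundary_layer \<epsilon> \<omega> k x"
proof -
  have "dist_to_set d y (- open_cube \<omega> k x) \<le> ereal (d y y)"
    unfolding dist_to_set_def by (rule INF_lower) (use closed_cube_overlap[OF assms(1-5)] in simp)
  also have "\<dots> < ereal (\<epsilon> * sc k)"
    using assms(6) by simp
  finally show ?thesis
    using assms(4) by (simp add: boundary_layer_def)
qed

text \<open>The source of Hoelder regularity: if two nearby points are separated by a cube, one of
  them lies in a boundary layer whose width is governed by their distance.\<close>

lemma boundary_layer_crossing:
  assumes "y \<in> closed_cube \<omega> k x" "y' \<notin> closed_cube \<omega> k x" "d y y' < \<epsilon> * sc k"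
  shows "y \<in> boundary_layer \<epsilon> \<omega> k x"
proof -
  have "y' \<notin> open_cube \<omega> k x"
    using assms(2) interior_of_subset[of "quasi_topology d" "closed_cube \<omega> k x"]
    unfolding open_cube_def by auto
  then have "dist_to_set d y (- open_cube \<omega> k x) \<le> ereal (d y y')"
    unfolding dist_to_set_def by (intro INF_lower) simp
  also have "\<dots> < ereal (\<epsilon> * sc k)"
    using assms(3) by simp
  finally show ?thesis
    using assms(1) by (simp add: boundary_layer_def)
qed

end

subsection \<open>Splines as probabilities of cubes\<close>

context labelled_dyadic_system
begin

abbreviation coin :: "(nat \<times> nat) measure" where
  "coin \<equiv> uniform_count_measure ({0..max_neighbours} \<times> {1..max_children})"

lemma max_children_pos: "1 \<le> max_children"
proof -
  obtain x where "x \<in> X 0" using X_nonempty[of 0] by blast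
  then show ?thesis using label2_range[of x 0] by auto
qed

lemma prob_space_coin: "prob_space coin"
  using max_children_pos by (intro prob_space_uniform_count_measure) auto

lemma prob_space_P: "prob_space P\<^sub>\<omega>"
  unfolding P\<^sub>\<omega>_def by (intro prob_space_PiM prob_space_coin)

lemma coin_count: "f \<in> measurable coin (count_space UNIV)"
  by (auto simp: measurable_def sets_uniform_count_measure space_uniform_count_measure)

section \<open>Dependence on coordinates and measurability of cube events\<close>

lemma coordinate_measurable: "(\<lambda>\<omega>. \<omega> j) \<in> measurable P\<^sub>\<omega> (count_space UNIV)"
proof -
  have "(\<lambda>\<omega>. \<omega> j) \<in> measurable P\<^sub>\<omega> coin"
    unfolding P\<^sub>\<omega>_def by (rule measurable_component_singleton) simp
  from measurable_compose[OF this coin_count[of "\<lambda>x. x"]] show ?thesis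
    by simp
qed

lemma new_point_cong: "\<omega> k = \<omega>' k \<Longrightarrow> new_point \<omega> k x = new_point \<omega>' k x"
  by (simp only: new_point_def)

lemma new_parent_cong: "\<omega> k = \<omega>' k \<Longrightarrow> new_parent \<omega> k y = new_parent \<omega>' k y"
  by (simp add: new_parent_def new_child_def new_point_cong[of \<omega> k \<omega>'])

lemma ancestor_cong: "(\<And>j. k \<le> j \<Longrightarrow> \<omega> j = \<omega>' j) \<Longrightarrow> ancestor \<omega> k m y = ancestor \<omega>' k m y"
proof (induction m arbitrary: y)
  case (Suc m)
  have "new_parent \<omega> (k + int m) y = new_parent \<omega>' (k + int m) y"
    by (rule new_parent_cong) (simp add: Suc.prems)
  then show ?case using Suc.IH[OF Suc.prems] by simp
qed simp

lemma closed_cube_cong: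
  assumes "\<And>j. k \<le> j \<Longrightarrow> \<omega> j = \<omega>' j" "x \<in> X k"
  shows "closed_cube \<omega> k x = closed_cube \<omega>' k x"
proof -
  have "new_point \<omega> (k + int m) y = new_point \<omega>' (k + int m) y" for m y
    by (rule new_point_cong) (simp add: assms(1))
  then have "z \<in> pre_cube \<omega> k x \<longleftrightarrow> z \<in> pre_cube \<omega>' k x" for z
    unfolding pre_cube_iff[OF assms(2)] using ancestor_cong[of k \<omega> \<omega>', OF assms(1)] by simp
  then have "pre_cube \<omega> k x = pre_cube \<omega>' k x"
    by blast
  then show ?thesis
    by (simp add: closed_cube_def)
qed

lemma coordinate_event:
  assumes "W \<in> measurable M (count_space UNIV)" "\<And>m. Q m \<longleftrightarrow> R (W m)"
  shows "{m \<in> space M. Q m} \<in> sets M"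
proof -
  have "{m \<in> space M. Q m} = W -` {u. R u} \<inter> space M"
    using assms(2) by auto
  then show ?thesis
    using measurable_sets[OF assms(1), of "{u. R u}"] by simp
qed

text \<open>The family \<open>Z\<close> of coordinates lives on an arbitrary measurable space
  because the events are needed twice: on the full space of \<omega> and on partial products in the
  independence argument.\<close>

lemma new_parent_event:
  assumes "(\<lambda>m. Z m j) \<in> measurable M (count_space UNIV)"
  shows "{m \<in> space M. new_parent (Z m) j w = v} \<in> sets M"
  by (rule coordinate_event[OF assms, where R = "\<lambda>u. new_parent (\<lambda>_. u) j w = v"])
    (metis new_parent_cong)

lemma new_point_event:
  assumes "(\<lambda>m. Z m j) \<in> measurable M (count_space UNIV)"
  shows "{m \<in> space M. d y (new_point (Z m) j w) < r} \<in> sets M"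
  by (rule coordinate_event[OF assms, where R = "\<lambda>u. d y (new_point (\<lambda>_. u) j w) < r"])
    (metis new_point_cong)

lemma ancestor_event:
  assumes "\<And>j. k \<le> j \<Longrightarrow> (\<lambda>m. Z m j) \<in> measurable M (count_space UNIV)" "w \<in> X (k + int n)"
  shows "{m \<in> space M. ancestor (Z m) k n w = x} \<in> sets M"
  using assms(2)
proof (induction n arbitrary: w)
  case 0
  then show ?case by simp
next
  case (Suc n)
  have w: "w \<in> X (k + int n + 1)"
    using Suc.prems by (simp add: algebra_simps)
  have "{m \<in> space M. ancestor (Z m) k (Suc n) w = x}
      = (\<Union>v\<in>X (k + int n). {m \<in> space M. new_parent (Z m) (k + int n) w = v} \<inter> {m \<in> space M. ancestor (Z m) k n v = x})"
    using new_parent_in[OF w] by auto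
  also have "\<dots> \<in> sets M"
    by (intro sets.countable_UN'' X_countable sets.Int Suc.IH new_parent_event assms(1)) simp_all
  finally show ?case .
qed

text \<open>The closure condition becomes countable by testing the radii 1 / (i + 1) only;
  generations and reference points are countable as well.\<close>

lemma closed_cube_event:
  assumes "\<And>j. k \<le> j \<Longrightarrow> (\<lambda>m. Z m j) \<in> measurable M (count_space UNIV)" "x \<in> X k"
  shows "{m \<in> space M. y \<in> closed_cube (Z m) k x} \<in> sets M"
proof -
  have *: "y \<in> closed_cube \<omega> k x \<longleftrightarrow>
    (\<forall>i::nat. \<exists>n. \<exists>w\<in>X (k + int n). ancestor \<omega> k n w = x \<and> d y (new_point \<omega> (k + int n) w) < inverse (real (Suc i)))" for \<omega>
  proof
    assume "y \<in> closed_cube \<omega> k x"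
    then have "\<exists>z\<in>pre_cube \<omega> k x. d y z < inverse (real (Suc i))" for i
      unfolding closed_cube_iff by simp
    then show "\<forall>i::nat. \<exists>n. \<exists>w\<in>X (k + int n). ancestor \<omega> k n w = x \<and> d y (new_point \<omega> (k + int n) w) < inverse (real (Suc i))"
      using pre_cube_iff[OF assms(2), of _ \<omega>] by metis
  next
    assume r: "\<forall>i::nat. \<exists>n. \<exists>w\<in>X (k + int n). ancestor \<omega> k n w = x \<and> d y (new_point \<omega> (k + int n) w) < inverse (real (Suc i))"
    show "y \<in> closed_cube \<omega> k x"
      unfolding closed_cube_iff
    proof (intro allI impI)
      fix r :: real assume "0 < r"
      then obtain i where i: "inverse (real (Suc i)) < r"
        using reals_Archimedean by blast
      obtain n w where "w \<in> X (k + int n)" "ancestor \<omega> k n w = x" "d y (new_point \<omega> (k + int n) w) < inverse (real (Suc i))"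
        using r by blast
      then show "\<exists>z\<in>pre_cube \<omega> k x. d y z < r"
        using i pre_cube_iff[OF assms(2), of _ \<omega>] by (metis order_less_trans)
    qed
  qed
  have "{m \<in> space M. y \<in> closed_cube (Z m) k x} =
    {m \<in> space M. \<forall>i::nat. \<exists>n. \<exists>w\<in>X (k + int n). ancestor (Z m) k n w = x \<and> d y (new_point (Z m) (k + int n) w) < inverse (real (Suc i))}"
    unfolding * ..
  also have "\<dots> \<in> sets M"
  proof (rule sets.sets_Collect_countable_All)
    fix i :: nat
    have "{m \<in> space M. \<exists>n. \<exists>w\<in>X (k + int n). ancestor (Z m) k n w = x \<and> d y (new_point (Z m) (k + int n) w) < inverse (real (Suc i))}
      = (\<Union>n. \<Union>w\<in>X (k + int n). {m \<in> space M. ancestor (Z m) k n w = x}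
        \<inter> {m \<in> space M. d y (new_point (Z m) (k + int n) w) < inverse (real (Suc i))})"
      by auto
    also have "\<dots> \<in> sets M"
      by (intro sets.countable_UN'' X_countable sets.Int ancestor_event new_point_event assms(1)) simp_all
    finally show "{m \<in> space M. \<exists>n. \<exists>w\<in>X (k + int n). ancestor (Z m) k n w = x \<and> d y (new_point (Z m) (k + int n) w) < inverse (real (Suc i))} \<in> sets M" .
  qed
  finally show ?thesis .
qed

definition cube_event :: "int \<Rightarrow> 'a \<Rightarrow> 'a \<Rightarrow> (int \<Rightarrow> nat \<times> nat) set" where
  "cube_event k x y = {\<omega> \<in> space P\<^sub>\<omega>. y \<in> closed_cube \<omega> k x}"

lemma cube_event_sets [measurable]: "x \<in> X k \<Longrightarrow> cube_event k x y \<in> sets P\<^sub>\<omega>"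
  unfolding cube_event_def by (intro closed_cube_event coordinate_measurable)

definition child_event :: "int \<Rightarrow> 'a \<Rightarrow> 'a \<Rightarrow> (int \<Rightarrow> nat \<times> nat) set" where
  "child_event k x \<sigma> = {\<omega> \<in> space P\<^sub>\<omega>. new_parent \<omega> k \<sigma> = x}"

lemma child_event_sets [measurable]: "child_event k x \<sigma> \<in> sets P\<^sub>\<omega>"
  unfolding child_event_def by (intro new_parent_event coordinate_measurable)

lemma event_Int_space [simp]: "cube_event k x y \<inter> space P\<^sub>\<omega> = cube_event k x y"
  "child_event k x \<sigma> \<inter> space P\<^sub>\<omega> = child_event k x \<sigma>"
  by (auto simp: cube_event_def child_event_def)

definition spline :: "int \<Rightarrow> 'a \<Rightarrow> 'a \<Rightarrow> real" where
  "spline k x y = measure P\<^sub>\<omega> (cube_event k x y)"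

definition refinement :: "int \<Rightarrow> 'a \<Rightarrow> 'a \<Rightarrow> real" where
  "refinement k x \<sigma> = measure P\<^sub>\<omega> (child_event k x \<sigma>)"

sublocale P: prob_space "P\<^sub>\<omega>"
  by (rule prob_space_P)

lemma spline_nonneg [simp]: "0 \<le> spline k x y" and spline_le_1: "spline k x y \<le> 1"
  by (auto simp: spline_def)

lemma spline_support: "x \<in> X k \<Longrightarrow> spline k x y \<noteq> 0 \<Longrightarrow> d x y < 8 * A0 ^ 5 * sc k"
proof (rule ccontr)
  assume x: "x \<in> X k" "spline k x y \<noteq> 0" "\<not> d x y < 8 * A0 ^ 5 * sc k"
  then have "cube_event k x y = {}"
    unfolding cube_event_def using closed_cube_dist by blast
  then show False using x by (simp add: spline_def)
qed

lemma spline_near_reference_point: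
  assumes "x \<in> X k" "x' \<in> X k" "d x' y < sc k / (8 * A0 ^ 3)"
  shows "spline k x y = (if x = x' then 1 else 0)"
proof -
  have n: "y \<in> closed_cube \<omega> k u \<Longrightarrow> u = x'" if "u \<in> X k" for \<omega> u
    using closed_cube_near_reference_point[OF assms(2) that _ assms(3)] by simp
  then have "y \<in> closed_cube \<omega> k x'" for \<omega>
    using closed_cube_cover[of k y \<omega>] by blast
  then have "cube_event k x' y = space P\<^sub>\<omega>"
    unfolding cube_event_def by blast
  moreover have "cube_event k x y = {}" if "x \<noteq> x'"
    unfolding cube_event_def using n[OF assms(1)] that by blast
  ultimately have "cube_event k x y = (if x = x' then space P\<^sub>\<omega> else {})"
    by simp
  then show ?thesis
    by (auto simp: spline_def P.prob_space)
qed

text \<open>The parent of \<sigma> depends on the coordinate k alone, the cube of \<sigma> on the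
  coordinates from k + 1 on. Restriction to disjoint sets of coordinates gives independent
  variables, and the product formula becomes the two-scale relation.\<close>

lemma independent_events:
  assumes "\<sigma> \<in> X (k + 1)"
  shows "measure P\<^sub>\<omega> (child_event k x \<sigma> \<inter> cube_event (k + 1) \<sigma> y) = refinement k x \<sigma> * spline (k + 1) \<sigma> y"
proof -
  let ?M = "\<lambda>_::int. coin"
  have ind: "P.indep_vars ?M (\<lambda>i \<omega>. \<omega> i) UNIV"
  proof (subst P.indep_vars_iff_distr_eq_PiM)
    show "(\<lambda>\<omega>. \<omega> i) \<in> measurable P\<^sub>\<omega> coin" for i
      unfolding P\<^sub>\<omega>_def by (rule measurable_component_singleton) simp
    have "distr P\<^sub>\<omega> (PiM UNIV ?M) (\<lambda>x. \<lambda>i\<in>UNIV. x i) = distr P\<^sub>\<omega> P\<^sub>\<omega> (\<lambda>x. x)"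
      unfolding P\<^sub>\<omega>_def by (rule distr_cong) auto
    also have "\<dots> = P\<^sub>\<omega>"
      by (rule distr_id)
    also have "\<dots> = PiM UNIV (\<lambda>i. distr P\<^sub>\<omega> coin (\<lambda>\<omega>. \<omega> i))"
    proof -
      have "distr P\<^sub>\<omega> coin (\<lambda>\<omega>. \<omega> i) = coin" for i
        unfolding P\<^sub>\<omega>_def by (rule distr_PiM_component[OF prob_space_coin]) simp
      then show ?thesis
        by (simp add: P\<^sub>\<omega>_def)
    qed
    finally show "distr P\<^sub>\<omega> (PiM UNIV ?M) (\<lambda>x. \<lambda>i\<in>UNIV. x i) = PiM UNIV (\<lambda>i. distr P\<^sub>\<omega> coin (\<lambda>\<omega>. \<omega> i))" .
  qed simp
  define A where "A = {k}"
  define B where "B = {k + 1..}"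
  define EA where "EA = {u \<in> space (PiM A ?M). new_parent u k \<sigma> = x}"
  define EB where "EB = {u \<in> space (PiM B ?M). y \<in> closed_cube u (k + 1) \<sigma>}"
  have cm: "(\<lambda>u. u j) \<in> measurable (PiM S ?M) (count_space UNIV)" if "j \<in> S" for j S
    using measurable_compose[OF measurable_component_singleton[OF that, of ?M] coin_count[of "\<lambda>x. x"]]
    by simp
  have "EA \<in> sets (PiM A ?M)"
    unfolding EA_def by (intro new_parent_event cm) (simp add: A_def)
  moreover have "EB \<in> sets (PiM B ?M)"
    unfolding EB_def by (intro closed_cube_event cm assms) (simp add: B_def)
  ultimately have *: "P.prob ((\<lambda>\<omega>. (restrict \<omega> A, restrict \<omega> B)) -` (EA \<times> EB) \<inter> space P\<^sub>\<omega>)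
      = P.prob ((\<lambda>\<omega>. restrict \<omega> A) -` EA \<inter> space P\<^sub>\<omega>) * P.prob ((\<lambda>\<omega>. restrict \<omega> B) -` EB \<inter> space P\<^sub>\<omega>)"
    using P.indep_var_restrict[OF ind, of A B] by (intro P.indep_varD) (auto simp: A_def B_def)
  have sp: "restrict \<omega> S \<in> space (PiM S ?M)" if "\<omega> \<in> space P\<^sub>\<omega>" for \<omega> S
    using that by (auto simp: P\<^sub>\<omega>_def space_PiM PiE_def Pi_def)
  have nA: "new_parent (restrict \<omega> A) k \<sigma> = new_parent \<omega> k \<sigma>" for \<omega>
    by (rule new_parent_cong) (simp add: A_def)
  have cB: "closed_cube (restrict \<omega> B) (k + 1) \<sigma> = closed_cube \<omega> (k + 1) \<sigma>" for \<omega>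
    by (rule closed_cube_cong[OF _ assms]) (simp add: B_def)
  have 1: "(\<lambda>\<omega>. restrict \<omega> A) -` EA \<inter> space P\<^sub>\<omega> = child_event k x \<sigma>"
    using sp by (auto simp: EA_def child_event_def nA)
  have 2: "(\<lambda>\<omega>. restrict \<omega> B) -` EB \<inter> space P\<^sub>\<omega> = cube_event (k + 1) \<sigma> y"
    using sp by (auto simp: EB_def cube_event_def cB)
  have 3: "(\<lambda>\<omega>. (restrict \<omega> A, restrict \<omega> B)) -` (EA \<times> EB) \<inter> space P\<^sub>\<omega> = child_event k x \<sigma> \<inter> cube_event (k + 1) \<sigma> y"
    using 1 2 by blast
  show ?thesis
    using * unfolding 1 2 3 by (simp add: refinement_def spline_def)
qed

lemma refinement_nonneg [simp]: "0 \<le> refinement k x \<sigma>"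
  by (simp add: refinement_def)

lemma refinement_support:
  assumes "\<sigma> \<in> X (k + 1)" "refinement k x \<sigma> \<noteq> 0"
  shows "d x \<sigma> < 3 * A0 ^ 2 * sc k"
proof (rule ccontr)
  assume "\<not> d x \<sigma> < 3 * A0 ^ 2 * sc k"
  then have "child_event k x \<sigma> = {}"
    using new_parent_dist[OF assms(1)] by (auto simp: child_event_def dist_sym)
  then show False
    using assms(2) by (simp add: refinement_def)
qed

end

section \<open>Consequences of the boundary estimate for the splines\<close>

locale regular_dyadic_system = labelled_dyadic_system +
  fixes \<eta> :: real
  assumes boundary_exponent: "boundary_exponent \<eta>"
begin

lemma eta: "0 < \<eta>" "\<eta> \<le> 1"
  using boundary_exponent by (auto simp: boundary_exponent_def)

text \<open>The boundary event itself need not be measurable. Monotonicity of the outer measure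
  transfers the estimate to every measurable event contained in it.\<close>

lemma boundary_bound:
  obtains C where "0 < C" "\<And>E x k \<epsilon>. E \<in> sets P\<^sub>\<omega> \<Longrightarrow> 0 < \<epsilon> \<Longrightarrow>
    (\<And>\<omega>. \<omega> \<in> E \<Longrightarrow> \<exists>x'\<in>X k. x \<in> boundary_layer \<epsilon> \<omega> k x') \<Longrightarrow> measure P\<^sub>\<omega> E \<le> C * \<epsilon> powr \<eta>"
proof -
  obtain C :: real where C: "\<And>x k \<epsilon>. \<epsilon> > 0 \<Longrightarrow>
        outer_measure_of P\<^sub>\<omega> {\<omega> \<in> space P\<^sub>\<omega>. x \<in> (\<Union>x'\<in>X k. boundary_layer \<epsilon> \<omega> k x')}
          \<le> ennreal (C * \<epsilon> powr \<eta>)"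
    using boundary_exponent unfolding boundary_exponent_def by blast
  have "measure P\<^sub>\<omega> E \<le> max 1 C * \<epsilon> powr \<eta>"
    if E: "E \<in> sets P\<^sub>\<omega>" "0 < \<epsilon>" "\<And>\<omega>. \<omega> \<in> E \<Longrightarrow> \<exists>x'\<in>X k. x \<in> boundary_layer \<epsilon> \<omega> k x'" for E x k \<epsilon>
  proof -
    have "ennreal (measure P\<^sub>\<omega> E) = outer_measure_of P\<^sub>\<omega> E"
      using E(1) by (simp add: P.emeasure_eq_measure)
    also have "\<dots> \<le> outer_measure_of P\<^sub>\<omega> {\<omega> \<in> space P\<^sub>\<omega>. x \<in> (\<Union>x'\<in>X k. boundary_layer \<epsilon> \<omega> k x')}"
      using E sets.sets_into_space[OF E(1)] by (intro outer_measure_of_mono) blast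
    also have "\<dots> \<le> ennreal (C * \<epsilon> powr \<eta>)"
      by (rule C[OF E(2)])
    also have "\<dots> \<le> ennreal (max 1 C * \<epsilon> powr \<eta>)"
      by (intro ennreal_leI mult_right_mono) auto
    finally show ?thesis
      by (subst (asm) ennreal_le_iff) auto
  qed
  then show ?thesis
    by (intro that[of "max 1 C"]) auto
qed

lemma overlap_null:
  assumes "x \<in> X k" "x' \<in> X k" "x \<noteq> x'"
  shows "AE \<omega> in P\<^sub>\<omega>. \<not> (y \<in> closed_cube \<omega> k x \<and> y \<in> closed_cube \<omega> k x')"
proof -
  obtain C where C: "0 < C" "\<And>E x k \<epsilon>. E \<in> sets P\<^sub>\<omega> \<Longrightarrow> 0 < \<epsilon> \<Longrightarrow>
    (\<And>\<omega>. \<omega> \<in> E \<Longrightarrow> \<exists>x'\<in>X k. x \<in> boundary_layer \<epsilon> \<omega> k x') \<Longrightarrow> measure P\<^sub>\<omega> E \<le> C * \<epsilon> powr \<eta>"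
    using boundary_bound by blast
  define E where "E = cube_event k x y \<inter> cube_event k x' y"
  have E: "E \<in> sets P\<^sub>\<omega>"
    using assms by (simp add: E_def)
  have "measure P\<^sub>\<omega> E = 0"
  proof (rule ccontr)
    assume "measure P\<^sub>\<omega> E \<noteq> 0"
    then have p: "0 < measure P\<^sub>\<omega> E"
      using zero_less_measure_iff by blast
    \<comment> \<open>An overlap lies in boundary layers of every width; this width makes the bound
      C \<epsilon>^\<eta> equal to half of the supposedly positive probability.\<close>
    define \<epsilon> where "\<epsilon> = (measure P\<^sub>\<omega> E / (2 * C)) powr (1 / \<eta>)"
    have "0 < \<epsilon>"
      using p C by (simp add: \<epsilon>_def)
    moreover have "\<exists>x'\<in>X k. y \<in> boundary_layer \<epsilon> \<omega> k x'" if "\<omega> \<in> E" for \<omega>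
      using that boundary_layer_overlap[OF assms _ _ \<open>0 < \<epsilon>\<close>, of y \<omega>] assms by (auto simp: E_def cube_event_def)
    ultimately have "measure P\<^sub>\<omega> E \<le> C * \<epsilon> powr \<eta>"
      by (intro C(2)[OF E])
    also have "\<dots> = measure P\<^sub>\<omega> E / 2"
      using C p eta by (simp add: \<epsilon>_def powr_powr)
    finally show False using p by simp
  qed
  then have "E \<in> null_sets P\<^sub>\<omega>"
    using E by (simp add: null_sets_def P.emeasure_eq_measure)
  then show ?thesis
    by (rule AE_I') (auto simp: E_def cube_event_def)
qed

lemma AE_unique_cube:
  assumes "finite F" "F \<subseteq> X k"
  shows "AE \<omega> in P\<^sub>\<omega>. \<forall>x\<in>F. \<forall>x'\<in>F. y \<in> closed_cube \<omega> k x \<longrightarrow> y \<in> closed_cube \<omega> k x' \<longrightarrow> x = x'"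
proof -
  have "AE \<omega> in P\<^sub>\<omega>. y \<in> closed_cube \<omega> k x \<longrightarrow> y \<in> closed_cube \<omega> k x' \<longrightarrow> x = x'" if "x \<in> F" "x' \<in> F" for x x'
  proof (cases "x = x'")
    case False
    then show ?thesis
      using overlap_null[of x k x' y] that assms by (auto elim: eventually_mono)
  qed auto
  then show ?thesis
    by (intro AE_finite_allI assms) 
qed

definition near :: "int \<Rightarrow> 'a \<Rightarrow> 'a set" where
  "near k y = {x \<in> X k. d y x < 8 * A0 ^ 5 * sc k}"

lemma finite_near [simp]: "finite (near k y)"
  unfolding near_def by (rule X_finite_near)

lemma near_subset: "near k y \<subseteq> X k"
  by (auto simp: near_def)

lemma spline_outside_near: "x \<in> X k \<Longrightarrow> x \<notin> near k y \<Longrightarrow> spline k x y = 0"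
  using spline_support[of x k y] by (auto simp: near_def dist_sym)

lemma closed_cube_near: "x \<in> X k \<Longrightarrow> y \<in> closed_cube \<omega> k x \<Longrightarrow> x \<in> near k y"
  using closed_cube_dist[of x k y \<omega>] by (auto simp: near_def dist_sym)

text \<open>Almost surely y lies in exactly one closed cube of generation k, and the sum of the
  splines is the expected number of such cubes. Only cubes of nearby reference points can
  contribute, so the sum is finite.\<close>

lemma spline_sum: "(\<Sum>x\<in>near k y. spline k x y) = 1"
proof -
  have "(\<Sum>x\<in>near k y. spline k x y) = (\<Sum>x\<in>near k y. P.expectation (indicator (cube_event k x y)))"
    using near_subset by (intro sum.cong) (auto simp: spline_def)
  also have "\<dots> = P.expectation (\<lambda>\<omega>. \<Sum>x\<in>near k y. indicator (cube_event k x y) \<omega>)"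
    using near_subset[of k y] by (intro Bochner_Integration.integral_sum[symmetric] P.integrable_const_bound[where B = 1])
      (auto simp: indicator_def intro!: borel_measurable_indicator cube_event_sets)
  also have "\<dots> = P.expectation (\<lambda>_. 1)"
  proof (rule integral_cong_AE)
    show "(\<lambda>\<omega>. \<Sum>x\<in>near k y. indicator (cube_event k x y) \<omega> :: real) \<in> borel_measurable P\<^sub>\<omega>"
      using near_subset by (intro borel_measurable_sum borel_measurable_indicator cube_event_sets) auto
    show "AE \<omega> in P\<^sub>\<omega>. (\<Sum>x\<in>near k y. indicator (cube_event k x y) \<omega>) = (1 :: real)"
      using AE_unique_cube[OF finite_near near_subset, of k y y] AE_space
    proof eventually_elim
      case (elim \<omega>)
      obtain x where x: "x \<in> X k" "y \<in> closed_cube \<omega> k x"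
        using closed_cube_cover by blast
      have xn: "x \<in> near k y"
        by (rule closed_cube_near[OF x])
      have "(\<Sum>u\<in>near k y. indicator (cube_event k u y) \<omega> :: real) = (\<Sum>u\<in>near k y. if u = x then 1 else 0)"
        using elim x xn by (intro sum.cong) (auto simp: cube_event_def indicator_def)
      then show ?case
        using xn by simp
    qed
  qed simp
  finally show ?thesis
    by (simp add: P.prob_space)
qed

text \<open>Almost surely y lies in one cube of generation k + 1, say that of \<sigma>, and then it
  lies in the cube of x exactly when x is the new parent of \<sigma>. Expectations and independence
  give the formula.\<close>

lemma spline_refine_near:
  assumes x: "x \<in> X k"
  shows "spline k x y = (\<Sum>\<sigma>\<in>near (k + 1) y. refinement k x \<sigma> * spline (k + 1) \<sigma> y)"
proof -
  let ?F = "near (k + 1) y"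
  have "(\<Sum>\<sigma>\<in>?F. refinement k x \<sigma> * spline (k + 1) \<sigma> y)
      = (\<Sum>\<sigma>\<in>?F. P.expectation (indicator (child_event k x \<sigma> \<inter> cube_event (k + 1) \<sigma> y)))"
  proof (intro sum.cong refl)
    fix \<sigma> assume "\<sigma> \<in> ?F"
    then have "\<sigma> \<in> X (k + 1)" using near_subset by blast
    then show "refinement k x \<sigma> * spline (k + 1) \<sigma> y = P.expectation (indicator (child_event k x \<sigma> \<inter> cube_event (k + 1) \<sigma> y))"
      using independent_events[of \<sigma> k x y] by simp
  qed
  also have "\<dots> = P.expectation (\<lambda>\<omega>. \<Sum>\<sigma>\<in>?F. indicator (child_event k x \<sigma> \<inter> cube_event (k + 1) \<sigma> y) \<omega>)"
    using near_subset[of "k + 1" y] by (intro Bochner_Integration.integral_sum[symmetric] P.integrable_const_bound[where B = 1])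
      (auto simp: indicator_def intro!: borel_measurable_indicator cube_event_sets child_event_sets sets.Int)
  also have "\<dots> = P.expectation (indicator (cube_event k x y))"
  proof (rule integral_cong_AE)
    show "(\<lambda>\<omega>. \<Sum>\<sigma>\<in>?F. indicator (child_event k x \<sigma> \<inter> cube_event (k + 1) \<sigma> y) \<omega> :: real) \<in> borel_measurable P\<^sub>\<omega>"
      using near_subset by (intro borel_measurable_sum borel_measurable_indicator cube_event_sets child_event_sets sets.Int) auto
    \<comment> \<open>x is inserted because it need not be near y.\<close>
    have unique: "AE \<omega> in P\<^sub>\<omega>. \<forall>u\<in>insert x (near k y). \<forall>v\<in>insert x (near k y).
        y \<in> closed_cube \<omega> k u \<longrightarrow> y \<in> closed_cube \<omega> k v \<longrightarrow> u = v"
      by (rule AE_unique_cube) (use x near_subset in auto)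
    show "AE \<omega> in P\<^sub>\<omega>. (\<Sum>\<sigma>\<in>?F. indicator (child_event k x \<sigma> \<inter> cube_event (k + 1) \<sigma> y) \<omega>)
        = (indicator (cube_event k x y) \<omega> :: real)"
      using AE_unique_cube[OF finite_near near_subset, of "k + 1" y y]
        unique AE_space
    proof eventually_elim
      case (elim \<omega>)
      obtain \<sigma> where \<sigma>: "\<sigma> \<in> X (k + 1)" "y \<in> closed_cube \<omega> (k + 1) \<sigma>"
        using closed_cube_cover by blast
      have \<sigma>n: "\<sigma> \<in> ?F"
        by (rule closed_cube_near[OF \<sigma>])
      have up: "y \<in> closed_cube \<omega> k (new_parent \<omega> k \<sigma>)"
        using closed_cube_new_parent[OF \<sigma>(1)] \<sigma>(2) by blast
      have iff: "new_parent \<omega> k \<sigma> = x \<longleftrightarrow> y \<in> closed_cube \<omega> k x"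
        using up elim(2) x near_subset finite_near closed_cube_near[OF new_parent_in[OF \<sigma>(1)] up] by auto
      have "(\<Sum>u\<in>?F. indicator (child_event k x u \<inter> cube_event (k + 1) u y) \<omega> :: real)
          = (\<Sum>u\<in>?F. if u = \<sigma> then indicator (cube_event k x y) \<omega> else 0)"
      proof (intro sum.cong refl)
        fix u assume u: "u \<in> ?F"
        show "indicator (child_event k x u \<inter> cube_event (k + 1) u y) \<omega> = (if u = \<sigma> then indicator (cube_event k x y) \<omega> else (0 :: real))"
        proof (cases "u = \<sigma>")
          case True
          then show ?thesis
            using iff elim(3) \<sigma> by (auto simp: indicator_def cube_event_def child_event_def)
        next
          case False
          then have "\<omega> \<notin> cube_event (k + 1) u y"
            using elim(1) u \<sigma>n \<sigma>(2) by (auto simp: cube_event_def)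
          then show ?thesis using False by (simp add: indicator_def)
        qed
      qed
      then show ?case
        using \<sigma>n by simp
    qed
  qed (use x in auto)
  finally show ?thesis
    using x by (simp add: spline_def)
qed

definition kids :: "int \<Rightarrow> 'a \<Rightarrow> 'a set" where
  "kids k x = {\<sigma> \<in> X (k + 1). d x \<sigma> < 3 * A0 ^ 2 * sc k}"

lemma finite_kids [simp]: "finite (kids k x)" and kids_subset: "kids k x \<subseteq> X (k + 1)"
  unfolding kids_def using X_finite_near by auto

text \<open>Here the index set no longer depends on y, so the relation becomes an identity between
  functions and can be inserted into inner products and spans.\<close>

lemma spline_refine:
  assumes x: "x \<in> X k"
  shows "spline k x y = (\<Sum>\<sigma>\<in>kids k x. refinement k x \<sigma> * spline (k + 1) \<sigma> y)"
proof -
  have "(\<Sum>\<sigma>\<in>near (k + 1) y. refinement k x \<sigma> * spline (k + 1) \<sigma> y)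
      = (\<Sum>\<sigma>\<in>near (k + 1) y \<inter> kids k x. refinement k x \<sigma> * spline (k + 1) \<sigma> y)"
    by (rule sum.mono_neutral_right)
      (use near_subset[of "k + 1" y] refinement_support[of _ k x] in \<open>auto simp: kids_def\<close>)
  also have "\<dots> = (\<Sum>\<sigma>\<in>kids k x. refinement k x \<sigma> * spline (k + 1) \<sigma> y)"
    by (rule sum.mono_neutral_left)
      (use kids_subset[of k x] spline_outside_near[of _ "k + 1" y] in auto)
  finally show ?thesis
    using spline_refine_near[OF x, of y] by simp
qed

text \<open>A point of \<open>X k\<close> lies, for every \<omega>, in the closed cube of its own
  new parent, and near a reference point that cube can only be its own. This allows the two-scale
  relation to be solved for the fine spline at an old point.\<close>

lemma refinement_reference_point:
  assumes "x \<in> X k" "\<sigma> \<in> X k"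
  shows "refinement k x \<sigma> = (if \<sigma> = x then 1 else 0)"
proof -
  have \<sigma>: "\<sigma> \<in> X (k + 1)"
    using assms X_mono by blast
  have "new_parent \<omega> k \<sigma> = \<sigma>" for \<omega>
  proof -
    have "\<sigma> \<in> closed_cube \<omega> k (new_parent \<omega> k \<sigma>)"
      using closed_cube_new_parent[OF \<sigma>] reference_point_in_closed_cube[OF \<sigma>] by blast
    then show ?thesis
      using A0_pos by (intro closed_cube_near_reference_point[OF assms(2) new_parent_in[OF \<sigma>]]) auto
  qed
  then have "child_event k x \<sigma> = (if \<sigma> = x then space P\<^sub>\<omega> else {})"
    by (auto simp: child_event_def)
  then show ?thesis
    by (auto simp: refinement_def P.prob_space)
qed

lemma spline_hoelder:
  obtains C where "0 < C" "\<And>k x y y'. x \<in> X k \<Longrightarrow> \<bar>spline k x y - spline k x y'\<bar> \<le> C * (d y y' / sc k) powr \<eta>"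
proof -
  obtain C where C: "0 < C" "\<And>E x k \<epsilon>. E \<in> sets P\<^sub>\<omega> \<Longrightarrow> 0 < \<epsilon> \<Longrightarrow>
    (\<And>\<omega>. \<omega> \<in> E \<Longrightarrow> \<exists>x'\<in>X k. x \<in> boundary_layer \<epsilon> \<omega> k x') \<Longrightarrow> measure P\<^sub>\<omega> E \<le> C * \<epsilon> powr \<eta>"
    using boundary_bound by blast
  define C' where "C' = C * 2 powr \<eta>"
  have one: "spline k x y - spline k x y' \<le> C' * (d y y' / sc k) powr \<eta>" if x: "x \<in> X k" for k x y y'
  proof (cases "y = y'")
    case False
    then have dp: "0 < d y y'"
      using dist_nonneg[of y y'] dist_eq_0[of y y'] by linarith
    \<comment> \<open>The factor 2 yields the strict inequality d y y' < \<epsilon>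
      \<open>sc k\<close>; positivity of \<epsilon> is why y = y' is treated apart.\<close>
    define \<epsilon> where "\<epsilon> = 2 * (d y y' / sc k)"
    have e: "0 < \<epsilon>" "d y y' < \<epsilon> * sc k"
      using dp delta_bounds by (auto simp: \<epsilon>_def)
    have s: "cube_event k x y \<in> sets P\<^sub>\<omega>" "cube_event k x y' \<in> sets P\<^sub>\<omega>"
      using x by auto
    have "spline k x y \<le> P.prob (cube_event k x y' \<union> (cube_event k x y - cube_event k x y'))"
      unfolding spline_def using s by (intro P.finite_measure_mono) auto
    also have "\<dots> \<le> spline k x y' + P.prob (cube_event k x y - cube_event k x y')"
      unfolding spline_def using s by (intro measure_Un_le) auto
    also have "P.prob (cube_event k x y - cube_event k x y') \<le> C * \<epsilon> powr \<eta>"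
      by (rule C(2)[of _ _ k y])
        (use s e x boundary_layer_crossing[of y _ k x y' \<epsilon>] in \<open>auto simp: cube_event_def\<close>)
    also have "C * \<epsilon> powr \<eta> = C' * (d y y' / sc k) powr \<eta>"
    proof -
      have "(2 * u) powr \<eta> = 2 powr \<eta> * u powr \<eta>" if "0 \<le> u" for u :: real
        using that by (simp add: powr_mult)
      from this[of "d y y' / sc k"] show ?thesis
        unfolding \<epsilon>_def C'_def using dp by simp
    qed
    finally show ?thesis by simp
  qed simp
  have "\<bar>spline k x y - spline k x y'\<bar> \<le> C' * (d y y' / sc k) powr \<eta>" if "x \<in> X k" for k x y y'
    using one[OF that, of y y'] one[OF that, of y' y] by (simp add: dist_sym abs_le_iff)
  then show ?thesis
    using C by (intro that[of C']) (auto simp: C'_def)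
qed

end

subsection \<open>Square-integrable functions\<close>

lemma L2_functionsD:
  assumes "f \<in> L2_functions M"
  shows "f \<in> borel_measurable M" "integrable M (\<lambda>x. (f x)\<^sup>2)"
  using assms by (auto simp: L2_functions_def)

lemma integrable_mult_L2:
  assumes "f \<in> L2_functions M" "g \<in> L2_functions M"
  shows "integrable M (\<lambda>x. f x * g x)"
proof (rule Bochner_Integration.integrable_bound)
  show "integrable M (\<lambda>x. ((f x)\<^sup>2 + (g x)\<^sup>2) / 2)"
    using assms by (intro Bochner_Integration.integrable_divide Bochner_Integration.integrable_add L2_functionsD)
  show "(\<lambda>x. f x * g x) \<in> borel_measurable M"
    using assms by (intro borel_measurable_times L2_functionsD)
  show "AE x in M. norm (f x * g x) \<le> norm (((f x)\<^sup>2 + (g x)\<^sup>2) / 2)"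
  proof (intro AE_I2)
    fix x
    have "0 \<le> (\<bar>f x\<bar> - \<bar>g x\<bar>)\<^sup>2" by simp
    then show "norm (f x * g x) \<le> norm (((f x)\<^sup>2 + (g x)\<^sup>2) / 2)"
      by (simp add: abs_mult power2_diff)
  qed
qed

lemma L2_add:
  assumes "f \<in> L2_functions M" "g \<in> L2_functions M"
  shows "(\<lambda>x. f x + g x) \<in> L2_functions M"
proof -
  have "integrable M (\<lambda>x. (f x)\<^sup>2 + 2 * (f x * g x) + (g x)\<^sup>2)"
    using assms by (intro Bochner_Integration.integrable_add integrable_mult_right integrable_mult_L2 L2_functionsD)
  moreover have "(\<lambda>x. (f x + g x)\<^sup>2) = (\<lambda>x. (f x)\<^sup>2 + 2 * (f x * g x) + (g x)\<^sup>2)"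
    by (auto simp: power2_sum)
  ultimately show ?thesis
    using assms by (auto simp: L2_functions_def)
qed

lemma L2_scale: "f \<in> L2_functions M \<Longrightarrow> (\<lambda>x. c * f x) \<in> L2_functions M"
  by (auto simp: L2_functions_def power_mult_distrib)

lemma L2_diff: "f \<in> L2_functions M \<Longrightarrow> g \<in> L2_functions M \<Longrightarrow> (\<lambda>x. f x - g x) \<in> L2_functions M"
  using L2_add[of f M "\<lambda>x. -1 * g x"] L2_scale[of g M "-1"] by simp

lemma L2_zero: "(\<lambda>_. 0) \<in> L2_functions M"
  by (simp add: L2_functions_def)

lemma L2_sum: "(\<And>i. i \<in> F \<Longrightarrow> f i \<in> L2_functions M) \<Longrightarrow> (\<lambda>x. \<Sum>i\<in>F. f i x) \<in> L2_functions M"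
  by (induction F rule: infinite_finite_induct) (auto intro: L2_add L2_zero)

lemma L2_bound:
  assumes "g \<in> L2_functions M" "f \<in> borel_measurable M" "\<And>x. \<bar>f x\<bar> \<le> \<bar>g x\<bar>"
  shows "f \<in> L2_functions M"
proof -
  have "(f x)\<^sup>2 \<le> (g x)\<^sup>2" for x
    using assms(3)[of x] by (simp add: abs_le_square_iff)
  then have "integrable M (\<lambda>x. (f x)\<^sup>2)"
    by (intro Bochner_Integration.integrable_bound[OF L2_functionsD(2)[OF assms(1)]])
      (use assms(2) in auto)
  then show ?thesis
    using assms(2) by (simp add: L2_functions_def)
qed

abbreviation "nsq M f \<equiv> (\<integral>x. (f x)\<^sup>2 \<partial>M)"

lemma nsq_add_le:
  assumes "f \<in> L2_functions M" "g \<in> L2_functions M"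
  shows "nsq M (\<lambda>x. f x + g x) \<le> 2 * nsq M f + 2 * nsq M g"
proof -
  have "nsq M (\<lambda>x. f x + g x) \<le> (\<integral>x. 2 * (f x)\<^sup>2 + 2 * (g x)\<^sup>2 \<partial>M)"
  proof (rule integral_mono)
    show "integrable M (\<lambda>x. (f x + g x)\<^sup>2)"
      using L2_functionsD(2)[OF L2_add[OF assms]] .
    show "integrable M (\<lambda>x. 2 * (f x)\<^sup>2 + 2 * (g x)\<^sup>2)"
      using assms by (intro Bochner_Integration.integrable_add integrable_mult_right L2_functionsD)
    show "(f x + g x)\<^sup>2 \<le> 2 * (f x)\<^sup>2 + 2 * (g x)\<^sup>2" for x
      using zero_le_power2[of "f x - g x"] by (simp add: power2_sum power2_diff)
  qed
  also have "\<dots> = 2 * nsq M f + 2 * nsq M g"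
    using assms by (subst Bochner_Integration.integral_add) (auto intro: L2_functionsD)
  finally show ?thesis .
qed

lemma nsq_triangle:
  assumes "f \<in> L2_functions M" "g \<in> L2_functions M" "h \<in> L2_functions M"
  shows "nsq M (\<lambda>x. f x - h x) \<le> 2 * nsq M (\<lambda>x. f x - g x) + 2 * nsq M (\<lambda>x. g x - h x)"
  using nsq_add_le[OF L2_diff[OF assms(1,2)] L2_diff[OF assms(2,3)]] by simp

inductive_set fspan :: "('a \<Rightarrow> real) set \<Rightarrow> ('a \<Rightarrow> real) set" for \<Phi> where
  zero: "(\<lambda>_. 0) \<in> fspan \<Phi>"
| add: "g \<in> fspan \<Phi> \<Longrightarrow> \<phi> \<in> \<Phi> \<Longrightarrow> (\<lambda>x. g x + c * \<phi> x) \<in> fspan \<Phi>"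

lemma fspan_L2: "g \<in> fspan \<Phi> \<Longrightarrow> \<Phi> \<subseteq> L2_functions M \<Longrightarrow> g \<in> L2_functions M"
proof (induction rule: fspan.induct)
  case (add g \<phi> c)
  then show ?case by (intro L2_add L2_scale) auto
qed (rule L2_zero)

lemma fspan_base: "\<phi> \<in> \<Phi> \<Longrightarrow> \<phi> \<in> fspan \<Phi>"
  using fspan.add[OF fspan.zero, of \<phi> \<Phi> 1] by simp

lemma fspan_add:
  assumes "f \<in> fspan \<Phi>" "g \<in> fspan \<Phi>"
  shows "(\<lambda>x. f x + c * g x) \<in> fspan \<Phi>"
  using assms(2)
proof induction
  case zero
  then show ?case using assms(1) by simp
next
  case (add g \<phi> b)
  have "(\<lambda>x. (f x + c * g x) + (c * b) * \<phi> x) \<in> fspan \<Phi>"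
    by (intro fspan.add add)
  then show ?case by (simp add: algebra_simps)
qed

lemma fspan_sum:
  assumes "finite F" "\<And>i. i \<in> F \<Longrightarrow> f i \<in> fspan \<Phi>"
  shows "(\<lambda>x. \<Sum>i\<in>F. c i * f i x) \<in> fspan \<Phi>"
  using assms
proof (induction F rule: finite_induct)
  case (insert i F)
  have "(\<lambda>x. (\<Sum>i\<in>F. c i * f i x) + c i * f i x) \<in> fspan \<Phi>"
    using insert by (intro fspan_add) auto
  then show ?case
    using insert by (simp add: add.commute)
qed (simp add: fspan.zero)

lemma fspan_trans: "g \<in> fspan \<Phi> \<Longrightarrow> \<Phi> \<subseteq> fspan \<Psi> \<Longrightarrow> g \<in> fspan \<Psi>"
  by (induction rule: fspan.induct) (auto intro: fspan.zero fspan_add)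

lemma fspan_Un:
  assumes "g \<in> fspan (\<Phi> \<union> \<Psi>)"
  shows "\<exists>v\<in>fspan \<Phi>. \<exists>w\<in>fspan \<Psi>. g = (\<lambda>x. v x + w x)"
  using assms
proof induction
  case zero
  show ?case
    by (intro bexI[OF _ fspan.zero]) simp
next
  case (add g \<phi> c)
  then obtain v w where vw: "v \<in> fspan \<Phi>" "w \<in> fspan \<Psi>" "g = (\<lambda>x. v x + w x)" by blast
  from add(2) show ?case
  proof
    assume "\<phi> \<in> \<Phi>"
    then have "(\<lambda>x. v x + c * \<phi> x) \<in> fspan \<Phi>"
      using vw by (intro fspan.add)
    then show ?thesis
      using vw by (intro bexI[of _ "\<lambda>x. v x + c * \<phi> x"] bexI[of _ w]) auto
  next
    assume "\<phi> \<in> \<Psi>"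
    then have "(\<lambda>x. w x + c * \<phi> x) \<in> fspan \<Psi>"
      using vw by (intro fspan.add)
    then show ?thesis
      using vw by (intro bexI[of _ v] bexI[of _ "\<lambda>x. w x + c * \<phi> x"]) auto
  qed
qed

lemma fspan_image:
  assumes "g \<in> fspan (\<psi> ` I)"
  shows "\<exists>F c. finite F \<and> F \<subseteq> I \<and> g = (\<lambda>x. \<Sum>i\<in>F. c i * \<psi> i x)"
  using assms
proof induction
  case zero
  show ?case by (rule exI[of _ "{}"]) simp
next
  case (add g \<phi> b)
  then obtain F c i where F: "finite F" "F \<subseteq> I" "g = (\<lambda>x. \<Sum>i\<in>F. c i * \<psi> i x)" "i \<in> I" "\<phi> = \<psi> i"
    by blast
  define c' where "c' j = (if j \<in> F then c j else 0) + (if j = i then b else 0)" for j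
  have "(\<Sum>j\<in>insert i F. c' j * \<psi> j x) = g x + b * \<phi> x" for x
  proof -
    have "(\<Sum>j\<in>insert i F. c' j * \<psi> j x)
        = (\<Sum>j\<in>insert i F. (if j \<in> F then c j else 0) * \<psi> j x) + (\<Sum>j\<in>insert i F. (if j = i then b else 0) * \<psi> j x)"
      unfolding sum.distrib[symmetric] c'_def by (simp add: distrib_right)
    also have "(\<Sum>j\<in>insert i F. (if j \<in> F then c j else 0) * \<psi> j x) = (\<Sum>j\<in>F. c j * \<psi> j x)"
      using F(1) by (intro sum.mono_neutral_cong_right) auto
    also have "(\<Sum>j\<in>insert i F. (if j = i then b else 0) * \<psi> j x) = (\<Sum>j\<in>{i}. b * \<psi> j x)"
      using F(1) by (intro sum.mono_neutral_cong_right) auto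
    finally show ?thesis
      using F by simp
  qed
  then show ?case
    using F by (intro exI[of _ "insert i F"] exI[of _ c']) auto
qed

text \<open>Membership in the closed linear span, measured by squared norms so that square roots are
  deferred to the end.\<close>

definition L2_approx :: "'a measure \<Rightarrow> ('a \<Rightarrow> real) set \<Rightarrow> ('a \<Rightarrow> real) \<Rightarrow> bool" where
  "L2_approx M \<Phi> f \<longleftrightarrow> f \<in> L2_functions M \<and> (\<forall>\<epsilon>>0. \<exists>g\<in>fspan \<Phi>. nsq M (\<lambda>x. f x - g x) < \<epsilon>)"

lemma L2_approxD: "L2_approx M \<Phi> f \<Longrightarrow> 0 < \<epsilon> \<Longrightarrow> \<exists>g\<in>fspan \<Phi>. nsq M (\<lambda>x. f x - g x) < \<epsilon>"
  and L2_approx_L2: "L2_approx M \<Phi> f \<Longrightarrow> f \<in> L2_functions M"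
  by (auto simp: L2_approx_def)

lemma L2_approx_span: "g \<in> fspan \<Phi> \<Longrightarrow> \<Phi> \<subseteq> L2_functions M \<Longrightarrow> L2_approx M \<Phi> g"
  unfolding L2_approx_def
proof (intro conjI allI impI)
  assume g: "g \<in> fspan \<Phi>" "\<Phi> \<subseteq> L2_functions M"
  show "g \<in> L2_functions M"
    by (rule fspan_L2[OF g])
  show "\<exists>h\<in>fspan \<Phi>. nsq M (\<lambda>x. g x - h x) < \<epsilon>" if "0 < \<epsilon>" for \<epsilon>
    by (rule bexI[OF _ g(1)]) (use that in simp)
qed

lemma L2_approx_limit:
  assumes \<Phi>: "\<Phi> \<subseteq> L2_functions M" and f: "f \<in> L2_functions M"
    and lim: "\<And>\<epsilon>. 0 < \<epsilon> \<Longrightarrow> \<exists>g. L2_approx M \<Phi> g \<and> nsq M (\<lambda>x. f x - g x) < \<epsilon>"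
  shows "L2_approx M \<Phi> f"
  unfolding L2_approx_def
proof (intro conjI f allI impI)
  fix \<epsilon> :: real assume "0 < \<epsilon>"
  then obtain g where g: "L2_approx M \<Phi> g" "nsq M (\<lambda>x. f x - g x) < \<epsilon> / 4"
    using lim[of "\<epsilon> / 4"] by auto
  then obtain h where h: "h \<in> fspan \<Phi>" "nsq M (\<lambda>x. g x - h x) < \<epsilon> / 4"
    using L2_approxD[OF g(1), of "\<epsilon> / 4"] \<open>0 < \<epsilon>\<close> by auto
  have "nsq M (\<lambda>x. f x - h x) < \<epsilon>"
    using nsq_triangle[OF f L2_approx_L2[OF g(1)] fspan_L2[OF h(1) \<Phi>]] g h by simp
  then show "\<exists>g\<in>fspan \<Phi>. nsq M (\<lambda>x. f x - g x) < \<epsilon>"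
    using h by blast
qed

lemma L2_approx_add:
  assumes \<Phi>: "\<Phi> \<subseteq> L2_functions M" and f: "L2_approx M \<Phi> f" and g: "L2_approx M \<Phi> g"
  shows "L2_approx M \<Phi> (\<lambda>x. f x + c * g x)"
  unfolding L2_approx_def
proof (intro conjI allI impI)
  show "(\<lambda>x. f x + c * g x) \<in> L2_functions M"
    by (intro L2_add L2_scale L2_approx_L2[OF f] L2_approx_L2[OF g])
  fix \<epsilon> :: real assume e: "0 < \<epsilon>"
  define \<epsilon>' where "\<epsilon>' = \<epsilon> / (4 * (c\<^sup>2 + 1))"
  have cp: "0 < c\<^sup>2 + 1" using zero_le_power2[of c] by linarith
  have e': "0 < \<epsilon>'" "c\<^sup>2 * \<epsilon>' \<le> \<epsilon> / 4"
    using e cp by (auto simp: \<epsilon>'_def field_simps)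
  obtain u where u: "u \<in> fspan \<Phi>" "nsq M (\<lambda>x. f x - u x) < \<epsilon> / 4"
    using L2_approxD[OF f, of "\<epsilon> / 4"] e by auto
  obtain v where v: "v \<in> fspan \<Phi>" "nsq M (\<lambda>x. g x - v x) < \<epsilon>'"
    using L2_approxD[OF g e'(1)] by auto
  have "nsq M (\<lambda>x. (f x - u x) + c * (g x - v x)) \<le> 2 * nsq M (\<lambda>x. f x - u x) + 2 * nsq M (\<lambda>x. c * (g x - v x))"
    by (intro nsq_add_le L2_scale L2_diff L2_approx_L2[OF f] L2_approx_L2[OF g] fspan_L2[OF u(1) \<Phi>] fspan_L2[OF v(1) \<Phi>])
  also have "nsq M (\<lambda>x. c * (g x - v x)) = c\<^sup>2 * nsq M (\<lambda>x. g x - v x)"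
    by (simp add: power_mult_distrib)
  also have "c\<^sup>2 * nsq M (\<lambda>x. g x - v x) \<le> c\<^sup>2 * \<epsilon>'"
    using v by (intro mult_left_mono) auto
  finally have "nsq M (\<lambda>x. (f x - u x) + c * (g x - v x)) < \<epsilon>"
    using u e' by simp
  moreover have "(f x - u x) + c * (g x - v x) = (f x + c * g x) - (u x + c * v x)" for x
    by (simp add: algebra_simps)
  ultimately have "nsq M (\<lambda>x. (f x + c * g x) - (u x + c * v x)) < \<epsilon>"
    by simp
  then show "\<exists>h\<in>fspan \<Phi>. nsq M (\<lambda>x. f x + c * g x - h x) < \<epsilon>"
    by (rule bexI[OF _ fspan_add[OF u(1) v(1), of c]])
qed

lemma L2_approx_sum:
  assumes "\<Phi> \<subseteq> L2_functions M" "finite F" "\<And>i. i \<in> F \<Longrightarrow> L2_approx M \<Phi> (f i)"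
  shows "L2_approx M \<Phi> (\<lambda>x. \<Sum>i\<in>F. c i * f i x)"
  using assms(2,3)
proof (induction F rule: finite_induct)
  case empty
  show ?case by (simp add: L2_approx_span[OF fspan.zero assms(1)])
next
  case (insert i F)
  have "L2_approx M \<Phi> (\<lambda>x. (\<Sum>i\<in>F. c i * f i x) + c i * f i x)"
    using insert by (intro L2_approx_add assms(1)) auto
  then show ?case
    using insert by (simp add: add.commute)
qed

lemma L2_approx_trans:
  assumes \<Psi>: "\<Psi> \<subseteq> L2_functions M" and f: "L2_approx M \<Phi> f"
    and "\<And>\<phi>. \<phi> \<in> \<Phi> \<Longrightarrow> L2_approx M \<Psi> \<phi>"
  shows "L2_approx M \<Psi> f"
proof (rule L2_approx_limit[OF \<Psi> L2_approx_L2[OF f]])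
  fix \<epsilon> :: real assume "0 < \<epsilon>"
  then obtain g where g: "g \<in> fspan \<Phi>" "nsq M (\<lambda>x. f x - g x) < \<epsilon>"
    using L2_approxD[OF f] by blast
  have "L2_approx M \<Psi> g"
    using g(1)
  proof (induction rule: fspan.induct)
    case zero
    show ?case by (rule L2_approx_span[OF fspan.zero \<Psi>])
  next
    case (add g \<phi> c)
    show ?case by (rule L2_approx_add[OF \<Psi> add.IH assms(3)[OF add.hyps(2)]])
  qed
  then show "\<exists>g. L2_approx M \<Psi> g \<and> nsq M (\<lambda>x. f x - g x) < \<epsilon>"
    using g by blast
qed

lemma L2_approx_mono: "\<Phi> \<subseteq> \<Psi> \<Longrightarrow> \<Psi> \<subseteq> L2_functions M \<Longrightarrow> L2_approx M \<Phi> f \<Longrightarrow> L2_approx M \<Psi> f"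
  by (rule L2_approx_trans[of \<Psi> M \<Phi>]) (auto intro: L2_approx_span fspan_base)

lemma L2_approx_tendsto:
  assumes "\<Phi> \<subseteq> L2_functions M" "f \<in> L2_functions M" "\<And>n. L2_approx M \<Phi> (g n)"
    and "(\<lambda>n. nsq M (\<lambda>x. f x - g n x)) \<longlonglongrightarrow> 0"
  shows "L2_approx M \<Phi> f"
proof (rule L2_approx_limit[OF assms(1,2)])
  fix \<epsilon> :: real assume "0 < \<epsilon>"
  then have "\<forall>\<^sub>F n in sequentially. nsq M (\<lambda>x. f x - g n x) < \<epsilon>"
    using order_tendstoD(2)[OF assms(4)] by blast
  then show "\<exists>g. L2_approx M \<Phi> g \<and> nsq M (\<lambda>x. f x - g x) < \<epsilon>"
    using assms(3) by (auto simp: eventually_sequentially)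
qed

text \<open>One square integrable dominating function yields at once membership of the limit, norm
  convergence and convergence of inner products. It takes the place of a completeness argument for
  L2.\<close>

lemma L2_dominated:
  assumes D: "D \<in> L2_functions M" and f: "\<And>n. f n \<in> borel_measurable M"
    and lim: "\<And>x. (\<lambda>n. f n x) \<longlonglongrightarrow> v x" and le: "\<And>n x. \<bar>f n x\<bar> \<le> D x"
  shows "v \<in> L2_functions M" "(\<lambda>n. nsq M (\<lambda>x. v x - f n x)) \<longlonglongrightarrow> 0"
    "\<And>g. g \<in> L2_functions M \<Longrightarrow> (\<lambda>n. L2_inner M (f n) g) \<longlonglongrightarrow> L2_inner M v g"
proof -
  have D0: "0 \<le> D x" for x
    using le[of 0 x] by linarith
  have vm: "v \<in> borel_measurable M"
    by (rule borel_measurable_LIMSEQ_metric[OF f lim])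
  have vle: "\<bar>v x\<bar> \<le> D x" for x
    by (rule Lim_bounded[OF tendsto_rabs[OF lim]]) (use le in auto)
  show vL: "v \<in> L2_functions M"
    by (rule L2_bound[OF D vm]) (use vle D0 in \<open>simp add: abs_of_nonneg\<close>)
  have "(\<lambda>n. nsq M (\<lambda>x. v x - f n x)) \<longlonglongrightarrow> (\<integral>x. 0 \<partial>M)"
  proof (rule integral_dominated_convergence[where w = "\<lambda>x. 4 * (D x)\<^sup>2"])
    show "integrable M (\<lambda>x. 4 * (D x)\<^sup>2)"
      using L2_functionsD(2)[OF D] by simp
    show "AE x in M. (\<lambda>n. (v x - f n x)\<^sup>2) \<longlonglongrightarrow> 0"
    proof (intro AE_I2)
      fix x
      have "(\<lambda>n. (v x - f n x)\<^sup>2) \<longlonglongrightarrow> (v x - v x)\<^sup>2"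
        by (intro tendsto_intros lim)
      then show "(\<lambda>n. (v x - f n x)\<^sup>2) \<longlonglongrightarrow> 0" by simp
    qed
    show "AE x in M. norm ((v x - f n x)\<^sup>2) \<le> 4 * (D x)\<^sup>2" for n
    proof (intro AE_I2)
      fix x
      have "\<bar>v x - f n x\<bar> \<le> \<bar>2 * D x\<bar>"
        using le[of n x] vle[of x] by linarith
      then have "(v x - f n x)\<^sup>2 \<le> (2 * D x)\<^sup>2"
        by (simp only: abs_le_square_iff)
      then show "norm ((v x - f n x)\<^sup>2) \<le> 4 * (D x)\<^sup>2"
        by (simp add: power_mult_distrib)
    qed
  qed (use vm f in auto)
  then show "(\<lambda>n. nsq M (\<lambda>x. v x - f n x)) \<longlonglongrightarrow> 0"
    by simp
  fix g assume g: "g \<in> L2_functions M"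
  show "(\<lambda>n. L2_inner M (f n) g) \<longlonglongrightarrow> L2_inner M v g"
    unfolding L2_inner_def
  proof (rule integral_dominated_convergence[where w = "\<lambda>x. \<bar>D x * g x\<bar>"])
    show "integrable M (\<lambda>x. \<bar>D x * g x\<bar>)"
      by (intro integrable_abs integrable_mult_L2 D g)
    show "AE x in M. (\<lambda>n. f n x * g x) \<longlonglongrightarrow> v x * g x"
      by (intro AE_I2 tendsto_intros lim)
    show "AE x in M. norm (f n x * g x) \<le> \<bar>D x * g x\<bar>" for n
      using le D0 by (intro AE_I2) (auto simp: abs_mult intro: mult_right_mono)
  qed (use vm f L2_functionsD(1)[OF g] in auto)
qed

lemma L2_inner_sum:
  assumes "\<And>i. i \<in> F \<Longrightarrow> f i \<in> L2_functions M" "g \<in> L2_functions M"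
  shows "L2_inner M (\<lambda>x. \<Sum>i\<in>F. c i * f i x) g = (\<Sum>i\<in>F. c i * L2_inner M (f i) g)"
proof -
  have "L2_inner M (\<lambda>x. \<Sum>i\<in>F. c i * f i x) g = (\<integral>x. (\<Sum>i\<in>F. c i * (f i x * g x)) \<partial>M)"
    unfolding L2_inner_def by (simp add: sum_distrib_right mult.assoc)
  also have "\<dots> = (\<Sum>i\<in>F. \<integral>x. c i * (f i x * g x) \<partial>M)"
    using assms by (intro Bochner_Integration.integral_sum integrable_mult_right integrable_mult_L2)
  finally show ?thesis
    by (simp add: L2_inner_def)
qed

lemma L2_inner_sym: "L2_inner M f g = L2_inner M g f"
  by (simp add: L2_inner_def mult.commute)

context homogeneous_space
begin

lemma wt_powr_integrable:
  assumes "0 < t" "0 < r"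
  shows "integrable \<mu> (\<lambda>y. wt r x y powr t)"
proof -
  obtain M where "0 < M" "\<And>r x. 0 < r \<Longrightarrow> (\<integral>\<^sup>+y. ennreal (wt r x y powr t) \<partial>\<mu>) \<le> ennreal (M * vol x r)"
    using wt_nn_integral[OF assms(1)] by blast
  from this(2)[OF assms(2), of x] have "(\<integral>\<^sup>+y. ennreal (wt r x y powr t) \<partial>\<mu>) < \<infinity>"
    by (rule order_le_less_trans) simp
  then show ?thesis
    using qcont_wt by (intro integrableI_bounded) auto
qed

lemma wt_powr_L2: "0 < t \<Longrightarrow> 0 < r \<Longrightarrow> (\<lambda>y. wt r x y powr t) \<in> L2_functions \<mu>"
  using wt_powr_integrable[of "2 * t" r x] qcont_wt[of r x t]
  by (auto simp: L2_functions_def powr_add[symmetric] power2_eq_square)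

lemma bounded_support_L2:
  assumes "f \<in> borel_measurable \<mu>" "\<And>y. \<bar>f y\<bar> \<le> 1" "\<And>y. f y \<noteq> 0 \<Longrightarrow> d x y < R"
  shows "f \<in> L2_functions \<mu>" "nsq \<mu> f \<le> vol x R"
proof -
  have fm: "quasi_ball d x R \<in> fmeasurable \<mu>"
    using ball_sets emeasure_ball_finite[of x R] by (auto intro!: fmeasurableI simp: less_top)
  have i: "integrable \<mu> (indicator (quasi_ball d x R) :: 'a \<Rightarrow> real)"
    using fm by (auto simp: fmeasurable_def)
  have le: "(f y)\<^sup>2 \<le> indicator (quasi_ball d x R) y" for y
    using assms(2)[of y] assms(3)[of y] by (cases "f y = 0") (auto simp: abs_square_le_1)
  have i2: "integrable \<mu> (\<lambda>y. (f y)\<^sup>2)"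
    by (rule Bochner_Integration.integrable_bound[OF i]) (use assms(1) le in auto)
  then show "f \<in> L2_functions \<mu>"
    using assms(1) by (simp add: L2_functions_def)
  have "nsq \<mu> f \<le> (\<integral>y. indicator (quasi_ball d x R) y \<partial>\<mu>)"
    by (rule integral_mono[OF i2 i le])
  also have "\<dots> = vol x R"
    using ball_sets by (simp add: vol_def space_eq)
  finally show "nsq \<mu> f \<le> vol x R" .
qed

end

subsection \<open>The mixed basis and its Gram matrix\<close>

context regular_dyadic_system
begin

definition blk_wt :: "int \<times> 'a \<Rightarrow> int \<times> 'a \<Rightarrow> real" where
  "blk_wt i j = (if fst i = fst j \<and> snd i \<in> X (fst i + 1) \<and> snd j \<in> X (fst j + 1)
    then wt (sc (fst i)) (snd i) (snd j) else 0)"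

text \<open>The index \<open>(k, y)\<close> stands for one function of block k: the coarse spline if
  y is already in \<open>X k\<close>, the fine spline otherwise. The block thus has one function per
  point of \<open>X (k + 1)\<close>.\<close>

definition basis_idx :: "(int \<times> 'a) set" where
  "basis_idx = {i. snd i \<in> X (fst i + 1)}"

definition new_idx :: "(int \<times> 'a) set" where
  "new_idx = {i \<in> basis_idx. snd i \<notin> X (fst i)}"

definition wt_bound :: "real \<Rightarrow> real" where
  "wt_bound t = (SOME B. \<forall>k i F. finite F \<longrightarrow> F \<subseteq> X (k + 1) \<longrightarrow> (\<Sum>j\<in>F. wt (sc k) i j powr t) \<le> B)"

lemma wt_bound: "0 < t \<Longrightarrow> finite F \<Longrightarrow> F \<subseteq> X (k + 1) \<Longrightarrow> (\<Sum>j\<in>F. wt (sc k) i j powr t) \<le> wt_bound t"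
proof -
  assume t: "0 < t"
  have "\<exists>B. \<forall>k i F. finite F \<longrightarrow> F \<subseteq> X (k + 1) \<longrightarrow> (\<Sum>j\<in>F. wt (sc k) i j powr t) \<le> B"
    using wt_sum_bound[OF t] by metis
  from someI_ex[OF this] show "finite F \<Longrightarrow> F \<subseteq> X (k + 1) \<Longrightarrow> (\<Sum>j\<in>F. wt (sc k) i j powr t) \<le> wt_bound t"
    unfolding wt_bound_def by blast
qed

sublocale W: exp_weight blk_wt basis_idx wt_bound
proof
  show "(\<Sum>j\<in>F. blk_wt i j powr t) \<le> wt_bound t" if "0 < t" "finite F" for t F i
  proof -
    let ?G = "{j. (fst i, j) \<in> F \<and> j \<in> X (fst i + 1)}"
    have fin: "finite ?G"
      by (rule finite_subset[of _ "snd ` F"]) (use that(2) in force)+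
    have "(\<Sum>j\<in>F. blk_wt i j powr t) = (\<Sum>j\<in>F \<inter> {j. fst j = fst i \<and> snd j \<in> X (fst i + 1)}. blk_wt i j powr t)"
      using that(2) by (intro sum.mono_neutral_right) (auto simp: blk_wt_def)
    also have "\<dots> \<le> (\<Sum>j\<in>F \<inter> {j. fst j = fst i \<and> snd j \<in> X (fst i + 1)}. wt (sc (fst i)) (snd i) (snd j) powr t)"
      by (intro sum_mono) (auto simp: blk_wt_def)
    also have "\<dots> = (\<Sum>j\<in>?G. wt (sc (fst i)) (snd i) j powr t)"
      by (rule sum.reindex_bij_witness[of _ "Pair (fst i)" snd]) auto
    also have "\<dots> \<le> wt_bound t"
      by (rule wt_bound[OF that(1) fin]) auto
    finally show ?thesis .
  qed
  show "blk_wt i k * blk_wt k j \<le> blk_wt i j" for i j k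
    using wt_triangle[of "sc (fst i)" "snd i" "snd k" "snd j"] by (auto simp: blk_wt_def)
qed (auto simp: blk_wt_def basis_idx_def wt_le_1 wt_sym)

definition idx_vol :: "int \<times> 'a \<Rightarrow> real" where "idx_vol i = vol (snd i) (sc (fst i))"

definition idx_wt :: "int \<times> 'a \<Rightarrow> 'a \<Rightarrow> real" where "idx_wt i x = wt (sc (fst i)) (snd i) x"

lemma idx_vol_pos [simp]: "0 < idx_vol i"
  by (simp add: idx_vol_def vol_pos)

lemma idx_vol_nonneg [simp]: "0 \<le> idx_vol i"
  using idx_vol_pos[of i] by linarith

lemma idx_wt_simps [simp]: "0 < idx_wt i x" "0 \<le> idx_wt i x" and idx_wt_le_1: "idx_wt i x \<le> 1"
  by (auto simp: idx_wt_def wt_le_1)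

lemma blk_wt_idx_wt: "blk_wt i j * idx_wt j x \<le> idx_wt i x"
  using wt_triangle[of "sc (fst i)" "snd i" "snd j" x] by (auto simp: blk_wt_def idx_wt_def)

lemma decaying_block: "W.decaying A \<Longrightarrow> fst i \<noteq> fst j \<Longrightarrow> A i j = 0"
proof -
  assume A: "W.decaying A" and ne: "fst i \<noteq> fst j"
  obtain C t where "W.decays C t A"
    using A unfolding W.decaying_def by blast
  from W.decaysD[OF this, of i j] show "A i j = 0"
    using ne by (simp add: blk_wt_def)
qed

text \<open>By the growth estimate, \<open>1 / sqrt (idx_vol j)\<close> may be replaced by \<open>1 / sqrt (idx_vol i)\<close> at the cost of half
  of the decay of \<open>A\<close>.\<close>

lemma decaying_comb_bound:
  assumes A: "W.decaying A" and \<tau>: "0 < \<tau>"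
  obtains C \<sigma> where "0 < C" "0 < \<sigma>"
    "\<And>i x S a c. finite S \<Longrightarrow> 0 \<le> c \<Longrightarrow> (\<And>j. j \<in> S \<Longrightarrow> \<bar>a j\<bar> \<le> c / sqrt (idx_vol j) * idx_wt j x powr \<tau>) \<Longrightarrow>
      (\<Sum>j\<in>S. \<bar>A i j * a j\<bar>) \<le> C * c / sqrt (idx_vol i) * idx_wt i x powr \<sigma>"
proof -
  obtain CA t where t: "0 \<le> CA" "0 < t" "W.decays CA t A"
    using A unfolding W.decaying_def by blast
  obtain M where M: "0 < M" "\<And>r x y. 0 < r \<Longrightarrow> vol x r * wt r x y powr t \<le> M * vol y r"
    using vol_compare[OF t(2)] by blast
  define \<sigma> where "\<sigma> = min (t / 4) \<tau>"
  have \<sigma>: "0 < \<sigma>" "\<sigma> \<le> t / 4" "\<sigma> \<le> \<tau>"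
    using t \<tau> by (auto simp: \<sigma>_def)
  define C where "C = CA * sqrt M * wt_bound (t / 4) + 1"
  have N0: "0 \<le> wt_bound (t / 4)"
    using t by (intro W.N_nonneg) auto
  have C: "0 < C" "CA * sqrt M * wt_bound (t / 4) \<le> C"
    using t M N0 by (auto simp: C_def intro!: add_nonneg_pos mult_nonneg_nonneg)
  have one: "\<bar>A i j * a\<bar> \<le> (CA * sqrt M * (c / sqrt (idx_vol i)) * idx_wt i x powr \<sigma>) * blk_wt i j powr (t / 4)"
    if c: "0 \<le> c" and a: "\<bar>a\<bar> \<le> c / sqrt (idx_vol j) * idx_wt j x powr \<tau>" for i j x a c
  proof (cases "blk_wt i j = 0")
    case True
    then have "A i j = 0"
      using W.decaysD[OF t(3), of i j] by simp
    then show ?thesis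
      using c t M by simp
  next
    case False
    then have e: "0 < blk_wt i j" "blk_wt i j = wt (sc (fst i)) (snd i) (snd j)" "fst j = fst i"
      using W.e_nonneg[of i j] by (auto simp: blk_wt_def split: if_splits)
    have "idx_vol i * blk_wt i j powr t \<le> M * idx_vol j"
      using M(2)[of "sc (fst i)" "snd i" "snd j"] e by (simp add: idx_vol_def)
    then have "sqrt (idx_vol i * blk_wt i j powr t) \<le> sqrt (M * idx_vol j)"
      by (rule real_sqrt_le_mono)
    moreover have "sqrt (blk_wt i j powr t) = blk_wt i j powr (t / 2)"
      using e by (simp add: powr_half_sqrt[symmetric] powr_powr)
    ultimately have "sqrt (idx_vol i) * blk_wt i j powr (t / 2) \<le> sqrt M * sqrt (idx_vol j)"
      by (simp add: real_sqrt_mult)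
    then have v: "blk_wt i j powr (t / 2) / sqrt (idx_vol j) \<le> sqrt M / sqrt (idx_vol i)"
      by (simp add: field_simps)
    have "blk_wt i j powr (t / 4) * idx_wt j x powr \<tau> \<le> blk_wt i j powr \<sigma> * idx_wt j x powr \<sigma>"
      using \<sigma> by (intro mult_mono powr_mono' W.e_powr_mono) (auto simp: idx_wt_le_1)
    also have "\<dots> \<le> idx_wt i x powr \<sigma>"
    proof -
      have "blk_wt i j powr \<sigma> * idx_wt j x powr \<sigma> = (blk_wt i j * idx_wt j x) powr \<sigma>"
        using e(1) by (simp add: powr_mult)
      also have "\<dots> \<le> idx_wt i x powr \<sigma>"
        using \<sigma> e(1) by (intro powr_mono2 blk_wt_idx_wt) auto
      finally show ?thesis .
    qed
    finally have w: "blk_wt i j powr (t / 4) * idx_wt j x powr \<tau> \<le> idx_wt i x powr \<sigma>" .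
    have "\<bar>A i j\<bar> * \<bar>a\<bar> \<le> (CA * blk_wt i j powr t) * (c / sqrt (idx_vol j) * idx_wt j x powr \<tau>)"
      using t by (intro mult_mono a W.decaysD) auto
    also have "blk_wt i j powr t = blk_wt i j powr (t / 2) * blk_wt i j powr (t / 4) * blk_wt i j powr (t / 4)"
      by (simp add: powr_add[symmetric])
    also have "(CA * (blk_wt i j powr (t / 2) * blk_wt i j powr (t / 4) * blk_wt i j powr (t / 4))) * (c / sqrt (idx_vol j) * idx_wt j x powr \<tau>)
        = (CA * c) * (blk_wt i j powr (t / 2) / sqrt (idx_vol j)) * (blk_wt i j powr (t / 4) * idx_wt j x powr \<tau>) * blk_wt i j powr (t / 4)"
      by simp
    also have "\<dots> \<le> (CA * c) * (sqrt M / sqrt (idx_vol i)) * idx_wt i x powr \<sigma> * blk_wt i j powr (t / 4)"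
      using t c M v w by (intro mult_right_mono mult_mono mult_left_mono) auto
    also have "\<dots> = (CA * sqrt M * (c / sqrt (idx_vol i)) * idx_wt i x powr \<sigma>) * blk_wt i j powr (t / 4)"
      by simp
    finally show ?thesis
      by (simp add: abs_mult)
  qed
  show ?thesis
  proof
    show "0 < C" "0 < \<sigma>" by fact+
    fix i x S a and c :: real
    assume S: "finite S" and c: "0 \<le> c" and a: "\<And>j. j \<in> S \<Longrightarrow> \<bar>a j\<bar> \<le> c / sqrt (idx_vol j) * idx_wt j x powr \<tau>"
    have "(\<Sum>j\<in>S. \<bar>A i j * a j\<bar>) \<le> (\<Sum>j\<in>S. (CA * sqrt M * (c / sqrt (idx_vol i)) * idx_wt i x powr \<sigma>) * blk_wt i j powr (t / 4))"
      by (intro sum_mono one c a)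
    also have "\<dots> = (CA * sqrt M * (c / sqrt (idx_vol i)) * idx_wt i x powr \<sigma>) * (\<Sum>j\<in>S. blk_wt i j powr (t / 4))"
      by (simp add: sum_distrib_left)
    also have "\<dots> \<le> (CA * sqrt M * (c / sqrt (idx_vol i)) * idx_wt i x powr \<sigma>) * wt_bound (t / 4)"
      using t c M S by (intro mult_left_mono W.e_sum_le mult_nonneg_nonneg) auto
    also have "\<dots> = (CA * sqrt M * wt_bound (t / 4)) * (c / sqrt (idx_vol i) * idx_wt i x powr \<sigma>)"
      by simp
    also have "\<dots> \<le> C * (c / sqrt (idx_vol i) * idx_wt i x powr \<sigma>)"
      using C c by (intro mult_right_mono mult_nonneg_nonneg) auto
    finally show "(\<Sum>j\<in>S. \<bar>A i j * a j\<bar>) \<le> C * c / sqrt (idx_vol i) * idx_wt i x powr \<sigma>"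
      by simp
  qed
qed

section \<open>Infinite combinations with decaying coefficients\<close>

definition exhaustion :: "int \<Rightarrow> nat \<Rightarrow> (int \<times> 'a) set" where
  "exhaustion k n = Pair k ` {j \<in> X (k + 1). d undefined j < real n}"

lemma finite_exhaustion [simp]: "finite (exhaustion k n)"
  unfolding exhaustion_def by (intro finite_imageI X_finite_near)

lemma exhaustion_basis_idx: "j \<in> exhaustion k n \<Longrightarrow> j \<in> basis_idx \<and> fst j = k"
  by (auto simp: exhaustion_def basis_idx_def)

text \<open>Unconditional sums converge along the net of finite sets, whereas dominated convergence
  is about sequences. The exhaustion of one level by countably many finite sets mediates between the
  two.\<close>

lemma exhaustion_tendsto:
  fixes f :: "int \<times> 'a \<Rightarrow> real"
  assumes "f summable_on UNIV" "\<And>j. j \<notin> basis_idx \<or> fst j \<noteq> k \<Longrightarrow> f j = 0"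
  shows "(\<lambda>n. sum f (exhaustion k n)) \<longlonglongrightarrow> infsum f UNIV"
proof -
  let ?S = "{j \<in> basis_idx. fst j = k}"
  have eq: "infsum f UNIV = infsum f ?S"
    by (rule infsum_cong_neutral) (use assms(2) in auto)
  have "f summable_on ?S"
    by (rule summable_on_subset[OF assms(1)]) simp
  then have lim: "(sum f \<longlongrightarrow> infsum f ?S) (finite_subsets_at_top ?S)"
    by (rule infsum_tendsto)
  have "filterlim (exhaustion k) (finite_subsets_at_top ?S) sequentially"
    unfolding filterlim_finite_subsets_at_top
  proof (intro allI impI)
    fix T assume T: "finite T \<and> T \<subseteq> ?S"
    obtain m where m: "\<And>j. j \<in> T \<Longrightarrow> d undefined (snd j) < real m"
    proof -
      obtain m where m: "Max (insert 0 ((\<lambda>j. d undefined (snd j)) ` T)) < real m"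
        using reals_Archimedean2 by blast
      show ?thesis
        by (rule that[of m], rule le_less_trans[OF Max_ge m]) (use T in auto)
    qed
    show "\<forall>\<^sub>F n in sequentially. finite (exhaustion k n) \<and> T \<subseteq> exhaustion k n \<and> exhaustion k n \<subseteq> ?S"
      unfolding eventually_sequentially
    proof (intro exI[of _ m] allI impI conjI)
      fix n assume n: "m \<le> n"
      show "T \<subseteq> exhaustion k n"
      proof
        fix j assume j: "j \<in> T"
        then have "d undefined (snd j) < real n" "j = (k, snd j)" "snd j \<in> X (k + 1)"
          using m[OF j] n T by (auto simp: basis_idx_def)
        then show "j \<in> exhaustion k n"
          unfolding exhaustion_def by blast
      qed
    qed (use exhaustion_basis_idx in auto)
  qed
  from filterlim_compose[OF lim this] show ?thesis
    unfolding eq .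
qed

definition comb :: "(int \<times> 'a \<Rightarrow> int \<times> 'a \<Rightarrow> real) \<Rightarrow> (int \<times> 'a \<Rightarrow> 'a \<Rightarrow> real) \<Rightarrow> int \<times> 'a \<Rightarrow> 'a \<Rightarrow> real" where
  "comb A u i x = (\<Sum>\<^sub>\<infinity>j. A i j * u j x)"

text \<open>A normalized decay condition that decaying matrices preserve up to constants. It
  supplies both integrability properties and the dominating functions for the limits.\<close>

definition localized :: "(int \<times> 'a \<Rightarrow> 'a \<Rightarrow> real) \<Rightarrow> bool" where
  "localized u \<longleftrightarrow> (\<exists>c \<tau>. 0 \<le> c \<and> 0 < \<tau> \<and> (\<forall>j\<in>basis_idx. u j \<in> borel_measurable \<mu> \<and>
     (\<forall>x. \<bar>u j x\<bar> \<le> c / sqrt (idx_vol j) * idx_wt j x powr \<tau>)))"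

lemma localized_dominant_L2: "0 < \<tau> \<Longrightarrow> (\<lambda>x. c / sqrt (idx_vol j) * idx_wt j x powr \<tau>) \<in> L2_functions \<mu>"
  unfolding idx_wt_def by (intro L2_scale wt_powr_L2) auto

lemma localized_L2: "localized u \<Longrightarrow> j \<in> basis_idx \<Longrightarrow> u j \<in> L2_functions \<mu>"
proof -
  assume u: "localized u" "j \<in> basis_idx"
  then obtain c \<tau> where c: "0 < \<tau>" "u j \<in> borel_measurable \<mu>" "\<And>x. \<bar>u j x\<bar> \<le> c / sqrt (idx_vol j) * idx_wt j x powr \<tau>"
    unfolding localized_def by blast
  show "u j \<in> L2_functions \<mu>"
    by (rule L2_bound[OF localized_dominant_L2[OF c(1)] c(2) order_trans[OF c(3) abs_ge_self]])
qed

lemma localized_integrable: "localized u \<Longrightarrow> j \<in> basis_idx \<Longrightarrow> integrable \<mu> (u j)"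
proof -
  assume u: "localized u" "j \<in> basis_idx"
  then obtain c \<tau> where c: "0 \<le> c" "0 < \<tau>" "u j \<in> borel_measurable \<mu>" "\<And>x. \<bar>u j x\<bar> \<le> c / sqrt (idx_vol j) * idx_wt j x powr \<tau>"
    unfolding localized_def by blast
  have "integrable \<mu> (\<lambda>x. c / sqrt (idx_vol j) * idx_wt j x powr \<tau>)"
    unfolding idx_wt_def using c by (intro integrable_mult_right wt_powr_integrable) auto
  then show "integrable \<mu> (u j)"
    by (rule Bochner_Integration.integrable_bound[OF _ c(3)])
      (simp only: real_norm_def order_trans[OF c(4) abs_ge_self] AE_I2)
qed

context
  fixes A u
  assumes A: "W.decaying A" and u: "localized u"
begin

lemma comb_zero: "j \<notin> basis_idx \<or> fst j \<noteq> fst i \<Longrightarrow> A i j = 0"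
  using W.decaying_outside[OF A, of i j] decaying_block[OF A, of i j] by metis

lemma comb_dominated:
  obtains c \<sigma> where "0 \<le> c" "0 < \<sigma>"
    "\<And>i x S. finite S \<Longrightarrow> S \<subseteq> basis_idx \<Longrightarrow> (\<Sum>j\<in>S. \<bar>A i j * u j x\<bar>) \<le> c / sqrt (idx_vol i) * idx_wt i x powr \<sigma>"
proof -
  obtain c \<tau> where c: "0 \<le> c" "0 < \<tau>" "\<And>j x. j \<in> basis_idx \<Longrightarrow> \<bar>u j x\<bar> \<le> c / sqrt (idx_vol j) * idx_wt j x powr \<tau>"
    using u unfolding localized_def by blast
  obtain C \<sigma> where C: "0 < C" "0 < \<sigma>" "\<And>i x S a c. finite S \<Longrightarrow> 0 \<le> c \<Longrightarrow> (\<And>j. j \<in> S \<Longrightarrow> \<bar>a j\<bar> \<le> c / sqrt (idx_vol j) * idx_wt j x powr \<tau>) \<Longrightarrow>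
      (\<Sum>j\<in>S. \<bar>A i j * a j\<bar>) \<le> C * c / sqrt (idx_vol i) * idx_wt i x powr \<sigma>"
    using decaying_comb_bound[OF A c(2)] by blast
  show ?thesis
  proof
    show "0 \<le> C * c" "0 < \<sigma>"
      using C c by auto
    show "(\<Sum>j\<in>S. \<bar>A i j * u j x\<bar>) \<le> C * c / sqrt (idx_vol i) * idx_wt i x powr \<sigma>" if "finite S" "S \<subseteq> basis_idx" for i x S
      by (rule C(3)[OF that(1) c(1)]) (use c(3) that in auto)
  qed
qed

lemma comb_summable: "(\<lambda>j. A i j * u j x) summable_on UNIV"
proof -
  obtain c \<sigma> where c: "\<And>i x S. finite S \<Longrightarrow> S \<subseteq> basis_idx \<Longrightarrow> (\<Sum>j\<in>S. \<bar>A i j * u j x\<bar>) \<le> c / sqrt (idx_vol i) * idx_wt i x powr \<sigma>"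
    using comb_dominated by metis
  have "(\<lambda>j. \<bar>A i j * u j x\<bar>) summable_on UNIV"
  proof (rule nonneg_bdd_above_summable_on)
    show "bdd_above (sum (\<lambda>j. \<bar>A i j * u j x\<bar>) ` {F. F \<subseteq> UNIV \<and> finite F})"
    proof (rule bdd_aboveI2)
      fix F :: "(int \<times> 'a) set" assume "F \<in> {F. F \<subseteq> UNIV \<and> finite F}"
      then have F: "finite F" by simp
      have "(\<Sum>j\<in>F. \<bar>A i j * u j x\<bar>) = (\<Sum>j\<in>F \<inter> basis_idx. \<bar>A i j * u j x\<bar>)"
        using F comb_zero by (intro sum.mono_neutral_right) auto
      also have "\<dots> \<le> c / sqrt (idx_vol i) * idx_wt i x powr \<sigma>"
        using F by (intro c) auto
      finally show "(\<Sum>j\<in>F. \<bar>A i j * u j x\<bar>) \<le> c / sqrt (idx_vol i) * idx_wt i x powr \<sigma>" .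
    qed
  qed simp
  then have "(\<lambda>j. norm (A i j * u j x)) summable_on UNIV"
    by simp
  then show ?thesis
    by (rule abs_summable_summable)
qed

lemma comb_partial_tendsto: "(\<lambda>n. \<Sum>j\<in>exhaustion (fst i) n. A i j * u j x) \<longlonglongrightarrow> comb A u i x"
  unfolding comb_def by (rule exhaustion_tendsto[OF comb_summable]) (use comb_zero in auto)

lemma comb_partial_measurable: "(\<lambda>x. \<Sum>j\<in>exhaustion (fst i) n. A i j * u j x) \<in> borel_measurable \<mu>"
proof (intro borel_measurable_sum borel_measurable_times borel_measurable_const)
  show "u j \<in> borel_measurable \<mu>" if "j \<in> exhaustion (fst i) n" for j
    using u exhaustion_basis_idx[OF that] unfolding localized_def by blast
qed

lemma comb_localized: "localized (comb A u)"
proof -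
  obtain c \<sigma> where c: "0 \<le> c" "0 < \<sigma>" "\<And>i x S. finite S \<Longrightarrow> S \<subseteq> basis_idx \<Longrightarrow> (\<Sum>j\<in>S. \<bar>A i j * u j x\<bar>) \<le> c / sqrt (idx_vol i) * idx_wt i x powr \<sigma>"
    using comb_dominated by metis
  have m: "comb A u i \<in> borel_measurable \<mu>" for i
    by (rule borel_measurable_LIMSEQ_metric[OF comb_partial_measurable comb_partial_tendsto])
  have b: "\<bar>comb A u i x\<bar> \<le> c / sqrt (idx_vol i) * idx_wt i x powr \<sigma>" for i x
  proof (rule Lim_bounded[OF tendsto_rabs[OF comb_partial_tendsto]], intro allI impI)
    fix n
    have "\<bar>\<Sum>j\<in>exhaustion (fst i) n. A i j * u j x\<bar> \<le> (\<Sum>j\<in>exhaustion (fst i) n. \<bar>A i j * u j x\<bar>)"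
      by (rule sum_abs)
    also have "\<dots> \<le> c / sqrt (idx_vol i) * idx_wt i x powr \<sigma>"
      by (rule c(3)) (use exhaustion_basis_idx in auto)
    finally show "\<bar>\<Sum>j\<in>exhaustion (fst i) n. A i j * u j x\<bar> \<le> c / sqrt (idx_vol i) * idx_wt i x powr \<sigma>" .
  qed
  show ?thesis
    unfolding localized_def using c(1,2) m b by blast
qed

lemma comb_convergence:
  shows "(\<lambda>n. nsq \<mu> (\<lambda>x. comb A u i x - (\<Sum>j\<in>exhaustion (fst i) n. A i j * u j x))) \<longlonglongrightarrow> 0"
    and "\<And>g. g \<in> L2_functions \<mu> \<Longrightarrow>
      (\<lambda>n. L2_inner \<mu> (\<lambda>x. \<Sum>j\<in>exhaustion (fst i) n. A i j * u j x) g) \<longlonglongrightarrow> L2_inner \<mu> (comb A u i) g"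
proof -
  obtain c \<sigma> where c: "0 \<le> c" "0 < \<sigma>" "\<And>i x S. finite S \<Longrightarrow> S \<subseteq> basis_idx \<Longrightarrow> (\<Sum>j\<in>S. \<bar>A i j * u j x\<bar>) \<le> c / sqrt (idx_vol i) * idx_wt i x powr \<sigma>"
    using comb_dominated by metis
  have le: "\<bar>\<Sum>j\<in>exhaustion (fst i) n. A i j * u j x\<bar> \<le> c / sqrt (idx_vol i) * idx_wt i x powr \<sigma>" for n x
    by (rule order_trans[OF sum_abs c(3)]) (use exhaustion_basis_idx in auto)
  note dom = localized_dominant_L2[OF c(2)] comb_partial_measurable comb_partial_tendsto le
  show "(\<lambda>n. nsq \<mu> (\<lambda>x. comb A u i x - (\<Sum>j\<in>exhaustion (fst i) n. A i j * u j x))) \<longlonglongrightarrow> 0"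
    by (rule L2_dominated(2)[OF dom])
  show "(\<lambda>n. L2_inner \<mu> (\<lambda>x. \<Sum>j\<in>exhaustion (fst i) n. A i j * u j x) g) \<longlonglongrightarrow> L2_inner \<mu> (comb A u i) g"
    if "g \<in> L2_functions \<mu>" for g
    by (rule L2_dominated(3)[OF dom that])
qed

lemma comb_inner:
  assumes "g \<in> L2_functions \<mu>" "(\<lambda>j. A i j * L2_inner \<mu> (u j) g) summable_on UNIV"
  shows "L2_inner \<mu> (comb A u i) g = (\<Sum>\<^sub>\<infinity>j. A i j * L2_inner \<mu> (u j) g)"
proof (rule LIMSEQ_unique[OF comb_convergence(2)[OF assms(1)]])
  have "L2_inner \<mu> (\<lambda>x. \<Sum>j\<in>exhaustion (fst i) n. A i j * u j x) g = (\<Sum>j\<in>exhaustion (fst i) n. A i j * L2_inner \<mu> (u j) g)" for n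
    by (rule L2_inner_sum) (use localized_L2[OF u] exhaustion_basis_idx assms(1) in auto)
  moreover have "(\<lambda>n. \<Sum>j\<in>exhaustion (fst i) n. A i j * L2_inner \<mu> (u j) g) \<longlonglongrightarrow> (\<Sum>\<^sub>\<infinity>j. A i j * L2_inner \<mu> (u j) g)"
    by (rule exhaustion_tendsto[OF assms(2)]) (use comb_zero in auto)
  ultimately show "(\<lambda>n. L2_inner \<mu> (\<lambda>x. \<Sum>j\<in>exhaustion (fst i) n. A i j * u j x) g) \<longlonglongrightarrow> (\<Sum>\<^sub>\<infinity>j. A i j * L2_inner \<mu> (u j) g)"
    by simp
qed

lemma comb_approx:
  assumes \<Phi>: "\<Phi> \<subseteq> L2_functions \<mu>" and i: "i \<in> basis_idx"
    and a: "\<And>j. j \<in> basis_idx \<Longrightarrow> fst j = fst i \<Longrightarrow> A i j \<noteq> 0 \<Longrightarrow> L2_approx \<mu> \<Phi> (u j)"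
  shows "L2_approx \<mu> \<Phi> (comb A u i)"
proof (rule L2_approx_tendsto[OF \<Phi> localized_L2[OF comb_localized i] _ comb_convergence(1)])
  fix n
  let ?F = "{j \<in> exhaustion (fst i) n. A i j \<noteq> 0}"
  have "L2_approx \<mu> \<Phi> (\<lambda>x. \<Sum>j\<in>?F. A i j * u j x)"
  proof (rule L2_approx_sum[OF \<Phi>])
    show "L2_approx \<mu> \<Phi> (u j)" if "j \<in> ?F" for j
      using that exhaustion_basis_idx[of j "fst i" n] by (intro a) auto
  qed simp
  moreover have "(\<Sum>j\<in>?F. A i j * u j x) = (\<Sum>j\<in>exhaustion (fst i) n. A i j * u j x)" for x
    by (rule sum.mono_neutral_left) auto
  ultimately show "L2_approx \<mu> \<Phi> (\<lambda>x. \<Sum>j\<in>exhaustion (fst i) n. A i j * u j x)"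
    by simp
qed

end

end

context regular_dyadic_system
begin

section \<open>The normalized mixed basis and its Riesz bounds\<close>

definition c0 :: real where "c0 = 8 * A0 ^ 5"

lemma c0: "1 \<le> c0" "0 < c0" "0 \<le> c0"
  using one_le_power[OF A0_ge_1, of 5] A0_pos by (auto simp: c0_def)

lemma idx_vol_neq_0 [simp]: "idx_vol i \<noteq> 0"
  by (rule less_imp_neq[OF idx_vol_pos, symmetric])

lemma spline_support': "x \<in> X k \<Longrightarrow> spline k x y \<noteq> 0 \<Longrightarrow> d x y < c0 * sc k"
  using spline_support[of x k y] by (simp add: c0_def)

lemma hoelder_qcont:
  assumes r: "0 < r" and le: "\<And>y y'. d y y' \<le> r \<Longrightarrow> \<bar>f y - f y'\<bar> \<le> C * (d y y' / r) powr \<eta>"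
  shows "qcont f"
  unfolding qcont_def
proof (intro allI impI)
  fix y and \<epsilon> :: real assume \<epsilon>: "0 < \<epsilon>"
  define C' where "C' = max C 0 + 1"
  have C': "0 < C'" "C \<le> C'" by (auto simp: C'_def)
  define s where "s = min r (r * (\<epsilon> / C') powr (1 / \<eta>))"
  show "\<exists>s>0. \<forall>z. d y z < s \<longrightarrow> \<bar>f y - f z\<bar> < \<epsilon>"
  proof (intro exI[of _ s] conjI allI impI)
    show "0 < s"
      using r \<epsilon> C' by (simp add: s_def)
    fix z assume z: "d y z < s"
    have "d y z / r < (\<epsilon> / C') powr (1 / \<eta>)"
      using z r by (simp add: s_def divide_less_eq mult.commute)
    then have "(d y z / r) powr \<eta> < ((\<epsilon> / C') powr (1 / \<eta>)) powr \<eta>"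
      using r eta dist_nonneg by (intro powr_less_mono2) auto
    also have "\<dots> = \<epsilon> / C'"
      using \<epsilon> C' eta by (simp add: powr_powr)
    finally have p: "(d y z / r) powr \<eta> < \<epsilon> / C'" .
    have "\<bar>f y - f z\<bar> \<le> C * (d y z / r) powr \<eta>"
      using z by (intro le) (simp add: s_def)
    also have "\<dots> \<le> C' * (d y z / r) powr \<eta>"
      using C' by (intro mult_right_mono) auto
    also have "\<dots> < C' * (\<epsilon> / C')"
      using C' p by (intro mult_strict_left_mono) auto
    finally show "\<bar>f y - f z\<bar> < \<epsilon>"
      using C' by simp
  qed
qed

lemma qcont_spline: "x \<in> X k \<Longrightarrow> qcont (spline k x)"
  using spline_hoelder hoelder_qcont[OF sc_pos, of k "spline k x"] by metis

lemma spline_measurable: "x \<in> X k \<Longrightarrow> spline k x \<in> borel_measurable \<mu>"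
  by (intro qcont_measurable qcont_spline)

lemma spline_L2: "x \<in> X k \<Longrightarrow> spline k x \<in> L2_functions \<mu>"
  and spline_nsq: "x \<in> X k \<Longrightarrow> nsq \<mu> (spline k x) \<le> vol x (c0 * sc k)"
  by (rule bounded_support_L2; auto intro: spline_measurable spline_le_1 spline_support')+

text \<open>Division by the square root of a ball volume keeps the norms bounded above and below
  uniformly in level and position. Fine splines live on the scale \<delta> \<open>sc k\<close>, a
  fixed fraction, so the same normalization fits both kinds.\<close>

definition mixed_basis :: "int \<times> 'a \<Rightarrow> 'a \<Rightarrow> real" where
  "mixed_basis i x = (if snd i \<in> X (fst i) then spline (fst i) (snd i) x else spline (fst i + 1) (snd i) x) / sqrt (idx_vol i)"

lemma basis_idx_cases:
  assumes "i \<in> basis_idx"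
  obtains l where "l = fst i \<or> l = fst i + 1" "snd i \<in> X l" "mixed_basis i = (\<lambda>x. spline l (snd i) x / sqrt (idx_vol i))"
proof (cases "snd i \<in> X (fst i)")
  case True
  then show ?thesis
    by (intro that[of "fst i"]) (auto simp: mixed_basis_def)
next
  case False
  then show ?thesis
    using assms by (intro that[of "fst i + 1"]) (auto simp: mixed_basis_def basis_idx_def)
qed

lemma mixed_basis_le: "i \<in> basis_idx \<Longrightarrow> \<bar>mixed_basis i x\<bar> \<le> 1 / sqrt (idx_vol i)"
  by (auto simp: mixed_basis_def spline_le_1 intro!: divide_right_mono)

lemma mixed_basis_support:
  assumes "i \<in> basis_idx" "mixed_basis i x \<noteq> 0"
  shows "d (snd i) x < c0 * sc (fst i)"
proof -
  obtain l where l: "l = fst i \<or> l = fst i + 1" "snd i \<in> X l" "mixed_basis i = (\<lambda>x. spline l (snd i) x / sqrt (idx_vol i))"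
    using basis_idx_cases[OF assms(1)] .
  then have "d (snd i) x < c0 * sc l"
    using assms(2) by (intro spline_support') auto
  also have "\<dots> \<le> c0 * sc (fst i)"
    using l(1) c0 sc_le_Suc by (intro mult_left_mono) auto
  finally show ?thesis .
qed

lemma mixed_basis_L2: "i \<in> basis_idx \<Longrightarrow> mixed_basis i \<in> L2_functions \<mu>"
proof -
  assume "i \<in> basis_idx"
  then obtain l where l: "snd i \<in> X l" "mixed_basis i = (\<lambda>x. spline l (snd i) x / sqrt (idx_vol i))"
    using basis_idx_cases by metis
  have "(\<lambda>x. 1 / sqrt (idx_vol i) * spline l (snd i) x) \<in> L2_functions \<mu>"
    by (intro L2_scale spline_L2 l(1))
  then show "mixed_basis i \<in> L2_functions \<mu>"
    by (simp add: l(2))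
qed

lemma idx_wt_ge: "d (snd i) x \<le> c * sc (fst i) \<Longrightarrow> 0 \<le> c \<Longrightarrow> exp (- (c powr aexp)) \<le> idx_wt i x"
  unfolding idx_wt_def by (rule wt_ge) auto

lemma mixed_basis_localized: "localized mixed_basis"
  unfolding localized_def
proof (rule exI[of _ "exp (c0 powr aexp)"], rule exI[of _ "1 :: real"], intro conjI ballI allI)
  fix j assume j: "j \<in> basis_idx"
  show "mixed_basis j \<in> borel_measurable \<mu>"
    using L2_functionsD(1)[OF mixed_basis_L2[OF j]] .
  fix x
  show "\<bar>mixed_basis j x\<bar> \<le> exp (c0 powr aexp) / sqrt (idx_vol j) * idx_wt j x powr 1"
  proof (cases "mixed_basis j x = 0")
    case False
    have "exp (- (c0 powr aexp)) \<le> idx_wt j x"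
      using mixed_basis_support[OF j False] c0 by (intro idx_wt_ge) auto
    then have "1 \<le> exp (c0 powr aexp) * idx_wt j x"
      by (simp add: exp_minus field_simps)
    then have "1 / sqrt (idx_vol j) \<le> exp (c0 powr aexp) * idx_wt j x / sqrt (idx_vol j)"
      by (intro divide_right_mono) auto
    then show ?thesis
      using mixed_basis_le[OF j, of x] by simp
  qed simp
qed auto

lemma mixed_basis_hoelder:
  obtains C where "0 \<le> C" "\<And>j x x'. j \<in> basis_idx \<Longrightarrow> d x x' \<le> sc (fst j) \<Longrightarrow>
    \<bar>mixed_basis j x - mixed_basis j x'\<bar> \<le> C * (d x x' / sc (fst j)) powr \<eta> / sqrt (idx_vol j) * idx_wt j x powr 1"
proof -
  obtain C where C: "0 < C" "\<And>k x y y'. x \<in> X k \<Longrightarrow> \<bar>spline k x y - spline k x y'\<bar> \<le> C * (d y y' / sc k) powr \<eta>"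
    using spline_hoelder by blast
  \<comment> \<open>The point x may lie outside the support while x' lies inside; this larger
    radius, obtained from the quasi-triangle inequality, still contains x.\<close>
  define c1 where "c1 = A0 * (c0 + 1)"
  have c1: "0 \<le> c1" "c0 \<le> c1"
  proof -
    have "c0 \<le> 1 * (c0 + 1)"
      by simp
    also have "\<dots> \<le> A0 * (c0 + 1)"
      using c0 A0_ge_1 by (intro mult_right_mono) auto
    finally show "c0 \<le> c1"
      by (simp only: c1_def)
    then show "0 \<le> c1"
      using c0 by linarith
  qed
  define C' where "C' = C * (1 / \<delta>) powr \<eta> * exp (c1 powr aexp)"
  have d1: "1 \<le> (1 / \<delta>) powr \<eta>"
    using delta_bounds eta by (intro ge_one_powr_ge_zero) auto
  show ?thesis
  proof
    show "0 \<le> C'"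
      using C by (simp add: C'_def)
    fix j x x' assume j: "j \<in> basis_idx" and dx: "d x x' \<le> sc (fst j)"
    show "\<bar>mixed_basis j x - mixed_basis j x'\<bar> \<le> C' * (d x x' / sc (fst j)) powr \<eta> / sqrt (idx_vol j) * idx_wt j x powr 1"
    proof (cases "mixed_basis j x = 0 \<and> mixed_basis j x' = 0")
      case True
      then show ?thesis
        using C by (auto simp: C'_def intro!: mult_nonneg_nonneg divide_nonneg_nonneg)
    next
      case False
      have near: "d (snd j) x \<le> c1 * sc (fst j)"
      proof (cases "mixed_basis j x = 0")
        case True
        then have "d (snd j) x' < c0 * sc (fst j)"
          using False mixed_basis_support[OF j] by blast
        then have "A0 * (d (snd j) x' + d x' x) \<le> A0 * (c0 * sc (fst j) + sc (fst j))"
          using dx A0_pos by (intro mult_left_mono) (auto simp: dist_sym)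
        then show ?thesis
          using quasi_triangle[of "snd j" x x'] by (simp add: c1_def algebra_simps)
      next
        case nz: False
        have "d (snd j) x \<le> c0 * sc (fst j)"
          using mixed_basis_support[OF j nz] by simp
        also have "\<dots> \<le> c1 * sc (fst j)"
          using c1 by (intro mult_right_mono) auto
        finally show ?thesis .
      qed
      have "exp (- (c1 powr aexp)) \<le> idx_wt j x"
        by (rule idx_wt_ge[OF near c1(1)])
      then have e: "1 \<le> exp (c1 powr aexp) * idx_wt j x"
        by (simp add: exp_minus field_simps)
      obtain l where l: "l = fst j \<or> l = fst j + 1" "snd j \<in> X l" "mixed_basis j = (\<lambda>x. spline l (snd j) x / sqrt (idx_vol j))"
        using basis_idx_cases[OF j] .
      \<comment> \<open>A fine spline is regular on the scale \<delta> \<open>sc (fst j)\<close>;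
        expressing this on the coarse scale costs the constant (1 / \<delta>)^\<eta>.\<close>
      have "(d x x' / sc l) powr \<eta> \<le> (1 / \<delta>) powr \<eta> * (d x x' / sc (fst j)) powr \<eta>"
        using l(1)
      proof
        assume "l = fst j"
        then show ?thesis
          using mult_right_mono[OF d1, of "(d x x' / sc (fst j)) powr \<eta>"] by simp
      next
        assume "l = fst j + 1"
        then have "d x x' / sc l = (1 / \<delta>) * (d x x' / sc (fst j))"
          by (simp add: sc_Suc)
        then show ?thesis
          using delta_bounds dist_nonneg[of x x'] by (simp only: powr_mult)
      qed
      then have "\<bar>spline l (snd j) x - spline l (snd j) x'\<bar> \<le> C * ((1 / \<delta>) powr \<eta> * (d x x' / sc (fst j)) powr \<eta>)"
        using C(2)[OF l(2), of x x'] C(1) by (meson mult_left_mono order_trans less_imp_le)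
      also have "\<dots> \<le> C * ((1 / \<delta>) powr \<eta> * (d x x' / sc (fst j)) powr \<eta>) * (exp (c1 powr aexp) * idx_wt j x)"
        using C(1) mult_left_mono[OF e, of "C * ((1 / \<delta>) powr \<eta> * (d x x' / sc (fst j)) powr \<eta>)"] by simp
      finally have "\<bar>spline l (snd j) x - spline l (snd j) x'\<bar> \<le> C' * (d x x' / sc (fst j)) powr \<eta> * idx_wt j x"
        by (simp add: C'_def mult_ac)
      then have "\<bar>spline l (snd j) x - spline l (snd j) x'\<bar> / sqrt (idx_vol j) \<le> C' * (d x x' / sc (fst j)) powr \<eta> * idx_wt j x / sqrt (idx_vol j)"
        by (intro divide_right_mono) auto
      then show ?thesis
        unfolding l(3) by (simp add: diff_divide_distrib[symmetric])
    qed
  qed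
qed

text \<open>Inner products between different levels are replaced by 0, although they need not
  vanish: each level is orthonormalized on its own. Orthogonality between levels is obtained later
  from the nesting of the spline spaces.\<close>

definition Gram :: "int \<times> 'a \<Rightarrow> int \<times> 'a \<Rightarrow> real" where
  "Gram i j = (if i \<in> basis_idx \<and> j \<in> basis_idx \<and> fst i = fst j then L2_inner \<mu> (mixed_basis i) (mixed_basis j) else 0)"

lemma Gram_sym: "Gram i j = Gram j i"
  by (simp add: Gram_def L2_inner_sym)

lemma mixed_basis_nsq_bound:
  obtains C where "0 < C" "\<And>i. i \<in> basis_idx \<Longrightarrow> nsq \<mu> (mixed_basis i) \<le> C"
proof -
  obtain C where C: "0 < C" "\<And>x r. 0 < r \<Longrightarrow> vol x (c0 * r) \<le> C * vol x r"
    using vol_scale[OF c0(2)] by blast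
  show ?thesis
  proof
    show "0 < C" by fact
    fix i assume i: "i \<in> basis_idx"
    obtain l where l: "l = fst i \<or> l = fst i + 1" "snd i \<in> X l" "mixed_basis i = (\<lambda>x. spline l (snd i) x / sqrt (idx_vol i))"
      using basis_idx_cases[OF i] .
    have "sc l \<le> sc (fst i)"
      using l(1) sc_le_Suc by auto
    then have "c0 * sc l \<le> c0 * sc (fst i)"
      using c0 by (intro mult_left_mono) auto
    then have "nsq \<mu> (spline l (snd i)) \<le> vol (snd i) (c0 * sc (fst i))"
      by (rule order_trans[OF spline_nsq[OF l(2)] vol_mono'])
    also have "\<dots> \<le> C * idx_vol i"
      unfolding idx_vol_def by (rule C(2)) simp
    finally have "nsq \<mu> (spline l (snd i)) / idx_vol i \<le> C"
      by (simp add: pos_divide_le_eq)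
    moreover have "nsq \<mu> (mixed_basis i) = nsq \<mu> (spline l (snd i)) / idx_vol i"
      unfolding l(3) by (simp add: power_divide)
    ultimately show "nsq \<mu> (mixed_basis i) \<le> C"
      by simp
  qed
qed

text \<open>An entry can be nonzero only if the two supports meet. Then the points are at distance
  O(\<open>sc k\<close>), where the weight is bounded below, so bounded entries suffice for
  exponential decay.\<close>

lemma Gram_decays:
  obtains C where "0 \<le> C" "W.decays C 1 Gram"
proof -
  obtain C where C: "0 < C" "\<And>i. i \<in> basis_idx \<Longrightarrow> nsq \<mu> (mixed_basis i) \<le> C"
    using mixed_basis_nsq_bound by blast
  define c2 where "c2 = 2 * A0 * c0"
  have c2: "0 \<le> c2"
    using c0 A0_pos by (simp add: c2_def)
  define E where "E = exp (c2 powr aexp)"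
  have "W.decays (C * E) 1 Gram"
    unfolding W.decays_def
  proof (intro allI)
    fix i j
    show "\<bar>Gram i j\<bar> \<le> C * E * blk_wt i j powr 1"
    proof (cases "Gram i j = 0")
      case True
      then show ?thesis
        using C W.e_nonneg[of i j] by (simp add: E_def)
    next
      case False
      then have ij: "i \<in> basis_idx" "j \<in> basis_idx" "fst i = fst j" and g: "Gram i j = L2_inner \<mu> (mixed_basis i) (mixed_basis j)"
        by (auto simp: Gram_def split: if_splits)
      have "\<exists>x. mixed_basis i x * mixed_basis j x \<noteq> 0"
      proof (rule ccontr)
        assume "\<not> ?thesis"
        then have z: "mixed_basis i x * mixed_basis j x = 0" for x by blast
        have "L2_inner \<mu> (mixed_basis i) (mixed_basis j) = 0"
          unfolding L2_inner_def z by simp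
        then show False
          using False g by simp
      qed
      then obtain x where x: "mixed_basis i x \<noteq> 0" "mixed_basis j x \<noteq> 0" by auto
      have "d (snd i) (snd j) < A0 * (c0 * sc (fst i) + c0 * sc (fst i))"
        using mixed_basis_support[OF ij(1) x(1)] mixed_basis_support[OF ij(2) x(2)] ij(3)
        by (intro quasi_triangle'[of _ x]) (auto simp: dist_sym)
      then have "d (snd i) (snd j) \<le> c2 * sc (fst i)"
        by (simp add: c2_def algebra_simps)
      then have "exp (- (c2 powr aexp)) \<le> idx_wt i (snd j)"
        by (rule idx_wt_ge[OF _ c2])
      also have "idx_wt i (snd j) = blk_wt i j"
        using ij by (simp add: idx_wt_def blk_wt_def basis_idx_def)
      finally have e: "1 \<le> E * blk_wt i j"
        by (simp add: E_def exp_minus field_simps)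
      have "\<bar>Gram i j\<bar> \<le> (\<integral>x. \<bar>mixed_basis i x * mixed_basis j x\<bar> \<partial>\<mu>)"
        unfolding g L2_inner_def by (rule integral_abs_bound)
      also have "\<dots> \<le> (\<integral>x. ((mixed_basis i x)\<^sup>2 + (mixed_basis j x)\<^sup>2) / 2 \<partial>\<mu>)"
      proof (rule integral_mono)
        show "integrable \<mu> (\<lambda>x. \<bar>mixed_basis i x * mixed_basis j x\<bar>)"
          using ij by (intro integrable_abs integrable_mult_L2 mixed_basis_L2)
        show "integrable \<mu> (\<lambda>x. ((mixed_basis i x)\<^sup>2 + (mixed_basis j x)\<^sup>2) / 2)"
          using ij by (intro Bochner_Integration.integrable_divide Bochner_Integration.integrable_add L2_functionsD(2) mixed_basis_L2)
        show "\<bar>mixed_basis i x * mixed_basis j x\<bar> \<le> ((mixed_basis i x)\<^sup>2 + (mixed_basis j x)\<^sup>2) / 2" for x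
          using zero_le_power2[of "\<bar>mixed_basis i x\<bar> - \<bar>mixed_basis j x\<bar>"] by (simp add: abs_mult power2_diff)
      qed
      also have "\<dots> = (nsq \<mu> (mixed_basis i) + nsq \<mu> (mixed_basis j)) / 2"
        using ij L2_functionsD(2)[OF mixed_basis_L2] by simp
      also have "\<dots> \<le> C"
        using C(2)[OF ij(1)] C(2)[OF ij(2)] by simp
      also have "\<dots> \<le> C * (E * blk_wt i j)"
        using mult_left_mono[OF e, of C] C(1) by simp
      finally show ?thesis
        using W.e_nonneg[of i j] by (simp add: mult_ac)
    qed
  qed
  then show ?thesis
    using C by (intro that[of "C * E"]) (auto simp: E_def)
qed

text \<open>Lower Riesz bound: near a point of \<open>X k\<close> only the coarse spline of that point survives, near a new
  point of \<open>X (k + 1)\<close> the fine spline of that point plus the coarse part; the latter is already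
  controlled by the coefficients of the coarse splines.\<close>

definition rball :: "int \<Rightarrow> real" where "rball k = sc (k + 1) / (8 * A0 ^ 3)"

lemma rball: "0 < rball k" "rball k \<le> sc k / (8 * A0 ^ 3)" "rball k \<le> sc (k + 1) / (2 * A0)"
proof -
  show "0 < rball k"
    using A0_pos by (simp add: rball_def)
  show "rball k \<le> sc k / (8 * A0 ^ 3)"
    unfolding rball_def using A0_pos sc_le_Suc[of k] by (intro divide_right_mono) auto
  have "2 * A0 \<le> 8 * A0 ^ 3"
    using A0_pow_le[of 1 3] A0_pos by simp
  then show "rball k \<le> sc (k + 1) / (2 * A0)"
    unfolding rball_def using A0_pos by (intro divide_left_mono) auto
qed

lemma sum_indicator_balls:
  assumes "finite F" "F \<subseteq> X (k + 1)"
  shows "\<And>y. y \<in> F \<Longrightarrow> z \<in> quasi_ball d y (rball k) \<Longrightarrow> (\<Sum>j\<in>F. f j * indicator (quasi_ball d j (rball k)) z) = (f y :: real)"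
    and "(\<And>y. y \<in> F \<Longrightarrow> z \<notin> quasi_ball d y (rball k)) \<Longrightarrow> (\<Sum>j\<in>F. f j * indicator (quasi_ball d j (rball k)) z) = 0"
proof -
  fix y assume y: "y \<in> F" "z \<in> quasi_ball d y (rball k)"
  have dis: "disjoint_family_on (\<lambda>j. quasi_ball d j (rball k)) F"
    by (rule X_balls_disjoint[OF assms(2) rball(3)])
  have "z \<notin> quasi_ball d j (rball k)" if "j \<in> F" "j \<noteq> y" for j
    using disjoint_family_onD[OF dis that(1) y(1) that(2)] y(2) by blast
  then have "(\<Sum>j\<in>F. f j * indicator (quasi_ball d j (rball k)) z) = (\<Sum>j\<in>F. if j = y then f y else 0)"
    using y by (intro sum.cong) (auto simp: indicator_def simp del: mem_ball)
  then show "(\<Sum>j\<in>F. f j * indicator (quasi_ball d j (rball k)) z) = f y"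
    using assms(1) y by simp
next
  assume "\<And>y. y \<in> F \<Longrightarrow> z \<notin> quasi_ball d y (rball k)"
  then show "(\<Sum>j\<in>F. f j * indicator (quasi_ball d j (rball k)) z) = 0"
    by (simp add: indicator_def)
qed

lemma integral_indicator_balls:
  "finite F \<Longrightarrow> integrable \<mu> (\<lambda>z. \<Sum>j\<in>F. f j * indicator (quasi_ball d j r) z :: real)"
  "finite F \<Longrightarrow> (\<integral>z. (\<Sum>j\<in>F. f j * indicator (quasi_ball d j r) z) \<partial>\<mu>) = (\<Sum>j\<in>F. f j * vol j r)"
proof -
  have i: "integrable \<mu> (\<lambda>z. f j * indicator (quasi_ball d j r) z :: real)" for j
    using ball_sets emeasure_ball_finite[of j r] by (intro integrable_mult_right) (simp add: less_top)
  show "integrable \<mu> (\<lambda>z. \<Sum>j\<in>F. f j * indicator (quasi_ball d j r) z :: real)" if "finite F"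
    by (intro Bochner_Integration.integrable_sum i)
  show "(\<integral>z. (\<Sum>j\<in>F. f j * indicator (quasi_ball d j r) z) \<partial>\<mu>) = (\<Sum>j\<in>F. f j * vol j r)" if "finite F"
    using i by (subst Bochner_Integration.integral_sum) (auto simp: vol_def space_eq)
qed

lemma spline_sum_le:
  assumes "finite F" "F \<subseteq> X k"
  shows "(\<Sum>x\<in>F. spline k x y) \<le> 1"
proof -
  have "(\<Sum>x\<in>F. spline k x y) = (\<Sum>x\<in>F \<inter> near k y. spline k x y)"
    using assms spline_outside_near by (intro sum.mono_neutral_right) auto
  also have "\<dots> \<le> (\<Sum>x\<in>near k y. spline k x y)"
    by (intro sum_mono2) auto
  finally show ?thesis
    by (simp add: spline_sum)
qed

text \<open>Jensen's inequality for the weights \<open>spline k x y\<close>, whose sum is at most 1,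
  in the form of Cauchy-Schwarz with square roots of the weights.\<close>

lemma spline_comb_square:
  assumes "finite F" "F \<subseteq> X k"
  shows "(\<Sum>x\<in>F. c x * spline k x y)\<^sup>2 \<le> (\<Sum>x\<in>F. (c x)\<^sup>2 * spline k x y)"
proof -
  have "(\<Sum>x\<in>F. c x * spline k x y)\<^sup>2 = (\<Sum>x\<in>F. (c x * sqrt (spline k x y)) * sqrt (spline k x y))\<^sup>2"
    by (simp add: mult.assoc)
  also have "\<dots> \<le> (\<Sum>x\<in>F. (c x * sqrt (spline k x y))\<^sup>2) * (\<Sum>x\<in>F. (sqrt (spline k x y))\<^sup>2)"
    by (rule Cauchy_Schwarz_ineq_sum)
  also have "\<dots> = (\<Sum>x\<in>F. (c x)\<^sup>2 * spline k x y) * (\<Sum>x\<in>F. spline k x y)"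
    by (simp add: power_mult_distrib)
  also have "\<dots> \<le> (\<Sum>x\<in>F. (c x)\<^sup>2 * spline k x y) * 1"
    using spline_sum_le[OF assms, of y] by (intro mult_left_mono sum_nonneg) auto
  finally show ?thesis by simp
qed

lemma spline_integrable: "x \<in> X k \<Longrightarrow> integrable \<mu> (spline k x)"
  and spline_integral_le: "x \<in> X k \<Longrightarrow> (\<integral>y. spline k x y \<partial>\<mu>) \<le> vol x (c0 * sc k)"
proof -
  assume x: "x \<in> X k"
  have i: "integrable \<mu> (indicator (quasi_ball d x (c0 * sc k)) :: 'a \<Rightarrow> real)"
    using ball_sets emeasure_ball_finite[of x "c0 * sc k"] by (simp add: less_top)
  have le: "spline k x y \<le> indicator (quasi_ball d x (c0 * sc k)) y" for y
    using spline_support'[OF x, of y] spline_le_1[of k x y] by (cases "spline k x y = 0") auto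
  show s: "integrable \<mu> (spline k x)"
    by (rule Bochner_Integration.integrable_bound[OF i spline_measurable[OF x]]) (use le in auto)
  have "(\<integral>y. spline k x y \<partial>\<mu>) \<le> (\<integral>y. indicator (quasi_ball d x (c0 * sc k)) y \<partial>\<mu>)"
    by (rule integral_mono[OF s i le])
  then show "(\<integral>y. spline k x y \<partial>\<mu>) \<le> vol x (c0 * sc k)"
    using ball_sets by (simp add: vol_def space_eq)
qed

lemma single_level_lower_bound:
  obtains c where "0 < c" "\<And>k F x. finite F \<Longrightarrow> F \<subseteq> X (k + 1) \<Longrightarrow>
    c * (\<Sum>j\<in>F. (x j)\<^sup>2) \<le> nsq \<mu> (\<lambda>z. \<Sum>j\<in>F. x j * mixed_basis (k, j) z)"
proof -
  obtain C1 where C1: "0 < C1" "\<And>x r. 0 < r \<Longrightarrow> vol x (8 * A0 ^ 3 / \<delta> * r) \<le> C1 * vol x r"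
    using vol_scale[of "8 * A0 ^ 3 / \<delta>"] A0_pos delta_bounds by auto
  obtain C2 where C2: "0 < C2" "\<And>x r. 0 < r \<Longrightarrow> vol x (c0 * r) \<le> C2 * vol x r"
    using vol_scale[OF c0(2)] by blast
  have volr: "idx_vol (k, j) \<le> C1 * vol j (rball k)" for k j
    using C1(2)[OF rball(1), of j k] A0_pos delta_bounds by (simp add: idx_vol_def rball_def sc_Suc)
  \<comment> \<open>The coarse coefficients contribute C1 and the new ones 2 C1 (1 + C1 C2); the
    reciprocal of their sum is the Riesz constant.\<close>
  define c where "c = 1 / (3 * C1 + 2 * C1 * C1 * C2)"
  have c: "0 < c"
    using C1 C2 by (auto simp: c_def intro!: add_pos_pos)
  have "c * (\<Sum>j\<in>F. (x j)\<^sup>2) \<le> nsq \<mu> (\<lambda>z. \<Sum>j\<in>F. x j * mixed_basis (k, j) z)"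
    if F: "finite F" "F \<subseteq> X (k + 1)" for k F x
  proof -
    define FA where "FA = F \<inter> X k"
    define FB where "FB = F - X k"
    have FF: "F = FA \<union> FB" "FA \<inter> FB = {}" "finite FA" "finite FB" "FA \<subseteq> X k" "FB \<subseteq> X (k + 1)" "FA \<subseteq> X (k + 1)"
      using F by (auto simp: FA_def FB_def)
    define cf where "cf j = x j / sqrt (idx_vol (k, j))" for j
    define h where "h z = (\<Sum>j\<in>F. x j * mixed_basis (k, j) z)" for z
    define w where "w z = (\<Sum>j\<in>FA. cf j * spline k j z)" for z
    define v where "v z = (\<Sum>j\<in>FB. cf j * spline (k + 1) j z)" for z
    have hwv: "h z = w z + v z" for z
      unfolding h_def w_def v_def FF(1) sum.union_disjoint[OF FF(3,4,2)]
      by (intro arg_cong2[where f = "(+)"] sum.cong) (auto simp: mixed_basis_def cf_def FA_def FB_def)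
    have hL: "h \<in> L2_functions \<mu>"
      unfolding h_def using F by (intro L2_sum L2_scale mixed_basis_L2) (auto simp: basis_idx_def)
    have wL: "w \<in> L2_functions \<mu>"
      unfolding w_def using FF by (intro L2_sum L2_scale spline_L2) auto
    have cf2: "(cf j)\<^sup>2 * idx_vol (k, j) = (x j)\<^sup>2" for j
      by (simp add: cf_def power_divide)
    \<comment> \<open>An old point also belongs to \<open>X (k + 1)\<close>, and near it the only
      fine spline that does not vanish is its own, which is absent from the sum v.\<close>
    have v_old: "v z = 0" if "y \<in> X k" "d y z < rball k" for y z
    proof -
      have "spline (k + 1) j z = 0" if j: "j \<in> FB" for j
      proof -
        have "j \<in> X (k + 1)" "y \<in> X (k + 1)" "j \<noteq> y"
          using j FF(6) X_mono[of k] \<open>y \<in> X k\<close> by (auto simp: FB_def)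
        then show ?thesis
          using spline_near_reference_point[of j "k + 1" y z] \<open>d y z < rball k\<close> by (simp add: rball_def)
      qed
      then show ?thesis by (simp add: v_def)
    qed
    have w_old: "w z = cf y" if "y \<in> FA" "d y z < rball k" for y z
    proof -
      have "y \<in> X k" "d y z < sc k / (8 * A0 ^ 3)"
        using that FF(5) rball(2)[of k] by auto
      then have "w z = (\<Sum>j\<in>FA. if j = y then cf y else 0)"
        unfolding w_def using FF(5) spline_near_reference_point[of _ k y z] by (intro sum.cong) auto
      then show ?thesis using that FF by simp
    qed
    have v_new: "v z = cf y" if "y \<in> FB" "d y z < rball k" for y z
    proof -
      have "y \<in> X (k + 1)" "d y z < sc (k + 1) / (8 * A0 ^ 3)"
        using that FF(6) by (auto simp: rball_def)
      then have "v z = (\<Sum>j\<in>FB. if j = y then cf y else 0)"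
        unfolding v_def using FF(6) spline_near_reference_point[of _ "k + 1" y z] by (intro sum.cong) auto
      then show ?thesis using that FF by simp
    qed
    have 1: "(\<Sum>j\<in>FA. (cf j)\<^sup>2 * vol j (rball k)) \<le> nsq \<mu> h"
      unfolding integral_indicator_balls(2)[OF FF(3), symmetric]
    proof (rule integral_mono[OF integral_indicator_balls(1)[OF FF(3)] L2_functionsD(2)[OF hL]])
      fix z
      show "(\<Sum>j\<in>FA. (cf j)\<^sup>2 * indicator (quasi_ball d j (rball k)) z) \<le> (h z)\<^sup>2"
      proof (cases "\<exists>y\<in>FA. z \<in> quasi_ball d y (rball k)")
        case True
        then obtain y where y: "y \<in> FA" "z \<in> quasi_ball d y (rball k)" by blast
        then have "h z = cf y"
          using hwv w_old v_old FF by auto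
        then show ?thesis
          using sum_indicator_balls(1)[OF FF(3,7) y, of "\<lambda>j. (cf j)\<^sup>2"] by simp
      next
        case False
        then show ?thesis
          using sum_indicator_balls(2)[OF FF(3,7), of z "\<lambda>j. (cf j)\<^sup>2"] by simp
      qed
    qed
    have 2: "(\<Sum>j\<in>FB. ((cf j)\<^sup>2 / 2) * vol j (rball k)) \<le> nsq \<mu> h + nsq \<mu> w"
    proof -
      have "(\<Sum>j\<in>FB. ((cf j)\<^sup>2 / 2) * vol j (rball k)) \<le> (\<integral>z. (h z)\<^sup>2 + (w z)\<^sup>2 \<partial>\<mu>)"
        unfolding integral_indicator_balls(2)[OF FF(4), symmetric]
      proof (rule integral_mono[OF integral_indicator_balls(1)[OF FF(4)]])
        show "integrable \<mu> (\<lambda>z. (h z)\<^sup>2 + (w z)\<^sup>2)"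
          by (intro Bochner_Integration.integrable_add L2_functionsD(2) hL wL)
        fix z
        show "(\<Sum>j\<in>FB. ((cf j)\<^sup>2 / 2) * indicator (quasi_ball d j (rball k)) z) \<le> (h z)\<^sup>2 + (w z)\<^sup>2"
        proof (cases "\<exists>y\<in>FB. z \<in> quasi_ball d y (rball k)")
          case True
          then obtain y where y: "y \<in> FB" "z \<in> quasi_ball d y (rball k)" by blast
          then have hz: "h z = w z + cf y"
            using hwv v_new by auto
          \<comment> \<open>With h = a + b near a new point, this recovers the fine coefficient b at
            the price of the coarse part a, which has already been estimated.\<close>
          have ab: "b\<^sup>2 / 2 \<le> (a + b)\<^sup>2 + a\<^sup>2" for a b :: real
            using zero_le_power2[of "2 * a + b"] by (simp add: power2_eq_square algebra_simps)
          show ?thesis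
            unfolding sum_indicator_balls(1)[OF FF(4,6) y, of "\<lambda>j. (cf j)\<^sup>2 / 2"] hz by (rule ab)
        next
          case False
          then show ?thesis
            using sum_indicator_balls(2)[OF FF(4,6), of z "\<lambda>j. (cf j)\<^sup>2 / 2"] by simp
        qed
      qed
      then show ?thesis
        using L2_functionsD(2)[OF hL] L2_functionsD(2)[OF wL] by simp
    qed
    have 3: "nsq \<mu> w \<le> C2 * (\<Sum>j\<in>FA. (x j)\<^sup>2)"
    proof -
      have "nsq \<mu> w \<le> (\<integral>z. (\<Sum>j\<in>FA. (cf j)\<^sup>2 * spline k j z) \<partial>\<mu>)"
        using FF spline_integrable unfolding w_def[symmetric]
        by (intro integral_mono L2_functionsD(2)[OF wL] Bochner_Integration.integrable_sum integrable_mult_right)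
          (auto simp: w_def intro!: spline_comb_square)
      also have "\<dots> = (\<Sum>j\<in>FA. (cf j)\<^sup>2 * (\<integral>z. spline k j z \<partial>\<mu>))"
        using FF spline_integrable by (subst Bochner_Integration.integral_sum) auto
      also have "\<dots> \<le> (\<Sum>j\<in>FA. (cf j)\<^sup>2 * (C2 * idx_vol (k, j)))"
      proof (intro sum_mono mult_left_mono)
        fix j assume "j \<in> FA"
        then have "(\<integral>z. spline k j z \<partial>\<mu>) \<le> vol j (c0 * sc k)"
          using FF by (intro spline_integral_le) auto
        also have "\<dots> \<le> C2 * idx_vol (k, j)"
          unfolding idx_vol_def by (simp add: C2)
        finally show "(\<integral>z. spline k j z \<partial>\<mu>) \<le> C2 * idx_vol (k, j)" .
      qed simp
      also have "\<dots> = C2 * (\<Sum>j\<in>FA. (x j)\<^sup>2)"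
        unfolding cf2[symmetric] sum_distrib_left by (simp add: mult_ac)
      finally show ?thesis .
    qed
    have vx: "(x j)\<^sup>2 \<le> C1 * ((cf j)\<^sup>2 * vol j (rball k))" for j
      unfolding cf2[symmetric] using mult_left_mono[OF volr[of k j], of "(cf j)\<^sup>2"] by (simp add: mult_ac)
    have A: "(\<Sum>j\<in>FA. (x j)\<^sup>2) \<le> C1 * nsq \<mu> h"
    proof -
      have "(\<Sum>j\<in>FA. (x j)\<^sup>2) \<le> (\<Sum>j\<in>FA. C1 * ((cf j)\<^sup>2 * vol j (rball k)))"
        by (intro sum_mono vx)
      also have "\<dots> \<le> C1 * nsq \<mu> h"
        unfolding sum_distrib_left[symmetric] using C1 1 by (intro mult_left_mono) auto
      finally show ?thesis .
    qed
    have B: "(\<Sum>j\<in>FB. (x j)\<^sup>2) \<le> 2 * C1 * (nsq \<mu> h + C2 * (C1 * nsq \<mu> h))"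
    proof -
      have "(\<Sum>j\<in>FB. (x j)\<^sup>2) \<le> (\<Sum>j\<in>FB. 2 * C1 * (((cf j)\<^sup>2 / 2) * vol j (rball k)))"
        using vx by (intro sum_mono) simp
      also have "\<dots> \<le> 2 * C1 * (nsq \<mu> h + nsq \<mu> w)"
        unfolding sum_distrib_left[symmetric] using C1 2 by (intro mult_left_mono) auto
      also have "\<dots> \<le> 2 * C1 * (nsq \<mu> h + C2 * (C1 * nsq \<mu> h))"
        using C1 C2 3 A by (intro mult_left_mono add_left_mono order_trans[OF 3] mult_left_mono) auto
      finally show ?thesis .
    qed
    have "(\<Sum>j\<in>F. (x j)\<^sup>2) = (\<Sum>j\<in>FA. (x j)\<^sup>2) + (\<Sum>j\<in>FB. (x j)\<^sup>2)"
      unfolding FF(1) by (rule sum.union_disjoint[OF FF(3,4,2)])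
    also have "\<dots> \<le> (3 * C1 + 2 * C1 * C1 * C2) * nsq \<mu> h"
      using A B by (simp add: algebra_simps)
    finally have "c * (\<Sum>j\<in>F. (x j)\<^sup>2) \<le> c * ((3 * C1 + 2 * C1 * C1 * C2) * nsq \<mu> h)"
      using c by (intro mult_left_mono) auto
    also have "\<dots> = nsq \<mu> h"
      using c by (simp add: c_def zero_less_divide_iff)
    finally show ?thesis
      by (simp add: h_def)
  qed
  then show ?thesis
    by (rule that[OF c])
qed

text \<open>A finite index set splits into its levels; since cross-level entries are 0, the form is
  the sum of the forms of the single levels.\<close>

lemma Gram_lower_bound:
  obtains c where "0 < c" "\<And>F x. finite F \<Longrightarrow> F \<subseteq> basis_idx \<Longrightarrow> c * (\<Sum>i\<in>F. (x i)\<^sup>2) \<le> (\<Sum>i\<in>F. \<Sum>j\<in>F. x i * x j * Gram i j)"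
proof -
  obtain c where c: "0 < c" "\<And>k F x. finite F \<Longrightarrow> F \<subseteq> X (k + 1) \<Longrightarrow>
    c * (\<Sum>j\<in>F. (x j)\<^sup>2) \<le> nsq \<mu> (\<lambda>z. \<Sum>j\<in>F. x j * mixed_basis (k, j) z)"
    using single_level_lower_bound by blast
  have "c * (\<Sum>i\<in>F. (x i)\<^sup>2) \<le> (\<Sum>i\<in>F. \<Sum>j\<in>F. x i * x j * Gram i j)" if F: "finite F" "F \<subseteq> basis_idx" for F x
  proof -
    define L where "L = fst ` F"
    define S where "S k = {j. (k, j) \<in> F}" for k
    have fS: "finite (S k)" for k
      using F(1) by (rule finite_subset[of _ "snd ` F", rotated, OF finite_imageI]) (force simp: S_def)
    have fL: "finite L"
      using F by (simp add: L_def)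
    have Sk: "S k \<subseteq> X (k + 1)" for k
      using F by (auto simp: S_def basis_idx_def)
    have FS: "F = Sigma L S"
      by (auto simp: L_def S_def image_iff) force
    have split: "(\<Sum>i\<in>F. f i) = (\<Sum>k\<in>L. \<Sum>j\<in>S k. f (k, j))" for f :: "_ \<Rightarrow> real"
      unfolding FS by (subst sum.Sigma) (auto simp: fL fS)
    have level: "(\<Sum>i\<in>F. x (k, j) * x i * Gram (k, j) i) = (\<Sum>i\<in>S k. x (k, j) * x (k, i) * Gram (k, j) (k, i))"
      if k: "k \<in> L" for k j
    proof -
      have "(\<Sum>i\<in>F. x (k, j) * x i * Gram (k, j) i) = (\<Sum>i\<in>F \<inter> {i. fst i = k}. x (k, j) * x i * Gram (k, j) i)"
        using F by (intro sum.mono_neutral_right) (auto simp: Gram_def)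
      also have "\<dots> = (\<Sum>i\<in>S k. x (k, j) * x (k, i) * Gram (k, j) (k, i))"
        by (rule sum.reindex_bij_witness[of _ "Pair k" snd]) (auto simp: S_def)
      finally show ?thesis .
    qed
    have "c * (\<Sum>i\<in>F. (x i)\<^sup>2) = (\<Sum>k\<in>L. c * (\<Sum>j\<in>S k. (x (k, j))\<^sup>2))"
      unfolding split by (simp add: sum_distrib_left)
    also have "\<dots> \<le> (\<Sum>k\<in>L. nsq \<mu> (\<lambda>z. \<Sum>j\<in>S k. x (k, j) * mixed_basis (k, j) z))"
      by (intro sum_mono c(2) fS Sk)
    also have "\<dots> = (\<Sum>k\<in>L. \<Sum>j\<in>S k. \<Sum>i\<in>S k. x (k, j) * x (k, i) * Gram (k, j) (k, i))"
    proof (intro sum.cong refl)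
      fix k
      have J: "(k, j) \<in> basis_idx" if "j \<in> S k" for j
        using that Sk by (auto simp: basis_idx_def)
      have L: "mixed_basis (k, j) \<in> L2_functions \<mu>" if "j \<in> S k" for j
        using J[OF that] by (rule mixed_basis_L2)
      have "nsq \<mu> (\<lambda>z. \<Sum>j\<in>S k. x (k, j) * mixed_basis (k, j) z)
          = L2_inner \<mu> (\<lambda>z. \<Sum>j\<in>S k. x (k, j) * mixed_basis (k, j) z) (\<lambda>z. \<Sum>j\<in>S k. x (k, j) * mixed_basis (k, j) z)"
        by (simp add: L2_inner_def power2_eq_square)
      also have "\<dots> = (\<Sum>j\<in>S k. x (k, j) * L2_inner \<mu> (mixed_basis (k, j)) (\<lambda>z. \<Sum>j\<in>S k. x (k, j) * mixed_basis (k, j) z))"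
        by (rule L2_inner_sum) (auto intro!: L2_sum L2_scale L)
      also have "\<dots> = (\<Sum>j\<in>S k. x (k, j) * (\<Sum>i\<in>S k. x (k, i) * L2_inner \<mu> (mixed_basis (k, i)) (mixed_basis (k, j))))"
        by (intro sum.cong refl, subst L2_inner_sym, subst L2_inner_sum) (auto intro!: L)
      also have "\<dots> = (\<Sum>j\<in>S k. \<Sum>i\<in>S k. x (k, j) * x (k, i) * Gram (k, j) (k, i))"
        unfolding sum_distrib_left
        by (intro sum.cong refl) (auto simp: Gram_def J L2_inner_sym)
      finally show "nsq \<mu> (\<lambda>z. \<Sum>j\<in>S k. x (k, j) * mixed_basis (k, j) z)
          = (\<Sum>j\<in>S k. \<Sum>i\<in>S k. x (k, j) * x (k, i) * Gram (k, j) (k, i))" .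
    qed
    also have "\<dots> = (\<Sum>i\<in>F. \<Sum>j\<in>F. x i * x j * Gram i j)"
      unfolding split[of "\<lambda>i. \<Sum>j\<in>F. x i * x j * Gram i j"] by (intro sum.cong refl level[symmetric])
    finally show ?thesis .
  qed
  then show ?thesis
    by (rule that[OF c(1)])
qed

end

subsection \<open>Density of the splines\<close>

context homogeneous_space
begin

text \<open>A point far from x carries a ball disjoint from B(x, R) whose volume is at least a fixed
  fraction 1/D of \<open>vol x R\<close>. Passing to a ball containing both multiplies the volume by
  at least 1 + 1/D, and this is repeated.\<close>

lemma vol_unbounded:
  assumes "\<not> quasi_bounded d"
  obtains R where "0 < R" "M \<le> vol x R"
proof -
  obtain D where D: "0 < D" "\<And>y r. 0 < r \<Longrightarrow> vol y (4 * A0 ^ 3 * r) \<le> D * vol y r"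
    using vol_scale[of "4 * A0 ^ 3"] A0_pos by auto
  have far: "\<exists>y. R < d x y" for R
  proof (rule ccontr)
    assume "\<not> ?thesis"
    then have "d x y \<le> R" for y
      by (simp add: not_less)
    then have "A0 * (d y x + d x z) \<le> A0 * (R + R)" for y z
      using A0_pos by (intro mult_left_mono add_mono) (auto simp: dist_sym[of _ x])
    then have "d y z \<le> A0 * (R + R)" for y z
      using quasi_triangle[of y z x] order_trans by blast
    then show False
      using assms unfolding quasi_bounded_def by blast
  qed
  have step: "\<exists>R'\<ge>R. (1 + 1 / D) * vol x R \<le> vol x R'" if R: "0 < R" for R
  proof -
    obtain y where y: "2 * A0 * R < d x y"
      using far by blast
    have "0 < 2 * A0 * R"
      using R A0_pos by simp
    then have dp: "0 < d x y"
      using y by linarith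
    define s where "s = d x y / (2 * A0)"
    have s: "R < s" "0 < s" "d x y = 2 * A0 * s"
      using y R A0_pos dp by (auto simp: s_def field_simps)
    have As: "s \<le> A0 * s" "s \<le> A0\<^sup>2 * s"
      using s A0_ge_1 mult_right_mono[of 1 A0 s] mult_right_mono[OF one_le_power[OF A0_ge_1, of 2], of s] by auto
    have dis: "quasi_ball d x R \<inter> quasi_ball d y s = {}"
    proof (rule equals0I)
      fix z assume "z \<in> quasi_ball d x R \<inter> quasi_ball d y s"
      then have "d x y < A0 * (s + s)"
        using s by (intro quasi_triangle'[of _ z]) (auto simp: dist_sym)
      then show False
        using s by simp
    qed
    define R' where "R' = A0 * ((2 * A0 * s + s) + s)"
    have R': "R \<le> R'"
    proof -
      have "A0 * s \<le> R'"
        unfolding R'_def using As A0_pos s by (intro mult_left_mono) auto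
      then show ?thesis using As(1) s(1) by linarith
    qed
    have sub: "quasi_ball d y s \<subseteq> quasi_ball d x R'"
    proof
      fix z assume "z \<in> quasi_ball d y s"
      then have "d x z < A0 * ((2 * A0 * s + s) + s)"
        using s by (intro quasi_triangle'[of x y]) auto
      then show "z \<in> quasi_ball d x R'"
        by (simp only: R'_def mem_ball)
    qed
    have "vol x R \<le> D * vol y s"
    proof -
      have "quasi_ball d x R \<subseteq> quasi_ball d y (4 * A0 ^ 3 * s)"
      proof
        fix z assume "z \<in> quasi_ball d x R"
        then have "d y z < A0 * ((2 * A0 * s + s) + s)"
          using s by (intro quasi_triangle'[of y x]) (auto simp: dist_sym)
        also have "\<dots> \<le> A0 * (4 * (A0\<^sup>2 * s))"
        proof -
          have "A0 * s \<le> A0\<^sup>2 * s"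
            using s A0_ge_1 by (intro mult_right_mono) (auto simp: power2_eq_square)
          then have "(2 * A0 * s + s) + s \<le> 4 * (A0\<^sup>2 * s)"
            using As(2) by linarith
          then show ?thesis
            using A0_pos by (intro mult_left_mono) auto
        qed
        finally show "z \<in> quasi_ball d y (4 * A0 ^ 3 * s)"
          by (simp add: power_numeral_reduce mult_ac)
      qed
      then show ?thesis
        using D(2)[OF s(2), of y] vol_mono by (meson order_trans)
    qed
    then have "vol x R / D \<le> vol y s"
      using D(1) by (simp add: divide_le_eq mult.commute)
    moreover have "vol x R + vol y s \<le> vol x R'"
    proof -
      have "vol x R + vol y s = measure \<mu> (quasi_ball d x R \<union> quasi_ball d y s)"
        unfolding vol_def using dis ball_sets emeasure_ball_finite
        by (intro measure_Union[symmetric]) auto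
      also have "\<dots> \<le> vol x R'"
        unfolding vol_def using sub R' ball_sets emeasure_ball_finite[of x R']
        by (intro measure_mono_fmeasurable) (auto intro!: fmeasurableI simp: less_top)
      finally show ?thesis .
    qed
    ultimately have "(1 + 1 / D) * vol x R \<le> vol x R'"
      by (simp add: distrib_right)
    then show ?thesis using R' by blast
  qed
  have "\<exists>R>0. (1 + 1 / D) ^ n * vol x 1 \<le> vol x R" for n
  proof (induction n)
    case 0
    show ?case by (intro exI[of _ 1]) simp
  next
    case (Suc n)
    then obtain R where R: "0 < R" "(1 + 1 / D) ^ n * vol x 1 \<le> vol x R" by blast
    obtain R' where R': "R \<le> R'" "(1 + 1 / D) * vol x R \<le> vol x R'"
      using step[OF R(1)] by blast
    have "(1 + 1 / D) * ((1 + 1 / D) ^ n * vol x 1) \<le> (1 + 1 / D) * vol x R"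
      using R D by (intro mult_left_mono) auto
    then show ?case
      using R R' by (intro exI[of _ R']) auto
  qed
  moreover obtain n where "M / vol x 1 < (1 + 1 / D) ^ n"
    using real_arch_pow[of "1 + 1 / D" "M / vol x 1"] D by auto
  ultimately show ?thesis
    using that vol_pos[of 1 x] by (metis divide_less_eq less_imp_le order_trans zero_less_one)
qed

lemma indicator_L2:
  assumes "E \<in> sets \<mu>" "E \<subseteq> quasi_ball d x R"
  shows "(indicator E :: 'a \<Rightarrow> real) \<in> L2_functions \<mu>"
  by (rule bounded_support_L2(1)[of _ x R]) (use assms in \<open>auto simp: indicator_def split: if_splits\<close>)

text \<open>Balls of d may fail to be open. Balls of the continuous metric \<open>rho\<close> are
  open and bounded, so they exhaust the space by open sets of finite measure.\<close>

definition rho_ball :: "nat \<Rightarrow> 'a set" where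
  "rho_ball n = {x. rho undefined x < real n}"

lemma rho_ball_open: "openin (quasi_topology d) (rho_ball n)"
  unfolding rho_ball_def by (rule qcont_openin(2)[OF qcont_rho])

lemma rho_ball_bounded: "\<exists>R. rho_ball n \<subseteq> quasi_ball d undefined R"
proof
  show "rho_ball n \<subseteq> quasi_ball d undefined ((Krho * real n) powr (1 / aexp) + 1)"
  proof
    fix x assume "x \<in> rho_ball n"
    then have "Krho * rho undefined x \<le> Krho * real n"
      using Krho(1) by (intro mult_left_mono) (auto simp: rho_ball_def)
    then have "d undefined x powr aexp \<le> Krho * real n"
      by (rule order_trans[OF Krho(2)])
    then have "(d undefined x powr aexp) powr (1 / aexp) \<le> (Krho * real n) powr (1 / aexp)"
      using aexp by (intro powr_mono2) auto
    then show "x \<in> quasi_ball d undefined ((Krho * real n) powr (1 / aexp) + 1)"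
      using aexp dist_nonneg[of undefined x] by (simp add: powr_powr)
  qed
qed

end

context regular_dyadic_system
begin

definition splines :: "int \<Rightarrow> ('a \<Rightarrow> real) set" where
  "splines k = spline k ` X k"

lemma splines_L2: "splines k \<subseteq> L2_functions \<mu>"
  by (auto simp: splines_def spline_L2)

lemma all_splines_L2: "(\<Union>k. splines k) \<subseteq> L2_functions \<mu>"
  using splines_L2 by blast

text \<open>The splines whose supporting ball lies inside U sum to a function that vanishes off U
  and is at most 1. At a point of U it equals 1 from some generation on, since all splines active
  there eventually fit into U; dominated convergence applies.\<close>

lemma approx_indicator_open:
  assumes U: "openin (quasi_topology d) U" "U \<subseteq> quasi_ball d u R"
  shows "L2_approx \<mu> (\<Union>k. splines k) (indicator U)"
proof -
  define T where "T m = {x \<in> X (int m). quasi_ball d x (c0 * sc (int m)) \<subseteq> U}" for m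
  have finT: "finite (T m)" for m
  proof (rule finite_subset[OF _ X_finite_near])
    show "T m \<subseteq> {x \<in> X (int m). d u x < R}"
    proof
      fix x assume x: "x \<in> T m"
      then have "x \<in> quasi_ball d x (c0 * sc (int m))"
        using c0 delta_bounds by simp
      then have "x \<in> quasi_ball d u R"
        using x U(2) unfolding T_def by blast
      then show "x \<in> {x \<in> X (int m). d u x < R}"
        using x by (simp add: T_def)
    qed
  qed
  define f where "f m y = (\<Sum>x\<in>T m. 1 * spline (int m) x y)" for m y
  have TX: "T m \<subseteq> X (int m)" for m
    by (auto simp: T_def)
  have f0: "f m y = 0" if "y \<notin> U" for m y
  proof -
    have "spline (int m) x y = 0" if "x \<in> T m" for x
    proof (rule ccontr)
      assume "spline (int m) x y \<noteq> 0"
      then have "y \<in> quasi_ball d x (c0 * sc (int m))"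
        using spline_support'[of x "int m" y] that TX by auto
      then show False
        using that \<open>y \<notin> U\<close> unfolding T_def by blast
    qed
    then show ?thesis by (simp add: f_def)
  qed
  have fb: "0 \<le> f m y" "f m y \<le> 1" for m y
    using spline_sum_le[OF finT TX, of m y] by (auto simp: f_def intro: sum_nonneg)
  have lim: "(\<lambda>m. f m y) \<longlonglongrightarrow> indicator U y" for y
  proof (cases "y \<in> U")
    case True
    then obtain r where r: "0 < r" "quasi_ball d y r \<subseteq> U"
      using U(1) unfolding openin_quasi_topology by blast
    obtain m0 where m0: "(2 * A0 * c0) * sc (0 + int m0) < r"
      using sc_small[OF r(1)] by blast
    have "f m y = 1" if m: "m0 \<le> m" for m
    proof -
      have "sc (int m) \<le> sc (int m0)"
        using sc_antimono[of "int m0" "m - m0"] m by (simp add: of_nat_diff)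
      then have "2 * A0 * c0 * sc (int m) \<le> 2 * A0 * c0 * sc (int m0)"
        using A0_pos c0 by (intro mult_left_mono) auto
      then have small: "A0 * (c0 * sc (int m) + c0 * sc (int m)) < r"
        using m0 by (simp add: algebra_simps)
      have "spline (int m) x y = 0" if x: "x \<in> near (int m) y - T m" for x
      proof (rule ccontr)
        assume nz: "spline (int m) x y \<noteq> 0"
        have xX: "x \<in> X (int m)"
          using x near_subset by blast
        have dx: "d x y < c0 * sc (int m)"
          by (rule spline_support'[OF xX nz])
        have "quasi_ball d x (c0 * sc (int m)) \<subseteq> quasi_ball d y r"
        proof
          fix z assume "z \<in> quasi_ball d x (c0 * sc (int m))"
          then have "d y z < A0 * (c0 * sc (int m) + c0 * sc (int m))"
            using dx by (intro quasi_triangle'[of _ x]) (auto simp: dist_sym)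
          then show "z \<in> quasi_ball d y r"
            using small by simp
        qed
        then have "x \<in> T m"
          using r xX by (auto simp: T_def)
        then show False using x by blast
      qed
      then have "(\<Sum>x\<in>near (int m) y. spline (int m) x y) = (\<Sum>x\<in>near (int m) y \<inter> T m. spline (int m) x y)"
        by (intro sum.mono_neutral_right) auto
      also have "\<dots> = (\<Sum>x\<in>T m. spline (int m) x y)"
      proof (rule sum.mono_neutral_left[OF finT])
        show "\<forall>x\<in>T m - near (int m) y \<inter> T m. spline (int m) x y = 0"
          using spline_outside_near[of _ "int m" y] TX[of m] by blast
      qed simp
      finally show ?thesis
        by (simp add: f_def spline_sum)
    qed
    then have "\<forall>\<^sub>F m in sequentially. f m y = 1"
      by (auto simp: eventually_sequentially)
    then show ?thesis
      using True by (simp add: tendsto_eventually)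
  next
    case False
    then show ?thesis using f0 by simp
  qed
  have fs: "f m \<in> fspan (\<Union>k. splines k)" for m
    unfolding f_def[abs_def]
    by (rule fspan_sum[OF finT]) (use TX in \<open>auto simp: splines_def intro!: fspan_base\<close>)
  have le: "\<bar>f m y\<bar> \<le> indicator U y" for m y
    using fb[of m y] f0[of y m] by (cases "y \<in> U") auto
  note dom = L2_dominated[OF indicator_L2[OF open_sets[OF U(1)] U(2)] _ lim le]
  have fm: "f m \<in> borel_measurable \<mu>" for m
    using L2_functionsD(1)[OF fspan_L2[OF fs all_splines_L2]] .
  show ?thesis
    by (rule L2_approx_tendsto[OF all_splines_L2 dom(1)[OF fm] L2_approx_span[OF fs all_splines_L2] dom(2)[OF fm]])
qed

text \<open>Dynkin's theorem: open sets form an intersection-stable generator, and approximability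
  passes to complements and disjoint unions. Intersecting with a bounded open set keeps every
  indicator square integrable.\<close>

lemma approx_indicator:
  assumes "E \<in> sets \<mu>"
  shows "L2_approx \<mu> (\<Union>k. splines k) (indicator (E \<inter> rho_ball n))"
proof -
  obtain R where R: "rho_ball n \<subseteq> quasi_ball d undefined R"
    using rho_ball_bounded by blast
  have Bs: "rho_ball n \<in> sets \<mu>"
    by (rule open_sets[OF rho_ball_open])
  let ?G = "{U. openin (quasi_topology d) U}"
  have B: "L2_approx \<mu> (\<Union>k. splines k) (indicator (rho_ball n))"
    by (rule approx_indicator_open[OF rho_ball_open R])
  have E: "E \<in> sigma_sets UNIV ?G"
    using assms by (simp add: sets_eq)
  have "Int_stable ?G" "?G \<subseteq> Pow UNIV"
    by (auto simp: Int_stable_def)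
  from this E show ?thesis
  proof (induction rule: sigma_sets_induct_disjoint)
    case (basic A)
    then have "openin (quasi_topology d) (A \<inter> rho_ball n)"
      using rho_ball_open by (auto intro: openin_Int)
    then show ?case
      using R by (intro approx_indicator_open) auto
  next
    case empty
    show ?case
      using L2_approx_span[OF fspan.zero all_splines_L2] by (simp add: indicator_def[abs_def])
  next
    case (compl A)
    have "(\<lambda>x. indicator (rho_ball n) x + (-1) * indicator (A \<inter> rho_ball n) x) = (indicator ((UNIV - A) \<inter> rho_ball n) :: 'a \<Rightarrow> real)"
      by (auto simp: indicator_def)
    then show ?case
      using L2_approx_add[OF all_splines_L2 B compl(2), of "-1"] by simp
  next
    case (union A)
    define f where "f m x = (\<Sum>i<m. 1 * indicator (A i \<inter> rho_ball n) x :: real)" for m :: nat and x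
    have f_eq: "f m x = indicator ((\<Union>i<m. A i) \<inter> rho_ball n) x" for m x
    proof -
      have "(\<Sum>i<m. indicator (A i) x :: real) = indicator (\<Union>i<m. A i) x"
        using union(1) by (subst indicator_UN_disjoint) (auto simp: disjoint_family_on_def)
      then show ?thesis
        by (simp add: f_def indicator_inter_arith sum_distrib_right[symmetric])
    qed
    have fap: "L2_approx \<mu> (\<Union>k. splines k) (f m)" for m
      unfolding f_def[abs_def] using union(3) by (intro L2_approx_sum all_splines_L2) auto
    have lim: "(\<lambda>m. f m x) \<longlonglongrightarrow> indicator ((\<Union>i. A i) \<inter> rho_ball n) x" for x
    proof (cases "\<exists>i. x \<in> A i")
      case True
      then obtain i where i: "x \<in> A i" by blast
      have "f m x = indicator ((\<Union>i. A i) \<inter> rho_ball n) x" if "Suc i \<le> m" for m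
        unfolding f_eq using i that by (auto simp: indicator_def)
      then have "\<forall>\<^sub>F m in sequentially. f m x = indicator ((\<Union>i. A i) \<inter> rho_ball n) x"
        unfolding eventually_sequentially by blast
      then show ?thesis by (rule tendsto_eventually)
    next
      case False
      then show ?thesis by (simp add: f_eq)
    qed
    have le: "\<bar>f m x\<bar> \<le> indicator (rho_ball n) x" for m x
      unfolding f_eq by (simp add: indicator_def)
    note dom = L2_dominated[OF indicator_L2[OF Bs R] L2_functionsD(1)[OF L2_approx_L2[OF fap]] lim le]
    show ?case
      by (rule L2_approx_tendsto[OF all_splines_L2 dom(1) fap dom(2)])
  qed
qed

lemma splines_dense:
  assumes f: "f \<in> L2_functions \<mu>"
  shows "L2_approx \<mu> (\<Union>k. splines k) f"
proof -
  obtain s where s: "\<And>i. simple_function \<mu> (s i)" "\<And>x. (\<lambda>i. s i x) \<longlonglongrightarrow> f x" "\<And>i x. dist (s i x) 0 \<le> 2 * dist (f x) (0 :: real)"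
    using borel_measurable_implies_sequence_metric[OF L2_functionsD(1)[OF f], of 0] by (auto simp: space_eq)
  define g where "g i x = s i x * indicator (rho_ball i) x" for i x
  have gap: "L2_approx \<mu> (\<Union>k. splines k) (g i)" for i
  proof -
    have fin: "finite (s i ` UNIV)"
      using simple_functionD(1)[OF s(1)[of i]] by (simp add: space_eq)
    have "g i x = (\<Sum>y\<in>s i ` UNIV. y * indicator ((s i -` {y}) \<inter> rho_ball i) x)" for x
    proof -
      have "(\<Sum>y\<in>s i ` UNIV. y * indicator ((s i -` {y}) \<inter> rho_ball i) x)
          = (\<Sum>y\<in>s i ` UNIV. if y = s i x then g i x else 0)"
        by (intro sum.cong) (auto simp: g_def indicator_def)
      then show ?thesis
        using fin by simp
    qed
    then have "g i = (\<lambda>x. \<Sum>y\<in>s i ` UNIV. y * indicator ((s i -` {y}) \<inter> rho_ball i) x)"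
      by blast
    moreover have "L2_approx \<mu> (\<Union>k. splines k) (\<lambda>x. \<Sum>y\<in>s i ` UNIV. y * indicator ((s i -` {y}) \<inter> rho_ball i) x)"
      using simple_functionD(2)[OF s(1)[of i]] fin
      by (intro L2_approx_sum all_splines_L2 approx_indicator) (auto simp: space_eq)
    ultimately show ?thesis by simp
  qed
  have lim: "(\<lambda>i. g i x) \<longlonglongrightarrow> f x" for x
  proof -
    obtain m :: nat where m: "rho undefined x < real m"
      using reals_Archimedean2 by blast
    have "\<forall>\<^sub>F i in sequentially. s i x = g i x"
      unfolding eventually_sequentially using m by (intro exI[of _ m]) (auto simp: g_def rho_ball_def indicator_def)
    then show ?thesis
      by (rule Lim_transform_eventually[OF s(2)])
  qed
  have le: "\<bar>g i x\<bar> \<le> 2 * \<bar>f x\<bar>" for i x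
    using s(3)[of i x] by (auto simp: g_def indicator_def)
  have "(\<lambda>x. 2 * \<bar>f x\<bar>) \<in> L2_functions \<mu>"
    by (rule L2_bound[OF L2_scale[OF f, of 2]]) (use L2_functionsD(1)[OF f] in auto)
  note dom = L2_dominated[OF this L2_functionsD(1)[OF L2_approx_L2[OF gap]] lim le]
  show ?thesis
    by (rule L2_approx_tendsto[OF all_splines_L2 f gap dom(2)])
qed

end

subsection \<open>The wavelets\<close>

lemma L2_inner_fspan_zero:
  assumes "g \<in> fspan \<Phi>" "\<Phi> \<subseteq> L2_functions M" "h \<in> L2_functions M"
    and "\<And>\<phi>. \<phi> \<in> \<Phi> \<Longrightarrow> L2_inner M \<phi> h = 0"
  shows "L2_inner M g h = 0"
  using assms(1)
proof induction
  case zero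
  show ?case by (simp add: L2_inner_def)
next
  case (add g \<phi> c)
  have g: "g \<in> L2_functions M" and \<phi>: "\<phi> \<in> L2_functions M"
    using fspan_L2[OF add(1) assms(2)] add(2) assms(2) by auto
  have "L2_inner M (\<lambda>x. g x + c * \<phi> x) h = (\<integral>x. g x * h x + c * (\<phi> x * h x) \<partial>M)"
    by (simp add: L2_inner_def algebra_simps)
  also have "\<dots> = L2_inner M g h + c * L2_inner M \<phi> h"
    unfolding L2_inner_def
    by (subst Bochner_Integration.integral_add)
      (auto intro!: integrable_mult_L2 integrable_mult_right g \<phi> assms(3))
  finally show ?case
    using add assms(4) by simp
qed

context regular_dyadic_system
begin

lemma Gram_decaying: "W.decaying Gram"
proof -
  obtain C where "W.decays C 1 Gram"
    using Gram_decays by blast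
  then show ?thesis
    by (rule W.decayingI) simp
qed

lemma mixed_basis_coarse: "x \<in> X k \<Longrightarrow> spline k x = (\<lambda>z. sqrt (idx_vol (k, x)) * mixed_basis (k, x) z)"
  by (simp add: mixed_basis_def)

lemma mixed_basis_fine: "x \<in> X (k + 1) \<Longrightarrow> x \<notin> X k \<Longrightarrow> spline (k + 1) x = (\<lambda>z. sqrt (idx_vol (k, x)) * mixed_basis (k, x) z)"
  by (simp add: mixed_basis_def)

lemma basis_idx_memI: "x \<in> X (k + 1) \<Longrightarrow> (k, x) \<in> basis_idx" "x \<in> X k \<Longrightarrow> (k, x) \<in> basis_idx"
  using X_mono[of k] by (auto simp: basis_idx_def)

context
  fixes A H :: "int \<times> 'a \<Rightarrow> int \<times> 'a \<Rightarrow> real"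
  assumes A: "W.decaying A" and H: "W.decaying H"
    and H_outside: "\<And>i j. i \<notin> new_idx \<or> j \<notin> new_idx \<Longrightarrow> H i j = 0"
    and A_Gram: "mmul A Gram = H" and H_A: "mmul H (\<lambda>i j. A j i) = mident new_idx"
    and H_A_Y: "\<And>i j. j \<in> new_idx \<Longrightarrow> mmul H A i j = mident new_idx i j"
begin

definition psi :: "int \<times> 'a \<Rightarrow> 'a \<Rightarrow> real" where
  "psi = comb A mixed_basis"

lemma psi_localized: "localized psi"
  unfolding psi_def by (rule comb_localized[OF A mixed_basis_localized])

lemma new_idx_basis_idx: "i \<in> new_idx \<Longrightarrow> i \<in> basis_idx"
  by (simp add: new_idx_def)

lemma psi_L2: "i \<in> new_idx \<Longrightarrow> psi i \<in> L2_functions \<mu>"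
  by (rule localized_L2[OF psi_localized new_idx_basis_idx])

lemma A_nonzero: "A i j \<noteq> 0 \<Longrightarrow> j \<in> basis_idx \<and> fst j = fst i"
  using comb_zero[OF A mixed_basis_localized, of j i] by blast

text \<open>\<open>A Gram = H\<close> identifies H as the table of inner products. Since H vanishes
  in all columns outside \<open>new_idx\<close>, the wavelets are orthogonal to the coarse splines
  of their level.\<close>

lemma psi_inner_mixed_basis:
  assumes "j \<in> basis_idx" "fst i = fst j"
  shows "L2_inner \<mu> (psi i) (mixed_basis j) = H i j"
proof -
  have eq: "A i l * L2_inner \<mu> (mixed_basis l) (mixed_basis j) = A i l * Gram l j" for l
    using A_nonzero[of i l] assms by (cases "A i l = 0") (auto simp: Gram_def)
  have "L2_inner \<mu> (psi i) (mixed_basis j) = (\<Sum>\<^sub>\<infinity>l. A i l * L2_inner \<mu> (mixed_basis l) (mixed_basis j))"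
    unfolding psi_def
    by (rule comb_inner[OF A mixed_basis_localized mixed_basis_L2[OF assms(1)]])
      (simp only: eq W.mmul_summable[OF A Gram_decaying])
  also have "\<dots> = mmul A Gram i j"
    by (simp add: eq mmul_def)
  finally show ?thesis
    by (simp add: A_Gram)
qed

lemma psi_inner_spline:
  assumes i: "i \<in> new_idx" and x: "x \<in> X (fst i - int m)"
  shows "L2_inner \<mu> (psi i) (spline (fst i - int m) x) = 0"
  using x
proof (induction m arbitrary: x)
  case 0
  then have x: "x \<in> X (fst i)" by simp
  have "L2_inner \<mu> (psi i) (spline (fst i) x) = sqrt (idx_vol (fst i, x)) * L2_inner \<mu> (psi i) (mixed_basis (fst i, x))"
    unfolding mixed_basis_coarse[OF x] by (simp add: L2_inner_def mult.left_commute)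
  also have "L2_inner \<mu> (psi i) (mixed_basis (fst i, x)) = H i (fst i, x)"
    using basis_idx_memI(2)[OF x] by (intro psi_inner_mixed_basis) auto
  also have "\<dots> = 0"
    using x by (intro H_outside) (auto simp: new_idx_def)
  finally show ?case by simp
next
  case (Suc m)
  let ?k = "fst i - int (Suc m)"
  have k: "?k + 1 = fst i - int m" by simp
  have "L2_inner \<mu> (spline ?k x) (psi i) = L2_inner \<mu> (\<lambda>z. \<Sum>\<sigma>\<in>kids ?k x. refinement ?k x \<sigma> * spline (?k + 1) \<sigma> z) (psi i)"
    by (rule arg_cong[where f = "\<lambda>f. L2_inner \<mu> f (psi i)"]) (intro ext spline_refine Suc.prems)
  also have "\<dots> = (\<Sum>\<sigma>\<in>kids ?k x. refinement ?k x \<sigma> * L2_inner \<mu> (spline (?k + 1) \<sigma>) (psi i))"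
    using kids_subset[of ?k x] by (intro L2_inner_sum spline_L2 psi_L2 i) auto
  also have "\<dots> = 0"
    unfolding k using kids_subset[of ?k x, unfolded k] Suc.IH
    by (intro sum.neutral ballI) (auto simp: L2_inner_sym[of \<mu> _ "psi i"])
  finally show ?case
    by (simp add: L2_inner_sym)
qed

lemma psi_inner_spline': "i \<in> new_idx \<Longrightarrow> k \<le> fst i \<Longrightarrow> x \<in> X k \<Longrightarrow> L2_inner \<mu> (psi i) (spline k x) = 0"
  using psi_inner_spline[of i x "nat (fst i - k)"] by simp

text \<open>The wavelet of the coarser level is built from splines of generation at most
  \<open>fst i + 1\<close>, hence at most \<open>fst j\<close>; to all of these the wavelet of the
  finer level is orthogonal.\<close>

lemma psi_orthogonal_levels:
  assumes "i \<in> new_idx" "j \<in> new_idx" "fst i < fst j"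
  shows "L2_inner \<mu> (psi i) (psi j) = 0"
proof -
  have z: "A i l * L2_inner \<mu> (mixed_basis l) (psi j) = 0" for l
  proof (cases "A i l = 0")
    case False
    then have l: "l \<in> basis_idx" "fst l = fst i"
      using A_nonzero by blast+
    obtain m where m: "m = fst l \<or> m = fst l + 1" "snd l \<in> X m" "mixed_basis l = (\<lambda>x. spline m (snd l) x / sqrt (idx_vol l))"
      using basis_idx_cases[OF l(1)] .
    have "m \<le> fst j"
      using m(1) l(2) assms(3) by auto
    then have "L2_inner \<mu> (psi j) (spline m (snd l)) = 0"
      using assms(2) m(2) by (intro psi_inner_spline')
    moreover have "L2_inner \<mu> (mixed_basis l) (psi j) = L2_inner \<mu> (psi j) (spline m (snd l)) / sqrt (idx_vol l)"
      unfolding m(3) L2_inner_def by (simp add: mult.commute)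
    ultimately show ?thesis by simp
  qed simp
  have "L2_inner \<mu> (comb A mixed_basis i) (psi j) = (\<Sum>\<^sub>\<infinity>l. A i l * L2_inner \<mu> (mixed_basis l) (psi j))"
    by (rule comb_inner[OF A mixed_basis_localized psi_L2[OF assms(2)]]) (simp only: z summable_on_0_simp)
  also have "\<dots> = 0"
    unfolding z by simp
  finally show ?thesis
    by (simp only: psi_def)
qed

text \<open>Expanding one wavelet in the mixed basis and reading the inner products with the other
  from H gives the entry (j, i) of H times the transpose of A.\<close>

lemma psi_orthonormal_level:
  assumes "i \<in> new_idx" "j \<in> new_idx" "fst i = fst j"
  shows "L2_inner \<mu> (psi i) (psi j) = (if i = j then 1 else 0)"
proof -
  have eq: "A i l * L2_inner \<mu> (mixed_basis l) (psi j) = H j l * A i l" for l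
  proof (cases "A i l = 0")
    case False
    then have l: "l \<in> basis_idx" "fst l = fst i"
      using A_nonzero by blast+
    then show ?thesis
      using psi_inner_mixed_basis[of l j] assms(3) by (simp add: L2_inner_sym[of \<mu> "mixed_basis l"])
  qed simp
  have "L2_inner \<mu> (psi i) (psi j) = (\<Sum>\<^sub>\<infinity>l. A i l * L2_inner \<mu> (mixed_basis l) (psi j))"
    using comb_inner[OF A mixed_basis_localized psi_L2[OF assms(2)], of i] W.mmul_summable[OF H W.decaying_transpose[OF A], of j i]
    unfolding eq by (simp add: psi_def[symmetric])
  also have "\<dots> = mmul H (\<lambda>i j. A j i) j i"
    by (simp add: eq mmul_def)
  also have "\<dots> = (if i = j then 1 else 0)"
    unfolding H_A using assms by (auto simp: mident_def)
  finally show ?thesis .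
qed

lemma psi_orthonormal:
  assumes "i \<in> new_idx" "j \<in> new_idx"
  shows "L2_inner \<mu> (psi i) (psi j) = (if i = j then 1 else 0)"
proof (cases "fst i" "fst j" rule: linorder_cases)
  case less
  then show ?thesis using psi_orthogonal_levels[OF assms] by auto
next
  case equal
  then show ?thesis using psi_orthonormal_level[OF assms] by simp
next
  case greater
  then show ?thesis
    using psi_orthogonal_levels[OF assms(2,1)] by (auto simp: L2_inner_sym[of \<mu> "psi i"])
qed

text \<open>The constant 1 is a pointwise increasing limit of finite sums of coarse splines, to
  which the wavelet is orthogonal. As 1 need not be square integrable, the limit uses integrability
  of the wavelet itself.\<close>

lemma psi_mean_zero:
  assumes i: "i \<in> new_idx"
  shows "has_bochner_integral \<mu> (psi i) 0"
proof -
  let ?k = "fst i"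
  have int: "integrable \<mu> (psi i)"
    by (rule localized_integrable[OF psi_localized new_idx_basis_idx[OF i]])
  define T where "T n = {x \<in> X ?k. d undefined x < real n}" for n
  have finT: "finite (T n)" for n
    unfolding T_def by (rule X_finite_near)
  have TX: "T n \<subseteq> X ?k" for n
    by (auto simp: T_def)
  define g where "g n z = (\<Sum>x\<in>T n. 1 * spline ?k x z)" for n z
  have gb: "0 \<le> g n z" "g n z \<le> 1" for n z
    using spline_sum_le[OF finT[of n] TX[of n], of z] by (auto simp: g_def intro: sum_nonneg)
  have lim: "(\<lambda>n. g n z) \<longlonglongrightarrow> 1" for z
  proof -
    obtain m where m: "Max (insert 0 (d undefined ` near ?k z)) < real m"
      using reals_Archimedean2 by blast
    have "g n z = 1" if n: "m \<le> n" for n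
    proof -
      have sub: "near ?k z \<subseteq> T n"
      proof
        fix x assume x: "x \<in> near ?k z"
        then have "d undefined x \<le> Max (insert 0 (d undefined ` near ?k z))"
          by (intro Max_ge) auto
        then show "x \<in> T n"
          using m n x near_subset[of ?k z] by (auto simp: T_def)
      qed
      have "(\<Sum>x\<in>near ?k z. spline ?k x z) = (\<Sum>x\<in>T n. spline ?k x z)"
        using finT[of n] sub TX[of n] spline_outside_near[of _ ?k z] by (intro sum.mono_neutral_left) blast+
      then show ?thesis
        by (simp add: g_def spline_sum)
    qed
    then have "\<forall>\<^sub>F n in sequentially. g n z = 1"
      unfolding eventually_sequentially by blast
    then show ?thesis by (rule tendsto_eventually)
  qed
  have gz: "(\<integral>z. psi i z * g n z \<partial>\<mu>) = 0" for n
  proof -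
    have "L2_inner \<mu> (g n) (psi i) = (\<Sum>x\<in>T n. 1 * L2_inner \<mu> (spline ?k x) (psi i))"
      unfolding g_def[abs_def] using TX by (intro L2_inner_sum spline_L2 psi_L2 i) auto
    also have "\<dots> = 0"
      using psi_inner_spline'[OF i order_refl] TX[of n] by (intro sum.neutral ballI) (auto simp: L2_inner_sym[of \<mu> _ "psi i"])
    finally show ?thesis
      by (simp add: L2_inner_def mult.commute)
  qed
  have gm: "g n \<in> borel_measurable \<mu>" for n
    unfolding g_def[abs_def] using TX spline_measurable by (intro borel_measurable_sum borel_measurable_times) auto
  have "(\<lambda>n. \<integral>z. psi i z * g n z \<partial>\<mu>) \<longlonglongrightarrow> (\<integral>z. psi i z \<partial>\<mu>)"
  proof (rule integral_dominated_convergence[where w = "\<lambda>z. \<bar>psi i z\<bar>"])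
    show "integrable \<mu> (\<lambda>z. \<bar>psi i z\<bar>)"
      using int by simp
    show "AE z in \<mu>. (\<lambda>n. psi i z * g n z) \<longlonglongrightarrow> psi i z"
      using tendsto_mult[OF tendsto_const lim] by (intro AE_I2) auto
    show "AE z in \<mu>. norm (psi i z * g n z) \<le> \<bar>psi i z\<bar>" for n
      using gb[of n] by (intro AE_I2) (auto simp: abs_mult intro!: mult_left_le)
  qed (use int gm in auto)
  then have "(\<integral>z. psi i z \<partial>\<mu>) = 0"
    unfolding gz using LIMSEQ_unique tendsto_const by blast
  then show ?thesis
    using int by (simp add: has_bochner_integral_iff)
qed

lemma psi_decay:
  obtains C \<tau> where "0 \<le> C" "0 < \<tau>" "\<And>i x. i \<in> new_idx \<Longrightarrow> \<bar>psi i x\<bar> \<le> C / sqrt (idx_vol i) * idx_wt i x powr \<tau>"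
  using psi_localized new_idx_basis_idx unfolding localized_def by metis

text \<open>For fixed x and x' the differences of the mixed basis functions obey the same kind of
  bound as the functions themselves, with the Hoelder factor included in the constant; the bound for
  decaying combinations applies to them directly.\<close>

lemma psi_hoelder:
  obtains C \<tau> where "0 \<le> C" "0 < \<tau>" "\<And>i x x'. d x x' \<le> sc (fst i) \<Longrightarrow>
    \<bar>psi i x - psi i x'\<bar> \<le> C * (d x x' / sc (fst i)) powr \<eta> / sqrt (idx_vol i) * idx_wt i x powr \<tau>"
proof -
  obtain C where C: "0 \<le> C" "\<And>j x x'. j \<in> basis_idx \<Longrightarrow> d x x' \<le> sc (fst j) \<Longrightarrow>
    \<bar>mixed_basis j x - mixed_basis j x'\<bar> \<le> C * (d x x' / sc (fst j)) powr \<eta> / sqrt (idx_vol j) * idx_wt j x powr 1"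
    using mixed_basis_hoelder by blast
  obtain D \<sigma> where D: "0 < D" "0 < \<sigma>" "\<And>i x S a c. finite S \<Longrightarrow> 0 \<le> c \<Longrightarrow> (\<And>j. j \<in> S \<Longrightarrow> \<bar>a j\<bar> \<le> c / sqrt (idx_vol j) * idx_wt j x powr 1) \<Longrightarrow>
      (\<Sum>j\<in>S. \<bar>A i j * a j\<bar>) \<le> D * c / sqrt (idx_vol i) * idx_wt i x powr \<sigma>"
    using decaying_comb_bound[OF A zero_less_one] by blast
  show ?thesis
  proof
    show "0 \<le> D * C" "0 < \<sigma>"
      using C D by auto
    fix i :: "int \<times> 'a" and x x' :: 'a
    assume dx: "d x x' \<le> sc (fst i)"
    let ?c = "C * (d x x' / sc (fst i)) powr \<eta>"
    have "(\<lambda>n. (\<Sum>j\<in>exhaustion (fst i) n. A i j * mixed_basis j x) - (\<Sum>j\<in>exhaustion (fst i) n. A i j * mixed_basis j x')) \<longlonglongrightarrow> psi i x - psi i x'"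
      unfolding psi_def by (intro tendsto_diff comb_partial_tendsto[OF A mixed_basis_localized])
    moreover have "\<bar>(\<Sum>j\<in>exhaustion (fst i) n. A i j * mixed_basis j x) - (\<Sum>j\<in>exhaustion (fst i) n. A i j * mixed_basis j x')\<bar> \<le> D * ?c / sqrt (idx_vol i) * idx_wt i x powr \<sigma>" for n
    proof -
      have "\<bar>(\<Sum>j\<in>exhaustion (fst i) n. A i j * mixed_basis j x) - (\<Sum>j\<in>exhaustion (fst i) n. A i j * mixed_basis j x')\<bar>
          \<le> (\<Sum>j\<in>exhaustion (fst i) n. \<bar>A i j * (mixed_basis j x - mixed_basis j x')\<bar>)"
        unfolding sum_subtractf[symmetric] right_diff_distrib[symmetric] by (rule sum_abs)
      also have "\<dots> \<le> D * ?c / sqrt (idx_vol i) * idx_wt i x powr \<sigma>"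
      proof (rule D(3))
        fix j assume "j \<in> exhaustion (fst i) n"
        then have j: "j \<in> basis_idx" "fst j = fst i"
          using exhaustion_basis_idx by blast+
        show "\<bar>mixed_basis j x - mixed_basis j x'\<bar> \<le> ?c / sqrt (idx_vol j) * idx_wt j x powr 1"
          using C(2)[OF j(1), of x x'] dx j(2) by simp
      qed (use C in auto)
      finally show ?thesis .
    qed
    ultimately have "\<bar>psi i x - psi i x'\<bar> \<le> D * ?c / sqrt (idx_vol i) * idx_wt i x powr \<sigma>"
      by (intro Lim_bounded[OF tendsto_rabs]) auto
    then show "\<bar>psi i x - psi i x'\<bar> \<le> D * C * (d x x' / sc (fst i)) powr \<eta> / sqrt (idx_vol i) * idx_wt i x powr \<sigma>"
      by (simp add: mult.assoc)
  qed
qed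

section \<open>Completeness of the wavelets\<close>

definition wavelets :: "int \<Rightarrow> ('a \<Rightarrow> real) set" where
  "wavelets k = psi ` {i \<in> new_idx. fst i = k}"

lemma wavelets_L2: "wavelets k \<subseteq> L2_functions \<mu>"
  by (auto simp: wavelets_def psi_L2)

text \<open>\<open>H \<psi>\<close> recovers the fine splines at new points, up to coarse splines.\<close>

lemma approx_mixed_basis:
  assumes i: "i \<in> new_idx"
  shows "L2_approx \<mu> (wavelets (fst i) \<union> splines (fst i)) (mixed_basis i)"
proof -
  let ?k = "fst i"
  let ?\<Phi> = "wavelets ?k \<union> splines ?k"
  have \<Phi>: "?\<Phi> \<subseteq> L2_functions \<mu>"
    using wavelets_L2 splines_L2 by blast
  \<comment> \<open>\<open>D\<close> collects the columns of H A that belong to coarse splines; on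
    \<open>new_idx\<close> the product H A is the identity.\<close>
  define D where "D i l = (if l \<in> new_idx then 0 else mmul H A i l)" for i l
  have HA: "W.decaying (mmul H A)"
    by (intro W.decaying_mmul H A)
  have D: "W.decaying D"
  proof -
    obtain C t where C: "0 \<le> C" "0 < t" "W.decays C t (mmul H A)"
      using HA unfolding W.decaying_def by blast
    have "W.decays C t D"
      unfolding W.decays_def D_def using W.decaysD[OF C(3)] C(1) by auto
    then show ?thesis
      using C(2) by (rule W.decayingI)
  qed
  have key: "comb H psi i x = mixed_basis i x + comb D mixed_basis i x" for x
  proof -
    \<comment> \<open>At a fixed point x only finitely many mixed basis functions of a level are
      nonzero, so the double sum in H (A u) has one finite index and may be reordered.\<close>
    define S where "S = {l \<in> basis_idx. fst l = ?k \<and> mixed_basis l x \<noteq> 0}"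
    have finS: "finite S"
    proof (rule finite_subset)
      show "S \<subseteq> Pair ?k ` {j \<in> X (?k + 1). d x j < c0 * sc ?k}"
      proof
        fix l assume l: "l \<in> S"
        then have "d (snd l) x < c0 * sc (fst l)"
          by (intro mixed_basis_support) (auto simp: S_def)
        then have "snd l \<in> {j \<in> X (?k + 1). d x j < c0 * sc ?k}" "l = (?k, snd l)"
          using l by (auto simp: S_def basis_idx_def dist_sym prod_eq_iff)
        then show "l \<in> Pair ?k ` {j \<in> X (?k + 1). d x j < c0 * sc ?k}"
          by blast
      qed
      show "finite (Pair ?k ` {j \<in> X (?k + 1). d x j < c0 * sc ?k})"
        by (intro finite_imageI X_finite_near)
    qed
    have fin_comb: "comb B mixed_basis j x = (\<Sum>l\<in>S. B j l * mixed_basis l x)" if B: "W.decaying B" "fst j = ?k" for B j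
    proof -
      have "comb B mixed_basis j x = (\<Sum>\<^sub>\<infinity>l\<in>S. B j l * mixed_basis l x)"
        unfolding comb_def
      proof (rule infsum_cong_neutral)
        fix l assume "l \<in> UNIV - S"
        then show "B j l * mixed_basis l x = 0"
          using comb_zero[OF B(1) mixed_basis_localized, of l j] B(2) by (auto simp: S_def)
      qed auto
      then show ?thesis
        using finS by simp
    qed
    have Hj: "H i j * psi j x = (\<Sum>l\<in>S. H i j * A j l * mixed_basis l x)" for j
    proof (cases "H i j = 0")
      case False
      then have "fst j = ?k"
        using comb_zero[OF H psi_localized, of j i] by blast
      then show ?thesis
        unfolding psi_def using fin_comb[OF A] by (simp add: sum_distrib_left mult.assoc)
    qed simp
    have "comb H psi i x = (\<Sum>\<^sub>\<infinity>j. \<Sum>l\<in>S. H i j * A j l * mixed_basis l x)"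
      unfolding comb_def Hj ..
    also have "\<dots> = (\<Sum>l\<in>S. \<Sum>\<^sub>\<infinity>j. H i j * A j l * mixed_basis l x)"
      by (rule infsum_of_sum(1)[OF finS]) (intro summable_on_cmult_left W.mmul_summable H A)
    also have "\<dots> = (\<Sum>l\<in>S. mmul H A i l * mixed_basis l x)"
      by (simp add: infsum_cmult_left' mmul_def)
    also have "\<dots> = (\<Sum>l\<in>S. (if l = i then mixed_basis i x else 0) + D i l * mixed_basis l x)"
      using i H_A_Y by (intro sum.cong refl) (auto simp: D_def mident_def)
    also have "\<dots> = (\<Sum>l\<in>S. if l = i then mixed_basis i x else 0) + comb D mixed_basis i x"
      using fin_comb[OF D] by (simp add: sum.distrib)
    also have "(\<Sum>l\<in>S. if l = i then mixed_basis i x else 0) = mixed_basis i x"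
      using finS new_idx_basis_idx[OF i] by (auto simp: S_def)
    finally show ?thesis .
  qed
  have 1: "L2_approx \<mu> ?\<Phi> (comb H psi i)"
  proof (rule comb_approx[OF H psi_localized \<Phi> new_idx_basis_idx[OF i]])
    fix j assume "j \<in> basis_idx" "fst j = fst i" "H i j \<noteq> 0"
    then have "psi j \<in> ?\<Phi>"
      using H_outside[of i j] by (auto simp: wavelets_def)
    then show "L2_approx \<mu> ?\<Phi> (psi j)"
      by (intro L2_approx_span fspan_base \<Phi>)
  qed
  have 2: "L2_approx \<mu> ?\<Phi> (comb D mixed_basis i)"
  proof (rule comb_approx[OF D mixed_basis_localized \<Phi> new_idx_basis_idx[OF i]])
    fix j assume j: "j \<in> basis_idx" "fst j = fst i" "D i j \<noteq> 0"
    then have jX: "snd j \<in> X ?k"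
      by (auto simp: D_def new_idx_def split: if_splits)
    have "(\<lambda>z. 0 + (1 / sqrt (idx_vol j)) * spline ?k (snd j) z) \<in> fspan ?\<Phi>"
      using jX by (intro fspan.add fspan.zero) (auto simp: splines_def)
    moreover have "mixed_basis j = (\<lambda>z. 0 + (1 / sqrt (idx_vol j)) * spline ?k (snd j) z)"
      using jX j(2) by (auto simp: mixed_basis_def)
    ultimately show "L2_approx \<mu> ?\<Phi> (mixed_basis j)"
      using \<Phi> by (metis L2_approx_span)
  qed
  have "mixed_basis i = (\<lambda>x. comb H psi i x + (-1) * comb D mixed_basis i x)"
    using key by (simp add: fun_eq_iff)
  then show ?thesis
    using L2_approx_add[OF \<Phi> 1 2, of "-1"] by simp
qed

text \<open>At a new point the normalization is undone. At an old point y the two-scale relation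
  contains the fine spline of y with coefficient 1 and otherwise only fine splines of new points, so
  it can be solved for the former.\<close>

lemma approx_spline_Suc:
  assumes y: "y \<in> X (k + 1)"
  shows "L2_approx \<mu> (wavelets k \<union> splines k) (spline (k + 1) y)"
proof -
  let ?\<Phi> = "wavelets k \<union> splines k"
  have \<Phi>: "?\<Phi> \<subseteq> L2_functions \<mu>"
    using wavelets_L2 splines_L2 by blast
  have new: "L2_approx \<mu> ?\<Phi> (spline (k + 1) \<sigma>)" if \<sigma>: "\<sigma> \<in> X (k + 1)" "\<sigma> \<notin> X k" for \<sigma>
  proof -
    have "L2_approx \<mu> ?\<Phi> (mixed_basis (k, \<sigma>))"
      using approx_mixed_basis[of "(k, \<sigma>)"] \<sigma> by (simp add: new_idx_def basis_idx_def)
    from L2_approx_add[OF \<Phi> L2_approx_span[OF fspan.zero \<Phi>] this, of "sqrt (idx_vol (k, \<sigma>))"]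
    show ?thesis
      unfolding mixed_basis_fine[OF \<sigma>] by simp
  qed
  show ?thesis
  proof (cases "y \<in> X k")
    case True
    define F where "F = {\<sigma> \<in> kids k y. \<sigma> \<notin> X k}"
    have F: "finite F"
      by (simp add: F_def)
    have yk: "y \<in> kids k y"
      using y A0_pos by (simp add: kids_def)
    have "spline k y z = spline (k + 1) y z + (\<Sum>\<sigma>\<in>F. refinement k y \<sigma> * spline (k + 1) \<sigma> z)" for z
    proof -
      have "spline k y z = (\<Sum>\<sigma>\<in>kids k y. refinement k y \<sigma> * spline (k + 1) \<sigma> z)"
        by (rule spline_refine[OF True])
      also have "\<dots> = (\<Sum>\<sigma>\<in>insert y F. refinement k y \<sigma> * spline (k + 1) \<sigma> z)"
        by (rule sum.mono_neutral_right)
          (use yk refinement_reference_point[OF True] in \<open>auto simp: F_def split: if_splits\<close>)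
      also have "\<dots> = refinement k y y * spline (k + 1) y z + (\<Sum>\<sigma>\<in>F. refinement k y \<sigma> * spline (k + 1) \<sigma> z)"
        using F True by (intro sum.insert) (auto simp: F_def)
      finally show ?thesis
        using refinement_reference_point[OF True True] by simp
    qed
    then have eq: "spline (k + 1) y = (\<lambda>z. spline k y z + (-1) * (\<Sum>\<sigma>\<in>F. refinement k y \<sigma> * spline (k + 1) \<sigma> z))"
      by (simp add: fun_eq_iff)
    show ?thesis
      unfolding eq
    proof (intro L2_approx_add \<Phi> L2_approx_sum F)
      show "L2_approx \<mu> ?\<Phi> (spline k y)"
        using True by (intro L2_approx_span fspan_base \<Phi>) (auto simp: splines_def)
      show "L2_approx \<mu> ?\<Phi> (spline (k + 1) \<sigma>)" if "\<sigma> \<in> F" for \<sigma>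
        using that kids_subset[of k y] by (intro new) (auto simp: F_def)
    qed
  next
    case False
    then show ?thesis by (rule new[OF y])
  qed
qed

lemma approx_spline:
  assumes "y \<in> X (k + int n)"
  shows "L2_approx \<mu> ((\<Union>l\<in>{k..<k + int n}. wavelets l) \<union> splines k) (spline (k + int n) y)"
  using assms
proof (induction n arbitrary: y)
  case 0
  then show ?case
    using splines_L2 by (intro L2_approx_span fspan_base) (auto simp: splines_def)
next
  case (Suc n)
  let ?\<Psi> = "(\<Union>l\<in>{k..<k + int (Suc n)}. wavelets l) \<union> splines k"
  have \<Psi>: "?\<Psi> \<subseteq> L2_functions \<mu>"
    using wavelets_L2 splines_L2 by blast
  have y: "y \<in> X (k + int n + 1)"
    using Suc.prems by (simp add: algebra_simps)
  have "L2_approx \<mu> ?\<Psi> (spline (k + int n + 1) y)"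
  proof (rule L2_approx_trans[OF \<Psi> approx_spline_Suc[OF y]])
    fix \<phi> assume "\<phi> \<in> wavelets (k + int n) \<union> splines (k + int n)"
    then show "L2_approx \<mu> ?\<Psi> \<phi>"
    proof
      assume "\<phi> \<in> wavelets (k + int n)"
      then have "\<phi> \<in> ?\<Psi>"
        by auto
      then show ?thesis
        by (intro L2_approx_span fspan_base \<Psi>)
    next
      assume "\<phi> \<in> splines (k + int n)"
      then obtain x where x: "x \<in> X (k + int n)" "\<phi> = spline (k + int n) x"
        by (auto simp: splines_def)
      show ?thesis
        unfolding x(2) by (rule L2_approx_mono[OF _ \<Psi> Suc.IH[OF x(1)]]) (intro Un_mono UN_mono; simp add: ivl_subset)
    qed
  qed
  then show ?case
    by (simp add: algebra_simps)
qed

lemma wavelet_inner_coarse: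
  assumes "w \<in> fspan (\<Union>l\<in>S. wavelets l)" "v \<in> fspan (splines k)" "\<And>l. l \<in> S \<Longrightarrow> k \<le> l"
  shows "L2_inner \<mu> w v = 0"
proof (rule L2_inner_fspan_zero[OF assms(1)])
  show "(\<Union>l\<in>S. wavelets l) \<subseteq> L2_functions \<mu>"
    using wavelets_L2 by blast
  show vL: "v \<in> L2_functions \<mu>"
    by (rule fspan_L2[OF assms(2) splines_L2])
  fix \<phi> assume "\<phi> \<in> (\<Union>l\<in>S. wavelets l)"
  then obtain i where i: "i \<in> new_idx" "fst i \<in> S" "\<phi> = psi i"
    by (auto simp: wavelets_def)
  have "L2_inner \<mu> v (psi i) = 0"
  proof (rule L2_inner_fspan_zero[OF assms(2) splines_L2 psi_L2[OF i(1)]])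
    fix s assume "s \<in> splines k"
    then show "L2_inner \<mu> s (psi i) = 0"
      using psi_inner_spline'[OF i(1) assms(3)[OF i(2)]] by (auto simp: splines_def L2_inner_sym[of \<mu> _ "psi i"])
  qed
  then show "L2_inner \<mu> \<phi> v = 0"
    by (simp add: i L2_inner_sym)
qed

text \<open>A coarse spline sum is locally small compared to its norm: its coefficients near \<open>a\<close> are
  controlled by the norm divided by the volume of a large ball.\<close>

lemma coarse_sum_local_bound:
  obtains C where "0 < C" "\<And>k l a v. l \<le> k \<Longrightarrow> v \<in> fspan (splines l) \<Longrightarrow>
    (\<And>x. d a x < c0 * sc k \<Longrightarrow> (v x)\<^sup>2 * vol a (sc l) \<le> C * nsq \<mu> v)"
proof -
  \<comment> \<open>The ball of radius \<open>sc l\<close> about a lies within A0 (2 A0 c0 + 1)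
    \<open>sc l\<close> of a contributing point j; the factor 8 A0^3 measures this in units of the
    radius on which the spline of j equals 1.\<close>
  define K where "K = A0 * (2 * A0 * c0 + 1) * (8 * A0 ^ 3)"
  have K: "0 < K"
    using A0_pos c0 by (simp add: K_def add_pos_pos)
  obtain C where C: "0 < C" "\<And>x r. 0 < r \<Longrightarrow> vol x (K * r) \<le> C * vol x r"
    using vol_scale[OF K] by blast
  have "(v x)\<^sup>2 * vol a (sc l) \<le> C * nsq \<mu> v"
    if k: "l \<le> k" and v: "v \<in> fspan (splines l)" and x: "d a x < c0 * sc k" for k l a v x
  proof -
    obtain F c where F: "finite F" "F \<subseteq> X l" "v = (\<lambda>z. \<Sum>j\<in>F. c j * spline l j z)"
      using fspan_image[of v "spline l" "X l"] v by (auto simp: splines_def)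
    have vL: "v \<in> L2_functions \<mu>"
      by (rule fspan_L2[OF v splines_L2])
    define s where "s = sc l / (8 * A0 ^ 3)"
    have s: "0 < s"
      using A0_pos by (simp add: s_def)
    have coef: "(c j)\<^sup>2 * vol a (sc l) \<le> C * nsq \<mu> v" if j: "j \<in> F" "spline l j x \<noteq> 0" for j
    proof -
      have jx: "d j x < c0 * sc l"
        using j F by (intro spline_support') auto
      have "c0 * sc k \<le> c0 * sc l"
        using sc_antimono[of l "nat (k - l)"] k c0 by (intro mult_left_mono) auto
      with x have "d a x < c0 * sc l"
        by (rule order_less_le_trans)
      then have "d j a < A0 * (c0 * sc l + c0 * sc l)"
        using jx by (intro quasi_triangle'[of _ x]) (auto simp: dist_sym)
      then have ja: "d j a < 2 * A0 * c0 * sc l"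
        by (simp add: algebra_simps)
      have "K * s = A0 * (2 * A0 * c0 * sc l + sc l)"
        using A0_pos by (simp add: K_def s_def algebra_simps)
      then have "quasi_ball d a (sc l) \<subseteq> quasi_ball d j (K * s)"
        using quasi_triangle'[OF ja] by auto
      then have "vol a (sc l) \<le> vol j (K * s)"
        by (rule vol_mono)
      also have "\<dots> \<le> C * vol j s"
        by (rule C(2)[OF s])
      finally have "(c j)\<^sup>2 * vol a (sc l) \<le> (c j)\<^sup>2 * (C * vol j s)"
        by (intro mult_left_mono) auto
      also have "\<dots> = C * (\<integral>z. (\<Sum>i\<in>{j}. (c i)\<^sup>2 * indicator (quasi_ball d i s) z) \<partial>\<mu>)"
        unfolding integral_indicator_balls(2)[OF finite.insertI[OF finite.emptyI]] by simp
      also have "\<dots> \<le> C * nsq \<mu> v"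
      proof (intro mult_left_mono integral_mono integral_indicator_balls(1) L2_functionsD(2)[OF vL])
        fix z
        show "(\<Sum>i\<in>{j}. (c i)\<^sup>2 * indicator (quasi_ball d i s) z) \<le> (v z)\<^sup>2"
        proof (cases "z \<in> quasi_ball d j s")
          case True
          have jX: "j \<in> X l"
            using j F by blast
          have "v z = (\<Sum>i\<in>F. if i = j then c j else 0)"
            unfolding F(3) using F(2) jX True
            by (intro sum.cong refl) (auto simp: spline_near_reference_point[of _ l j z] s_def subset_iff)
          then have "v z = c j"
            using F j by simp
          then show ?thesis
            using True by simp
        qed simp
      qed (use C in auto)
      finally show ?thesis .
    qed
    have "(v x)\<^sup>2 * vol a (sc l) \<le> (\<Sum>j\<in>F. (c j)\<^sup>2 * spline l j x) * vol a (sc l)"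
      unfolding F(3) by (intro mult_right_mono spline_comb_square F) auto
    also have "\<dots> = (\<Sum>j\<in>F. ((c j)\<^sup>2 * vol a (sc l)) * spline l j x)"
      unfolding sum_distrib_right by (intro sum.cong refl) (simp add: mult_ac)
    also have "\<dots> \<le> (\<Sum>j\<in>F. (C * nsq \<mu> v) * spline l j x)"
    proof (rule sum_mono)
      fix j assume "j \<in> F"
      then show "((c j)\<^sup>2 * vol a (sc l)) * spline l j x \<le> (C * nsq \<mu> v) * spline l j x"
        using coef by (cases "spline l j x = 0") (auto intro!: mult_right_mono)
    qed
    also have "\<dots> = (C * nsq \<mu> v) * (\<Sum>j\<in>F. spline l j x)"
      by (simp add: sum_distrib_left)
    also have "\<dots> \<le> (C * nsq \<mu> v) * 1"
      using C by (intro mult_left_mono spline_sum_le F mult_nonneg_nonneg) auto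
    finally show ?thesis by simp
  qed
  then show ?thesis
    by (rule that[OF C(1)])
qed

lemma all_wavelets_L2: "psi ` new_idx \<subseteq> L2_functions \<mu>"
  by (auto simp: psi_L2)

text \<open>Approximate f by w + v with w in the wavelet span and v a very coarse spline sum, with
  error e. As w and v are orthogonal, the squared norm of v is <f, v> - <e, v>; the first term is
  small because f lives on a fixed ball where v is tiny compared to its norm. Hence v may be
  dropped.\<close>

lemma approx_spline_unbounded:
  assumes ub: "\<not> quasi_bounded d" and a: "a \<in> X k"
  shows "L2_approx \<mu> (psi ` new_idx) (spline k a)"
  unfolding L2_approx_def
proof (intro conjI allI impI)
  let ?f = "spline k a"
  show fL: "?f \<in> L2_functions \<mu>"
    by (rule spline_L2[OF a])
  fix \<epsilon> :: real assume \<epsilon>: "0 < \<epsilon>"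
  obtain C where C: "0 < C" "\<And>k l a v x. l \<le> k \<Longrightarrow> v \<in> fspan (splines l) \<Longrightarrow>
    d a x < c0 * sc k \<Longrightarrow> (v x)\<^sup>2 * vol a (sc l) \<le> C * nsq \<mu> v"
    using coarse_sum_local_bound by metis
  define m where "m = vol a (c0 * sc k)"
  have m: "0 < m"
    unfolding m_def using c0 delta_bounds by (intro vol_pos) simp
  \<comment> \<open>The volume requirement makes C m^2 / V smaller than \<epsilon> / 16 once the
    coarse scale \<open>sc l\<close> is at least R.\<close>
  obtain R where R: "0 < R" "16 * C * m\<^sup>2 / \<epsilon> + 1 \<le> vol a R"
    using vol_unbounded[OF ub] by blast
  obtain n where n: "R * sc (0 + int n) < sc k"
    using sc_small[of "sc k" R 0] by auto
  define l where "l = k - int n"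
  have l: "k = l + int n" "l \<le> k"
    by (auto simp: l_def)
  have "R \<le> sc l"
  proof -
    have "\<delta> ^ n * R < \<delta> ^ n * sc l"
      using n sc_add[of l n] l(1) by (simp add: mult.commute)
    then show ?thesis
      using delta_bounds by simp
  qed
  then have "vol a R \<le> vol a (sc l)"
    by (rule vol_mono')
  define V where "V = vol a (sc l)"
  have V: "0 < V" "16 * C * m\<^sup>2 / \<epsilon> < V"
    using R(2) \<open>vol a R \<le> vol a (sc l)\<close> vol_pos[of "sc l" a] by (auto simp: V_def)
  have "L2_approx \<mu> ((\<Union>j\<in>{l..<l + int n}. wavelets j) \<union> splines l) ?f"
    using approx_spline[of a l n] a l(1) by simp
  then obtain g where g: "g \<in> fspan ((\<Union>j\<in>{l..<l + int n}. wavelets j) \<union> splines l)" "nsq \<mu> (\<lambda>x. ?f x - g x) < \<epsilon> / 12"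
    using L2_approxD[of \<mu> _ ?f "\<epsilon> / 12"] \<epsilon> by auto
  obtain w v where w: "w \<in> fspan (\<Union>j\<in>{l..<l + int n}. wavelets j)" and v: "v \<in> fspan (splines l)" and gwv: "g = (\<lambda>x. w x + v x)"
    using fspan_Un[OF g(1)] by blast
  have vL: "v \<in> L2_functions \<mu>"
    by (rule fspan_L2[OF v splines_L2])
  have wL: "w \<in> L2_functions \<mu>"
    using wavelets_L2 by (intro fspan_L2[OF w]) blast
  define e where "e x = ?f x - (w x + v x)" for x
  have eL: "e \<in> L2_functions \<mu>"
    unfolding e_def[abs_def] by (intro L2_diff L2_add fL wL vL)
  have e_small: "nsq \<mu> e < \<epsilon> / 12"
    using g(2) unfolding gwv e_def .
  have wv: "(\<integral>x. w x * v x \<partial>\<mu>) = 0"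
    using wavelet_inner_coarse[OF w v] by (simp add: L2_inner_def)
  have "(\<integral>x. e x * v x \<partial>\<mu>) = (\<integral>x. (?f x * v x - w x * v x) - (v x)\<^sup>2 \<partial>\<mu>)"
    by (simp add: e_def algebra_simps power2_eq_square)
  also have "\<dots> = (\<integral>x. ?f x * v x \<partial>\<mu>) - nsq \<mu> v"
    using wv by (simp add: integrable_mult_L2 fL vL wL L2_functionsD(2)[OF vL])
  finally have id: "nsq \<mu> v = (\<integral>x. ?f x * v x \<partial>\<mu>) - (\<integral>x. e x * v x \<partial>\<mu>)"
    by simp
  have ev: "- (\<integral>x. e x * v x \<partial>\<mu>) \<le> (nsq \<mu> e + nsq \<mu> v) / 2"
  proof -
    have "(\<integral>x. - (e x * v x) \<partial>\<mu>) \<le> (\<integral>x. ((e x)\<^sup>2 + (v x)\<^sup>2) / 2 \<partial>\<mu>)"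
    proof (rule integral_mono)
      show "integrable \<mu> (\<lambda>x. - (e x * v x))"
        using integrable_mult_L2[OF eL vL] by simp
      show "integrable \<mu> (\<lambda>x. ((e x)\<^sup>2 + (v x)\<^sup>2) / 2)"
        by (intro Bochner_Integration.integrable_divide Bochner_Integration.integrable_add L2_functionsD(2) eL vL)
      show "- (e x * v x) \<le> ((e x)\<^sup>2 + (v x)\<^sup>2) / 2" for x
        using zero_le_power2[of "e x + v x"] by (simp add: power2_sum)
    qed
    then show ?thesis
      using L2_functionsD(2)[OF eL] L2_functionsD(2)[OF vL] by simp
  qed
  have fv: "(\<integral>x. ?f x * v x \<partial>\<mu>) \<le> nsq \<mu> v / 4 + C * m\<^sup>2 / V"
  proof -
    define b where "b = nsq \<mu> v / (4 * m) + C * m / V"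
    have b: "0 \<le> b"
      using m C V by (auto simp: b_def intro!: add_nonneg_nonneg divide_nonneg_nonneg)
    have "(\<integral>x. ?f x * v x \<partial>\<mu>) \<le> (\<integral>x. (\<Sum>j\<in>{a}. b * indicator (quasi_ball d j (c0 * sc k)) x) \<partial>\<mu>)"
    proof (rule integral_mono[OF integrable_mult_L2[OF fL vL] integral_indicator_balls(1)])
      fix x
      show "?f x * v x \<le> (\<Sum>j\<in>{a}. b * indicator (quasi_ball d j (c0 * sc k)) x)"
      proof (cases "?f x = 0")
        case True
        then show ?thesis using b by (simp add: indicator_def)
      next
        case False
        then have dx: "d a x < c0 * sc k"
          using spline_support'[OF a] by blast
        have vx: "(v x)\<^sup>2 * V \<le> C * nsq \<mu> v"
          unfolding V_def by (rule C(2)[OF l(2) v dx])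
        \<comment> \<open>The parameter in |v| <= t v^2 + 1 / (4 t) is chosen so that, after
          integration over the ball of volume m, the first term becomes a quarter of the squared
          norm of v and the second C m^2 / V.\<close>
        define t where "t = V / (4 * C * m)"
        have t: "0 < t"
          using V C m by (simp add: t_def)
        have "?f x * v x \<le> 1 * \<bar>v x\<bar>"
          using spline_le_1[of k a x] abs_ge_self[of "v x"]
          by (intro order_trans[OF mult_left_mono[of "v x" "\<bar>v x\<bar>"] mult_right_mono]) auto
        also have "1 * \<bar>v x\<bar> \<le> t * (v x)\<^sup>2 + 1 / (4 * t)"
        proof -
          have "0 \<le> (2 * t * \<bar>v x\<bar> - 1)\<^sup>2" by simp
          then have "4 * t * \<bar>v x\<bar> \<le> 4 * t * t * (v x)\<^sup>2 + 1"
            by (simp add: power2_diff power_mult_distrib power2_eq_square[of t])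
          then show ?thesis
            using t by (simp add: field_simps)
        qed
        also have "t * (v x)\<^sup>2 = (v x)\<^sup>2 * V / (4 * C * m)"
          by (simp add: t_def)
        also have "\<dots> \<le> C * nsq \<mu> v / (4 * C * m)"
          using vx C m by (intro divide_right_mono) auto
        also have "C * nsq \<mu> v / (4 * C * m) + 1 / (4 * t) = b"
          using C m V by (simp add: b_def t_def)
        finally show ?thesis
          using dx by simp
      qed
    qed simp
    also have "\<dots> = b * m"
      unfolding integral_indicator_balls(2)[OF finite.insertI[OF finite.emptyI]] by (simp add: m_def)
    also have "\<dots> = nsq \<mu> v / 4 + C * m\<^sup>2 / V"
      using m by (simp add: b_def distrib_right power2_eq_square)
    finally show ?thesis .
  qed
  have small: "C * m\<^sup>2 / V < \<epsilon> / 16"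
  proof -
    have "16 * C * m\<^sup>2 < V * \<epsilon>"
      using V(2) \<epsilon> by (simp add: divide_less_eq)
    then show ?thesis
      using V(1) by (simp add: divide_less_eq algebra_simps)
  qed
  have v_small: "nsq \<mu> v < 5 * \<epsilon> / 12"
  proof -
    \<comment> \<open>Absorbing N/2 and N/4 leaves N/4 < \<epsilon>/24 + \<epsilon>/16 = 5
      \<epsilon>/48. The final estimate then adds up exactly: 2 (1/12 + 5/12) = 1.\<close>
    have *: "N < 5 * \<epsilon> / 12" if "N = P - Q" "- Q \<le> (E + N) / 2" "P \<le> N / 4 + S" "S < \<epsilon> / 16" "E < \<epsilon> / 12"
      for N P Q E S :: real
      using that by (simp add: field_simps)
    show ?thesis
      by (rule *[OF id ev fv small e_small])
  qed
  have "nsq \<mu> (\<lambda>x. ?f x - w x) = nsq \<mu> (\<lambda>x. e x + v x)"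
    by (simp add: e_def)
  also have "\<dots> \<le> 2 * nsq \<mu> e + 2 * nsq \<mu> v"
    by (rule nsq_add_le[OF eL vL])
  also have "\<dots> < \<epsilon>"
    using e_small v_small by linarith
  finally have "nsq \<mu> (\<lambda>x. ?f x - w x) < \<epsilon>" .
  moreover have "w \<in> fspan (psi ` new_idx)"
    by (rule fspan_trans[OF w]) (auto simp: wavelets_def intro: fspan_base)
  ultimately show "\<exists>g\<in>fspan (psi ` new_idx). nsq \<mu> (\<lambda>x. ?f x - g x) < \<epsilon>"
    by blast
qed

lemma wavelets_dense_unbounded:
  assumes "\<not> quasi_bounded d" "f \<in> L2_functions \<mu>"
  shows "L2_approx \<mu> (psi ` new_idx) f"
  by (rule L2_approx_trans[OF all_wavelets_L2 splines_dense[OF assms(2)]])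
    (use approx_spline_unbounded[OF assms(1)] in \<open>auto simp: splines_def\<close>)

lemma spline_single:
  assumes "X k = {a}"
  shows "spline k a = (\<lambda>_. 1)"
proof
  fix y
  have "near k y \<subseteq> {a}"
    using near_subset assms by blast
  then have "near k y = {} \<or> near k y = {a}"
    by blast
  then show "spline k a y = 1"
    using spline_sum[of k y] by auto
qed

lemma splines_coarser:
  assumes "X k = {a}" "x \<in> X (k - int n)"
  shows "spline (k - int n) x \<in> fspan (splines k)"
  using assms(2)
proof (induction n arbitrary: x)
  case 0
  then show ?case by (auto simp: splines_def intro: fspan_base)
next
  case (Suc n)
  let ?k = "k - int (Suc n)"
  have k: "?k + 1 = k - int n" by simp
  have "spline ?k x = (\<lambda>y. \<Sum>\<sigma>\<in>kids ?k x. refinement ?k x \<sigma> * spline (?k + 1) \<sigma> y)"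
    by (intro ext spline_refine Suc.prems)
  moreover have "(\<lambda>y. \<Sum>\<sigma>\<in>kids ?k x. refinement ?k x \<sigma> * spline (?k + 1) \<sigma> y) \<in> fspan (splines k)"
    unfolding k using kids_subset[of ?k x, unfolded k] Suc.IH by (intro fspan_sum) auto
  ultimately show ?case by simp
qed

text \<open>Wavelets from generation \<open>k0\<close> on together with the spline space of
  \<open>k0\<close> have dense span, and the latter consists of constants. Both f and the wavelets
  are orthogonal to constants, so removing the constant part does not worsen the
  approximation.\<close>

lemma wavelets_dense_bounded:
  assumes k0: "X k0 = {a}" and f: "f \<in> L2_perp_constants \<mu>" and \<epsilon>: "0 < \<epsilon>"
  shows "\<exists>w\<in>fspan (psi ` {i \<in> new_idx. k0 \<le> fst i}). nsq \<mu> (\<lambda>x. f x - w x) < \<epsilon>"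
proof -
  let ?\<Psi> = "psi ` {i \<in> new_idx. k0 \<le> fst i}"
  let ?\<Phi> = "?\<Psi> \<union> splines k0"
  have \<Psi>: "?\<Psi> \<subseteq> L2_functions \<mu>"
    by (auto simp: psi_L2)
  then have \<Phi>: "?\<Phi> \<subseteq> L2_functions \<mu>"
    using splines_L2 by blast
  have fL: "f \<in> L2_functions \<mu>"
    using f by (simp add: L2_perp_constants_def)
  have "L2_approx \<mu> ?\<Phi> (spline k x)" if x: "x \<in> X k" for k x
  proof (cases "k0 \<le> k")
    case True
    define n where "n = nat (k - k0)"
    have k: "k = k0 + int n"
      using True by (simp add: n_def)
    have "L2_approx \<mu> ((\<Union>j\<in>{k0..<k0 + int n}. wavelets j) \<union> splines k0) (spline k x)"
      unfolding k by (rule approx_spline) (use x k in simp)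
    then show ?thesis
      by (rule L2_approx_mono[OF _ \<Phi>, rotated]) (auto simp: wavelets_def)
  next
    case False
    define n where "n = nat (k0 - k)"
    have k: "k = k0 - int n"
      using False by (simp add: n_def)
    have "spline k x \<in> fspan (splines k0)"
      unfolding k by (rule splines_coarser[OF k0]) (use x k in simp)
    then have "spline k x \<in> fspan ?\<Phi>"
      by (rule fspan_trans) (auto intro: fspan_base)
    then show ?thesis
      by (intro L2_approx_span \<Phi>)
  qed
  then have "L2_approx \<mu> ?\<Phi> f"
    by (intro L2_approx_trans[OF \<Phi> splines_dense[OF fL]]) (auto simp: splines_def)
  then obtain g where g: "g \<in> fspan ?\<Phi>" "nsq \<mu> (\<lambda>x. f x - g x) < \<epsilon>"
    using L2_approxD \<epsilon> by blast
  obtain w v where w: "w \<in> fspan ?\<Psi>" and v: "v \<in> fspan (splines k0)" and gwv: "g = (\<lambda>x. w x + v x)"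
    using fspan_Un[OF g(1)] by blast
  have one: "splines k0 = {\<lambda>_. 1}"
    using spline_single[OF k0] k0 by (simp add: splines_def)
  have oneL: "(\<lambda>_. 1) \<in> L2_functions \<mu>"
    using splines_L2[of k0] by (simp add: one)
  obtain c where c: "v = (\<lambda>_. c)"
  proof -
    have "\<exists>c. v = (\<lambda>_. c)"
      using v unfolding one
    proof induction
      case zero
      show ?case by blast
    next
      case (add g \<phi> b)
      then obtain c where "g = (\<lambda>_. c)" "\<phi> = (\<lambda>_. 1)" by blast
      then show ?case by (intro exI[of _ "c + b"]) simp
    qed
    then show ?thesis using that by blast
  qed
  have wL: "w \<in> L2_functions \<mu>"
    by (rule fspan_L2[OF w \<Psi>])
  have w0: "L2_inner \<mu> w (\<lambda>_. 1) = 0"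
  proof (rule L2_inner_fspan_zero[OF w \<Psi> oneL])
    fix \<phi> assume "\<phi> \<in> ?\<Psi>"
    then obtain i where "i \<in> new_idx" "\<phi> = psi i" by blast
    then show "L2_inner \<mu> \<phi> (\<lambda>_. 1) = 0"
      using psi_mean_zero[of i] by (simp add: L2_inner_def has_bochner_integral_integral_eq)
  qed
  have f0: "L2_inner \<mu> f (\<lambda>_. 1) = 0"
    using f unfolding L2_perp_constants_def by blast
  define h where "h x = f x - w x" for x
  have hL: "h \<in> L2_functions \<mu>"
    unfolding h_def[abs_def] by (intro L2_diff fL wL)
  have h0: "(\<integral>x. h x \<partial>\<mu>) = 0"
    using f0 w0 integrable_mult_L2[OF fL oneL] integrable_mult_L2[OF wL oneL]
    by (simp add: h_def L2_inner_def)
  have h1: "integrable \<mu> h"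
    using integrable_mult_L2[OF hL oneL] by simp
  have c2: "integrable \<mu> (\<lambda>_. c\<^sup>2)"
    using integrable_mult_right[OF L2_functionsD(2)[OF oneL], of "c\<^sup>2"] by simp
  \<comment> \<open>Pythagoras: h has mean zero, so subtracting the constant c can only increase its
    norm.\<close>
  have "nsq \<mu> h \<le> nsq \<mu> h + (\<integral>x. c\<^sup>2 \<partial>\<mu>)"
    by (simp add: measure_nonneg)
  also have "\<dots> = (\<integral>x. ((h x)\<^sup>2 - 2 * c * h x) + c\<^sup>2 \<partial>\<mu>)"
    using h0 h1 c2 L2_functionsD(2)[OF hL]
    by (subst Bochner_Integration.integral_add) (auto simp: Bochner_Integration.integral_diff)
  also have "\<dots> = nsq \<mu> (\<lambda>x. f x - g x)"
    unfolding gwv c h_def by (intro Bochner_Integration.integral_cong refl) (simp add: power2_eq_square algebra_simps)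
  also have "\<dots> < \<epsilon>"
    by (rule g(2))
  finally show ?thesis
    using w unfolding h_def by blast
qed

end

lemma wavelet_basis:
  assumes single: "quasi_bounded d \<Longrightarrow> is_singleton (X k0)"
  shows "\<exists>(\<psi> :: int \<times> 'a \<Rightarrow> 'a \<Rightarrow> real) (C::real) (\<gamma>::real). \<gamma> > 0 \<and>
    L2_orthonormal_basis \<mu> (if quasi_bounded d then L2_perp_constants \<mu> else L2_functions \<mu>)
      (wavelet_indices d X k0) \<psi> \<and>
    (\<forall>(k, y) \<in> wavelet_indices d X k0.
      (\<forall>x. \<bar>\<psi> (k, y) x\<bar> \<le> C / sqrt (measure \<mu> (quasi_ball d y (\<delta> powi k)))
             * exp (- \<gamma> * (\<delta> powi (- k) * d y x) powr aexp)) \<and>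
      (\<forall>x x'. d x x' \<le> \<delta> powi k \<longrightarrow>
         \<bar>\<psi> (k, y) x - \<psi> (k, y) x'\<bar> \<le> C / sqrt (measure \<mu> (quasi_ball d y (\<delta> powi k)))
             * (d x x' / \<delta> powi k) powr \<eta>
             * exp (- \<gamma> * (\<delta> powi (- k) * d y x) powr aexp)) \<and>
      has_bochner_integral \<mu> (\<psi> (k, y)) 0)"
proof -
  obtain CG where CG: "0 \<le> CG" "W.decays CG 1 Gram"
    using Gram_decays by blast
  obtain c where c: "0 < c" "\<And>F x. finite F \<Longrightarrow> F \<subseteq> basis_idx \<Longrightarrow> c * (\<Sum>i\<in>F. (x i)\<^sup>2) \<le> (\<Sum>i\<in>F. \<Sum>j\<in>F. x i * x j * Gram i j)"
    using Gram_lower_bound by blast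
  have YJ: "new_idx \<subseteq> basis_idx" by (auto simp: new_idx_def)
  obtain A H where A: "W.decaying A" and H: "W.decaying H" and H0: "\<And>i j. i \<notin> new_idx \<or> j \<notin> new_idx \<Longrightarrow> H i j = 0"
    and AG: "mmul A Gram = H" and HA: "mmul H (\<lambda>i j. A j i) = mident new_idx"
    and HAY: "\<And>i j. j \<in> new_idx \<Longrightarrow> mmul H A i j = mident new_idx i j"
  proof (rule W.dual_orthonormalization[OF CG(2) zero_less_one CG(1) c(1) Gram_sym c(2) YJ])
  qed (assumption | rule that)+
  note hyps = A H H0 AG HA HAY
  define \<psi> where "\<psi> = psi A"
  let ?I = "wavelet_indices d X k0"
  have IY: "?I = {i \<in> new_idx. quasi_bounded d \<longrightarrow> k0 \<le> fst i}"
    by (auto simp: wavelet_indices_def wavelet_points_def new_idx_def basis_idx_def)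
  obtain C1 \<tau>1 where C1: "0 \<le> C1" "0 < \<tau>1" "\<And>i x. i \<in> new_idx \<Longrightarrow> \<bar>\<psi> i x\<bar> \<le> C1 / sqrt (idx_vol i) * idx_wt i x powr \<tau>1"
    unfolding \<psi>_def using psi_decay[OF hyps] by metis
  obtain C2 \<tau>2 where C2: "0 \<le> C2" "0 < \<tau>2" "\<And>i x x'. d x x' \<le> sc (fst i) \<Longrightarrow>
    \<bar>\<psi> i x - \<psi> i x'\<bar> \<le> C2 * (d x x' / sc (fst i)) powr \<eta> / sqrt (idx_vol i) * idx_wt i x powr \<tau>2"
    unfolding \<psi>_def using psi_hoelder[OF hyps] by metis
  define \<tau> where "\<tau> = min \<tau>1 \<tau>2"
  \<comment> \<open>The weights decay in \<open>rho\<close>; dividing by \<open>Krho\<close>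
    converts this into decay in the power of d.\<close>
  define \<gamma> where "\<gamma> = \<tau> / Krho"
  define C where "C = max C1 C2"
  have \<tau>: "0 < \<tau>" "\<tau> \<le> \<tau>1" "\<tau> \<le> \<tau>2"
    using C1 C2 by (auto simp: \<tau>_def)
  have \<gamma>: "0 < \<gamma>"
    using \<tau> Krho(1) by (simp add: \<gamma>_def)
  have idx_wt_exp: "idx_wt (k, y) x powr s \<le> exp (- \<gamma> * (sc (- k) * d y x) powr aexp)" if "\<tau> \<le> s" for k y x s
  proof -
    have "idx_wt (k, y) x powr s \<le> idx_wt (k, y) x powr \<tau>"
      using that by (intro powr_mono') (auto simp: idx_wt_le_1)
    also have "\<dots> \<le> exp (- (1 / Krho) * (d y x / sc k) powr aexp) powr \<tau>"
      using \<tau> wt_le[of "sc k" y x] by (intro powr_mono2) (auto simp: idx_wt_def)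
    also have "\<dots> = exp (- \<gamma> * (sc (- k) * d y x) powr aexp)"
      by (simp add: powr_def \<gamma>_def power_int_minus field_simps)
    finally show ?thesis .
  qed
  have basis: "L2_orthonormal_basis \<mu> (if quasi_bounded d then L2_perp_constants \<mu> else L2_functions \<mu>) ?I \<psi>"
    unfolding L2_orthonormal_basis_def
  proof (intro conjI ballI allI impI)
    fix i assume "i \<in> ?I"
    then have i: "i \<in> new_idx" using IY by blast
    have "L2_inner \<mu> (\<psi> i) (\<lambda>_. b) = 0" for b
      using psi_mean_zero[OF hyps i] by (simp add: L2_inner_def \<psi>_def has_bochner_integral_integral_eq)
    then show "\<psi> i \<in> (if quasi_bounded d then L2_perp_constants \<mu> else L2_functions \<mu>)"
      using psi_L2[OF hyps i] by (simp add: \<psi>_def L2_perp_constants_def)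
    fix j assume "j \<in> ?I"
    then have j: "j \<in> new_idx" using IY by blast
    show "L2_inner \<mu> (\<psi> i) (\<psi> j) = (if i = j then 1 else 0)"
      unfolding \<psi>_def by (rule psi_orthonormal[OF hyps i j])
  next
    fix f and \<epsilon> :: real
    assume f: "f \<in> (if quasi_bounded d then L2_perp_constants \<mu> else L2_functions \<mu>)" and \<epsilon>: "0 < \<epsilon>"
    \<comment> \<open>\<open>L2_approx\<close> measures squared norms, hence the square of
      \<epsilon>.\<close>
    have "\<exists>w\<in>fspan (\<psi> ` ?I). nsq \<mu> (\<lambda>x. f x - w x) < \<epsilon>\<^sup>2"
    proof (cases "quasi_bounded d")
      case True
      then obtain a where "X k0 = {a}"
        using single by (auto simp: is_singleton_def)
      then show ?thesis
        using wavelets_dense_bounded[OF hyps, of k0 a f "\<epsilon>\<^sup>2"] f True \<epsilon> by (simp add: \<psi>_def IY)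
    next
      case False
      then show ?thesis
        using L2_approxD[OF wavelets_dense_unbounded[OF hyps False, of f], of "\<epsilon>\<^sup>2"] f \<epsilon> by (simp add: \<psi>_def IY)
    qed
    then obtain w where w: "w \<in> fspan (\<psi> ` ?I)" "nsq \<mu> (\<lambda>x. f x - w x) < \<epsilon>\<^sup>2"
      by blast
    obtain F b where F: "finite F" "F \<subseteq> ?I" "w = (\<lambda>x. \<Sum>i\<in>F. b i * \<psi> i x)"
      using fspan_image[OF w(1)] by blast
    have "sqrt (nsq \<mu> (\<lambda>x. f x - w x)) < \<epsilon>"
      using w(2) \<epsilon> real_sqrt_less_mono[OF w(2)] by simp
    then show "\<exists>F c. finite F \<and> F \<subseteq> ?I \<and> sqrt (\<integral>x. (f x - (\<Sum>i\<in>F. c i * \<psi> i x))\<^sup>2 \<partial>\<mu>) < \<epsilon>"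
      using F by blast
  qed
  show ?thesis
  proof (rule exI[of _ \<psi>], rule exI[of _ C], rule exI[of _ \<gamma>], intro conjI \<gamma> basis ballI, clarify, intro conjI allI impI)
    fix k y assume "(k, y) \<in> ?I"
    then have i: "(k, y) \<in> new_idx" using IY by blast
    have vvk: "idx_vol (k, y) = measure \<mu> (quasi_ball d y (sc k))"
      by (simp add: idx_vol_def vol_def)
    show "\<bar>\<psi> (k, y) x\<bar> \<le> C / sqrt (measure \<mu> (quasi_ball d y (sc k))) * exp (- \<gamma> * (sc (- k) * d y x) powr aexp)" for x
    proof (rule order_trans[OF C1(3)[OF i]])
      show "C1 / sqrt (idx_vol (k, y)) * idx_wt (k, y) x powr \<tau>1
          \<le> C / sqrt (measure \<mu> (quasi_ball d y (sc k))) * exp (- \<gamma> * (sc (- k) * d y x) powr aexp)"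
        unfolding vvk[symmetric] using C1(1) \<tau>
        by (intro mult_mono divide_right_mono idx_wt_exp) (auto simp: C_def)
    qed
    show "has_bochner_integral \<mu> (\<psi> (k, y)) 0"
      unfolding \<psi>_def by (rule psi_mean_zero[OF hyps i])
    fix x x' assume "d x x' \<le> sc k"
    then have "\<bar>\<psi> (k, y) x - \<psi> (k, y) x'\<bar> \<le> C2 * (d x x' / sc k) powr \<eta> / sqrt (idx_vol (k, y)) * idx_wt (k, y) x powr \<tau>2"
      using C2(3)[of x x' "(k, y)"] by simp
    also have "\<dots> = C2 / sqrt (idx_vol (k, y)) * (d x x' / sc k) powr \<eta> * idx_wt (k, y) x powr \<tau>2"
      by simp
    also have "\<dots> \<le> C / sqrt (idx_vol (k, y)) * (d x x' / sc k) powr \<eta> * exp (- \<gamma> * (sc (- k) * d y x) powr aexp)"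
      using C2(1) \<tau> by (intro mult_mono divide_right_mono idx_wt_exp) (auto simp: C_def)
    finally show "\<bar>\<psi> (k, y) x - \<psi> (k, y) x'\<bar> \<le> C / sqrt (measure \<mu> (quasi_ball d y (sc k)))
             * (d x x' / sc k) powr \<eta> * exp (- \<gamma> * (sc (- k) * d y x) powr aexp)"
      unfolding vvk .
  qed
qed

end

theorem theorem7p2:
  fixes d :: "'a \<Rightarrow> 'a \<Rightarrow> real" and A0 \<delta> \<eta> a :: real and \<mu> :: "'a measure"
    and X :: "int \<Rightarrow> 'a set" and parent :: "int \<Rightarrow> 'a \<Rightarrow> 'a"
    and label1 label2 :: "int \<Rightarrow> 'a \<Rightarrow> nat" and k0 :: int
  assumes "labelled_dyadic_system d A0 \<mu> \<delta> X parent label1 label2"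
    and "labelled_dyadic_system.boundary_exponent d A0 \<delta> X parent label1 label2 \<eta>"
    and "quasi_bounded d \<Longrightarrow> is_singleton (X k0)"
    and "a = decay_exponent d A0"
  shows "\<exists>(\<psi> :: int \<times> 'a \<Rightarrow> 'a \<Rightarrow> real) (C::real) (\<gamma>::real). \<gamma> > 0 \<and>
    L2_orthonormal_basis \<mu> (if quasi_bounded d then L2_perp_constants \<mu> else L2_functions \<mu>)
      (wavelet_indices d X k0) \<psi> \<and>
    (\<forall>(k, y) \<in> wavelet_indices d X k0.
      (\<forall>x. \<bar>\<psi> (k, y) x\<bar> \<le> C / sqrt (measure \<mu> (quasi_ball d y (\<delta> powi k)))
             * exp (- \<gamma> * (\<delta> powi (- k) * d y x) powr a)) \<and>
      (\<forall>x x'. d x x' \<le> \<delta> powi k \<longrightarrow>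
         \<bar>\<psi> (k, y) x - \<psi> (k, y) x'\<bar> \<le> C / sqrt (measure \<mu> (quasi_ball d y (\<delta> powi k)))
             * (d x x' / \<delta> powi k) powr \<eta>
             * exp (- \<gamma> * (\<delta> powi (- k) * d y x) powr a)) \<and>
      has_bochner_integral \<mu> (\<psi> (k, y)) 0)"
proof -
  interpret labelled_dyadic_system d A0 \<mu> \<delta> X parent label1 label2
    by (rule assms(1))
  interpret regular_dyadic_system d A0 \<mu> \<delta> X parent label1 label2 \<eta>
    by unfold_locales (rule assms(2))
  show ?thesis
    using wavelet_basis[OF assms(3)] unfolding aexp_def assms(4) .
qed

end
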